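(* Up to affine unimodular equivalence there are exactly $114$ lattice $3$-polytopes that are weakly sporadic $F$-hollow but not sporadic $F$-hollow. They consist of exactly $31$ Gorenstein polytopes of index $2$, $2$ Gorenstein polytopes of index $3$, $1$ Gorenstein polytope of index $4$, $1$ exceptional simplex with $\mu=\frac52$, and $79$ polytopes of lattice width $2$ with $\mu=\frac32$.
   Context: For $M\cong\mathbb Z^d$ with dual lattice $N$, a lattice $d$-polytope is a $d$-dimensional polytope in $M_{\mathbb R}=M\otimes\mathbb R$ with all vertices in $M$. Affine unimodular equivalence means equivalence under affine isomorphisms preserving the lattice. $\mathrm{Min}_P(y)=\min\{\langle x,y\rangle\mid x\in P\}$. The Fine interior of a polytope $P\subseteq M_{\mathbb R}$ is $F(P)=\{x\in M_{\mathbb R}\mid \langle x,n\rangle\ge \mathrm{Min}_P(n)+1\ \forall n\in N\setminus\{0\}\}$. The minimal multiplier $\mu=\mu(P)$ is the smallest real $\lambda\ge 0$ with $F(\lambda P)\ne\emptyset$. A lattice $d$-polytope $P$ is $F$-hollow if $\mu(P)>1$. It is weakly sporadic $F$-hollow if $\mu(P)>1$ and $\dim F(\mu(P)P)=0$. A weakly sporadic $F$-hollow lattice $d$-polytope is sporadic $F$-hollow if it is not affine unimodular equivalent to a subset of $P'\times\mathbb R^{d-k}$ for any $F$-hollow lattice $k$-polytope $P'\subseteq\mathbb R^k$ with $1\le k<d$. The lattice width of $P$ is $\min\{-\mathrm{Min}_P(-n)-\mathrm{Min}_P(n)\mid n\in N\setminus\{0\}\}$. A lattice polytope $Q\subseteq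 M_{\mathbb R}$ with $0\in\mathrm{int}(Q)$ is reflexive if $Q^*=\{y\in N_{\mathbb R}\mid\langle x,y\rangle\ge-1\ \forall x\in Q\}$ is a lattice polytope. $P$ is a Gorenstein polytope of index $k\in\mathbb Z_{\ge1}$ if $kP$ is affine unimodular equivalent to a reflexive polytope. *)

theory Defs
  imports "HOL-Analysis.Analysis"
begin

text \<open>
  The lattice of a Euclidean space is spanned by its standard basis, so on \<open>real ^ 'n\<close> and
  on products of such spaces it is the usual integer lattice. It is self-dual for the inner
  product: \<open>int_lattice\<close> plays the role of both $M$ and $N$, and \<open>x \<bullet> n\<close> is the pairing.
\<close>

definition int_lattice :: "'a::euclidean_space set" where
  "int_lattice = {x. \<forall>b\<in>Basis. x \<bullet> b \<in> \<int>}"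

definition lattice_polytope :: "'a::euclidean_space set \<Rightarrow> bool" where
  "lattice_polytope P \<longleftrightarrow> polytope P \<and> (\<forall>v. v extreme_point_of P \<longrightarrow> v \<in> int_lattice)"

definition full_lattice_polytope :: "'a::euclidean_space set \<Rightarrow> bool" where
  "full_lattice_polytope P \<longleftrightarrow> lattice_polytope P \<and> aff_dim P = int DIM('a)"

text \<open>The two sets may live in different spaces, such as \<open>real ^ 3\<close> and \<open>real ^ 2 \<times> real ^ 1\<close>.\<close>

definition unimodular_equiv ::
    "'a::euclidean_space set \<Rightarrow> 'b::euclidean_space set \<Rightarrow> bool" where
  "unimodular_equiv P Q \<longleftrightarrow>
     (\<exists>(A :: 'a \<Rightarrow> 'b) t. linear A \<and> bij A \<and>
        (\<lambda>x. A x + t) ` int_lattice = int_lattice \<and> (\<lambda>x. A x + t) ` P = Q)"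

definition Min_on :: "'a::euclidean_space set \<Rightarrow> 'a \<Rightarrow> real" where
  "Min_on P y = (INF x\<in>P. x \<bullet> y)"

definition fine_interior :: "'a::euclidean_space set \<Rightarrow> 'a set" where
  "fine_interior P = {x. \<forall>n \<in> int_lattice - {0}. x \<bullet> n \<ge> Min_on P n + 1}"

definition dilate :: "real \<Rightarrow> 'a::euclidean_space set \<Rightarrow> 'a set" where
  "dilate c P = (\<lambda>x. c *\<^sub>R x) ` P"

definition min_multiplier :: "'a::euclidean_space set \<Rightarrow> real" where
  "min_multiplier P = (LEAST c. c \<ge> 0 \<and> fine_interior (dilate c P) \<noteq> {})"

definition F_hollow :: "'a::euclidean_space set \<Rightarrow> bool" where
  "F_hollow P \<longleftrightarrow> full_lattice_polytope P \<and> min_multiplier P > 1"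

definition weakly_sporadic_F_hollow :: "'a::euclidean_space set \<Rightarrow> bool" where
  "weakly_sporadic_F_hollow P \<longleftrightarrow>
     F_hollow P \<and> aff_dim (fine_interior (dilate (min_multiplier P) P)) = 0"

text \<open>
  \<open>P\<close> is equivalent to a subset of \<open>P' \<times> \<real>\<^sup>m\<close> for an \<open>F\<close>-hollow lattice \<open>k\<close>-polytope
  \<open>P' \<subseteq> \<real>\<^sup>k\<close>, where \<open>k\<close> and \<open>m\<close> are the dimensions of the two factors of the type argument.
\<close>

definition fits_over_F_hollow ::
    "('k::euclidean_space \<times> 'm::euclidean_space) itself \<Rightarrow> 'a::euclidean_space set \<Rightarrow> bool" where
  "fits_over_F_hollow T P \<longleftrightarrow>
     (\<exists>(P' :: 'k set) (Q :: ('k \<times> 'm) set).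
        F_hollow P' \<and> unimodular_equiv P Q \<and> Q \<subseteq> P' \<times> UNIV)"

text \<open>
  Dimensions are types and cannot be quantified over, so the range \<open>1 \<le> k < d\<close> is written
  out for \<open>d = 3\<close>.
\<close>

definition sporadic_F_hollow :: "(real ^ 3) set \<Rightarrow> bool" where
  "sporadic_F_hollow P \<longleftrightarrow> weakly_sporadic_F_hollow P \<and>
     \<not> fits_over_F_hollow TYPE((real ^ 1) \<times> (real ^ 2)) P \<and>
     \<not> fits_over_F_hollow TYPE((real ^ 2) \<times> (real ^ 1)) P"

definition lattice_width :: "'a::euclidean_space set \<Rightarrow> real" where
  "lattice_width P = (INF n \<in> int_lattice - {0}. - Min_on P (- n) - Min_on P n)"

definition polar_dual :: "'a::euclidean_space set \<Rightarrow> 'a set" where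
  "polar_dual Q = {y. \<forall>x\<in>Q. x \<bullet> y \<ge> - 1}"

definition reflexive_polytope :: "'a::euclidean_space set \<Rightarrow> bool" where
  "reflexive_polytope Q \<longleftrightarrow>
     lattice_polytope Q \<and> 0 \<in> interior Q \<and> lattice_polytope (polar_dual Q)"

definition Gorenstein_polytope :: "nat \<Rightarrow> 'a::euclidean_space set \<Rightarrow> bool" where
  "Gorenstein_polytope k P \<longleftrightarrow> k \<ge> 1 \<and> full_lattice_polytope P \<and>
     (\<exists>Q :: 'a set. reflexive_polytope Q \<and> unimodular_equiv (dilate (real k) P) Q)"

text \<open>The number of equivalence classes that meet the family (\<open>0\<close> if there are infinitely many).\<close>

definition num_classes :: "'a::euclidean_space set set \<Rightarrow> nat" where
  "num_classes \<P> = card (\<P> // {(P, Q). unimodular_equiv P Q})"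

definition weakly_not_sporadic :: "(real ^ 3) set set" where
  "weakly_not_sporadic = {P. weakly_sporadic_F_hollow P \<and> \<not> sporadic_F_hollow P}"

end

(*
A weakly sporadic polytope that is not sporadic lies over an F-hollow polygon or segment. Such a base
lies over the segment [0, 1] or over twice the unit triangle, so up to equivalence the polytope lies
between two adjacent lattice planes or over 2 Delta_2. Fine interiors of integer dilates are
computed from lattice points, and the uniqueness of the point of F(mu P) bounds the heights of the
columns over the lattice points of the base. This leaves finitely many point configurations; each of
them is mapped to one of 114 representatives, or shown to have width one, by a stored affine map.

The value of mu separates the five families. A Gorenstein polytope of index k has mu = k, as a
reflexive polytope has Fine interior {0} and its smaller dilates have none. Polytopes of the same
family are told apart by a sum over all quadruples of vertices of a function of the normalized volume
and of the number of edges that are divisible by 2, which is invariant under unimodular equivalence.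
*)

theory Submission
  imports Defs
begin

section \<open>Unimodular invariance of Fine interiors, and passage to integer points\<close>

subsection \<open>Lattice isomorphisms\<close>

text \<open>Uniqueness can be exploited because the dilation at which points first appear is known
  beforehand: \<open>F(d P)\<close> is empty for \<open>d < 2\<close> between adjacent planes, for
  \<open>d < 3\<close> over the unit triangle and for \<open>d < 3/2\<close> over
  \<open>2 Delta_2\<close>. Two explicit points at that dilation contradict the dimension condition,
  while mu may still be larger.

  Between adjacent planes there is no base polygon. The Minkowski sum of the two layers takes its
  place: it is the middle slice of \<open>2 P\<close>, its interior lattice points lie in
  \<open>F(2 P)\<close>, and so it has at most one. Polygons with at most one interior lattice point
  are therefore classified, though only coarsely: width one or \<open>2 Delta_2\<close> without such
  a point, width two or \<open>3 Delta_2\<close> with one.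

  Over \<open>2 Delta_2\<close> the critical dilation is not an integer. The points exhibited there
  are \<open>(1, 1, t / 2)\<close> with integral \<open>t\<close>, and how low \<open>t\<close> may
  be depends on parities of corner heights.

  A Fine interior is defined by infinitely many normals. Membership over a triangle is shown by
  adding the negated inequalities of a few points, so that only the height component of the normal
  survives.\<close>

lemma int_lattice_0 [simp]: "0 \<in> int_lattice"
  by (simp add: int_lattice_def)

lemma int_lattice_add: "x \<in> int_lattice \<Longrightarrow> y \<in> int_lattice \<Longrightarrow> x + y \<in> int_lattice"
  by (simp add: int_lattice_def inner_add_left)

lemma int_lattice_minus: "x \<in> int_lattice \<Longrightarrow> - x \<in> int_lattice"
  by (simp add: int_lattice_def)

lemma int_lattice_diff: "x \<in> int_lattice \<Longrightarrow> y \<in> int_lattice \<Longrightarrow> x - y \<in> int_lattice"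
  by (simp add: int_lattice_def inner_diff_left)

lemma Basis_int_lattice: "b \<in> Basis \<Longrightarrow> b \<in> int_lattice"
  by (auto simp: int_lattice_def inner_Basis)

lemma int_lattice_inner:
  assumes "x \<in> int_lattice" "y \<in> int_lattice"
  shows "x \<bullet> y \<in> \<int>"
  using assms by (subst euclidean_inner) (auto simp: int_lattice_def intro!: Ints_sum Ints_mult)

definition unimod :: "('a::euclidean_space \<Rightarrow> 'b::euclidean_space) \<Rightarrow> bool" where
  "unimod A \<longleftrightarrow> linear A \<and> bij A \<and> A ` int_lattice = int_lattice"

text \<open>Evaluating the affine map at 0 shows that \<open>t\<close> is a lattice vector; hence
  the linear part preserves the lattice by itself and its adjoint can act on dual vectors.\<close>

lemma unimodular_equiv_iff:
  "unimodular_equiv P Q \<longleftrightarrow>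
    (\<exists>A t. unimod A \<and> t \<in> int_lattice \<and> Q = (\<lambda>x. A x + t) ` P)" (is "?L = ?R")
proof
  assume ?L
  then obtain A t where A: "linear A" "bij A" "(\<lambda>x. A x + t) ` int_lattice = int_lattice"
    "(\<lambda>x. A x + t) ` P = Q"
    unfolding unimodular_equiv_def by blast
  have t: "t \<in> int_lattice"
    using A(1,3) imageI[of 0 int_lattice "\<lambda>x. A x + t"] by (simp add: linear_0)
  have "A ` int_lattice = int_lattice"
  proof
    show "A ` int_lattice \<subseteq> int_lattice"
    proof
      fix y assume "y \<in> A ` int_lattice"
      then obtain x where x: "x \<in> int_lattice" "y = A x" by blast
      have "A x + t \<in> int_lattice" using A(3) x(1) by blast
      from int_lattice_diff[OF this t] show "y \<in> int_lattice" by (simp add: x)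
    qed
    show "int_lattice \<subseteq> A ` int_lattice"
    proof
      fix y :: 'b assume "y \<in> int_lattice"
      then have "y + t \<in> (\<lambda>x. A x + t) ` int_lattice" using t A(3) int_lattice_add by blast
      then show "y \<in> A ` int_lattice" by auto
    qed
  qed
  then show ?R using A t unfolding unimod_def by blast
next
  assume ?R
  then obtain A t where A: "unimod A" "t \<in> int_lattice" "Q = (\<lambda>x. A x + t) ` P" by blast
  have "(\<lambda>x. A x + t) ` int_lattice = (\<lambda>y. y + t) ` (A ` int_lattice)" by auto
  also have "\<dots> = (\<lambda>y. y + t) ` int_lattice" using A(1) by (simp add: unimod_def)
  also have "\<dots> = int_lattice"
  proof
    show "(\<lambda>y. y + t) ` int_lattice \<subseteq> int_lattice" using A(2) int_lattice_add by blast
    show "int_lattice \<subseteq> (\<lambda>y. y + t) ` int_lattice"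
    proof
      fix y :: 'b assume "y \<in> int_lattice"
      then have "y - t \<in> int_lattice" using A(2) int_lattice_diff by blast
      then show "y \<in> (\<lambda>y. y + t) ` int_lattice" by (metis diff_add_cancel imageI)
    qed
  qed
  finally show ?L using A unfolding unimodular_equiv_def unimod_def by blast
qed

lemma unimod_id: "unimod (\<lambda>x. x)"
  by (simp add: unimod_def linear_iff bij_def)

lemma unimod_comp: "unimod A \<Longrightarrow> unimod B \<Longrightarrow> unimod (\<lambda>x. B (A x))"
  unfolding unimod_def
  using linear_compose[of A B] bij_comp[of A B] by (auto simp: o_def image_image[symmetric])

lemma unimod_inv:
  assumes "unimod A" shows "unimod (inv A)"
proof -
  have A: "linear A" "bij A" "A ` int_lattice = int_lattice" using assms by (auto simp: unimod_def)
  have i: "inv A (A x) = x" and s: "A (inv A y) = y" for x y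
    using A(2) by (auto simp: bij_def surj_f_inv_f)
  have "linear (inv A)"
  proof (rule linearI)
    fix x y
    have "inv A (x + y) = inv A (A (inv A x + inv A y))"
      by (simp add: linear_add[OF A(1)] s)
    then show "inv A (x + y) = inv A x + inv A y" by (simp only: i)
  next
    fix c x
    have "inv A (c *\<^sub>R x) = inv A (A (c *\<^sub>R inv A x))"
      by (simp add: linear_cmul[OF A(1)] s)
    then show "inv A (c *\<^sub>R x) = c *\<^sub>R inv A x" by (simp only: i)
  qed
  moreover have "inv A ` int_lattice = int_lattice"
    by (metis A(2,3) bij_def image_inv_f_f)
  ultimately show ?thesis using A(2) by (simp add: unimod_def bij_imp_bij_inv)
qed

text \<open>Normals transform by the adjoint. Integrality of \<open>adjoint A n\<close> is tested on
  the basis, where it is the pairing of \<open>n\<close> with the lattice vector \<open>A b\<close>;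
  the inverse of the adjoint is the adjoint of the inverse.\<close>

lemma unimod_adjoint:
  fixes A :: "'a::euclidean_space \<Rightarrow> 'b::euclidean_space"
  assumes "unimod A" shows "unimod (adjoint A)"
proof -
  have A: "linear A" "bij A" "A ` int_lattice = int_lattice" using assms by (auto simp: unimod_def)
  let ?C = "inv A"
  have C: "linear ?C" "?C ` int_lattice = int_lattice"
    using unimod_inv[OF assms] by (auto simp: unimod_def)
  have i: "inv A (A x) = x" and s: "A (inv A y) = y" for x y
    using A(2) by (auto simp: bij_def surj_f_inv_f)
  have 1: "adjoint A (adjoint ?C n) = n" for n
    by (metis (no_types, lifting) A(1) C(1) adjoint_works i vector_eq_ldot)
  have 2: "adjoint ?C (adjoint A n) = n" for n
    by (metis (no_types, lifting) A(1) C(1) adjoint_works s vector_eq_ldot)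
  have sub: "adjoint B n \<in> int_lattice"
    if "linear B" "B ` int_lattice = int_lattice" "n \<in> int_lattice"
    for B :: "'c::euclidean_space \<Rightarrow> 'd::euclidean_space" and n
  proof -
    have "adjoint B n \<bullet> b \<in> \<int>" if b: "b \<in> Basis" for b
    proof -
      have "B b \<in> int_lattice" using \<open>B ` int_lattice = int_lattice\<close> Basis_int_lattice[OF b] by blast
      then have "B b \<bullet> n \<in> \<int>" using int_lattice_inner \<open>n \<in> int_lattice\<close> by blast
      then show ?thesis by (metis adjoint_works[OF \<open>linear B\<close>] inner_commute)
    qed
    then show ?thesis by (simp add: int_lattice_def)
  qed
  have "bij (adjoint A)" using 1 2 by (rule_tac o_bij[of "adjoint ?C"]) auto
  moreover have "adjoint A ` int_lattice = int_lattice"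
  proof
    show "adjoint A ` int_lattice \<subseteq> int_lattice" using sub[OF A(1,3)] by blast
    show "int_lattice \<subseteq> adjoint A ` int_lattice"
    proof
      fix n :: 'a assume "n \<in> int_lattice"
      then have "adjoint ?C n \<in> int_lattice" using sub[OF C] by blast
      then show "n \<in> adjoint A ` int_lattice" by (metis 1 imageI)
    qed
  qed
  ultimately show ?thesis using adjoint_linear[OF A(1)] by (simp add: unimod_def)
qed

lemma unimod_adjoint_dual:
  assumes "unimod A"
  shows "adjoint A ` (int_lattice - {0}) = int_lattice - {0}"
proof -
  have "linear (adjoint A)" "bij (adjoint A)" "adjoint A ` int_lattice = int_lattice"
    using unimod_adjoint[OF assms] by (auto simp: unimod_def)
  then show ?thesis by (simp add: image_set_diff bij_def linear_0)
qed

lemma unimodular_equiv_refl: "unimodular_equiv P P"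
  unfolding unimodular_equiv_iff by (rule exI[of _ "\<lambda>x. x"], rule exI[of _ 0]) (simp add: unimod_id)

lemma unimodular_equiv_sym:
  assumes "unimodular_equiv P Q" shows "unimodular_equiv Q P"
proof -
  obtain A t where A: "unimod A" "t \<in> int_lattice" "Q = (\<lambda>x. A x + t) ` P"
    using assms unimodular_equiv_iff by blast
  have B: "unimod (inv A)" "linear (inv A)" using unimod_inv[OF A(1)] by (auto simp: unimod_def)
  have i: "inv A (A x) = x" for x using A(1) by (auto simp: bij_def unimod_def)
  have "inv A t \<in> int_lattice" using B A(2) by (auto simp: unimod_def)
  moreover have "P = (\<lambda>x. inv A x + - inv A t) ` Q"
    by (simp add: A(3) image_image linear_add[OF B(2)] i)
  ultimately show ?thesis using B int_lattice_minus unfolding unimodular_equiv_iff by blast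
qed

lemma unimodular_equiv_trans:
  assumes "unimodular_equiv P Q" "unimodular_equiv Q R" shows "unimodular_equiv P R"
proof -
  obtain A t where A: "unimod A" "t \<in> int_lattice" "Q = (\<lambda>x. A x + t) ` P"
    using assms(1) unimodular_equiv_iff by blast
  obtain B s where B: "unimod B" "s \<in> int_lattice" "R = (\<lambda>x. B x + s) ` Q"
    using assms(2) unimodular_equiv_iff by blast
  have "linear B" using B(1) by (simp add: unimod_def)
  then have "R = (\<lambda>x. B (A x) + (B t + s)) ` P"
    by (simp add: A(3) B(3) image_image linear_add algebra_simps)
  moreover have "B t + s \<in> int_lattice" using A(2) B(1,2) int_lattice_add by (auto simp: unimod_def)
  ultimately show ?thesis using unimod_comp[OF A(1) B(1)] unfolding unimodular_equiv_iff by blast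
qed

subsection \<open>Fine interiors and multipliers\<close>

text \<open>The infimum over a compact set is attained, so it can be replaced by an existential
  statement; membership in Fine interiors is handled in this form.\<close>

lemma Min_on_le_iff:
  assumes "compact P" "P \<noteq> {}"
  shows "Min_on P n \<le> r \<longleftrightarrow> (\<exists>p\<in>P. p \<bullet> n \<le> r)"
proof -
  have "continuous_on P (\<lambda>x. x \<bullet> n)" by (intro continuous_intros)
  then obtain p where p: "p \<in> P" "\<And>q. q \<in> P \<Longrightarrow> p \<bullet> n \<le> q \<bullet> n"
    using continuous_attains_inf[OF assms] by blast
  then have "Min_on P n = p \<bullet> n"
    unfolding Min_on_def by (intro cInf_eq_minimum) auto
  then show ?thesis using p by (metis order_trans)
qed

lemma dilate_facts:
  assumes "compact P" "P \<noteq> {}"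
  shows "compact (dilate c P)" "dilate c P \<noteq> {}"
  using assms compact_scaling by (auto simp: dilate_def)

lemma fine_interior_iff:
  assumes "compact P" "P \<noteq> {}"
  shows "x \<in> fine_interior P \<longleftrightarrow> (\<forall>n\<in>int_lattice - {0}. \<exists>p\<in>P. p \<bullet> n + 1 \<le> x \<bullet> n)"
proof -
  have "Min_on P n + 1 \<le> x \<bullet> n \<longleftrightarrow> (\<exists>p\<in>P. p \<bullet> n + 1 \<le> x \<bullet> n)" for n
    using Min_on_le_iff[OF assms, of n "x \<bullet> n - 1"] by (simp add: le_diff_eq)
  then show ?thesis by (simp add: fine_interior_def)
qed

lemma fine_interior_dilate_iff:
  assumes "compact P" "P \<noteq> {}"
  shows "x \<in> fine_interior (dilate c P) \<longleftrightarrow>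
    (\<forall>n\<in>int_lattice - {0}. \<exists>p\<in>P. c * (p \<bullet> n) + 1 \<le> x \<bullet> n)"
  unfolding fine_interior_iff[OF dilate_facts[OF assms]] by (auto simp: dilate_def)

lemma affine_image_eq:
  fixes A :: "'a \<Rightarrow> 'b::euclidean_space"
  shows "(\<lambda>x. A x + t) ` P = (\<lambda>y. t + y) ` A ` P"
  unfolding image_image by (rule image_cong) (auto simp: add.commute)

text \<open>Normals are pulled back by the adjoint, which permutes the nonzero dual vectors. The
  translation is dilated together with the polytope, hence \<open>c *\<^sub>R t\<close>.\<close>

lemma fine_interior_dilate_image:
  assumes A: "unimod A" and P: "compact P" "P \<noteq> {}"
  shows "fine_interior (dilate c ((\<lambda>x. A x + t) ` P)) =
    (\<lambda>x. A x + c *\<^sub>R t) ` fine_interior (dilate c P)"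
proof -
  have lin: "linear A" and bij: "bij A" using A by (auto simp: unimod_def)
  have P': "compact ((\<lambda>x. A x + t) ` P)" "(\<lambda>x. A x + t) ` P \<noteq> {}"
    using P by (simp_all add: affine_image_eq compact_translation compact_continuous_image
        linear_continuous_on linear_linear lin)
  have "A x + c *\<^sub>R t \<in> fine_interior (dilate c ((\<lambda>x. A x + t) ` P)) \<longleftrightarrow>
      x \<in> fine_interior (dilate c P)" for x
  proof -
    have "A x + c *\<^sub>R t \<in> fine_interior (dilate c ((\<lambda>x. A x + t) ` P)) \<longleftrightarrow>
      (\<forall>n\<in>int_lattice - {0}. \<exists>p\<in>P. c * (p \<bullet> adjoint A n) + 1 \<le> x \<bullet> adjoint A n)"
      unfolding fine_interior_dilate_iff[OF P']
      by (simp add: inner_add_left adjoint_works[OF lin] algebra_simps)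
    also have "\<dots> \<longleftrightarrow> (\<forall>n\<in>adjoint A ` (int_lattice - {0}). \<exists>p\<in>P. c * (p \<bullet> n) + 1 \<le> x \<bullet> n)"
      by blast
    finally show ?thesis
      unfolding unimod_adjoint_dual[OF A] fine_interior_dilate_iff[OF P] .
  qed
  moreover have "\<exists>x. y = A x + c *\<^sub>R t" for y
    by (metis bij bij_pointE diff_add_cancel)
  ultimately show ?thesis by (auto simp: image_iff) metis
qed

lemma fine_interior_dilate_image_empty:
  assumes "unimod A" "compact P" "P \<noteq> {}"
  shows "fine_interior (dilate c ((\<lambda>x. A x + t) ` P)) = {} \<longleftrightarrow> fine_interior (dilate c P) = {}"
  by (simp add: fine_interior_dilate_image[OF assms])

lemma min_multiplier_image:
  assumes "unimod A" "compact P" "P \<noteq> {}"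
  shows "min_multiplier ((\<lambda>x. A x + t) ` P) = min_multiplier P"
  unfolding min_multiplier_def using fine_interior_dilate_image_empty[OF assms] by simp

lemma min_multiplier_eqI:
  assumes "c \<ge> 0" "fine_interior (dilate c P) \<noteq> {}"
    and "\<And>d. 0 \<le> d \<Longrightarrow> d < c \<Longrightarrow> fine_interior (dilate d P) = {}"
  shows "min_multiplier P = c"
  unfolding min_multiplier_def
  by (rule Least_equality) (use assms in \<open>auto simp: not_less[symmetric]\<close>)

text \<open>\<open>min_multiplier\<close> is a \<open>LEAST\<close> over the reals and carries
  information only if the minimum is attained. The pairs \<open>(d, x)\<close> with
  \<open>0 \<le> d \<le> c\<close> and \<open>x\<close> in \<open>F(d P)\<close> form a compact set,
  so the first coordinate has a minimum there.\<close>

lemma min_multiplier_le: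
  fixes P :: "'a::euclidean_space set"
  assumes P: "compact P" "P \<noteq> {}" and c: "0 \<le> c" "fine_interior (dilate c P) \<noteq> {}"
  shows "min_multiplier P \<le> c"
proof -
  define Z where "Z = {(d, x). 0 \<le> d \<and> d \<le> c \<and> x \<in> fine_interior (dilate d P)}"
  have mem: "x \<in> fine_interior (dilate d P) \<longleftrightarrow>
      (\<forall>n\<in>int_lattice - {0}. d * Min_on P n + 1 \<le> x \<bullet> n)" if "0 \<le> d" for d x
  proof -
    have "(\<exists>p\<in>P. d * (p \<bullet> n) + 1 \<le> r) \<longleftrightarrow> d * Min_on P n + 1 \<le> r" for n r
    proof (cases "d = 0")
      case True then show ?thesis using P by auto
    next
      case False
      then have "d > 0" using that by simp
      then show ?thesis using Min_on_le_iff[OF P, of n "(r - 1) / d"]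
        by (simp add: field_simps)
    qed
    then show ?thesis by (simp add: fine_interior_dilate_iff[OF P])
  qed
  have "Z = (\<Inter>n\<in>int_lattice - {0}. {z. fst z * Min_on P n + 1 \<le> snd z \<bullet> n}) \<inter> {z. 0 \<le> fst z} \<inter> {z. fst z \<le> c}"
    by (auto simp: Z_def mem)
  moreover have "closed \<dots>"
    by (intro closed_Int closed_INT ballI closed_Collect_le continuous_intros)
  ultimately have "closed Z" by simp
  moreover have "bounded Z"
  proof -
    \<comment> \<open>The basis vectors and their negatives, as normals, bound every coordinate of a
      point of \<open>F(d P)\<close> uniformly for \<open>d \<le> c\<close>.\<close>
    define M where "M = c * (\<Sum>b\<in>Basis. \<bar>Min_on P b\<bar> + \<bar>Min_on P (-b)\<bar>)"
    have "\<bar>x \<bullet> b\<bar> \<le> M" if z: "(d, x) \<in> Z" and b: "b \<in> Basis" for d x b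
    proof -
      have d: "0 \<le> d" "d \<le> c" and x: "x \<in> fine_interior (dilate d P)" using z by (auto simp: Z_def)
      have n: "b \<in> int_lattice - {0}" "- b \<in> int_lattice - {0}"
        using b Basis_int_lattice int_lattice_minus by (auto simp: nonzero_Basis)
      have 1: "d * Min_on P b + 1 \<le> x \<bullet> b" "d * Min_on P (-b) + 1 \<le> - (x \<bullet> b)"
        using x n unfolding mem[OF d(1)] by (metis inner_minus_right)+
      have 2: "\<bar>Min_on P b\<bar> + \<bar>Min_on P (-b)\<bar> \<le> (\<Sum>b\<in>Basis. \<bar>Min_on P b\<bar> + \<bar>Min_on P (-b)\<bar>)"
        by (rule member_le_sum[OF b]) auto
      have 3: "d * \<bar>Min_on P b\<bar> \<le> M" "d * \<bar>Min_on P (-b)\<bar> \<le> M"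
        unfolding M_def using d 2 by (auto intro!: mult_mono)
      have "- (d * \<bar>Min_on P b\<bar>) \<le> d * Min_on P b" "- (d * \<bar>Min_on P (-b)\<bar>) \<le> d * Min_on P (-b)"
        using d by (metis abs_ge_minus_self abs_mult abs_of_nonneg minus_le_iff)+
      then show ?thesis using 1 3 by linarith
    qed
    then have "norm x \<le> real DIM('a) * M" if "(d, x) \<in> Z" for d x
      using that norm_le_l1[of x] sum_bounded_above[of Basis "\<lambda>b. \<bar>x \<bullet> b\<bar>" M] by fastforce
    then have "Z \<subseteq> {0..c} \<times> cball 0 (real DIM('a) * M)"
      by (auto simp: Z_def)
    then show ?thesis by (rule bounded_subset[rotated]) (intro bounded_Times bounded_closed_interval bounded_cball)
  qed
  ultimately have "compact Z" by (simp add: compact_eq_bounded_closed)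
  moreover have "Z \<noteq> {}" using c by (auto simp: Z_def)
  ultimately obtain d x where dx: "(d, x) \<in> Z" "\<And>z. z \<in> Z \<Longrightarrow> d \<le> fst z"
    using continuous_attains_inf[of Z fst] continuous_on_fst[OF continuous_on_id, of Z] by force
  have "min_multiplier P = d"
  proof (rule min_multiplier_eqI)
    show "0 \<le> d" "fine_interior (dilate d P) \<noteq> {}" using dx(1) by (auto simp: Z_def)
    fix e assume e: "0 \<le> e" "e < d"
    show "fine_interior (dilate e P) = {}"
    proof (rule ccontr)
      assume "fine_interior (dilate e P) \<noteq> {}"
      then obtain y where "y \<in> fine_interior (dilate e P)" by blast
      then have "(e, y) \<in> Z" using e dx(1) by (auto simp: Z_def)
      then show False using dx(2)[of "(e, y)"] e by simp
    qed
  qed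
  then show ?thesis using dx(1) by (simp add: Z_def)
qed

subsection \<open>Lattice polytopes\<close>

lemma lattice_polytope_iff:
  "lattice_polytope P \<longleftrightarrow> (\<exists>V. finite V \<and> V \<subseteq> int_lattice \<and> P = convex hull V)"
proof
  assume P: "lattice_polytope P"
  then have "polytope P" by (simp add: lattice_polytope_def)
  then obtain S where S: "finite S" "P = convex hull S" by (auto simp: polytope_def)
  have "P = convex hull {v. v extreme_point_of P}"
    using \<open>polytope P\<close> by (intro Krein_Milman_Minkowski polytope_imp_compact polytope_imp_convex)
  moreover have "finite {v. v extreme_point_of P}" using \<open>polytope P\<close> by (rule finite_polyhedron_extreme_points[OF polytope_imp_polyhedron])
  ultimately show "\<exists>V. finite V \<and> V \<subseteq> int_lattice \<and> P = convex hull V"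
    using P by (auto simp: lattice_polytope_def)
next
  assume "\<exists>V. finite V \<and> V \<subseteq> int_lattice \<and> P = convex hull V"
  then show "lattice_polytope P"
    using extreme_point_of_convex_hull by (fastforce simp: lattice_polytope_def polytope_def)
qed

lemma lattice_polytope_image:
  assumes "unimod A" "t \<in> int_lattice" "lattice_polytope P"
  shows "lattice_polytope ((\<lambda>x. A x + t) ` P)"
proof -
  obtain V where V: "finite V" "V \<subseteq> int_lattice" "P = convex hull V"
    using assms(3) lattice_polytope_iff by blast
  have lin: "linear A" using assms(1) by (simp add: unimod_def)
  have "(\<lambda>x. A x + t) ` P = convex hull ((\<lambda>x. A x + t) ` V)"
    by (simp add: affine_image_eq V(3) convex_hull_linear_image[OF lin] convex_hull_translation)
  moreover have "(\<lambda>x. A x + t) ` V \<subseteq> int_lattice"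
  proof
    fix y assume "y \<in> (\<lambda>x. A x + t) ` V"
    then obtain v where v: "v \<in> V" "y = A v + t" by blast
    then have "A v \<in> int_lattice" using V(2) assms(1) by (auto simp: unimod_def)
    then show "y \<in> int_lattice" using v assms(2) int_lattice_add by blast
  qed
  ultimately show ?thesis using V(1) unfolding lattice_polytope_iff by blast
qed

lemma aff_dim_unimod_image:
  assumes "unimod A" shows "aff_dim ((\<lambda>x. A x + t) ` P) = aff_dim P"
proof -
  have "linear A" "inj A" using assms by (auto simp: unimod_def bij_def)
  then show ?thesis by (simp add: affine_image_eq aff_dim_translation_eq aff_dim_injective_linear_image)
qed

lemma unimod_DIM:
  fixes A :: "'a::euclidean_space \<Rightarrow> 'b::euclidean_space"
  assumes "unimod A" shows "DIM('a) = DIM('b)"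
proof -
  have "(\<lambda>x. A x + 0) ` UNIV = UNIV" using assms by (auto simp: unimod_def bij_def)
  then show ?thesis using aff_dim_unimod_image[OF assms, of 0 UNIV] by simp
qed

lemma full_lattice_polytope_image:
  assumes "unimod A" "t \<in> int_lattice" "full_lattice_polytope P"
  shows "full_lattice_polytope ((\<lambda>x. A x + t) ` P)"
  using assms lattice_polytope_image[OF assms(1,2)] unimod_DIM[OF assms(1)]
  by (simp add: full_lattice_polytope_def aff_dim_unimod_image)

lemma full_lattice_polytope_compact:
  assumes "full_lattice_polytope P" shows "compact P" "P \<noteq> {}"
  using assms polytope_imp_compact by (auto simp: full_lattice_polytope_def lattice_polytope_def)

lemma F_hollow_image:
  assumes "unimod A" "t \<in> int_lattice" "F_hollow P"
  shows "F_hollow ((\<lambda>x. A x + t) ` P)"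
  using assms full_lattice_polytope_image[OF assms(1,2)] full_lattice_polytope_compact[of P]
  by (simp add: F_hollow_def min_multiplier_image)

lemma weakly_sporadic_image:
  assumes "unimod A" "t \<in> int_lattice" "weakly_sporadic_F_hollow P"
  shows "weakly_sporadic_F_hollow ((\<lambda>x. A x + t) ` P)"
proof -
  have P: "compact P" "P \<noteq> {}"
    using assms(3) full_lattice_polytope_compact by (auto simp: weakly_sporadic_F_hollow_def F_hollow_def)
  show ?thesis using assms(3) F_hollow_image[OF assms(1,2)]
    by (simp add: weakly_sporadic_F_hollow_def min_multiplier_image[OF assms(1) P]
        fine_interior_dilate_image[OF assms(1) P] aff_dim_unimod_image[OF assms(1)])
qed

lemma weakly_sporadic_equiv:
  "unimodular_equiv P Q \<Longrightarrow> weakly_sporadic_F_hollow P \<Longrightarrow> weakly_sporadic_F_hollow Q"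
  using weakly_sporadic_image unfolding unimodular_equiv_iff by blast

lemma weakly_sporadic_compact:
  assumes "weakly_sporadic_F_hollow P" shows "compact P" "P \<noteq> {}"
  using assms full_lattice_polytope_compact by (auto simp: weakly_sporadic_F_hollow_def F_hollow_def)

lemma min_multiplier_equiv:
  "unimodular_equiv P Q \<Longrightarrow> compact P \<Longrightarrow> P \<noteq> {} \<Longrightarrow> min_multiplier Q = min_multiplier P"
  using min_multiplier_image unfolding unimodular_equiv_iff by blast

text \<open>Emptiness of \<open>F(P)\<close> gives a dual vector on which \<open>p\<close> exceeds
  the minimum by less than 1. Both values are integers, so \<open>p\<close> does not exceed it at
  all: the vector supports \<open>P\<close> at or beyond \<open>p\<close>.\<close>

lemma F_hollow_no_interior_point:
  assumes "F_hollow P" "P = convex hull W" "finite W" "W \<subseteq> int_lattice" "p \<in> int_lattice"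
  obtains n where "n \<in> int_lattice - {0}" "\<And>w. w \<in> W \<Longrightarrow> p \<bullet> n \<le> w \<bullet> n"
proof -
  have P: "compact P" "P \<noteq> {}" using assms(1) full_lattice_polytope_compact by (auto simp: F_hollow_def)
  have "fine_interior (dilate 1 P) = {}"
    using min_multiplier_le[OF P, of 1] assms(1) by (force simp: F_hollow_def)
  then have "p \<notin> fine_interior (dilate 1 P)" by simp
  then obtain n where n: "n \<in> int_lattice - {0}" "\<And>q. q \<in> P \<Longrightarrow> p \<bullet> n < q \<bullet> n + 1"
    unfolding fine_interior_dilate_iff[OF P] by force
  have "p \<bullet> n \<le> w \<bullet> n" if w: "w \<in> W" for w
  proof -
    have "w \<in> P" using w assms(2) hull_subset by fastforce
    then have 1: "p \<bullet> n < w \<bullet> n + 1" using n by blast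
    have "p \<bullet> n \<in> \<int>" "w \<bullet> n \<in> \<int>" using assms(4,5) w n(1) int_lattice_inner by blast+
    then obtain a b :: int where "p \<bullet> n = of_int a" "w \<bullet> n = of_int b" by (auto elim!: Ints_cases)
    then have "real_of_int a < of_int (b + 1)" using 1 by simp
    then have "a \<le> b" by (simp only: of_int_less_iff)
    then show ?thesis using \<open>p \<bullet> n = of_int a\<close> \<open>w \<bullet> n = of_int b\<close> by simp
  qed
  then show ?thesis using that n(1) by blast
qed

lemma int_lattice_Pair: "(a, b) \<in> int_lattice \<longleftrightarrow> a \<in> int_lattice \<and> b \<in> int_lattice"
  by (simp add: int_lattice_def Basis_prod_def ball_Un)

lemma int_lattice_real: "(x::real) \<in> int_lattice \<longleftrightarrow> x \<in> \<int>"
  by (simp add: int_lattice_def)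

lemma int_lattice_vec: "(x::real^'n) \<in> int_lattice \<longleftrightarrow> (\<forall>i. x $ i \<in> \<int>)"
  by (auto simp: int_lattice_def Basis_vec_def inner_axis)

lemma unimodI:
  assumes "linear A" "\<And>x. B (A x) = x" "\<And>y. A (B y) = y"
    "\<And>x. x \<in> int_lattice \<Longrightarrow> A x \<in> int_lattice" "\<And>x. x \<in> int_lattice \<Longrightarrow> B x \<in> int_lattice"
  shows "unimod A"
proof -
  have "bij A" using assms(2,3) by (intro o_bij[of B]) auto
  moreover have "A ` int_lattice = int_lattice" using assms(3-5) by (metis image_subset_iff subsetI subset_antisym image_eqI)
  ultimately show ?thesis using assms(1) by (simp add: unimod_def)
qed

subsection \<open>Lattice polytopes given by integer points\<close>

type_synonym i3 = "int \<times> int \<times> int"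
type_synonym r3 = "real \<times> real \<times> real"

definition pt :: "i3 \<Rightarrow> r3" where
  "pt = (\<lambda>(x, y, z). (of_int x, of_int y, of_int z))"

definition hullZ :: "i3 set \<Rightarrow> r3 set" where
  "hullZ V = convex hull (pt ` V)"

definition pair :: "i3 \<Rightarrow> i3 \<Rightarrow> int" where
  "pair = (\<lambda>(a, b, c) (x, y, z). a * x + b * y + c * z)"

lemma pair_simp [simp]: "pair (a, b, c) (x, y, z) = a * x + b * y + c * z"
  by (simp add: pair_def)

lemma pt_simp [simp]: "pt (x, y, z) = (of_int x, of_int y, of_int z)"
  by (simp add: pt_def)

lemma inner_pt: "pt v \<bullet> pt n = of_int (pair n v)"
  by (cases v; cases n) (simp add: algebra_simps)

lemma int_lattice_r3: "(int_lattice :: r3 set) = range pt"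
  by (force simp: int_lattice_Pair int_lattice_real pt_def image_iff elim!: Ints_cases)

lemma inj_pt: "inj pt"
  by (auto simp: inj_def pt_def)

lemma pt_eq_0: "pt n = 0 \<longleftrightarrow> n = (0, 0, 0)"
  by (cases n) (auto simp: zero_prod_def)

lemma dual_r3: "(int_lattice :: r3 set) - {0} = pt ` (- {(0, 0, 0)})"
  using image_set_diff[OF inj_pt, of UNIV "{(0, 0, 0)}"]
  by (simp add: int_lattice_r3 Compl_eq_Diff_UNIV zero_prod_def)

text \<open>The Fine interior of \<open>c\<close> times \<open>hullZ V\<close>; a linear function
  takes its minimum over the polytope at a generating point, so \<open>V\<close> replaces the
  hull.\<close>

definition FinZ :: "real \<Rightarrow> i3 set \<Rightarrow> r3 set" where
  "FinZ c V = {x. \<forall>n. n \<noteq> (0, 0, 0) \<longrightarrow> (\<exists>v\<in>V. c * of_int (pair n v) + 1 \<le> x \<bullet> pt n)}"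

lemma hull_exists_le_iff:
  "(\<exists>p\<in>convex hull W. c * (p \<bullet> n) \<le> r) \<longleftrightarrow> (\<exists>w\<in>W. c * (w \<bullet> n) \<le> r)"
proof
  assume L: "\<exists>p\<in>convex hull W. c * (p \<bullet> n) \<le> r"
  show "\<exists>w\<in>W. c * (w \<bullet> n) \<le> r"
  proof (rule ccontr)
    assume "\<not> (\<exists>w\<in>W. c * (w \<bullet> n) \<le> r)"
    then have "W \<subseteq> {x. (c *\<^sub>R n) \<bullet> x > r}" by (force simp: inner_commute)
    then have "convex hull W \<subseteq> {x. (c *\<^sub>R n) \<bullet> x > r}"
      by (intro hull_minimal convex_halfspace_gt)
    then show False using L by (force simp: inner_commute)
  qed
qed (use hull_subset in fastforce)

lemma hullZ_compact:
  assumes "finite V" "V \<noteq> {}" shows "compact (hullZ V)" "hullZ V \<noteq> {}"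
  using assms by (auto simp: hullZ_def finite_imp_compact_convex_hull)

lemma ball_pt: "(\<forall>m\<in>pt ` (- {n0}). Q m) \<longleftrightarrow> (\<forall>n. n \<noteq> n0 \<longrightarrow> Q (pt n))"
  by blast

lemma fine_interior_hullZ:
  assumes "finite V" "V \<noteq> {}"
  shows "fine_interior (dilate c (hullZ V)) = FinZ c V"
proof -
  have "x \<in> fine_interior (dilate c (hullZ V)) \<longleftrightarrow> x \<in> FinZ c V" for x
  proof -
    have "(\<exists>p\<in>hullZ V. c * (p \<bullet> m) + 1 \<le> x \<bullet> m) \<longleftrightarrow> (\<exists>p\<in>pt ` V. c * (p \<bullet> m) + 1 \<le> x \<bullet> m)" for m
      using hull_exists_le_iff[of "pt ` V" c m "x \<bullet> m - 1"] by (simp add: hullZ_def le_diff_eq)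
    then show ?thesis
      unfolding fine_interior_dilate_iff[OF hullZ_compact[OF assms]] dual_r3 ball_pt FinZ_def
      by (simp add: inner_pt del: pt_simp split_paired_All)
  qed
  then show ?thesis by blast
qed

lemma hullZ_lattice: "finite V \<Longrightarrow> lattice_polytope (hullZ V)"
  unfolding lattice_polytope_iff hullZ_def by (rule exI[of _ "pt ` V"]) (auto simp: int_lattice_r3)

lemma lattice_polytope_hullZ:
  assumes "lattice_polytope (P :: r3 set)"
  obtains V where "finite V" "P = hullZ V"
proof -
  obtain W where W: "finite W" "W \<subseteq> int_lattice" "P = convex hull W"
    using assms lattice_polytope_iff by blast
  then obtain V where "V \<subseteq> UNIV" "finite V" "W = pt ` V"
    unfolding int_lattice_r3 by (meson finite_subset_image)
  then show ?thesis using that W(3) by (simp add: hullZ_def)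
qed

lemma full_not_in_plane:
  assumes "full_lattice_polytope (hullZ V)" "n \<noteq> (0, 0, 0)"
  shows "\<not> (\<forall>v\<in>V. pair n v = d)"
proof
  assume "\<forall>v\<in>V. pair n v = d"
  then have "\<forall>v\<in>V. pt n \<bullet> pt v = of_int d" by (metis inner_commute inner_pt)
  then have "pt ` V \<subseteq> {x. pt n \<bullet> x = of_int d}" by blast
  then have "hullZ V \<subseteq> {x. pt n \<bullet> x = of_int d}"
    unfolding hullZ_def by (intro hull_minimal convex_hyperplane)
  then have "aff_dim (hullZ V) \<le> aff_dim {x. pt n \<bullet> x = of_int d}" by (rule aff_dim_subset)
  also have "\<dots> = int DIM(r3) - 1" using assms(2) aff_dim_hyperplane[of "pt n" "of_int d"] pt_eq_0[of n] by simp
  finally show False using assms(1) by (simp add: full_lattice_polytope_def)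
qed

definition vdet :: "i3 \<Rightarrow> i3 \<Rightarrow> i3 \<Rightarrow> i3 \<Rightarrow> int" where
  "vdet = (\<lambda>(a1, a2, a3) (b1, b2, b3) (c1, c2, c3) (d1, d2, d3).
     (b1 - a1) * ((c2 - a2) * (d3 - a3) - (c3 - a3) * (d2 - a2)) -
     (b2 - a2) * ((c1 - a1) * (d3 - a3) - (c3 - a3) * (d1 - a1)) +
     (b3 - a3) * ((c1 - a1) * (d2 - a2) - (c2 - a2) * (d1 - a1)))"

text \<open>Cramer's rule: \<open>D\<close> times a coordinate is a combination of the three
  equations with cofactors as coefficients.\<close>

lemma det3_kernel:
  fixes m1 m2 m3 :: real
  assumes "m1 * p1 + m2 * p2 + m3 * p3 = 0" "m1 * q1 + m2 * q2 + m3 * q3 = 0"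
    "m1 * r1 + m2 * r2 + m3 * r3 = 0"
  defines "D \<equiv> p1 * (q2 * r3 - q3 * r2) - p2 * (q1 * r3 - q3 * r1) + p3 * (q1 * r2 - q2 * r1)"
  shows "D * m1 = 0" "D * m2 = 0" "D * m3 = 0"
proof -
  have "D * m1 = (q2 * r3 - q3 * r2) * (m1 * p1 + m2 * p2 + m3 * p3)
      - (p2 * r3 - p3 * r2) * (m1 * q1 + m2 * q2 + m3 * q3) + (p2 * q3 - p3 * q2) * (m1 * r1 + m2 * r2 + m3 * r3)"
    unfolding D_def by algebra
  then show "D * m1 = 0" using assms(1-3) by simp
  have "D * m2 = - (q1 * r3 - q3 * r1) * (m1 * p1 + m2 * p2 + m3 * p3)
      + (p1 * r3 - p3 * r1) * (m1 * q1 + m2 * q2 + m3 * q3) - (p1 * q3 - p3 * q1) * (m1 * r1 + m2 * r2 + m3 * r3)"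
    unfolding D_def by algebra
  then show "D * m2 = 0" using assms(1-3) by simp
  have "D * m3 = (q1 * r2 - q2 * r1) * (m1 * p1 + m2 * p2 + m3 * p3)
      - (p1 * r2 - p2 * r1) * (m1 * q1 + m2 * q2 + m3 * q3) + (p1 * q2 - p2 * q1) * (m1 * r1 + m2 * r2 + m3 * r3)"
    unfolding D_def by algebra
  then show "D * m3 = 0" using assms(1-3) by simp
qed

lemma hullZ_full:
  assumes "finite V" "a \<in> V" "b \<in> V" "c \<in> V" "d \<in> V" "vdet a b c d \<noteq> 0"
  shows "full_lattice_polytope (hullZ V)"
proof -
  have "aff_dim (hullZ V) = int DIM(r3)"
  proof (rule ccontr)
    assume "aff_dim (hullZ V) \<noteq> int DIM(r3)"
    then have "aff_dim (hullZ V) < int DIM(r3)" using aff_dim_le_DIM[of "hullZ V"] by simp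
    then obtain m r where m: "m \<noteq> 0" "hullZ V \<subseteq> {x. m \<bullet> x = r}"
      by (rule aff_lowdim_subset_hyperplane)
    have in_hull: "pt v \<in> hullZ V" if "v \<in> V" for v
      using that by (simp add: hullZ_def hull_inc)
    obtain m1 m2 m3 where mm: "m = (m1, m2, m3)" by (cases m)
    obtain a1 a2 a3 where a: "a = (a1, a2, a3)" by (cases a)
    obtain b1 b2 b3 where b: "b = (b1, b2, b3)" by (cases b)
    obtain c1 c2 c3 where c: "c = (c1, c2, c3)" by (cases c)
    obtain d1 d2 d3 where d: "d = (d1, d2, d3)" by (cases d)
    define D where "D = real_of_int (vdet a b c d)"
    have D: "D = (of_int b1 - of_int a1) * ((of_int c2 - of_int a2) * (of_int d3 - of_int a3) - (of_int c3 - of_int a3) * (of_int d2 - of_int a2)) -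
     (of_int b2 - of_int a2) * ((of_int c1 - of_int a1) * (of_int d3 - of_int a3) - (of_int c3 - of_int a3) * (of_int d1 - of_int a1)) +
     (of_int b3 - of_int a3) * ((of_int c1 - of_int a1) * (of_int d2 - of_int a2) - (of_int c2 - of_int a2) * (of_int d1 - of_int a1))"
      by (simp add: D_def vdet_def a b c d)
    have "m \<bullet> pt v = r" if "v \<in> V" for v using m(2) in_hull[OF that] by blast
    from this[OF assms(2)] this[OF assms(3)] this[OF assms(4)] this[OF assms(5)]
    have e: "m1 * of_int a1 + m2 * of_int a2 + m3 * of_int a3 = r"
      "m1 * of_int b1 + m2 * of_int b2 + m3 * of_int b3 = r"
      "m1 * of_int c1 + m2 * of_int c2 + m3 * of_int c3 = r"
      "m1 * of_int d1 + m2 * of_int d2 + m3 * of_int d3 = r"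
      by (simp_all add: mm a b c d)
    have e': "m1 * (of_int b1 - of_int a1) + m2 * (of_int b2 - of_int a2) + m3 * (of_int b3 - of_int a3) = 0"
      "m1 * (of_int c1 - of_int a1) + m2 * (of_int c2 - of_int a2) + m3 * (of_int c3 - of_int a3) = 0"
      "m1 * (of_int d1 - of_int a1) + m2 * (of_int d2 - of_int a2) + m3 * (of_int d3 - of_int a3) = 0"
      using e by (simp_all add: algebra_simps)
    have "D * m1 = 0" "D * m2 = 0" "D * m3 = 0" unfolding D using det3_kernel[OF e'] by simp_all
    then have "m = 0" using assms(6) by (simp add: mm D_def zero_prod_def)
    then show False using m(1) by simp
  qed
  then show ?thesis using hullZ_lattice[OF assms(1)] by (simp add: full_lattice_polytope_def)
qed

subsection \<open>Integer affine maps\<close>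

type_synonym i12 = "int \<times> int \<times> int \<times> int \<times> int \<times> int \<times> int \<times> int \<times> int \<times> int \<times> int \<times> int"

definition amap :: "i12 \<Rightarrow> i3 \<Rightarrow> i3" where
  "amap = (\<lambda>(a, b, c, d, e, f, g, h, i, s, t, u) (x, y, z).
     (a * x + b * y + c * z + s, d * x + e * y + f * z + t, g * x + h * y + i * z + u))"

definition amap_det :: "i12 \<Rightarrow> int" where
  "amap_det = (\<lambda>(a, b, c, d, e, f, g, h, i, s, t, u).
     a * (e * i - f * h) - b * (d * i - f * g) + c * (d * h - e * g))"

lemma hullZ_amap:
  assumes "amap_det g \<in> {1, -1}"
  shows "unimodular_equiv (hullZ V) (hullZ (amap g ` V))"
proof -
  obtain a b c d e f k where "g = (a, b, c, d, e, f, k)" by (cases g)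
  moreover obtain g' h i s t u where "k = (g', h, i, s, t, u)" by (cases k)
  ultimately have g: "g = (a, b, c, d, e, f, g', h, i, s, t, u)" by simp
  define M :: "int \<Rightarrow> int \<Rightarrow> int \<Rightarrow> int \<Rightarrow> int \<Rightarrow> int \<Rightarrow> int \<Rightarrow> int \<Rightarrow> int \<Rightarrow> r3 \<Rightarrow> r3" where
    "M a b c d e f g h i = (\<lambda>(x, y, z). (of_int a * x + of_int b * y + of_int c * z,
       of_int d * x + of_int e * y + of_int f * z, of_int g * x + of_int h * y + of_int i * z))"
    for a b c d e f g h i
  define D where "D = amap_det g"
  have D: "D = a * (e * i - f * h) - b * (d * i - f * g') + c * (d * h - e * g')"
    by (simp add: D_def amap_det_def g)
  have D2: "D * D = 1" using assms by (auto simp: D_def)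
  have rD2: "real_of_int D * real_of_int D = 1" by (metis D2 of_int_1 of_int_mult)
  have rD: "real_of_int D = of_int a * (of_int e * of_int i - of_int f * of_int h)
      - of_int b * (of_int d * of_int i - of_int f * of_int g') + of_int c * (of_int d * of_int h - of_int e * of_int g')"
    by (simp add: D)
  let ?A = "M a b c d e f g' h i"
  \<comment> \<open>Since \<open>D * D = 1\<close>, the inverse matrix is \<open>D\<close> times the
    adjugate, which has integer entries.\<close>
  let ?B = "M (D * (e*i-f*h)) (D * (c*h-b*i)) (D * (b*f-c*e)) (D * (f*g'-d*i)) (D * (a*i-c*g')) (D * (c*d-a*f))
     (D * (d*h-e*g')) (D * (b*g'-a*h)) (D * (a*e-b*d))"
  have L: "M a b c d e f g h i x \<in> int_lattice" if "x \<in> int_lattice" for a b c d e f g h i x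
    using that by (cases x) (auto simp: M_def int_lattice_Pair int_lattice_real intro!: Ints_add Ints_mult)
  have "unimod ?A"
  proof (rule unimodI[of _ ?B])
    show "linear ?A" by (rule linearI) (auto simp: M_def algebra_simps)
    show "?B (?A x) = x" for x
    proof (cases x)
      case (fields p q r)
      have "?B (?A (p, q, r)) = (real_of_int D * real_of_int D * p, real_of_int D * real_of_int D * q, real_of_int D * real_of_int D * r)"
        by (simp add: M_def) (intro conjI; use rD in algebra)
      then show ?thesis using rD2 fields by simp
    qed
    show "?A (?B x) = x" for x
    proof (cases x)
      case (fields p q r)
      have "?A (?B (p, q, r)) = (real_of_int D * real_of_int D * p, real_of_int D * real_of_int D * q, real_of_int D * real_of_int D * r)"
        by (simp add: M_def) (intro conjI; use rD in algebra)
      then show ?thesis using rD2 fields by simp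
    qed
  qed (use L in auto)
  moreover have "hullZ (amap g ` V) = (\<lambda>x. ?A x + pt (s, t, u)) ` hullZ V"
  proof -
    have lin: "linear ?A" by (rule linearI) (auto simp: M_def algebra_simps)
    have "pt (amap g v) = pt (s, t, u) + ?A (pt v)" for v
      by (cases v) (simp add: amap_def g M_def)
    then have "pt ` amap g ` V = (\<lambda>y. pt (s, t, u) + y) ` ?A ` pt ` V"
      by (simp add: image_image del: pt_simp)
    then show ?thesis
      by (simp add: affine_image_eq hullZ_def convex_hull_linear_image[OF lin] convex_hull_translation del: pt_simp)
  qed
  moreover have "pt (s, t, u) \<in> int_lattice" by (simp add: int_lattice_r3 del: pt_simp)
  ultimately show ?thesis unfolding unimodular_equiv_iff by blast
qed

subsection \<open>Weakly sporadic polytopes given by integer points\<close>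

definition ws :: "i3 set \<Rightarrow> bool" where
  "ws V \<longleftrightarrow> finite V \<and> weakly_sporadic_F_hollow (hullZ V)"

lemma wsD:
  assumes "ws V"
  shows "finite V" "V \<noteq> {}" "full_lattice_polytope (hullZ V)" "weakly_sporadic_F_hollow (hullZ V)"
  using assms weakly_sporadic_compact(2)[of "hullZ V"]
  by (auto simp: ws_def weakly_sporadic_F_hollow_def F_hollow_def hullZ_def)

lemma ws_amap: "ws V \<Longrightarrow> amap_det g \<in> {1, -1} \<Longrightarrow> ws (amap g ` V)"
  unfolding ws_def using hullZ_amap weakly_sporadic_equiv by blast

text \<open>The tool that bounds the configurations: if nothing exists below \<open>c\<close>, then
  a point at \<open>c\<close> shows that mu is \<open>c\<close>, and a second one makes the Fine
  interior there positive-dimensional.\<close>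

lemma ws_not_two_points:
  assumes "ws V" "0 \<le> c" "x \<in> FinZ c V" "y \<in> FinZ c V" "x \<noteq> y"
    and "\<And>d. 0 \<le> d \<Longrightarrow> d < c \<Longrightarrow> FinZ d V = {}"
  shows False
proof -
  note V = wsD[OF assms(1)]
  have "min_multiplier (hullZ V) = c"
    using assms(2,3,6) by (intro min_multiplier_eqI) (auto simp: fine_interior_hullZ[OF V(1,2)])
  then have "aff_dim (FinZ c V) = 0"
    using V(4) by (simp add: weakly_sporadic_F_hollow_def fine_interior_hullZ[OF V(1,2)])
  then show False using assms(3-5) by (auto simp: aff_dim_eq_0)
qed

lemma min_multiplier_hullZ:
  assumes "finite V" "0 \<le> c" "FinZ c V \<noteq> {}" "\<And>d. 0 \<le> d \<Longrightarrow> d < c \<Longrightarrow> FinZ d V = {}"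
  shows "min_multiplier (hullZ V) = c"
proof (cases "V = {}")
  case False
  then show ?thesis
    using assms by (intro min_multiplier_eqI) (auto simp: fine_interior_hullZ[OF assms(1) False])
next
  case True
  have "x \<notin> FinZ c V" for x
    using True by (auto simp: FinZ_def intro: exI[of _ "1::int"])
  then have "FinZ c V = {}" by blast
  then show ?thesis using assms(3) by blast
qed

lemma wsI:
  assumes "finite V" "full_lattice_polytope (hullZ V)" "1 < c" "FinZ c V = {x}"
    "\<And>d. 0 \<le> d \<Longrightarrow> d < c \<Longrightarrow> FinZ d V = {}"
  shows "ws V" "min_multiplier (hullZ V) = c"
proof -
  show mu: "min_multiplier (hullZ V) = c"
    using assms by (intro min_multiplier_hullZ) auto
  have "V \<noteq> {}" using assms(2) full_lattice_polytope_compact(2)[of "hullZ V"] by (auto simp: hullZ_def)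
  then show "ws V" using assms mu
    by (simp add: ws_def weakly_sporadic_F_hollow_def F_hollow_def fine_interior_hullZ aff_dim_eq_0)
qed

section \<open>Lattice polygons with at most one interior lattice point\<close>

subsection \<open>Lattice points in the plane\<close>

type_synonym i2 = "int \<times> int"
type_synonym i6 = "int \<times> int \<times> int \<times> int \<times> int \<times> int"

text \<open>For finite \<open>C\<close> this is membership in the interior of the convex hull.
  Integer normals suffice because \<open>C\<close> is integral, and the test stays in integer
  arithmetic.\<close>

definition in2 :: "i2 set \<Rightarrow> i2 \<Rightarrow> bool" where
  "in2 C = (\<lambda>(a, b). \<forall>m n. (m, n) \<noteq> (0, 0) \<longrightarrow> (\<exists>(x, y)\<in>C. m * (x - a) + n * (y - b) < 0))"

text \<open>For finite \<open>C\<close>, the lattice points of the convex hull, again tested by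
  integer functionals.\<close>

definition cl2 :: "i2 set \<Rightarrow> i2 set" where
  "cl2 C = {(a, b). \<forall>m n. \<exists>(x, y)\<in>C. m * (x - a) + n * (y - b) \<le> 0}"

definition closed2 :: "i2 set \<Rightarrow> bool" where
  "closed2 C \<longleftrightarrow> cl2 C \<subseteq> C"

lemma not_in2E:
  assumes "\<not> in2 C (a, b)"
  obtains m n where "(m, n) \<noteq> (0, 0)" "\<And>x y. (x, y) \<in> C \<Longrightarrow> 0 \<le> m * (x - a) + n * (y - b)"
proof -
  have "\<exists>m n. (m, n) \<noteq> (0, 0) \<and> \<not> (\<exists>(x, y)\<in>C. m * (x - a) + n * (y - b) < 0)"
    using assms unfolding in2_def prod.case by blast
  then show ?thesis using that by (metis (no_types, lifting) case_prodI not_less)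
qed

text \<open>The \<open>l1\<close>, \<open>l2\<close>, \<open>l3\<close> are barycentric coordinates
  with the denominator cleared. A functional that is positive at all points of \<open>C\<close>
  relative to \<open>(a, b)\<close> would have a positive weighted sum, but that sum is
  zero.\<close>

lemma closed2I:
  assumes C: "closed2 C" "(x1, y1) \<in> C" "(x2, y2) \<in> C" "(x3, y3) \<in> C"
    and l: "0 \<le> l1" "0 \<le> l2" "0 \<le> l3" "0 < l1 + l2 + l3"
    and e: "(l1 + l2 + l3) * a = l1 * x1 + l2 * x2 + l3 * x3"
      "(l1 + l2 + l3) * b = l1 * y1 + l2 * y2 + l3 * y3"
  shows "(a, b) \<in> C"
proof -
  have "\<exists>(x, y)\<in>C. m * (x - a) + n * (y - b) \<le> 0" for m n
  proof (rule ccontr)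
    let ?v = "\<lambda>x y. m * (x - a) + n * (y - b)"
    assume "\<not> (\<exists>(x, y)\<in>C. ?v x y \<le> 0)"
    then have p: "1 \<le> ?v x y" if "(x, y) \<in> C" for x y using that by force
    have "l1 * ?v x1 y1 + l2 * ?v x2 y2 + l3 * ?v x3 y3 =
      m * (l1 * x1 + l2 * x2 + l3 * x3 - (l1 + l2 + l3) * a) + n * (l1 * y1 + l2 * y2 + l3 * y3 - (l1 + l2 + l3) * b)"
      by (simp add: algebra_simps)
    also have "\<dots> = 0" by (simp add: e)
    finally have "l1 * ?v x1 y1 + l2 * ?v x2 y2 + l3 * ?v x3 y3 = 0" .
    moreover have "l1 * 1 \<le> l1 * ?v x1 y1" "l2 * 1 \<le> l2 * ?v x2 y2" "l3 * 1 \<le> l3 * ?v x3 y3"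
      using l p C by (intro mult_left_mono; simp)+
    ultimately show False using l by linarith
  qed
  then show ?thesis using C(1) unfolding closed2_def cl2_def by blast
qed

text \<open>Positive weight on an interior point makes the combination interior: a functional
  supporting at \<open>(a, b)\<close> would be at most 0 at the interior point, from which some
  point of \<open>C\<close> lies strictly lower still.\<close>

lemma in2_combine:
  assumes i: "in2 C (x0, y0)" and C: "(x1, y1) \<in> C" "(x2, y2) \<in> C"
    and l: "0 < l0" "0 \<le> l1" "0 \<le> l2"
    and e: "(l0 + l1 + l2) * a = l0 * x0 + l1 * x1 + l2 * x2"
      "(l0 + l1 + l2) * b = l0 * y0 + l1 * y1 + l2 * y2"
  shows "in2 C (a, b)"
proof (rule ccontr)
  assume "\<not> in2 C (a, b)"
  then obtain m n where mn: "(m, n) \<noteq> (0, 0)"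
    and p: "\<And>x y. (x, y) \<in> C \<Longrightarrow> 0 \<le> m * (x - a) + n * (y - b)" using not_in2E by metis
  let ?v = "\<lambda>x y. m * (x - a) + n * (y - b)"
  have "l0 * ?v x0 y0 + l1 * ?v x1 y1 + l2 * ?v x2 y2 =
    m * (l0 * x0 + l1 * x1 + l2 * x2 - (l0 + l1 + l2) * a) + n * (l0 * y0 + l1 * y1 + l2 * y2 - (l0 + l1 + l2) * b)"
    by (simp add: algebra_simps)
  also have "\<dots> = 0" by (simp add: e)
  finally have "l0 * ?v x0 y0 + l1 * ?v x1 y1 + l2 * ?v x2 y2 = 0" .
  moreover have "0 \<le> l1 * ?v x1 y1" "0 \<le> l2 * ?v x2 y2" using l p C by simp_all
  ultimately have "l0 * ?v x0 y0 \<le> 0" by linarith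
  then have v0: "?v x0 y0 \<le> 0" using l(1) by (metis mult_le_0_iff not_less)
  have "\<exists>(x, y)\<in>C. m * (x - x0) + n * (y - y0) < 0" using i mn unfolding in2_def prod.case by blast
  then obtain x y where xy: "(x, y) \<in> C" "m * (x - x0) + n * (y - y0) < 0" by blast
  have "?v x y = (m * (x - x0) + n * (y - y0)) + ?v x0 y0" by (simp add: algebra_simps)
  then show False using p[OF xy(1)] xy(2) v0 by linarith
qed

text \<open>A functional supporting at a point strictly inside a triangle vanishes at the corners;
  by \<open>d\<close> the vectors to two of them are independent, so it is zero.\<close>

lemma in2I:
  assumes C: "(x1, y1) \<in> C" "(x2, y2) \<in> C" "(x3, y3) \<in> C"
    and l: "0 < l1" "0 < l2" "0 < l3"
    and e: "(l1 + l2 + l3) * a = l1 * x1 + l2 * x2 + l3 * x3"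
      "(l1 + l2 + l3) * b = l1 * y1 + l2 * y2 + l3 * y3"
    and d: "(x1 - a) * (y2 - b) \<noteq> (x2 - a) * (y1 - b)"
  shows "in2 C (a, b)"
proof (rule ccontr)
  assume "\<not> in2 C (a, b)"
  then obtain m n where mn: "(m, n) \<noteq> (0, 0)"
    and p: "\<And>x y. (x, y) \<in> C \<Longrightarrow> 0 \<le> m * (x - a) + n * (y - b)" using not_in2E by metis
  let ?v = "\<lambda>x y. m * (x - a) + n * (y - b)"
  have "l1 * ?v x1 y1 + l2 * ?v x2 y2 + l3 * ?v x3 y3 =
    m * (l1 * x1 + l2 * x2 + l3 * x3 - (l1 + l2 + l3) * a) + n * (l1 * y1 + l2 * y2 + l3 * y3 - (l1 + l2 + l3) * b)"
    by (simp add: algebra_simps)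
  also have "\<dots> = 0" by (simp add: e)
  finally have s: "l1 * ?v x1 y1 + l2 * ?v x2 y2 + l3 * ?v x3 y3 = 0" .
  have "0 \<le> l1 * ?v x1 y1" "0 \<le> l2 * ?v x2 y2" "0 \<le> l3 * ?v x3 y3" using l p C by simp_all
  with s have "l1 * ?v x1 y1 \<le> 0" "l2 * ?v x2 y2 \<le> 0" by linarith+
  then have "?v x1 y1 \<le> 0" "?v x2 y2 \<le> 0" using l(1,2) by (metis mult_le_0_iff not_less)+
  then have z: "?v x1 y1 = 0" "?v x2 y2 = 0" using p[OF C(1)] p[OF C(2)] by linarith+
  define E where "E = (x1 - a) * (y2 - b) - (x2 - a) * (y1 - b)"
  have "m * E = (y2 - b) * ?v x1 y1 - (y1 - b) * ?v x2 y2"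
    "n * E = (x1 - a) * ?v x2 y2 - (x2 - a) * ?v x1 y1"
    by (simp_all add: E_def algebra_simps)
  then have "m * E = 0" "n * E = 0" by (simp_all only: z mult_zero_right diff_zero)
  moreover have "E \<noteq> 0" using d by (simp add: E_def)
  ultimately show False using mn by simp
qed

lemma in2_mem: "in2 C (a, b) \<Longrightarrow> closed2 C \<Longrightarrow> C \<noteq> {} \<Longrightarrow> (a, b) \<in> C"
proof -
  assume i: "in2 C (a, b)" and c: "closed2 C" and "C \<noteq> {}"
  have "\<exists>(x, y)\<in>C. m * (x - a) + n * (y - b) \<le> 0" for m n
  proof (cases "(m, n) = (0, 0)")
    case True
    then show ?thesis using \<open>C \<noteq> {}\<close> by auto
  next
    case False
    then have "\<exists>(x, y)\<in>C. m * (x - a) + n * (y - b) < 0" using i unfolding in2_def prod.case by blast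
    then show ?thesis by (auto intro: less_imp_le)
  qed
  then show "(a, b) \<in> C" using c unfolding closed2_def cl2_def by blast
qed

lemma closed2_cl2: "closed2 (cl2 C)"
proof -
  have "(a, b) \<in> cl2 C" if ab: "(a, b) \<in> cl2 (cl2 C)" for a b
  proof -
    have "\<exists>(x, y)\<in>C. m * (x - a) + n * (y - b) \<le> 0" for m n
    proof -
      obtain c d where cd: "(c, d) \<in> cl2 C" "m * (c - a) + n * (d - b) \<le> 0"
        using ab unfolding cl2_def[of "cl2 C"] by blast
      then obtain x y where xy: "(x, y) \<in> C" "m * (x - c) + n * (y - d) \<le> 0"
        unfolding cl2_def by blast
      have "m * (x - a) + n * (y - b) = (m * (c - a) + n * (d - b)) + (m * (x - c) + n * (y - d))" by (simp add: algebra_simps)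
      then show ?thesis using xy cd(2) by (intro bexI[of _ "(x, y)"]) auto
    qed
    then show ?thesis by (auto simp: cl2_def)
  qed
  then show ?thesis by (auto simp: closed2_def)
qed

lemma subset_cl2: "C \<subseteq> cl2 C"
proof
  fix p assume p: "p \<in> C"
  obtain a b where ab: "p = (a, b)" by (cases p)
  have "\<exists>(x, y)\<in>C. m * (x - a) + n * (y - b) \<le> 0" for m n
    using p by (intro bexI[of _ "(a, b)"]) (auto simp: ab)
  then show "p \<in> cl2 C" by (simp add: cl2_def ab)
qed

lemma in2_cl2: "in2 (cl2 C) p \<longleftrightarrow> in2 C p"
proof (cases p)
  case (Pair a b)
  have "in2 C (a, b)" if i: "in2 (cl2 C) (a, b)"
    unfolding in2_def prod.case
  proof (intro allI impI)
    fix m n :: int assume "(m, n) \<noteq> (0, 0)"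
    then have "\<exists>(c, d)\<in>cl2 C. m * (c - a) + n * (d - b) < 0" using i unfolding in2_def prod.case by blast
    then obtain c d where cd: "(c, d) \<in> cl2 C" "m * (c - a) + n * (d - b) < 0" by blast
    then obtain x y where xy: "(x, y) \<in> C" "m * (x - c) + n * (y - d) \<le> 0"
      unfolding cl2_def by blast
    have "m * (x - a) + n * (y - b) = (m * (c - a) + n * (d - b)) + (m * (x - c) + n * (y - d))" by (simp add: algebra_simps)
    then show "\<exists>(x, y)\<in>C. m * (x - a) + n * (y - b) < 0"
      using xy cd(2) by (intro bexI[of _ "(x, y)"]) auto
  qed
  moreover have "in2 (cl2 C) (a, b)" if "in2 C (a, b)"
    using that subset_cl2[of C] unfolding in2_def prod.case by blast
  ultimately show ?thesis using Pair by blast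
qed

subsection \<open>Planar integer affine maps\<close>

definition am2 :: "i6 \<Rightarrow> i2 \<Rightarrow> i2" where
  "am2 = (\<lambda>(a, b, c, d, s, t) (x, y). (a * x + b * y + s, c * x + d * y + t))"

definition U2 :: "i6 \<Rightarrow> bool" where
  "U2 = (\<lambda>(a, b, c, d, s, t). a * d - b * c \<in> {1, -1})"

lemma am2_simp [simp]: "am2 (a, b, c, d, s, t) (x, y) = (a * x + b * y + s, c * x + d * y + t)"
  by (simp add: am2_def)

lemma U2_simp [simp]: "U2 (a, b, c, d, s, t) \<longleftrightarrow> a * d - b * c \<in> {1, -1}"
  by (simp add: U2_def)

text \<open>Permits a normalisation by \<open>h\<close> before the required map is sought, since the
  planar maps are closed under composition.\<close>

lemma U2_wlog:
  assumes h: "U2 h" and "\<exists>g. U2 g \<and> G (am2 g ` am2 h ` C)"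
  shows "\<exists>g. U2 g \<and> G (am2 g ` C)"
proof -
  obtain g where g: "U2 g" "G (am2 g ` am2 h ` C)" using assms by blast
  obtain a b c d s t where g': "g = (a, b, c, d, s, t)" by (cases g)
  obtain a' b' c' d' s' t' where h': "h = (a', b', c', d', s', t')" by (cases h)
  define k where "k = (a * a' + b * c', a * b' + b * d', c * a' + d * c', c * b' + d * d',
      a * s' + b * t' + s, c * s' + d * t' + t)"
  have "am2 g (am2 h p) = am2 k p" for p
    by (cases p) (simp add: g' h' k_def algebra_simps)
  then have 1: "am2 g ` am2 h ` C = am2 k ` C" by (simp add: image_image)
  have "(a * a' + b * c') * (c * b' + d * d') - (a * b' + b * d') * (c * a' + d * c') =
    (a * d - b * c) * (a' * d' - b' * c')" by algebra
  then have "U2 k" using g(1) h by (auto simp: k_def g' h')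
  then show ?thesis using g(2) 1 by metis
qed

lemma am2_inverse:
  assumes "U2 g"
  obtains h where "U2 h" "\<And>p. am2 h (am2 g p) = p" "\<And>p. am2 g (am2 h p) = p"
proof -
  obtain a b c d s t where g: "g = (a, b, c, d, s, t)" by (cases g)
  define D where "D = a * d - b * c"
  have D: "D * D = 1" using assms by (auto simp: g D_def)
  define h where "h = (D * d, - D * b, - D * c, D * a, - D * (d * s - b * t), - D * (a * t - c * s))"
  have 1: "am2 h (am2 g p) = p" for p
  proof (cases p)
    case (Pair x y)
    have "am2 h (am2 g (x, y)) = (D * D * x, D * D * y)"
      by (simp add: h_def g) (simp add: D_def; intro conjI; algebra)
    then show ?thesis using D Pair by simp
  qed
  have 2: "am2 g (am2 h p) = p" for p
  proof (cases p)
    case (Pair x y)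
    have "am2 g (am2 h (x, y)) = (D * D * x + (1 - D * D) * s, D * D * y + (1 - D * D) * t)"
      by (simp add: h_def g) (simp add: D_def; intro conjI; algebra)
    then show ?thesis using D Pair by simp
  qed
  have "(D * d) * (D * a) - (- D * b) * (- D * c) = D * D * D" unfolding D_def by algebra
  then have "U2 h" using assms D by (simp add: h_def g D_def)
  then show ?thesis using that 1 2 by blast
qed

lemma am2_functional:
  "am2 (a, b, c, d, s, t) (p, q) = (p', q') \<Longrightarrow> am2 (a, b, c, d, s, t) (x, y) = (x', y') \<Longrightarrow>
    m * (x' - p') + n * (y' - q') = (m * a + n * c) * (x - p) + (m * b + n * d) * (y - q)"
  by (auto simp: algebra_simps)

lemma in2_am2_imp:
  assumes "U2 g" "in2 C p" shows "in2 (am2 g ` C) (am2 g p)"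
proof -
  obtain a b c d s t where g: "g = (a, b, c, d, s, t)" by (cases g)
  obtain u v where p: "p = (u, v)" by (cases p)
  obtain u' v' where p': "am2 g p = (u', v')" by (cases "am2 g p")
  have dn: "a * d - b * c \<noteq> 0" using assms(1) by (auto simp: g)
  show ?thesis
    unfolding p' in2_def prod.case
  proof (intro allI impI)
    fix m n :: int assume mn: "(m, n) \<noteq> (0, 0)"
    have "(m * a + n * c, m * b + n * d) \<noteq> (0, 0)"
    proof
      assume "(m * a + n * c, m * b + n * d) = (0, 0)"
      then have z: "m * a + n * c = 0" "m * b + n * d = 0" by simp_all
      have "m * (a * d - b * c) = 0" "n * (a * d - b * c) = 0" using z by algebra+
      then show False using dn mn by simp
    qed
    then have "\<exists>(x, y)\<in>C. (m * a + n * c) * (x - u) + (m * b + n * d) * (y - v) < 0"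
      using assms(2) unfolding p in2_def prod.case by blast
    then obtain x y where xy: "(x, y) \<in> C" "(m * a + n * c) * (x - u) + (m * b + n * d) * (y - v) < 0" by blast
    obtain x' y' where xy': "am2 g (x, y) = (x', y')" by (cases "am2 g (x, y)")
    have "m * (x' - u') + n * (y' - v') < 0"
      using am2_functional[of a b c d s t u v u' v' x y x' y' m n] xy(2) xy' p' by (simp add: g p)
    moreover have "(x', y') \<in> am2 g ` C" using xy(1) xy' by (metis imageI)
    ultimately show "\<exists>(x, y)\<in>am2 g ` C. m * (x - u') + n * (y - v') < 0" by blast
  qed
qed

lemma in2_am2:
  assumes "U2 g" shows "in2 (am2 g ` C) (am2 g p) \<longleftrightarrow> in2 C p"
proof -
  obtain h where h: "U2 h" "\<And>p. am2 h (am2 g p) = p" using am2_inverse[OF assms] by metis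
  have "am2 h ` am2 g ` C = C" by (simp add: image_image h)
  then show ?thesis using in2_am2_imp[OF assms, of C p] in2_am2_imp[OF h(1), of "am2 g ` C" "am2 g p"] h(2) by auto
qed

lemma closed2_am2:
  assumes "U2 g" "closed2 C" shows "closed2 (am2 g ` C)"
proof -
  obtain a b c d s t where g: "g = (a, b, c, d, s, t)" by (cases g)
  obtain h where h: "\<And>p. am2 g (am2 h p) = p" using am2_inverse[OF assms(1)] by metis
  have dn: "(a * d - b * c) * (a * d - b * c) = 1" using assms(1) by (auto simp: g)
  have "(u', v') \<in> am2 g ` C" if uv': "(u', v') \<in> cl2 (am2 g ` C)" for u' v'
  proof -
    obtain u v where uv: "am2 g (u, v) = (u', v')" using h by (metis surj_pair)
    have "\<exists>(x, y)\<in>C. m * (x - u) + n * (y - v) \<le> 0" for m n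
    proof -
      define D where "D = a * d - b * c"
      \<comment> \<open>\<open>(m', n')\<close> is the functional that pulls back to
        \<open>(m, n)\<close>: the inverse transpose, made integral by
        \<open>D * D = 1\<close>.\<close>
      define m' n' where "m' = D * (m * d - n * c)" and "n' = D * (n * a - m * b)"
      have "m' * a + n' * c = D * D * m" "m' * b + n' * d = D * D * n"
        unfolding m'_def n'_def D_def by algebra+
      then have mn: "m' * a + n' * c = m" "m' * b + n' * d = n" using dn by (simp_all add: D_def)
      have "\<exists>(x', y')\<in>am2 g ` C. m' * (x' - u') + n' * (y' - v') \<le> 0"
        using uv' unfolding cl2_def mem_Collect_eq prod.case by blast
      then obtain x' y' where xy': "(x', y') \<in> am2 g ` C" "m' * (x' - u') + n' * (y' - v') \<le> 0"
        by (elim bexE case_prodE) (simp only:)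
      then obtain x y where xy: "(x, y) \<in> C" "am2 g (x, y) = (x', y')" by auto
      have "m * (x - u) + n * (y - v) \<le> 0"
        using am2_functional[of a b c d s t u v u' v' x y x' y' m' n'] xy'(2) xy(2) uv mn by (simp add: g)
      then show ?thesis using xy(1) by blast
    qed
    then have "(u, v) \<in> C" using assms(2) unfolding closed2_def cl2_def by blast
    then show ?thesis using uv by (metis imageI)
  qed
  then show ?thesis by (auto simp: closed2_def)
qed

lemma am2_transport:
  assumes "U2 g" "closed2 C" "\<And>p. in2 C p \<Longrightarrow> p = o2"
  shows "closed2 (am2 g ` C)" "\<And>p. in2 (am2 g ` C) p \<Longrightarrow> p = am2 g o2"
proof -
  show "closed2 (am2 g ` C)" by (rule closed2_am2[OF assms(1,2)])
  obtain h where h: "U2 h" "\<And>p. am2 g (am2 h p) = p" using am2_inverse[OF assms(1)] by metis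
  show "p = am2 g o2" if "in2 (am2 g ` C) p" for p
    using that in2_am2[OF assms(1), of C "am2 h p"] h(2) assms(3) by metis
qed

text \<open>Rounding of \<open>c / q\<close>, kept free of fractions. It finds lattice points near
  the centre of a slice of a triangle.\<close>

lemma nearest_multiple:
  fixes c q :: int assumes "0 < q"
  obtains y where "- q \<le> 2 * (q * y - c)" "2 * (q * y - c) \<le> q"
proof -
  let ?y = "(2 * c + q) div (2 * q)"
  have "2 * q * ?y + (2 * c + q) mod (2 * q) = 2 * c + q" by (rule mult_div_mod_eq)
  moreover have "0 \<le> (2 * c + q) mod (2 * q)" "(2 * c + q) mod (2 * q) < 2 * q" using assms by simp_all
  ultimately show ?thesis by (intro that[of ?y]) (simp_all add: algebra_simps)
qed

text \<open>Rounding up of \<open>a / h\<close>: the first lattice point in a slice that starts at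
  \<open>a / h\<close>.\<close>

lemma ceiling_multiple:
  fixes a h :: int assumes "0 < h"
  obtains s where "0 \<le> h * s - a" "h * s - a \<le> h - 1"
proof -
  let ?s = "(a + h - 1) div h"
  have "h * ?s + (a + h - 1) mod h = a + h - 1" by (rule mult_div_mod_eq)
  moreover have "0 \<le> (a + h - 1) mod h" "(a + h - 1) mod h < h" using assms by simp_all
  ultimately show ?thesis by (intro that[of ?s]; linarith)
qed

subsection \<open>Hollow lattice polygons\<close>

definition strip2 :: "int \<Rightarrow> i2 set \<Rightarrow> bool" where
  "strip2 k C \<longleftrightarrow> (\<exists>a. \<forall>(x, y)\<in>C. a \<le> x \<and> x \<le> a + k)"

text \<open>The corners are demanded besides the inclusion because a corner of a Minkowski sum
  splits into corners of the summands, which \<open>tri_good\<close> exploits.\<close>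

definition tri2 :: "int \<Rightarrow> i2 set \<Rightarrow> bool" where
  "tri2 k C \<longleftrightarrow> (\<forall>(x, y)\<in>C. 0 \<le> x \<and> 0 \<le> y \<and> x + y \<le> k) \<and> {(0, 0), (k, 0), (0, k)} \<subseteq> C"

lemma strip2I: "(\<And>x y. (x, y) \<in> C \<Longrightarrow> a \<le> x \<and> x \<le> a + k) \<Longrightarrow> strip2 k C"
  unfolding strip2_def by blast

definition fits2 :: "int \<Rightarrow> int \<Rightarrow> i2 set \<Rightarrow> bool" where
  "fits2 j k C \<longleftrightarrow> (\<exists>g. U2 g \<and> (strip2 j (am2 g ` C) \<or> tri2 k (am2 g ` C)))"

lemma fits2_am2: "U2 h \<Longrightarrow> fits2 j k (am2 h ` C) \<Longrightarrow> fits2 j k C"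
  unfolding fits2_def by (rule U2_wlog)

lemma fits2I: "U2 g \<Longrightarrow> strip2 j (am2 g ` C) \<Longrightarrow> fits2 j k C"
  "U2 g \<Longrightarrow> tri2 k (am2 g ` C) \<Longrightarrow> fits2 j k C"
  unfolding fits2_def by blast+

lemma am2_mem: "(x, y) \<in> C \<Longrightarrow> (a * x + b * y + s, c * x + d * y + t) \<in> am2 (a, b, c, d, s, t) ` C"
  by (rule image_eqI[of _ _ "(x, y)"]) simp_all

text \<open>A point with \<open>x \<ge> 2\<close> spans a triangle with the segment on
  \<open>x = 0\<close>. Its slice at \<open>x = 1\<close> has an interior lattice point unless the
  point is 2 units away at odd height. In that case lattice points on the other two edges of the
  triangle are boundary points of \<open>C\<close>, and their supporting lines cut out
  \<open>2 Delta_2\<close>.\<close>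

lemma hollow_midpoint_halfplane:
  assumes "closed2 C" "\<And>p. \<not> in2 C p"
    and C: "(0, -1) \<in> C" "(0, 0) \<in> C" "(0, 1) \<in> C" and pos: "\<And>x y. (x, y) \<in> C \<Longrightarrow> 0 \<le> x"
  shows "fits2 1 2 C"
proof (cases "\<forall>(x, y)\<in>C. x \<le> 1")
  case True
  then show ?thesis using pos
    by (intro fits2I(1)[of "(1, 0, 0, 1, 0, 0)"] strip2I[of _ 0]) auto
next
  case False
  then obtain h b where hb: "(h, b) \<in> C" "2 \<le> h" by force
  have two: "x = 2 \<and> odd y" if xy: "(x, y) \<in> C" "2 \<le> x" for x y
  proof (rule ccontr)
    assume neg: "\<not> (x = 2 \<and> odd y)"
    \<comment> \<open>In the triangle with corners \<open>(0, 1)\<close>, \<open>(0, -1)\<close>,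
      \<open>(x, y)\<close> the slice at 1 has centre \<open>y / x\<close> and half-length
      \<open>(x - 1) / x\<close>. The rounding error \<open>x / 2\<close> is below
      \<open>x - 1\<close> from \<open>x = 3\<close> on.\<close>
    obtain z where z: "\<bar>x * z - y\<bar> < x - 1"
    proof (cases "x = 2")
      case True
      then have "even y" using neg by simp
      then obtain k where "y = 2 * k" by (rule evenE)
      then show ?thesis using that[of k] True by simp
    next
      case False
      obtain z where z: "- x \<le> 2 * (x * z - y)" "2 * (x * z - y) \<le> x"
        using nearest_multiple[of x y] xy(2) by auto
      define w where "w = x * z - y"
      have "- x \<le> 2 * w" "2 * w \<le> x" using z by (simp_all add: w_def)
      moreover have "3 \<le> x" using False xy(2) by simp
      ultimately have "\<bar>w\<bar> < x - 1" by (simp add: abs_less_iff)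
      then have "\<bar>x * z - y\<bar> < x - 1" by (simp add: w_def)
      then show ?thesis by (rule that)
    qed
    have "in2 C (1, z)"
      by (rule in2I[OF C(1,3) xy(1), of "x - 1 - x * z + y" "x - 1 + x * z - y" 2])
        (use z xy(2) in \<open>auto simp: algebra_simps abs_less_iff\<close>)
    then show False using assms(2) by blast
  qed
  have h: "h = 2" "odd b" using two[OF hb] by auto
  \<comment> \<open>The shear by this \<open>k\<close> moves \<open>(2, b)\<close> to
    \<open>(2, -1)\<close>.\<close>
  define k where "k = (b + 1) div 2"
  have b: "b = 2 * k - 1" using h(2) by (auto simp: k_def elim!: oddE)
  let ?g = "(1, 0, - k, 1, 0, 0)"
  let ?D = "am2 ?g ` C"
  have U: "U2 ?g" by simp
  have D: "closed2 ?D" "\<not> in2 ?D p" for p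
  proof -
    show "closed2 ?D" by (rule closed2_am2[OF U assms(1)])
    obtain h where h: "\<And>p. am2 ?g (am2 h p) = p" using am2_inverse[OF U] by metis
    show "\<not> in2 ?D p" using in2_am2[OF U, of C "am2 h p"] assms(2) h by simp
  qed
  have m: "(0, -1) \<in> ?D" "(0, 0) \<in> ?D" "(0, 1) \<in> ?D" "(2, -1) \<in> ?D"
    using am2_mem[OF C(1), of 1 0 0 "-k" 1 0] am2_mem[OF C(2), of 1 0 0 "-k" 1 0]
      am2_mem[OF C(3), of 1 0 0 "-k" 1 0] am2_mem[OF hb(1), of 1 0 0 "-k" 1 0]
    by (simp_all add: h b)
  have x: "0 \<le> x" if "(x, y) \<in> ?D" for x y using that pos by auto
  \<comment> \<open>\<open>(1, 0)\<close> is the midpoint of \<open>(0, 1)\<close> and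
    \<open>(2, -1)\<close>, so a functional supporting there is constant on that edge.\<close>
  obtain m1 n1 where mn1: "(m1, n1) \<noteq> (0, 0)" "\<And>x y. (x, y) \<in> ?D \<Longrightarrow> 0 \<le> m1 * (x - 1) + n1 * (y - 0)"
    using not_in2E[OF D(2)[of "(1, 0)"]] by metis
  have "0 \<le> m1 * (0 - 1) + n1 * (1 - 0)" "0 \<le> m1 * (2 - 1) + n1 * (-1 - 0)" "0 \<le> m1 * (0 - 1) + n1 * (-1 - 0)"
    by (rule mn1(2), rule m)+
  then have "n1 = m1" "m1 \<le> 0" by simp_all
  with mn1(1) have 1: "n1 = m1" "m1 < 0" by auto
  have xy: "x + y \<le> 1" if "(x, y) \<in> ?D" for x y
  proof -
    have "0 \<le> m1 * (x + y - 1)" using mn1(2)[OF that] 1 by (simp add: algebra_simps)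
    then show ?thesis using 1(2) by (simp add: zero_le_mult_iff)
  qed
  \<comment> \<open>\<open>(1, -1)\<close> is the midpoint of the lower edge from
    \<open>(0, -1)\<close> to \<open>(2, -1)\<close>.\<close>
  obtain m2 n2 where mn2: "(m2, n2) \<noteq> (0, 0)" "\<And>x y. (x, y) \<in> ?D \<Longrightarrow> 0 \<le> m2 * (x - 1) + n2 * (y - (-1))"
    using not_in2E[OF D(2)[of "(1, -1)"]] by metis
  have "0 \<le> m2 * (0 - 1) + n2 * (-1 - (-1))" "0 \<le> m2 * (2 - 1) + n2 * (-1 - (-1))" "0 \<le> m2 * (0 - 1) + n2 * (1 - (-1))"
    by (rule mn2(2), rule m)+
  then have "m2 = 0" "0 \<le> n2" by simp_all
  with mn2(1) have 2: "m2 = 0" "0 < n2" by auto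
  have y: "-1 \<le> y" if "(x, y) \<in> ?D" for x y
  proof -
    have "0 \<le> n2 * (y + 1)" using mn2(2)[OF that] 2 by (simp add: algebra_simps)
    then show ?thesis using 2(2) by (simp add: zero_le_mult_iff)
  qed
  have "fits2 1 2 ?D"
  proof (rule fits2I(2)[of "(1, 0, 0, 1, 0, 1)"])
    show "tri2 2 (am2 (1, 0, 0, 1, 0, 1) ` ?D)"
      unfolding tri2_def
    proof
      have "0 \<le> fst w \<and> 0 \<le> snd w \<and> fst w + snd w \<le> 2" if w: "w \<in> am2 (1, 0, 0, 1, 0, 1) ` ?D" for w
      proof -
        obtain z where z: "z \<in> ?D" "w = am2 (1, 0, 0, 1, 0, 1) z" using w by blast
        obtain x' y' where e: "z = (x', y')" by (cases z)
        show ?thesis using x[of x' y'] y[of x' y'] xy[of x' y'] z(1) unfolding z(2) e by simp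
      qed
      then show "\<forall>(u, v)\<in>am2 (1, 0, 0, 1, 0, 1) ` ?D. 0 \<le> u \<and> 0 \<le> v \<and> u + v \<le> 2" by fastforce
      show "{(0, 0), (2, 0), (0, 2)} \<subseteq> am2 (1, 0, 0, 1, 0, 1) ` ?D"
        using am2_mem[OF m(1), of 1 0 0 0 1 1] am2_mem[OF m(3), of 1 0 0 0 1 1] am2_mem[OF m(4), of 1 0 0 0 1 1]
        by simp
    qed
  qed simp
  then show ?thesis by (rule fits2_am2[OF U])
qed

lemma not_in2_am2:
  assumes "U2 g" "\<And>p. \<not> in2 C p" shows "\<not> in2 (am2 g ` C) p"
proof -
  obtain h where h: "\<And>p. am2 g (am2 h p) = p" using am2_inverse[OF assms(1)] by metis
  show ?thesis using in2_am2[OF assms(1), of C "am2 h p"] assms(2) h by simp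
qed

text \<open>The origin is not interior but lies between two points of \<open>C\<close>, so its
  supporting line contains both; \<open>C\<close> is on one side of \<open>x = 0\<close>, and a
  reflection chooses the side.\<close>

lemma hollow_midpoint:
  assumes "closed2 C" "\<And>p. \<not> in2 C p"
    and C: "(0, -1) \<in> C" "(0, 0) \<in> C" "(0, 1) \<in> C"
  shows "fits2 1 2 C"
proof -
  obtain m n where mn: "(m, n) \<noteq> (0, 0)" "\<And>x y. (x, y) \<in> C \<Longrightarrow> 0 \<le> m * (x - 0) + n * (y - 0)"
    using not_in2E[OF assms(2)[of "(0, 0)"]] by metis
  have "0 \<le> m * (0 - 0) + n * (-1 - 0)" "0 \<le> m * (0 - 0) + n * (1 - 0)"
    by (rule mn(2), rule C)+
  then have n: "n = 0" by simp
  then have m: "0 \<le> m * x" if "(x, y) \<in> C" for x y using mn(2)[OF that] by simp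
  show ?thesis
  proof (cases "m > 0")
    case True
    then show ?thesis using m
      by (intro hollow_midpoint_halfplane[OF assms]) (auto simp: zero_le_mult_iff)
  next
    case False
    then have "m < 0" using mn(1) n by auto
    then have neg: "x \<le> 0" if "(x, y) \<in> C" for x y using m[OF that] by (simp add: zero_le_mult_iff)
    let ?g = "(-1, 0, 0, 1, 0, 0)"
    have U: "U2 ?g" by simp
    have "fits2 1 2 (am2 ?g ` C)"
    proof (rule hollow_midpoint_halfplane)
      show "closed2 (am2 ?g ` C)" by (rule closed2_am2[OF U assms(1)])
      show "\<not> in2 (am2 ?g ` C) p" for p by (rule not_in2_am2[OF U assms(2)])
      show "(0, -1) \<in> am2 ?g ` C" "(0, 0) \<in> am2 ?g ` C" "(0, 1) \<in> am2 ?g ` C"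
        using am2_mem[OF C(1), of "-1" 0 0 0 1 0] am2_mem[OF C(2), of "-1" 0 0 0 1 0] am2_mem[OF C(3), of "-1" 0 0 0 1 0]
        by simp_all
      show "0 \<le> x" if "(x, y) \<in> am2 ?g ` C" for x y using that neg by auto
    qed
    then show ?thesis by (rule fits2_am2[OF U])
  qed
qed

lemma primitive_decomp:
  fixes a b :: int assumes "(a, b) \<noteq> (0, 0)"
  obtains k c d u v where "a = k * c" "b = k * d" "1 \<le> k" "u * c + v * d = 1"
proof -
  define k where "k = gcd a b"
  have k: "1 \<le> k" using assms by (metis gcd_eq_0_iff gcd_ge_0_int int_one_le_iff_zero_less k_def less_le prod.inject)
  obtain c d where cd: "a = k * c" "b = k * d" by (metis dvdE gcd_dvd1 gcd_dvd2 k_def)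
  obtain u v where "u * a + v * b = k" using bezout_int[of a b] k_def by blast
  then have "k * (u * c + v * d) = k * 1" unfolding cd by (simp add: algebra_simps)
  then have "u * c + v * d = 1" using k by simp
  then show ?thesis using that cd k by blast
qed

text \<open>The triangle over the unit segment with apex \<open>(a, h)\<close> meets height 1 in a
  segment of length \<open>1 - 1/h\<close>, which contains a lattice point \<open>(s, 1)\<close>. If
  that is interior, \<open>C\<close> is not hollow. If it lies on a side, the next lattice point on
  this side is congruent mod 2 to the end of the base from which the side starts.\<close>

lemma hollow_segment_bound:
  assumes "closed2 C" "\<And>p. \<not> in2 C p"
    and nocong: "\<And>x y x' y'. (x, y) \<in> C \<Longrightarrow> (x', y') \<in> C \<Longrightarrow> even (x - x') \<Longrightarrow> even (y - y') \<Longrightarrow> (x, y) = (x', y')"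
    and C: "(0, 0) \<in> C" "(1, 0) \<in> C" and ah: "(a, h) \<in> C"
  shows "h \<le> 1"
proof (rule ccontr)
  assume "\<not> h \<le> 1"
  then have h: "2 \<le> h" by simp
  obtain s where s: "0 \<le> h * s - a" "h * s - a \<le> h - 1" using ceiling_multiple[of h a] h by auto
  define l where "l = h * s - a"
  have "l = 0 \<or> l = h - 1 \<or> (0 < l \<and> l < h - 1)" using s by (auto simp: l_def)
  then show False
  proof (elim disjE)
    assume "l = 0"
    then have a: "a = h * s" by (simp add: l_def)
    have "(2 * s, 2) \<in> C"
      by (rule closed2I[OF assms(1) ah C(1) C(1), of 2 "h - 2" 0]) (use h in \<open>auto simp: a algebra_simps\<close>)
    then show False using nocong[OF _ C(1)] by fastforce
  next
    assume "l = h - 1"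
    then have a: "a = h * s - h + 1" by (simp add: l_def)
    have "(1 + 2 * (s - 1), 2) \<in> C"
      by (rule closed2I[OF assms(1) ah C(2) C(1), of 2 "h - 2" 0]) (use h in \<open>auto simp: a algebra_simps\<close>)
    then show False using nocong[OF _ C(2)] by fastforce
  next
    assume l: "0 < l \<and> l < h - 1"
    have "in2 C (s, 1)"
      by (rule in2I[OF C(1,2) ah, of "h - 1 - l" l 1]) (use h l in \<open>auto simp: l_def algebra_simps\<close>)
    then show False using assms(2) by blast
  qed
qed

lemma nocong_am2:
  assumes "U2 g" and nc: "\<And>x y x' y'. (x, y) \<in> C \<Longrightarrow> (x', y') \<in> C \<Longrightarrow> even (x - x') \<Longrightarrow> even (y - y') \<Longrightarrow> (x, y) = (x', y')"
    and "(x, y) \<in> am2 g ` C" "(x', y') \<in> am2 g ` C" "even (x - x')" "even (y - y')"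
  shows "(x, y) = (x', y')"
proof -
  obtain a b c d s t where g: "g = (a, b, c, d, s, t)" by (cases g)
  obtain p q p' q' where C: "(p, q) \<in> C" "(p', q') \<in> C"
    and e: "x = a * p + b * q + s" "y = c * p + d * q + t" "x' = a * p' + b * q' + s" "y' = c * p' + d * q' + t"
    using assms(3,4) by (auto simp: g)
  define D where "D = a * d - b * c"
  have D: "D = 1 \<or> D = -1" using assms(1) by (auto simp: g D_def)
  have "d * (x - x') - b * (y - y') = D * (p - p')" "a * (y - y') - c * (x - x') = D * (q - q')"
    unfolding e D_def by algebra+
  then have "even (D * (p - p'))" "even (D * (q - q'))" using assms(5,6) by (metis dvd_mult dvd_diff)+
  then have "even (p - p')" "even (q - q')" using D by auto
  then have "(p, q) = (p', q')" by (rule nc[OF C])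
  then show ?thesis using e by simp
qed

text \<open>\<open>hollow_segment_bound\<close> applies on both sides of every segment from the
  origin to a primitive point of \<open>C\<close>. For \<open>(1, 0)\<close> it leaves the rows -1,
  0 and 1; if both outer rows occur, it is applied to \<open>(c, 1)\<close> as well.\<close>

lemma hollow_normalized:
  assumes "closed2 C" "\<And>p. \<not> in2 C p"
    and nocong: "\<And>x y x' y'. (x, y) \<in> C \<Longrightarrow> (x', y') \<in> C \<Longrightarrow> even (x - x') \<Longrightarrow> even (y - y') \<Longrightarrow> (x, y) = (x', y')"
    and C: "(0, 0) \<in> C" "(1, 0) \<in> C"
  shows "fits2 1 2 C"
proof -
  have bound: "\<bar>c * x + d * y\<bar> \<le> 1" if g: "U2 (a, b, c, d, 0, 0)" "(p, q) \<in> C" "a * p + b * q = 1" "c * p + d * q = 0"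
    and xy: "(x, y) \<in> C" for a b c d p q x y
  proof -
    have le: "c' * x + d' * y \<le> 1" if g': "U2 (a, b, c', d', 0, 0)" "c' * p + d' * q = 0" for c' d'
    proof (rule hollow_segment_bound)
      show "closed2 (am2 (a, b, c', d', 0, 0) ` C)" by (rule closed2_am2[OF g'(1) assms(1)])
      show "\<not> in2 (am2 (a, b, c', d', 0, 0) ` C) p" for p by (rule not_in2_am2[OF g'(1) assms(2)])
      show "(0, 0) \<in> am2 (a, b, c', d', 0, 0) ` C" using am2_mem[OF C(1), of a b 0 c' d' 0] by simp
      show "(1, 0) \<in> am2 (a, b, c', d', 0, 0) ` C" using am2_mem[OF g(2), of a b 0 c' d' 0] g(3) g'(2) by simp
      show "(a * x + b * y, c' * x + d' * y) \<in> am2 (a, b, c', d', 0, 0) ` C" using am2_mem[OF xy, of a b 0 c' d' 0] by simp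
    qed (rule nocong_am2[OF g'(1) nocong])
    have "U2 (a, b, -c, -d, 0, 0)" using g(1) by auto
    then show ?thesis using le[OF g(1,4)] le[of "-c" "-d"] g(4) by (auto simp: abs_le_iff)
  qed
  have y: "\<bar>y\<bar> \<le> 1" if "(x, y) \<in> C" for x y
    using bound[of 1 0 0 1 1 0 x y] C that by simp
  show ?thesis
  proof (cases "(\<exists>c. (c, 1) \<in> C) \<and> (\<exists>b. (b, -1) \<in> C)")
    case False
    then have "strip2 1 (am2 (0, 1, 1, 0, 0, 0) ` C)"
    proof -
      have sw: "\<bar>u\<bar> \<le> 1 \<and> (v, u) \<in> C" if "(u, v) \<in> am2 (0, 1, 1, 0, 0, 0) ` C" for u v
        using that y by auto
      show ?thesis
      proof (cases "\<exists>c. (c, 1) \<in> C")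
        case True
        then have "u \<noteq> -1" if "(v, u) \<in> C" for u v using False that by blast
        then show ?thesis using sw by (intro strip2I[of _ 0]) (force simp: abs_le_iff)
      next
        case F: False
        then have "u \<noteq> 1" if "(v, u) \<in> C" for u v using that by blast
        then show ?thesis using sw by (intro strip2I[of _ "-1"]) (force simp: abs_le_iff)
      qed
    qed
    then show ?thesis by (intro fits2I(1)) simp_all
  next
    case True
    then obtain c b where cb: "(c, 1) \<in> C" "(b, -1) \<in> C" by blast
    have x: "\<bar>x - c * y\<bar> \<le> 1" if "(x, y) \<in> C" for x y
      using bound[of 0 1 1 "-c" c 1 x y] cb that by simp
    have "\<bar>b + c\<bar> \<le> 1" using x[OF cb(2)] by simp
    moreover have "odd (b + c)"
    proof
      assume "even (b + c)"
      then have "even (c - b)" by simp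
      then show False using nocong[OF cb] by simp
    qed
    ultimately consider "b = 1 - c" | "b = - 1 - c" by (cases "b + c = 0"; force simp: abs_le_iff)
    then show ?thesis
    proof cases
      case 1
      \<comment> \<open>Each of the three candidates with \<open>x - c * y = -1\<close> is congruent
        mod 2 to, and different from, a known point.\<close>
      have "0 \<le> x - c * y" if xy: "(x, y) \<in> C" for x y
      proof (rule ccontr)
        assume "\<not> 0 \<le> x - c * y"
        then have e: "x = c * y - 1" using x[OF xy] by simp
        have "y = 0 \<or> y = 1 \<or> y = -1" using y[OF xy] by linarith
        then show False
          using e nocong[OF xy C(2)] nocong[OF xy cb(1)] nocong[OF xy cb(2)] 1 by auto
      qed
      then show ?thesis using x
        by (intro fits2I(1)[of "(1, -c, 0, 1, 0, 0)"] strip2I[of _ 0]) (force simp: abs_le_iff)+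
    next
      case 2
      \<comment> \<open>Here \<open>(1, 0) + (c, 1) + (b, -1) = 0\<close>.\<close>
      have "in2 C (0, 0)"
        by (rule in2I[OF C(2) cb, of 1 1 1]) (simp_all add: 2)
      then show ?thesis using assms(2) by blast
    qed
  qed
qed

text \<open>The dichotomy is by residues mod 2. Two congruent points have a lattice midpoint, and
  \<open>hollow_midpoint\<close> applies; otherwise every segment in \<open>C\<close> is primitive,
  and one of them is moved to the unit segment.\<close>

theorem hollow2:
  assumes "closed2 C" "\<And>p. \<not> in2 C p"
  shows "fits2 1 2 C"
proof (cases "\<forall>x y x' y'. (x, y) \<in> C \<longrightarrow> (x', y') \<in> C \<longrightarrow> even (x - x') \<longrightarrow> even (y - y') \<longrightarrow> (x, y) = (x', y')")
  case nc: True
  then have nocong: "\<And>x y x' y'. (x, y) \<in> C \<Longrightarrow> (x', y') \<in> C \<Longrightarrow> even (x - x') \<Longrightarrow> even (y - y') \<Longrightarrow> (x, y) = (x', y')"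
    by blast
  show ?thesis
  proof (cases "\<exists>x y x' y'. (x, y) \<in> C \<and> (x', y') \<in> C \<and> (x, y) \<noteq> (x', y')")
    case False
    then show ?thesis
    proof (cases "C = {}")
      case True
      then show ?thesis by (intro fits2I(1)[of "(1, 0, 0, 1, 0, 0)"]) (auto simp: strip2_def)
    next
      case F: False
      then obtain x y where "(x, y) \<in> C" by auto
      then have "a = x" if "(a, b) \<in> C" for a b using False that by blast
      then show ?thesis
        by (intro fits2I(1)[of "(1, 0, 0, 1, 0, 0)"] strip2I[of _ x]) auto
    qed
  next
    case True
    then obtain x y x' y' where xy: "(x, y) \<in> C" "(x', y') \<in> C" and ne: "(x' - x, y' - y) \<noteq> (0, 0)" by auto
    obtain k c d u v where k: "x' - x = k * c" "y' - y = k * d" "1 \<le> k" "u * c + v * d = 1"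
      using primitive_decomp[OF ne] by metis
    have "k = 1"
    proof (rule ccontr)
      assume "k \<noteq> 1"
      then have k2: "2 \<le> k" using k(3) by simp
      have "(x + 2 * c, y + 2 * d) \<in> C"
        by (rule closed2I[OF assms(1) xy(1) xy(2) xy(1), of "k - 2" 2 0])
          (use k k2 in \<open>auto simp: algebra_simps\<close>)
      then have "(x + 2 * c, y + 2 * d) = (x, y)" by (rule nocong[OF _ xy(1)]) simp_all
      then show False using k(4) by simp
    qed
    define g where "g = (u, v, - d, c, - (u * x + v * y), d * x - c * y)"
    have U: "U2 g" using k(4) by (simp add: g_def algebra_simps)
    have e: "x' = x + c" "y' = y + d" using k(1,2) \<open>k = 1\<close> by simp_all
    have "fits2 1 2 (am2 g ` C)"
    proof (rule hollow_normalized)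
      show "closed2 (am2 g ` C)" by (rule closed2_am2[OF U assms(1)])
      show "\<not> in2 (am2 g ` C) p" for p by (rule not_in2_am2[OF U assms(2)])
      have "am2 g (x, y) = (0, 0)" by (simp add: g_def)
      then show "(0, 0) \<in> am2 g ` C" using xy(1) by (metis imageI)
      have "am2 g (x', y') = (1, 0)" using k(4) by (simp add: g_def e algebra_simps)
      then show "(1, 0) \<in> am2 g ` C" using xy(2) by (metis imageI)
    qed (rule nocong_am2[OF U nocong])
    then show ?thesis by (rule fits2_am2[OF U])
  qed
next
  case False
  then obtain x y x' y' where xy: "(x, y) \<in> C" "(x', y') \<in> C" "even (x - x')" "even (y - y')" "(x, y) \<noteq> (x', y')"
    by blast
  obtain e f where ef: "x - x' = 2 * e" "y - y' = 2 * f" using xy(3,4) by (meson evenE)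
  then have ne: "(e, f) \<noteq> (0, 0)" using xy(5) by auto
  obtain k c d u v where k: "e = k * c" "f = k * d" "1 \<le> k" "u * c + v * d = 1"
    using primitive_decomp[OF ne] by metis
  have X: "x = x' + 2 * k * c" "y = y' + 2 * k * d" using ef k by simp_all
  define p q where "p = x' + k * c" and "q = y' + k * d"
  \<comment> \<open>The midpoint and its two lattice neighbours on the segment.\<close>
  have m: "(p + j * c, q + j * d) \<in> C" if "\<bar>j\<bar> \<le> 1" for j
    by (rule closed2I[OF assms(1) xy(1) xy(2) xy(1), of "k + j" "k - j" 0])
      (use k(3) that in \<open>auto simp: p_def q_def X algebra_simps\<close>)
  define g where "g = (d, - c, u, v, c * q - d * p, - (u * p + v * q))"
  have U: "U2 g" using k(4) by (simp add: g_def algebra_simps)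
  have "am2 g (p + j * c, q + j * d) = (0, j * (u * c + v * d))" for j by (simp add: g_def algebra_simps)
  then have gm: "(0, j) \<in> am2 g ` C" if "\<bar>j\<bar> \<le> 1" for j using m[OF that] k(4) by (metis imageI mult.right_neutral)
  have "fits2 1 2 (am2 g ` C)"
  proof (rule hollow_midpoint)
    show "closed2 (am2 g ` C)" by (rule closed2_am2[OF U assms(1)])
    show "\<not> in2 (am2 g ` C) p" for p by (rule not_in2_am2[OF U assms(2)])
  qed (rule gm; simp)+
  then show ?thesis by (rule fits2_am2[OF U])
qed

subsection \<open>Lattice polygons with a single interior lattice point\<close>

lemma am2_id: "am2 (1, 0, 0, 1, 0, 0) = (\<lambda>p. p)"
  by auto

lemma one_int_am2:
  assumes g: "U2 (a, b, c, d, 0, 0)" and C: "closed2 C" "in2 C (0, 0)" "\<And>p. in2 C p \<Longrightarrow> p = (0, 0)"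
  defines "D \<equiv> am2 (a, b, c, d, 0, 0) ` C"
  shows "closed2 D" "in2 D (0, 0)" "\<And>p. in2 D p \<Longrightarrow> p = (0, 0)"
proof -
  have z: "am2 (a, b, c, d, 0, 0) (0, 0) = (0, 0)" by simp
  show "closed2 D" unfolding D_def by (rule closed2_am2[OF g C(1)])
  show "in2 D (0, 0)" using in2_am2_imp[OF g C(2)] unfolding D_def z .
  show "p = (0, 0)" if "in2 D p" for p
    using am2_transport(2)[OF g C(1) C(3) that[unfolded D_def]] unfolding z .
qed

lemma no_opposite_am2:
  assumes U: "U2 (a, b, c, d, 0, 0)"
    and no: "\<And>x y. (x, y) \<in> C \<Longrightarrow> (- x, - y) \<in> C \<Longrightarrow> (x, y) = (0, 0)"
    and xy: "(x, y) \<in> am2 (a, b, c, d, 0, 0) ` C" "(- x, - y) \<in> am2 (a, b, c, d, 0, 0) ` C"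
  shows "(x, y) = (0, 0)"
proof -
  obtain h where h: "\<And>p. am2 h (am2 (a, b, c, d, 0, 0) p) = p" using am2_inverse[OF U] by metis
  obtain p q where p: "(p, q) \<in> C" "am2 (a, b, c, d, 0, 0) (p, q) = (x, y)" using xy(1) by auto
  obtain z where z: "z \<in> C" "am2 (a, b, c, d, 0, 0) z = (- x, - y)" using xy(2) by auto
  have "am2 (a, b, c, d, 0, 0) (- p, - q) = (- x, - y)" using p(2) by auto
  then have "z = (- p, - q)" using z(2) h by metis
  then have "(p, q) = (0, 0)" using no[OF p(1)] z(1) by simp
  then show ?thesis using p(2) by simp
qed

text \<open>The slice argument of \<open>hollow_midpoint_halfplane\<close>: an interior lattice
  point in row 1 would be different from the origin.\<close>

lemma one_int_row_bound:
  assumes C: "closed2 C" "in2 C (0, 0)" "\<And>p. in2 C p \<Longrightarrow> p = (0, 0)"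
    and m: "(1, 0) \<in> C" "(-1, 0) \<in> C" and ab: "(a, b) \<in> C" "2 \<le> b"
  shows "b = 2 \<and> odd a"
proof (rule ccontr)
  assume neg: "\<not> (b = 2 \<and> odd a)"
  obtain z where z: "\<bar>b * z - a\<bar> < b - 1"
  proof (cases "b = 2")
    case True
    then have "even a" using neg by simp
    then obtain k where "a = 2 * k" by (rule evenE)
    then show ?thesis using that[of k] True by simp
  next
    case False
    obtain z where z: "- b \<le> 2 * (b * z - a)" "2 * (b * z - a) \<le> b"
      using nearest_multiple[of b a] ab(2) by auto
    define w where "w = b * z - a"
    have "- b \<le> 2 * w" "2 * w \<le> b" using z by (simp_all add: w_def)
    moreover have "3 \<le> b" using False ab(2) by simp
    ultimately have "\<bar>w\<bar> < b - 1" by (simp add: abs_less_iff)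
    then have "\<bar>b * z - a\<bar> < b - 1" by (simp add: w_def)
    then show ?thesis by (rule that)
  qed
  have "in2 C (z, 1)"
    by (rule in2I[OF m ab(1), of "b - 1 + b * z - a" "b - 1 - b * z + a" 2])
      (use z ab(2) in \<open>auto simp: algebra_simps abs_less_iff\<close>)
  then show False by (auto dest: C(3))
qed

text \<open>The boundary points \<open>(-1, 1)\<close> and \<open>(0, 1)\<close> have the supporting
  lines \<open>x = -1\<close> and \<open>x + y = 1\<close>. Width two in direction \<open>x\<close>
  or \<open>x + y\<close> fails only if there are points beyond \<open>x = 1\<close> and beyond
  \<open>x + y = -1\<close>; since \<open>(0, -1)\<close> is not interior, these are the corners
  \<open>(2, -1)\<close> and \<open>(-1, -1)\<close> of a translate of
  \<open>3 Delta_2\<close>.\<close>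

lemma reflexive_triangle_case:
  assumes C: "closed2 C" "in2 C (0, 0)" "\<And>p. in2 C p \<Longrightarrow> p = (0, 0)"
    and m: "(1, 0) \<in> C" "(-1, 0) \<in> C" "(-1, 2) \<in> C"
  shows "fits2 2 3 C"
proof -
  have mem: "(-1, 1) \<in> C" "(0, 1) \<in> C"
    by (rule closed2I[OF C(1) m, of 0 1 1] closed2I[OF C(1) m, of 1 0 1]; simp)+
  have "\<not> in2 C (-1, 1)" by (auto dest: C(3))
  then obtain m1 n1 where mn1: "(m1, n1) \<noteq> (0, 0)" "\<And>x y. (x, y) \<in> C \<Longrightarrow> 0 \<le> m1 * (x - (-1)) + n1 * (y - 1)"
    using not_in2E by metis
  have "0 \<le> m1 * (-1 - (-1)) + n1 * (0 - 1)" "0 \<le> m1 * (-1 - (-1)) + n1 * (2 - 1)" "0 \<le> m1 * (1 - (-1)) + n1 * (0 - 1)"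
    by (rule mn1(2), rule m)+
  then have "n1 = 0" "0 \<le> m1" by simp_all
  with mn1(1) have 1: "n1 = 0" "0 < m1" by auto
  have x: "-1 \<le> x" if "(x, y) \<in> C" for x y
  proof -
    have "0 \<le> m1 * (x + 1)" using mn1(2)[OF that] 1 by simp
    then show ?thesis using 1(2) by (simp add: zero_le_mult_iff)
  qed
  have "\<not> in2 C (0, 1)" by (auto dest: C(3))
  then obtain m2 n2 where mn2: "(m2, n2) \<noteq> (0, 0)" "\<And>x y. (x, y) \<in> C \<Longrightarrow> 0 \<le> m2 * (x - 0) + n2 * (y - 1)"
    using not_in2E by metis
  have "0 \<le> m2 * (-1 - 0) + n2 * (2 - 1)" "0 \<le> m2 * (1 - 0) + n2 * (0 - 1)" "0 \<le> m2 * (-1 - 0) + n2 * (0 - 1)"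
    by (rule mn2(2), rule m)+
  then have "n2 = m2" "m2 \<le> 0" by simp_all
  with mn2(1) have 2: "n2 = m2" "m2 < 0" by auto
  have xy: "x + y \<le> 1" if "(x, y) \<in> C" for x y
  proof -
    have "0 \<le> m2 * (x + y - 1)" using mn2(2)[OF that] 2 by (simp add: algebra_simps)
    then show ?thesis using 2(2) by (simp add: zero_le_mult_iff)
  qed
  \<comment> \<open>Reflection in the first axis turns \<open>one_int_row_bound\<close> into a bound
    from below.\<close>
  have y: "-2 \<le> y \<and> (y = -2 \<longrightarrow> odd x)" if xyC: "(x, y) \<in> C" for x y
  proof (cases "y \<le> -2")
    case True
    have U: "U2 (1, 0, 0, -1, 0, 0)" by simp
    note D = one_int_am2[OF U C]
    have "-y = 2 \<and> odd x"
      by (rule one_int_row_bound[OF D]) (use True am2_mem[OF m(1), of 1 0 0 0 "-1" 0]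
          am2_mem[OF m(2), of 1 0 0 0 "-1" 0] am2_mem[OF xyC, of 1 0 0 0 "-1" 0] in simp_all)
    then show ?thesis by auto
  qed simp
  show ?thesis
  proof (cases "\<forall>(x, y)\<in>C. x \<le> 1")
    case True
    then show ?thesis using x
      by (intro fits2I(1)[of "(1, 0, 0, 1, 0, 0)"] strip2I[of _ "-1"]) force+
  next
    case F1: False
    show ?thesis
    proof (cases "\<forall>(x, y)\<in>C. -1 \<le> x + y")
      case True
      then show ?thesis using xy
        by (intro fits2I(1)[of "(1, 1, 0, 1, 0, 0)"] strip2I[of _ "-1"]) force+
    next
      case F2: False
      obtain x1 y1 where p: "(x1, y1) \<in> C" "2 \<le> x1" using F1 by force
      obtain x2 y2 where q: "(x2, y2) \<in> C" "x2 + y2 \<le> -2" using F2 by force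
      \<comment> \<open>Two candidates survive for each of the two points, and three of the four
        combinations have \<open>(0, -1)\<close> in the interior.\<close>
      have "(x1 = 2 \<and> y1 = -1) \<or> (x1 = 3 \<and> y1 = -2)"
      proof -
        have "y1 = -1 \<or> y1 = -2" "x1 + y1 \<le> 1" using xy[OF p(1)] y[OF p(1)] p(2) by linarith+
        moreover have "x1 \<noteq> 2 \<or> y1 \<noteq> -2" using y[OF p(1)] by auto
        ultimately show ?thesis using p(2) by auto
      qed
      moreover have "x2 = -1 \<and> (y2 = -1 \<or> y2 = -2)"
      proof -
        have "y2 = -1 \<or> y2 = -2" using x[OF q(1)] y[OF q(1)] q(2) by linarith
        moreover have "x2 \<noteq> 0 \<or> y2 \<noteq> -2" using y[OF q(1)] by auto
        ultimately show ?thesis using q(2) x[OF q(1)] by auto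
      qed
      moreover have no: "\<not> in2 C (0, -1)" by (auto dest: C(3))
      moreover have "in2 C (0, -1)" if "x1 = 3" "y1 = -2" "x2 = -1" "y2 = -2"
        by (rule in2I[OF p(1) q(1) m(3), of 1 2 1]) (simp_all add: that)
      moreover have "in2 C (0, -1)" if "x1 = 2" "y1 = -1" "x2 = -1" "y2 = -2"
        by (rule in2I[OF p(1) q(1) m(3), of 2 3 1]) (simp_all add: that)
      moreover have "in2 C (0, -1)" if "x1 = 3" "y1 = -2" "x2 = -1" "y2 = -1"
        by (rule in2I[OF p(1) q(1) m(3), of 3 8 1]) (simp_all add: that)
      ultimately have pq: "(2, -1) \<in> C" "(-1, -1) \<in> C" using p q by auto
      \<comment> \<open>\<open>(0, -1)\<close> lies on the edge joining the two corners, so the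
        supporting line is \<open>y = -1\<close>.\<close>
      obtain m3 n3 where mn3: "(m3, n3) \<noteq> (0, 0)" "\<And>x y. (x, y) \<in> C \<Longrightarrow> 0 \<le> m3 * (x - 0) + n3 * (y - (-1))"
        using not_in2E[OF no] by metis
      have "0 \<le> m3 * (2 - 0) + n3 * (-1 - (-1))" "0 \<le> m3 * (-1 - 0) + n3 * (-1 - (-1))" "0 \<le> m3 * (-1 - 0) + n3 * (2 - (-1))"
        by (rule mn3(2), rule pq m)+
      then have "m3 = 0" "0 \<le> n3" by simp_all
      with mn3(1) have 3: "m3 = 0" "0 < n3" by auto
      have y': "-1 \<le> y" if "(x, y) \<in> C" for x y
      proof -
        have "0 \<le> n3 * (y + 1)" using mn3(2)[OF that] 3 by simp
        then show ?thesis using 3(2) by (simp add: zero_le_mult_iff)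
      qed
      have "tri2 3 (am2 (1, 0, 0, 1, 1, 1) ` C)"
        unfolding tri2_def
      proof
        show "\<forall>(u, v)\<in>am2 (1, 0, 0, 1, 1, 1) ` C. 0 \<le> u \<and> 0 \<le> v \<and> u + v \<le> 3"
          using x y' xy by force
        show "{(0, 0), (3, 0), (0, 3)} \<subseteq> am2 (1, 0, 0, 1, 1, 1) ` C"
          using am2_mem[OF pq(1), of 1 0 1 0 1 1] am2_mem[OF pq(2), of 1 0 1 0 1 1] am2_mem[OF m(3), of 1 0 1 0 1 1]
          by simp
      qed
      then show ?thesis by (intro fits2I(2)) simp_all
    qed
  qed
qed

text \<open>Otherwise \<open>(c, d)\<close> lies strictly between the interior point 0 and a point
  of \<open>C\<close>, and is a second interior point.\<close>

lemma one_int_primitive: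
  assumes C: "in2 C (0, 0)" "\<And>p. in2 C p \<Longrightarrow> p = (0, 0)" and t: "(k * c, k * d) \<in> C" "1 \<le> k" "(c, d) \<noteq> (0, 0)"
  shows "k = 1"
proof (rule ccontr)
  assume "k \<noteq> 1"
  then have "2 \<le> k" using t(2) by simp
  then have "in2 C (c, d)"
    by (intro in2_combine[OF C(1) t(1) t(1), of "k - 1" 1 0]) (auto simp: algebra_simps)
  then show False using C(2) t(3) by blast
qed

lemma reflexive_upper_case:
  assumes C: "closed2 C" "in2 C (0, 0)" "\<And>p. in2 C p \<Longrightarrow> p = (0, 0)"
    and m: "(1, 0) \<in> C" "(-1, 0) \<in> C" and ab: "(a, b) \<in> C" "2 \<le> b"
  shows "fits2 2 3 C"
proof -
  have b: "b = 2" "odd a" using one_int_row_bound[OF C m ab] by auto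
  define k where "k = (a + 1) div 2"
  have a: "a = 2 * k - 1" using b(2) by (auto simp: k_def elim!: oddE)
  have U: "U2 (1, - k, 0, 1, 0, 0)" by simp
  have "fits2 2 3 (am2 (1, - k, 0, 1, 0, 0) ` C)"
    by (rule reflexive_triangle_case[OF one_int_am2[OF U C]])
      (use am2_mem[OF m(1), of 1 "-k" 0 0 1 0] am2_mem[OF m(2), of 1 "-k" 0 0 1 0]
        am2_mem[OF ab(1), of 1 "-k" 0 0 1 0] in \<open>simp_all add: a b\<close>)
  then show ?thesis by (rule fits2_am2[OF U])
qed

lemma reflexive_opposite_case:
  assumes C: "closed2 C" "in2 C (0, 0)" "\<And>p. in2 C p \<Longrightarrow> p = (0, 0)"
    and m: "(1, 0) \<in> C" "(-1, 0) \<in> C"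
  shows "fits2 2 3 C"
proof (cases "\<forall>(x, y)\<in>C. \<bar>y\<bar> \<le> 1")
  case True
  then show ?thesis
    by (intro fits2I(1)[of "(0, 1, 1, 0, 0, 0)"] strip2I[of _ "-1"]) (force simp: abs_le_iff)+
next
  case False
  then obtain a b where ab: "(a, b) \<in> C" "\<not> \<bar>b\<bar> \<le> 1" by blast
  show ?thesis
  proof (cases "b \<ge> 2")
    case True
    show ?thesis by (rule reflexive_upper_case[OF C m ab(1) True])
  next
    case F: False
    have U: "U2 (1, 0, 0, -1, 0, 0)" by simp
    have "fits2 2 3 (am2 (1, 0, 0, -1, 0, 0) ` C)"
      by (rule reflexive_upper_case[OF one_int_am2[OF U C], where a = a and b = "- b"])
        (use F ab am2_mem[OF m(1), of 1 0 0 0 "-1" 0] am2_mem[OF m(2), of 1 0 0 0 "-1" 0]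
          am2_mem[OF ab(1), of 1 0 0 0 "-1" 0] in simp_all)
    then show ?thesis by (rule fits2_am2[OF U])
  qed
qed

text \<open>The three points form a piece of an edge on \<open>x = 1\<close>. A point with
  \<open>x = -h\<close>, \<open>h \<ge> 2\<close>, spans a triangle with it whose slices at
  \<open>x = 0\<close> and \<open>x = -1\<close> have half-lengths \<open>h / (h + 1)\<close> and
  \<open>(h - 1) / (h + 1)\<close>. The first has only the origin in its interior and the second no
  lattice point; this forces \<open>h \<le> 3\<close>, and the few remaining cases give an interior
  point or one opposite to a point of the edge.\<close>

lemma reflexive_edge_case:
  assumes C: "closed2 C" "in2 C (0, 0)" "\<And>p. in2 C p \<Longrightarrow> p = (0, 0)"
    and m: "(1, -1) \<in> C" "(1, 0) \<in> C" "(1, 1) \<in> C"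
    and noopp: "\<And>x y. (x, y) \<in> C \<Longrightarrow> (- x, - y) \<in> C \<Longrightarrow> (x, y) = (0, 0)"
  shows "strip2 2 C"
proof -
  have "(0, 0) \<in> C" using in2_mem[OF C(2,1)] m by blast
  have "\<not> in2 C (1, 0)" by (auto dest: C(3))
  then obtain m1 n1 where mn1: "(m1, n1) \<noteq> (0, 0)" "\<And>x y. (x, y) \<in> C \<Longrightarrow> 0 \<le> m1 * (x - 1) + n1 * (y - 0)"
    using not_in2E by metis
  have "0 \<le> m1 * (1 - 1) + n1 * (-1 - 0)" "0 \<le> m1 * (1 - 1) + n1 * (1 - 0)" "0 \<le> m1 * (0 - 1) + n1 * (0 - 0)"
    by (rule mn1(2), rule m \<open>(0, 0) \<in> C\<close>)+
  then have "n1 = 0" "m1 \<le> 0" by simp_all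
  with mn1(1) have 1: "n1 = 0" "m1 < 0" by auto
  have x: "x \<le> 1" if "(x, y) \<in> C" for x y
  proof -
    have "0 \<le> m1 * (x - 1)" using mn1(2)[OF that] 1 by simp
    then show ?thesis using 1(2) by (simp add: zero_le_mult_iff)
  qed
  have "-1 \<le> x" if xb: "(x, b) \<in> C" for x b
  proof (rule ccontr)
    assume "\<not> -1 \<le> x"
    then obtain h where h: "x = - h" "2 \<le> h" by (metis add.inverse_inverse linorder_not_le minus_le_iff not_less zless_imp_add1_zle one_add_one)
    have hb: "(- h, b) \<in> C" using xb h by simp
    have row0: "y = 0" if "\<bar>(h + 1) * y - b\<bar> < h" for y
    proof -
      have "in2 C (0, y)"
        by (rule in2I[OF hb m(3,1), of 2 "h + (h + 1) * y - b" "h - (h + 1) * y + b"])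
          (use that h in \<open>auto simp: algebra_simps abs_less_iff\<close>)
      then show ?thesis by (auto dest: C(3))
    qed
    have row1: "\<not> \<bar>(h + 1) * y - 2 * b\<bar> < h - 1" for y
    proof
      assume a: "\<bar>(h + 1) * y - 2 * b\<bar> < h - 1"
      have "in2 C (-1, y)"
        by (rule in2I[OF hb m(3,1), of 4 "h - 1 + (h + 1) * y - 2 * b" "h - 1 - (h + 1) * y + 2 * b"])
          (use a h in \<open>auto simp: algebra_simps abs_less_iff\<close>)
      then show False by (auto dest: C(3))
    qed
    have row1': "(-1, y) \<in> C" if "\<bar>(h + 1) * y - 2 * b\<bar> \<le> h - 1" for y
      by (rule closed2I[OF C(1) hb m(3,1), of 4 "h - 1 + (h + 1) * y - 2 * b" "h - 1 - (h + 1) * y + 2 * b"])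
        (use that h in \<open>auto simp: algebra_simps abs_le_iff\<close>)
    have small: "(-1, y) \<notin> C" if "\<bar>y\<bar> \<le> 1" for y
    proof
      assume y: "(-1, y) \<in> C"
      have "(1, - y) \<in> C"
      proof -
        have "y = -1 \<or> y = 0 \<or> y = 1" using that by linarith
        then show ?thesis using m by auto
      qed
      then show False using noopp[OF y] by simp
    qed
    obtain y0 where y0: "- (h + 1) \<le> 2 * ((h + 1) * y0 - b)" "2 * ((h + 1) * y0 - b) \<le> h + 1"
      using nearest_multiple[of "h + 1" b] h(2) by auto
    define w where "w = (h + 1) * y0 - b"
    have w: "- (h + 1) \<le> 2 * w" "2 * w \<le> h + 1" using y0 by (simp_all add: w_def)
    then have "\<bar>w\<bar> < h" using h(2) by (simp add: abs_less_iff)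
    then have "y0 = 0" by (intro row0) (simp add: w_def)
    then have b: "- (h + 1) \<le> 2 * b" "2 * b \<le> h + 1" using w by (simp_all add: w_def)
    obtain y1 where y1: "- (h + 1) \<le> 2 * ((h + 1) * y1 - 2 * b)" "2 * ((h + 1) * y1 - 2 * b) \<le> h + 1"
      using nearest_multiple[of "h + 1" "2 * b"] h(2) by auto
    define w1 where "w1 = (h + 1) * y1 - 2 * b"
    have w1: "- (h + 1) \<le> 2 * w1" "2 * w1 \<le> h + 1" using y1 by (simp_all add: w1_def)
    have "\<not> \<bar>w1\<bar> < h - 1" using row1[of y1] by (simp add: w1_def)
    \<comment> \<open>Rounding gives \<open>2 * w1\<close> between \<open>- (h + 1)\<close> and
      \<open>h + 1\<close>, while \<open>w1\<close> must have absolute value at least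
      \<open>h - 1\<close>.\<close>
    then have "h \<le> 3" using w1 by (simp add: abs_less_iff) presburger
    then have "h = 2 \<or> h = 3" using h(2) by auto
    then show False
    proof
      assume h2: "h = 2"
      then have "b = -1 \<or> b = 0 \<or> b = 1" using b by auto
      then show False
      proof (elim disjE)
        assume "b = -1" then show False using row1'[of "-1"] small[of "-1"] h2 by simp
      next
        assume "b = 0" then show False using row1[of 0] h2 by simp
      next
        assume "b = 1" then show False using row1'[of 1] small[of 1] h2 by simp
      qed
    next
      assume h3: "h = 3"
      then have "b = -2 \<or> b = -1 \<or> b = 0 \<or> b = 1 \<or> b = 2" using b by auto
      then show False
      proof (elim disjE)
        assume "b = -2" then show False using row1[of "-1"] h3 by simp
      next
        assume "b = -1" then show False using row1'[of 0] small[of 0] h3 by simp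
      next
        assume "b = 0" then show False using row1[of 0] h3 by simp
      next
        assume "b = 1" then show False using row1'[of 0] small[of 0] h3 by simp
      next
        assume "b = 2" then show False using row1[of 1] h3 by simp
      qed
    qed
  qed
  then show ?thesis using x by (intro strip2I[of _ "-1"]) force
qed

text \<open>Three situations: an opposite pair of points; all determinants of pairs at most 1 in
  absolute value, where the determinant with a fixed primitive point is a coordinate of width two;
  or a pair of larger determinant, whose connecting segment then contains three consecutive lattice
  points.\<close>

theorem reflexive2:
  assumes C: "closed2 C" "in2 C (0, 0)" "\<And>p. in2 C p \<Longrightarrow> p = (0, 0)"
  shows "fits2 2 3 C"
proof -
  obtain a b where ab: "(a, b) \<in> C" "(a, b) \<noteq> (0, 0)"
  proof -
    have "\<exists>(x, y)\<in>C. x < 0"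
      using C(2)[unfolded in2_def prod.case, rule_format, of 1 0] by simp
    then obtain x y where "(x, y) \<in> C" "x < 0" by auto
    then show ?thesis by (intro that[of x y]) auto
  qed
  have basis: "\<exists>u v. u * x + v * y = 1" if xyb: "(x, y) \<in> C" "(x, y) \<noteq> (0, 0)" for x y
  proof -
    obtain k c d u v where k: "x = k * c" "y = k * d" "1 \<le> k" "u * c + v * d = 1"
      using primitive_decomp[OF xyb(2)] by metis
    have "(c, d) \<noteq> (0, 0)" using xyb(2) k by auto
    then have "k = 1" using one_int_primitive[OF C(2,3)] xyb(1) k by blast
    then show ?thesis using k by auto
  qed
  show ?thesis
  proof (cases "\<exists>x y. (x, y) \<in> C \<and> (- x, - y) \<in> C \<and> (x, y) \<noteq> (0, 0)")
    case True
    then obtain x y where xy: "(x, y) \<in> C" "(- x, - y) \<in> C" "(x, y) \<noteq> (0, 0)" by blast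
    obtain u v where uv: "u * x + v * y = 1" using basis[OF xy(1,3)] by blast
    have U: "U2 (u, v, - y, x, 0, 0)" using uv by (simp add: algebra_simps)
    have "fits2 2 3 (am2 (u, v, - y, x, 0, 0) ` C)"
    proof (rule reflexive_opposite_case[OF one_int_am2[OF U C]])
      show "(1, 0) \<in> am2 (u, v, - y, x, 0, 0) ` C"
        using am2_mem[OF xy(1), of u v 0 "-y" x 0] uv by (simp add: mult.commute)
      show "(-1, 0) \<in> am2 (u, v, - y, x, 0, 0) ` C"
      proof -
        have "u * (- x) + v * (- y) + 0 = -1" using uv by simp
        then show ?thesis using am2_mem[OF xy(2), of u v 0 "-y" x 0] by (simp only:) (simp add: mult.commute)
      qed
    qed
    then show ?thesis by (rule fits2_am2[OF U])
  next
    case noopp: False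
    show ?thesis
    proof (cases "\<forall>x y x' y'. (x, y) \<in> C \<longrightarrow> (x', y') \<in> C \<longrightarrow> \<bar>x * y' - x' * y\<bar> \<le> 1")
      case True
      obtain u v where uv: "u * a + v * b = 1" using basis[OF ab] by blast
      have "\<bar>b * x - a * y\<bar> \<le> 1" if "(x, y) \<in> C" for x y
        using True[rule_format, OF that ab(1)] by (simp add: algebra_simps)
      then have s: "-1 \<le> b * x - a * y \<and> b * x - a * y \<le> -1 + 2" if "(x, y) \<in> C" for x y
        using that by (simp add: abs_le_iff) (metis add.inverse_inverse minus_diff_eq neg_le_iff_le)
      have "strip2 2 (am2 (b, - a, u, v, 0, 0) ` C)"
      proof (rule strip2I[of _ "-1"])
        fix p q assume "(p, q) \<in> am2 (b, - a, u, v, 0, 0) ` C"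
        then obtain x y where "(x, y) \<in> C" "p = b * x - a * y" by auto
        then show "-1 \<le> p \<and> p \<le> -1 + 2" using s by blast
      qed
      moreover have "U2 (b, - a, u, v, 0, 0)" using uv by (simp add: algebra_simps)
      ultimately show ?thesis by (intro fits2I(1))
    next
      case False
      then obtain x y x' y' where xy: "(x, y) \<in> C" "(x', y') \<in> C" and d: "\<not> \<bar>x * y' - x' * y\<bar> \<le> 1" by blast
      have ne: "(x, y) \<noteq> (0, 0)" using d by auto
      obtain u v where uv: "u * x + v * y = 1" using basis[OF xy(1) ne] by blast
      \<comment> \<open>The sign chooses the orientation in which the second point gets a positive
        height \<open>q\<close>.\<close>
      define e :: int where "e = (if x * y' - x' * y \<ge> 2 then 1 else -1)"
      have e: "e = 1 \<or> e = -1" "2 \<le> e * (x * y' - x' * y)" using d by (auto simp: e_def)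
      define p q where "p = u * x' + v * y'" and "q = e * (x * y' - x' * y)"
      have U: "U2 (u, v, - e * y, e * x, 0, 0)" using uv e(1) by (auto simp: algebra_simps)
      let ?D = "am2 (u, v, - e * y, e * x, 0, 0) ` C"
      note D = one_int_am2[OF U C]
      have m: "(1, 0) \<in> ?D" "(p, q) \<in> ?D"
        using am2_mem[OF xy(1), of u v 0 "- e * y" "e * x" 0] am2_mem[OF xy(2), of u v 0 "- e * y" "e * x" 0] uv
        by (simp_all add: p_def q_def algebra_simps)
      have q: "2 \<le> q" using e by (simp add: q_def)
      obtain s where s: "0 \<le> q * s - p" "q * s - p \<le> q - 1" using ceiling_multiple[of q p] q by auto
      \<comment> \<open>Otherwise \<open>(s, 1)\<close> is a convex combination of the origin,
        \<open>(1, 0)\<close> and \<open>(p, q)\<close> with positive weight on the origin, which is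
        interior.\<close>
      have "q * s - p = q - 1"
      proof (rule ccontr)
        assume "q * s - p \<noteq> q - 1"
        then have i: "in2 ?D (s, 1)"
          by (intro in2_combine[OF D(2) m, of "q - 1 - (q * s - p)" "q * s - p" 1])
            (use s in \<open>auto simp: algebra_simps\<close>)
        have "(s, 1) = (0 :: int, 0 :: int)" by (rule D(3)[OF _ i])
        then show False by simp
      qed
      then have p: "p = q * s - q + 1" by simp
      define r where "r = s - 1"
      have pr: "p = q * r + 1" by (simp add: p r_def algebra_simps)
      have seg1: "(1 + r, 1) \<in> ?D"
        by (rule closed2I[OF D(1) m(1,2,1), of "q - 1" 1 0]) (use q in \<open>simp_all add: pr algebra_simps\<close>)
      have seg2: "(1 + 2 * r, 2) \<in> ?D"
        by (rule closed2I[OF D(1) m(1,2,1), of "q - 2" 2 0]) (use q in \<open>simp_all add: pr algebra_simps\<close>)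
      \<comment> \<open>Sends \<open>(1, 0)\<close>, \<open>(1 + r, 1)\<close>,
        \<open>(1 + 2 r, 2)\<close> to \<open>(1, -1)\<close>, \<open>(1, 0)\<close>,
        \<open>(1, 1)\<close>.\<close>
      let ?h = "(1, - r, -1, r + 1, 0, 0)"
      have U': "U2 ?h" by (simp add: algebra_simps)
      let ?E = "am2 ?h ` ?D"
      note E = one_int_am2[OF U' D]
      have "strip2 2 ?E"
      proof (rule reflexive_edge_case[OF E])
        show "(1, -1) \<in> ?E" using am2_mem[OF m(1), of 1 "-r" 0 "-1" "r+1" 0] by simp
        show "(1, 0) \<in> ?E" using am2_mem[OF seg1, of 1 "-r" 0 "-1" "r+1" 0] by simp
        show "(1, 1) \<in> ?E" using am2_mem[OF seg2, of 1 "-r" 0 "-1" "r+1" 0] by (simp add: algebra_simps)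
        have no0: "(x, y) = (0, 0)" if "(x, y) \<in> C" "(- x, - y) \<in> C" for x y
          using noopp that by blast
        have no1: "(x, y) = (0, 0)" if "(x, y) \<in> ?D" "(- x, - y) \<in> ?D" for x y
          by (rule no_opposite_am2[OF U no0 that])
        show "(x, y) = (0, 0)" if "(x, y) \<in> ?E" "(- x, - y) \<in> ?E" for x y
          by (rule no_opposite_am2[OF U' no1 that])
      qed
      then have "fits2 2 3 ?E"
        by (intro fits2I(1)[of "(1, 0, 0, 1, 0, 0)"]) (simp_all only: am2_id image_ident, simp)
      then have "fits2 2 3 ?D" by (rule fits2_am2[OF U'])
      then show ?thesis by (rule fits2_am2[OF U])
    qed
  qed
qed

section \<open>Normal forms of the base: the segment and twice the unit triangle\<close>

subsection \<open>\<open>F\<close>-hollow polytopes of dimension one and two\<close>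

definition vec1 :: "real \<Rightarrow> real ^ 1" where "vec1 z = (\<chi> i. z)"
definition vec2 :: "real \<times> real \<Rightarrow> real ^ 2" where "vec2 = (\<lambda>(x, y). vector [x, y])"
definition vec3 :: "r3 \<Rightarrow> real ^ 3" where "vec3 = (\<lambda>(x, y, z). vector [x, y, z])"
text \<open>\<open>flat\<close> bounds \<open>z\<close> and \<open>over2\<close> bounds
  \<open>(x, y)\<close>; the bounded coordinates must fill the first factor, so \<open>vec12\<close>
  and \<open>vec21\<close> order them differently.\<close>

definition vec12 :: "r3 \<Rightarrow> (real ^ 1) \<times> (real ^ 2)" where "vec12 = (\<lambda>(x, y, z). (vec1 z, vec2 (x, y)))"
definition vec21 :: "r3 \<Rightarrow> (real ^ 2) \<times> (real ^ 1)" where "vec21 = (\<lambda>(x, y, z). (vec2 (x, y), vec1 z))"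

lemma vec_nth [simp]: "vec1 z $ i = z" "vec2 (x, y) $ 1 = x" "vec2 (x, y) $ 2 = y"
  "vec3 (x, y, z) $ 1 = x" "vec3 (x, y, z) $ 2 = y" "vec3 (x, y, z) $ 3 = z"
  by (simp_all add: vec1_def vec2_def vec3_def)

lemma vec_eta [simp]: "vec1 (p $ 1) = p" "vec2 (q $ 1, q $ 2) = q"
  "vec3 (r $ 1, r $ 2, r $ 3) = r"
  by (simp_all add: vec_eq_iff forall_1 forall_2 forall_3)

lemma unimod_vec1: "unimod vec1"
  by (rule unimodI[of _ "\<lambda>p. p $ 1"], rule linearI)
    (auto simp: vec_eq_iff forall_1 int_lattice_vec int_lattice_real)

lemma unimod_vec2: "unimod vec2"
  by (rule unimodI[of _ "\<lambda>q. (q $ 1, q $ 2)"], rule linearI)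
    (auto simp: vec_eq_iff forall_2 int_lattice_vec int_lattice_real int_lattice_Pair)

lemma unimod_vec3: "unimod vec3"
  by (rule unimodI[of _ "\<lambda>r. (r $ 1, r $ 2, r $ 3)"], rule linearI)
    (auto simp: vec_eq_iff forall_3 int_lattice_vec int_lattice_real int_lattice_Pair)

lemma unimod_vec12: "unimod vec12"
  by (rule unimodI[of _ "\<lambda>(p, q). (q $ 1, q $ 2, p $ 1)"], rule linearI)
    (auto simp: vec12_def vec_eq_iff forall_2 forall_1 int_lattice_vec int_lattice_real int_lattice_Pair)

lemma unimod_vec21: "unimod vec21"
  by (rule unimodI[of _ "\<lambda>(q, p). (q $ 1, q $ 2, p $ 1)"], rule linearI)
    (auto simp: vec21_def vec_eq_iff forall_2 forall_1 int_lattice_vec int_lattice_real int_lattice_Pair)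

lemma unimod_equiv_image: "unimod A \<Longrightarrow> unimodular_equiv P (A ` P)"
  unfolding unimodular_equiv_iff by (rule exI[of _ A], rule exI[of _ 0]) simp

lemma lattice_polytope_equiv: "unimodular_equiv P Q \<Longrightarrow> lattice_polytope P \<Longrightarrow> lattice_polytope Q"
  using lattice_polytope_image unfolding unimodular_equiv_iff by blast

lemma unimod_hullZ:
  fixes P :: "'a::euclidean_space set" and A :: "r3 \<Rightarrow> 'b::euclidean_space"
  assumes "unimod A" "unimodular_equiv P Q" "lattice_polytope P"
  obtains V where "finite V" "unimodular_equiv P (hullZ V)" "Q = A ` hullZ V"
proof -
  have i: "inv A (A x) = x" and s: "A (inv A y) = y" for x y
    using assms(1) by (auto simp: unimod_def bij_def surj_f_inv_f)
  have e: "unimodular_equiv P (inv A ` Q)"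
    using unimodular_equiv_trans[OF assms(2) unimod_equiv_image[OF unimod_inv[OF assms(1)]]] .
  then obtain V where V: "finite V" "inv A ` Q = hullZ V"
    using lattice_polytope_hullZ lattice_polytope_equiv assms(3) by metis
  moreover have "Q = A ` hullZ V" by (simp add: V(2)[symmetric] image_image s)
  ultimately show ?thesis using that e by simp
qed

lemma full_latticeI:
  fixes W :: "'a::euclidean_space set"
  assumes "finite W" "W \<subseteq> int_lattice" "\<And>m r. (\<And>w. w \<in> W \<Longrightarrow> m \<bullet> w = r) \<Longrightarrow> m = 0"
  shows "full_lattice_polytope (convex hull W)"
proof -
  have "aff_dim (convex hull W) = int DIM('a)"
  proof (rule ccontr)
    assume "aff_dim (convex hull W) \<noteq> int DIM('a)"
    then have "aff_dim (convex hull W) < int DIM('a)" using aff_dim_le_DIM[of "convex hull W"] by simp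
    then obtain m r where m: "m \<noteq> 0" "convex hull W \<subseteq> {x. m \<bullet> x = r}"
      by (rule aff_lowdim_subset_hyperplane)
    then have "m \<bullet> w = r" if "w \<in> W" for w using hull_inc[OF that, of convex] by blast
    then show False using assms(3) m(1) by blast
  qed
  then show ?thesis using assms(1,2) by (auto simp: full_lattice_polytope_def lattice_polytope_iff)
qed

lemma hull_fine_interior_iff:
  assumes "finite W" "W \<noteq> {}"
  shows "x \<in> fine_interior (dilate c (convex hull W)) \<longleftrightarrow>
    (\<forall>n\<in>int_lattice - {0}. \<exists>w\<in>W. c * (w \<bullet> n) + 1 \<le> x \<bullet> n)"
proof -
  have "compact (convex hull W)" "convex hull W \<noteq> {}"
    using assms by (auto simp: finite_imp_compact_convex_hull)
  then show ?thesis
    using hull_exists_le_iff[where W = W] by (simp add: fine_interior_dilate_iff le_diff_eq[symmetric])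
qed

lemma F_hollow_segment: "F_hollow (convex hull {0, 1 :: real})"
proof -
  have 1: "1 \<in> fine_interior (dilate 2 (convex hull {0, 1 :: real}))"
    by (auto simp: hull_fine_interior_iff int_lattice_real elim!: Ints_cases)
  have 2: "fine_interior (dilate d (convex hull {0, 1 :: real})) = {}" if "0 \<le> d" "d < 2" for d
  proof (rule ccontr)
    assume "fine_interior (dilate d (convex hull {0, 1 :: real})) \<noteq> {}"
    then obtain x where x: "x \<in> fine_interior (dilate d (convex hull {0, 1 :: real}))" by blast
    have "1 \<le> x \<or> d + 1 \<le> x" "1 \<le> - x \<or> - d + 1 \<le> - x"
      using x[unfolded hull_fine_interior_iff[OF finite.insertI[OF finite.insertI[OF finite.emptyI]] insert_not_empty], rule_format, of 1]
        x[unfolded hull_fine_interior_iff[OF finite.insertI[OF finite.insertI[OF finite.emptyI]] insert_not_empty], rule_format, of "-1"]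
      by (simp_all add: int_lattice_real)
    then show False using that by linarith
  qed
  have "min_multiplier (convex hull {0, 1 :: real}) = 2"
    using 1 2 by (intro min_multiplier_eqI) auto
  moreover have "full_lattice_polytope (convex hull {0, 1 :: real})"
  proof (rule full_latticeI)
    show "{0, 1 :: real} \<subseteq> int_lattice" by (simp add: int_lattice_real)
    fix m r :: real assume *: "\<And>w. w \<in> {0, 1} \<Longrightarrow> m \<bullet> w = r"
    have "m \<bullet> 0 = r" "m \<bullet> 1 = r" by (rule *, simp)+
    then show "m = 0" by simp
  qed simp
  ultimately show ?thesis by (simp add: F_hollow_def)
qed

text \<open>The normals \<open>(1, 0)\<close>, \<open>(0, 1)\<close>, \<open>(-1, -1)\<close> force
  \<open>x, y \<ge> 1\<close> and \<open>x + y \<le> 2 d - 1\<close>, so nothing exists before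
  \<open>d = 3/2\<close>, where \<open>(1, 1)\<close> appears.\<close>

lemma F_hollow_triangle: "F_hollow (convex hull {(0, 0), (2, 0), (0, 2)} :: (real \<times> real) set)"
proof -
  let ?W = "{(0, 0), (2, 0), (0, 2)} :: (real \<times> real) set"
  note iff = hull_fine_interior_iff[of ?W, simplified]
  have 1: "(1, 1) \<in> fine_interior (dilate (3 / 2) (convex hull ?W))"
  proof -
    have "\<exists>w\<in>?W. 3 / 2 * (w \<bullet> n) + 1 \<le> (1, 1) \<bullet> n" if n: "n \<in> int_lattice - {0}" for n
    proof -
      obtain a b :: int where ab: "n = (of_int a, of_int b)"
        using n by (cases n) (auto simp: int_lattice_Pair int_lattice_real elim!: Ints_cases)
      then have "a \<noteq> 0 \<or> b \<noteq> 0" using n by (auto simp: zero_prod_def)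
      \<comment> \<open>If all three failed, \<open>a + b\<close> would be at most \<open>0\<close>,
        \<open>3 a\<close> and \<open>3 b\<close>. These add up to \<open>3 (a + b)\<close>, so all
        are equal and \<open>a = b = 0\<close>.\<close>
      then have "1 \<le> a + b \<or> 3 * a + 1 \<le> a + b \<or> 3 * b + 1 \<le> a + b" by linarith
      then have "real_of_int 1 \<le> of_int (a + b) \<or> real_of_int (3 * a + 1) \<le> of_int (a + b) \<or>
          real_of_int (3 * b + 1) \<le> of_int (a + b)"
        by (simp only: of_int_le_iff)
      then show ?thesis by (auto simp: ab)
    qed
    then show ?thesis by (subst hull_fine_interior_iff) auto
  qed
  have 2: "fine_interior (dilate d (convex hull ?W)) = {}" if d: "0 \<le> d" "d < 3 / 2" for d
  proof (rule ccontr)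
    assume "fine_interior (dilate d (convex hull ?W)) \<noteq> {}"
    then obtain x y where x: "(x, y) \<in> fine_interior (dilate d (convex hull ?W))" by auto
    have "\<forall>n\<in>int_lattice - {0}. \<exists>w\<in>?W. d * (w \<bullet> n) + 1 \<le> (x, y) \<bullet> n"
      using x by (subst (asm) hull_fine_interior_iff) auto
    from bspec[OF this, of "(1, 0)"] bspec[OF this, of "(0, 1)"] bspec[OF this, of "(-1, -1)"]
    have "1 \<le> x \<or> d * 2 + 1 \<le> x" "1 \<le> y \<or> d * 2 + 1 \<le> y" "1 \<le> - x - y \<or> - (d * 2) + 1 \<le> - x - y"
      by (auto simp: int_lattice_Pair int_lattice_real zero_prod_def)
    then show False using d by linarith
  qed
  have "min_multiplier (convex hull ?W) = 3 / 2"
    using 1 2 by (intro min_multiplier_eqI) auto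
  moreover have "full_lattice_polytope (convex hull ?W)"
  proof (rule full_latticeI)
    show "?W \<subseteq> int_lattice" by (simp add: int_lattice_Pair int_lattice_real)
    fix m r assume *: "\<And>w. w \<in> ?W \<Longrightarrow> m \<bullet> w = r"
    have "m \<bullet> (0, 0) = r" "m \<bullet> (2, 0) = r" "m \<bullet> (0, 2) = r" by (rule *, simp)+
    then show "m = 0" by (cases m) (simp add: zero_prod_def)
  qed simp
  ultimately show ?thesis by (simp add: F_hollow_def)
qed

text \<open>In a segment longer than 1 the lattice point next to the lower end is interior.\<close>

lemma F_hollow_dim1:
  assumes "F_hollow (P :: (real ^ 1) set)"
  obtains a :: int where "\<And>p. p \<in> P \<Longrightarrow> of_int a \<le> p $ 1 \<and> p $ 1 \<le> of_int (a + 1)"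
proof -
  obtain W where W: "finite W" "W \<subseteq> int_lattice" "P = convex hull W"
    using assms by (auto simp: F_hollow_def full_lattice_polytope_def lattice_polytope_iff)
  have "P \<noteq> {}" using assms full_lattice_polytope_compact by (auto simp: F_hollow_def)
  then have "W \<noteq> {}" using W(3) by auto
  then obtain v where v: "v \<in> W" "\<And>w. w \<in> W \<Longrightarrow> v $ 1 \<le> w $ 1"
    using arg_min_if_finite[OF W(1), of "\<lambda>w. w $ 1"] by (metis linorder_not_less)
  obtain a where a: "v $ 1 = of_int a" using v(1) W(2) by (metis Ints_cases int_lattice_vec subsetD)
  have up: "w $ 1 \<le> of_int (a + 1)" if w: "w \<in> W" for w
  proof (rule ccontr)
    assume big: "\<not> w $ 1 \<le> of_int (a + 1)"
    have "vec1 (of_int (a + 1)) \<in> int_lattice" by (simp add: int_lattice_vec)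
    then obtain n where n: "n \<in> int_lattice - {0}" "\<And>w. w \<in> W \<Longrightarrow> vec1 (of_int (a + 1)) \<bullet> n \<le> w \<bullet> n"
      using F_hollow_no_interior_point[OF assms W(3,1,2)] by metis
    have "n $ 1 \<noteq> 0" using n(1) by (auto simp: vec_eq_iff forall_1)
    moreover have "of_int (a + 1) * n $ 1 \<le> of_int a * n $ 1" "of_int (a + 1) * n $ 1 \<le> w $ 1 * n $ 1"
      using n(2)[OF v(1)] n(2)[OF w] by (simp_all add: inner_vec_def a)
    then have "n $ 1 \<le> 0" "0 \<le> (w $ 1 - of_int (a + 1)) * n $ 1" by (simp_all add: algebra_simps)
    then have "n $ 1 \<le> 0" "0 \<le> n $ 1" using big by (auto simp: zero_le_mult_iff)
    ultimately show False by simp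
  qed
  have "P \<subseteq> {p. axis 1 1 \<bullet> p \<ge> of_int a} \<inter> {p. axis 1 1 \<bullet> p \<le> of_int (a + 1)}"
    unfolding W(3)
  proof (rule hull_minimal)
    show "W \<subseteq> {p. axis 1 1 \<bullet> p \<ge> of_int a} \<inter> {p. axis 1 1 \<bullet> p \<le> of_int (a + 1)}"
      using v(2) a up by (auto simp: inner_axis')
  qed (intro convex_Int convex_halfspace_ge convex_halfspace_le)
  then show ?thesis by (intro that[of a]) (auto simp: inner_axis')
qed

text \<open>\<open>F_hollow_no_interior_point\<close> makes the generating points hollow in the
  sense of \<open>in2\<close>, so \<open>hollow2\<close> applies to the lattice points of
  \<open>P\<close>. The conclusion speaks of those only, because the points lying above
  \<open>P\<close> are integral too.\<close>

lemma F_hollow_dim2: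
  assumes "F_hollow (P :: (real ^ 2) set)"
  obtains g where "U2 g"
    "(\<exists>a. \<forall>p. vec2 (of_int (fst p), of_int (snd p)) \<in> P \<longrightarrow> a \<le> fst (am2 g p) \<and> fst (am2 g p) \<le> a + 1) \<or>
     (\<forall>p. vec2 (of_int (fst p), of_int (snd p)) \<in> P \<longrightarrow>
        0 \<le> fst (am2 g p) \<and> 0 \<le> snd (am2 g p) \<and> fst (am2 g p) + snd (am2 g p) \<le> 2)"
proof -
  let ?v = "\<lambda>p :: i2. vec2 (of_int (fst p), of_int (snd p))"
  obtain W where W: "finite W" "W \<subseteq> int_lattice" "P = convex hull W"
    using assms by (auto simp: F_hollow_def full_lattice_polytope_def lattice_polytope_iff)
  define T where "T = {p. ?v p \<in> W}"
  have inner: "?v p \<bullet> ?v q = of_int (fst q * fst p + snd q * snd p)" for p q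
    by (simp add: inner_vec_def sum_2)
  have L: "\<exists>p. w = ?v p" if wL: "w \<in> int_lattice" for w
  proof -
    obtain a where "w $ 1 = of_int a" using wL by (metis Ints_cases int_lattice_vec)
    moreover obtain b where "w $ 2 = of_int b" using wL by (metis Ints_cases int_lattice_vec)
    ultimately have "w = ?v (a, b)" by (simp add: vec_eq_iff forall_2)
    then show ?thesis by blast
  qed
  have vL: "?v p \<in> int_lattice" for p by (simp add: int_lattice_vec forall_2)
  have WT: "W = ?v ` T" using L W(2) by (auto simp: T_def image_iff) (metis fst_conv snd_conv subsetD)+
  have no: "\<not> in2 T p" for p
  proof
    assume i: "in2 T p"
    obtain a b where p: "p = (a, b)" by (cases p)
    obtain n where n: "n \<in> int_lattice - {0}" "\<And>w. w \<in> W \<Longrightarrow> ?v p \<bullet> n \<le> w \<bullet> n"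
      using F_hollow_no_interior_point[OF assms W(3,1,2) vL[of p]] by metis
    obtain c d where cd: "n = ?v (c, d)" using L n(1) by (metis DiffD1 surj_pair)
    have "(c, d) \<noteq> (0, 0)" using n(1) cd by (auto simp: vec_eq_iff forall_2)
    then have "\<exists>(x, y)\<in>T. c * (x - a) + d * (y - b) < 0" using i unfolding p in2_def prod.case by blast
    then obtain x y where xy: "(x, y) \<in> T" "c * (x - a) + d * (y - b) < 0" by auto
    have "?v p \<bullet> n \<le> ?v (x, y) \<bullet> n" using xy(1) by (intro n(2)) (auto simp: T_def)
    then have "c * a + d * b \<le> c * x + d * y" unfolding cd inner p of_int_le_iff by simp
    then show False using xy(2) by (simp add: algebra_simps)
  qed
  have "fits2 1 2 (cl2 T)" by (rule hollow2[OF closed2_cl2]) (simp add: in2_cl2 no)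
  then obtain g where g: "U2 g" "strip2 1 (am2 g ` cl2 T) \<or> tri2 2 (am2 g ` cl2 T)"
    unfolding fits2_def by blast
  have mem: "p \<in> cl2 T" if pP: "?v p \<in> P" for p
  proof -
    obtain a b where p: "p = (a, b)" by (cases p)
    have "\<exists>(x, y)\<in>T. c * (x - a) + d * (y - b) \<le> 0" for c d
    proof -
      have "\<exists>w\<in>W. 1 * (w \<bullet> ?v (c, d)) \<le> ?v p \<bullet> ?v (c, d)"
        using pP hull_exists_le_iff[of W 1 "?v (c, d)" "?v p \<bullet> ?v (c, d)"] unfolding W(3) by auto
      then obtain q where q: "q \<in> T" "?v q \<bullet> ?v (c, d) \<le> ?v p \<bullet> ?v (c, d)" by (auto simp: WT)
      then have "c * fst q + d * snd q \<le> c * a + d * b" unfolding inner of_int_le_iff by (simp add: p)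
      then show ?thesis using q(1) by (intro bexI[of _ q]) (auto simp: algebra_simps split: prod.split)
    qed
    then show ?thesis by (auto simp: cl2_def p)
  qed
  from g(2) show ?thesis
  proof
    assume "strip2 1 (am2 g ` cl2 T)"
    then obtain a where a: "\<And>p. p \<in> cl2 T \<Longrightarrow> a \<le> fst (am2 g p) \<and> fst (am2 g p) \<le> a + 1"
      unfolding strip2_def by (force simp: split_beta)
    show ?thesis using mem a by (intro that[OF g(1)]) blast
  next
    assume "tri2 2 (am2 g ` cl2 T)"
    then have a: "\<And>p. p \<in> cl2 T \<Longrightarrow> 0 \<le> fst (am2 g p) \<and> 0 \<le> snd (am2 g p) \<and> fst (am2 g p) + snd (am2 g p) \<le> 2"
      unfolding tri2_def by (force simp: split_beta)
    show ?thesis using mem a by (intro that[OF g(1)]) blast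
  qed
qed

definition flat :: "i3 set \<Rightarrow> bool" where
  "flat V \<longleftrightarrow> (\<forall>(x, y, z)\<in>V. 0 \<le> z \<and> z \<le> 1)"

definition over2 :: "i3 set \<Rightarrow> bool" where
  "over2 V \<longleftrightarrow> (\<forall>(x, y, z)\<in>V. 0 \<le> x \<and> 0 \<le> y \<and> x + y \<le> 2)"

lemma pt_mem_hullZ: "v \<in> V \<Longrightarrow> pt v \<in> hullZ V"
  by (simp add: hullZ_def hull_inc)

lemma fits_over_dim1:
  assumes "fits_over_F_hollow TYPE((real ^ 1) \<times> (real ^ 2)) (P :: (real ^ 3) set)" "lattice_polytope P"
  obtains V where "finite V" "unimodular_equiv P (hullZ V)" "flat V"
proof -
  obtain P' :: "(real ^ 1) set" and Q :: "((real ^ 1) \<times> (real ^ 2)) set"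
    where PQ: "F_hollow P'" "unimodular_equiv P Q" "Q \<subseteq> P' \<times> UNIV"
    using assms(1) by (auto simp: fits_over_F_hollow_def)
  obtain V where V: "finite V" "unimodular_equiv P (hullZ V)" "Q = vec12 ` hullZ V"
    using unimod_hullZ[OF unimod_vec12 PQ(2) assms(2)] by metis
  obtain a :: int where a: "\<And>p. p \<in> P' \<Longrightarrow> of_int a \<le> p $ 1 \<and> p $ 1 \<le> of_int (a + 1)"
    using F_hollow_dim1[OF PQ(1)] by metis
  have z: "a \<le> z \<and> z \<le> a + 1" if "(x, y, z) \<in> V" for x y z
  proof -
    have "vec12 (pt (x, y, z)) \<in> P' \<times> UNIV" using pt_mem_hullZ[OF that] V(3) PQ(3) by blast
    then have "vec1 (of_int z) \<in> P'" by (simp add: vec12_def)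
    from a[OF this] show ?thesis unfolding vec_nth of_int_le_iff by simp
  qed
  define g :: i12 where "g = (1, 0, 0, 0, 1, 0, 0, 0, 1, 0, 0, - a)"
  have "amap_det g \<in> {1, -1}" by (simp add: g_def amap_det_def)
  then have "unimodular_equiv P (hullZ (amap g ` V))" using unimodular_equiv_trans[OF V(2) hullZ_amap] by blast
  moreover have "flat (amap g ` V)" using z by (force simp: flat_def g_def amap_def)
  ultimately show ?thesis using that V(1) by blast
qed

lemma fits_over_dim2:
  assumes "fits_over_F_hollow TYPE((real ^ 2) \<times> (real ^ 1)) (P :: (real ^ 3) set)" "lattice_polytope P"
  obtains V where "finite V" "unimodular_equiv P (hullZ V)" "flat V \<or> over2 V"
proof -
  obtain P' :: "(real ^ 2) set" and Q :: "((real ^ 2) \<times> (real ^ 1)) set"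
    where PQ: "F_hollow P'" "unimodular_equiv P Q" "Q \<subseteq> P' \<times> UNIV"
    using assms(1) by (auto simp: fits_over_F_hollow_def)
  obtain V where V: "finite V" "unimodular_equiv P (hullZ V)" "Q = vec21 ` hullZ V"
    using unimod_hullZ[OF unimod_vec21 PQ(2) assms(2)] by metis
  obtain g where g: "U2 g" and alt:
    "(\<exists>a. \<forall>p. vec2 (of_int (fst p), of_int (snd p)) \<in> P' \<longrightarrow> a \<le> fst (am2 g p) \<and> fst (am2 g p) \<le> a + 1) \<or>
     (\<forall>p. vec2 (of_int (fst p), of_int (snd p)) \<in> P' \<longrightarrow>
        0 \<le> fst (am2 g p) \<and> 0 \<le> snd (am2 g p) \<and> fst (am2 g p) + snd (am2 g p) \<le> 2)"
    using F_hollow_dim2[OF PQ(1)] by metis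
  obtain a b c d s t where g': "g = (a, b, c, d, s, t)" by (cases g)
  have mem: "vec2 (of_int (fst (x, y)), of_int (snd (x, y))) \<in> P'" if "(x, y, z) \<in> V" for x y z
  proof -
    have "vec21 (pt (x, y, z)) \<in> P' \<times> UNIV" using pt_mem_hullZ[OF that] V(3) PQ(3) by blast
    then show ?thesis by (simp add: vec21_def)
  qed
  from alt show ?thesis
  proof
    assume "\<exists>a. \<forall>p. vec2 (of_int (fst p), of_int (snd p)) \<in> P' \<longrightarrow> a \<le> fst (am2 g p) \<and> fst (am2 g p) \<le> a + 1"
    then obtain e where e: "\<And>p. vec2 (of_int (fst p), of_int (snd p)) \<in> P' \<Longrightarrow> e \<le> fst (am2 g p) \<and> fst (am2 g p) \<le> e + 1"
      by blast
    \<comment> \<open>Moves the bounded coordinate to third place, where \<open>flat\<close> expects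
      it.\<close>
    define h :: i12 where "h = (c, d, 0, 0, 0, 1, a, b, 0, t, 0, s - e)"
    have "amap_det h \<in> {1, -1}" using g by (auto simp: h_def amap_det_def g' algebra_simps)
    then have "unimodular_equiv P (hullZ (amap h ` V))" using unimodular_equiv_trans[OF V(2) hullZ_amap] by blast
    moreover have "flat (amap h ` V)"
      unfolding flat_def
    proof clarify
      fix x y z p q r assume "(x, y, z) = amap h (p, q, r)" "(p, q, r) \<in> V"
      then show "0 \<le> z \<and> z \<le> 1" using e[OF mem[of p q r]] by (simp add: h_def amap_def g')
    qed
    ultimately show ?thesis using that V(1) by blast
  next
    assume e: "\<forall>p. vec2 (of_int (fst p), of_int (snd p)) \<in> P' \<longrightarrow>
        0 \<le> fst (am2 g p) \<and> 0 \<le> snd (am2 g p) \<and> fst (am2 g p) + snd (am2 g p) \<le> 2"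
    define h :: i12 where "h = (a, b, 0, c, d, 0, 0, 0, 1, s, t, 0)"
    have "amap_det h \<in> {1, -1}" using g by (auto simp: h_def amap_det_def g' algebra_simps)
    then have "unimodular_equiv P (hullZ (amap h ` V))" using unimodular_equiv_trans[OF V(2) hullZ_amap] by blast
    moreover have "over2 (amap h ` V)"
      unfolding over2_def
    proof clarify
      fix x y z p q r assume "(x, y, z) = amap h (p, q, r)" "(p, q, r) \<in> V"
      then show "0 \<le> x \<and> 0 \<le> y \<and> x + y \<le> 2" using e mem[of p q r] by (auto simp: h_def amap_def g' split_beta)
    qed
    ultimately show ?thesis using that V(1) by blast
  qed
qed

lemma weakly_not_sporadicE:
  assumes "P \<in> weakly_not_sporadic"
  obtains V where "ws V" "unimodular_equiv P (hullZ V)" "flat V \<or> over2 V"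
proof -
  have P: "weakly_sporadic_F_hollow P"
    "fits_over_F_hollow TYPE((real ^ 1) \<times> (real ^ 2)) P \<or> fits_over_F_hollow TYPE((real ^ 2) \<times> (real ^ 1)) P"
    using assms by (auto simp: weakly_not_sporadic_def sporadic_F_hollow_def)
  have "lattice_polytope P"
    using P(1) by (simp add: weakly_sporadic_F_hollow_def F_hollow_def full_lattice_polytope_def)
  then obtain V where "finite V" "unimodular_equiv P (hullZ V)" "flat V \<or> over2 V"
    using P(2) by (meson fits_over_dim1 fits_over_dim2)
  moreover from this have "ws V" using weakly_sporadic_equiv[OF _ P(1)] by (simp add: ws_def)
  ultimately show ?thesis using that by blast
qed

definition rep3 :: "i3 set \<Rightarrow> (real ^ 3) set" where
  "rep3 V = vec3 ` hullZ V"

lemma rep3_equiv: "unimodular_equiv (rep3 V) (hullZ V)"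
  unfolding rep3_def by (rule unimodular_equiv_sym[OF unimod_equiv_image[OF unimod_vec3]])

text \<open>Shows that the representatives belong to the family: \<open>hullZ V\<close> projects
  into the segment from 0 to 1 or into \<open>2 Delta_2\<close>, which are F-hollow.\<close>

lemma rep3_weakly_not_sporadic:
  assumes "ws V" "flat V \<or> over2 V"
  shows "rep3 V \<in> weakly_not_sporadic"
proof -
  have w: "weakly_sporadic_F_hollow (rep3 V)"
    using assms(1) weakly_sporadic_equiv[OF unimodular_equiv_sym[OF rep3_equiv]] unfolding ws_def by blast
  have "fits_over_F_hollow TYPE((real ^ 1) \<times> (real ^ 2)) (rep3 V) \<or>
    fits_over_F_hollow TYPE((real ^ 2) \<times> (real ^ 1)) (rep3 V)"
    using assms(2)
  proof
    assume f: "flat V"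
    define S where "S = vec1 ` (convex hull {0, 1})"
    have "F_hollow S"
      using F_hollow_image[OF unimod_vec1 int_lattice_0 F_hollow_segment] by (simp only: S_def add.right_neutral)
    moreover have "unimodular_equiv (rep3 V) (vec12 ` hullZ V)"
      by (rule unimodular_equiv_trans[OF rep3_equiv unimod_equiv_image[OF unimod_vec12]])
    moreover have "vec12 ` hullZ V \<subseteq> S \<times> UNIV"
    proof -
      have "hullZ V \<subseteq> {x. (0, 0, 1) \<bullet> x \<ge> 0} \<inter> {x. (0, 0, 1) \<bullet> x \<le> 1}"
        unfolding hullZ_def by (rule hull_minimal)
          (use f in \<open>force simp: flat_def pt_def intro!: convex_Int convex_halfspace_ge convex_halfspace_le\<close>)+
      moreover have "convex hull {0, 1 :: real} = {0..1}" by (simp add: convex_hull_eq_real_cbox)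
      ultimately show ?thesis by (force simp: S_def vec12_def)
    qed
    ultimately show ?thesis unfolding fits_over_F_hollow_def by blast
  next
    assume f: "over2 V"
    define S where "S = vec2 ` (convex hull {(0, 0), (2, 0), (0, 2)})"
    have "F_hollow S"
      using F_hollow_image[OF unimod_vec2 int_lattice_0 F_hollow_triangle] by (simp only: S_def add.right_neutral)
    moreover have "unimodular_equiv (rep3 V) (vec21 ` hullZ V)"
      by (rule unimodular_equiv_trans[OF rep3_equiv unimod_equiv_image[OF unimod_vec21]])
    moreover have "vec21 ` hullZ V \<subseteq> S \<times> UNIV"
    proof -
      have "hullZ V \<subseteq> {x. (1, 0, 0) \<bullet> x \<ge> 0} \<inter> {x. (0, 1, 0) \<bullet> x \<ge> 0} \<inter> {x. (1, 1, 0) \<bullet> x \<le> 2}"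
        unfolding hullZ_def
      proof (rule hull_minimal)
        show "pt ` V \<subseteq> {x. (1, 0, 0) \<bullet> x \<ge> 0} \<inter> {x. (0, 1, 0) \<bullet> x \<ge> 0} \<inter> {x. (1, 1, 0) \<bullet> x \<le> 2}"
        proof
          fix u assume "u \<in> pt ` V"
          then obtain x y z where u: "(x, y, z) \<in> V" "u = pt (x, y, z)" by (metis imageE prod_cases3)
          then have "0 \<le> x" "0 \<le> y" "x + y \<le> 2" using f by (auto simp: over2_def)
          moreover from this have "real_of_int x + real_of_int y \<le> 2" by linarith
          ultimately show "u \<in> {x. (1, 0, 0) \<bullet> x \<ge> 0} \<inter> {x. (0, 1, 0) \<bullet> x \<ge> 0} \<inter> {x. (1, 1, 0) \<bullet> x \<le> 2}"
            by (simp add: u(2))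
        qed
      qed (intro convex_Int convex_halfspace_ge convex_halfspace_le)
      then have b: "0 \<le> x \<and> 0 \<le> y \<and> x + y \<le> 2" if "(x, y, z) \<in> hullZ V" for x y z
        using that by (auto dest!: subsetD)
      have c: "(x, y) \<in> convex hull {(0, 0), (2, 0), (0, 2)}" if "0 \<le> x" "0 \<le> y" "x + y \<le> 2" for x y :: real
        unfolding convex_hull_3 mem_Collect_eq
        by (rule exI[of _ "1 - x / 2 - y / 2"], rule exI[of _ "x / 2"], rule exI[of _ "y / 2"]) (use that in simp)
      show ?thesis
      proof
        fix u assume "u \<in> vec21 ` hullZ V"
        then obtain x y z where u: "(x, y, z) \<in> hullZ V" "u = vec21 (x, y, z)" by (metis imageE prod_cases3)
        then have "(x, y) \<in> convex hull {(0, 0), (2, 0), (0, 2)}" using b[OF u(1)] c by blast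
        then show "u \<in> S \<times> UNIV" by (simp add: u(2) S_def vec21_def)
      qed
    qed
    ultimately show ?thesis unfolding fits_over_F_hollow_def by blast
  qed
  then show ?thesis using w by (simp add: weakly_not_sporadic_def sporadic_F_hollow_def)
qed

section \<open>Representatives, maps and enumerations for the finite checks\<close>

subsection \<open>Tables\<close>

text \<open>The representatives over \<open>2 Delta_2\<close>: 79 with mu = 3/2 and, as last entry,
  twice a unimodular simplex, which has mu = 2. The nesting by 25, 5 and 1 serves the digit-wise
  access of \<open>look\<close>.\<close>

definition half_tree :: "i3 list list list list" where
  "half_tree =
    [[[[(0,0,0),(0,1,-2),(0,2,0),(1,0,-2),(2,0,0)],[(0,0,0),(0,1,-1),(0,2,0),(1,0,-2),(1,1,-1),
    (2,0,0)],[(0,0,0),(0,1,-1),(0,2,0),(1,0,-2),(2,0,0)],[(0,0,0),(0,2,0),(1,0,-2),(2,0,0)],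
    [(0,0,0),(0,1,-1),(0,2,0),(1,0,-1),(1,1,1),(2,0,0)]],[[(0,0,0),(0,1,-1),(0,1,1),(0,2,0),
    (1,0,-1),(2,0,0)],[(0,0,0),(0,1,-1),(0,1,1),(0,2,0),(1,0,-1),(1,1,1),(2,0,0)],[(0,0,0),(0,1,-1),
    (0,1,1),(0,2,0),(1,0,-1),(1,0,1),(2,0,0)],[(0,0,0),(0,2,0),(1,0,-1),(1,1,1),(2,0,0)],[(0,0,0),
    (0,2,0),(1,0,-1),(1,0,1),(2,0,0)]],[[(0,0,0),(0,1,-1),(0,2,0),(0,2,1),(1,0,-1),(2,0,0)],
    [(0,0,0),(0,1,-1),(0,2,0),(0,2,1),(1,0,-1),(1,1,1),(2,0,0)],[(0,0,0),(0,1,-1),(0,1,1),(0,2,0),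
    (0,2,1),(1,0,-1),(2,0,0)],[(0,0,0),(0,1,-1),(0,1,1),(0,2,0),(0,2,1),(1,0,-1),(1,1,1),(2,0,0)],
    [(0,0,0),(0,1,1),(0,2,0),(0,2,1),(1,0,-1),(1,1,1),(2,0,0)]],[[(0,0,0),(0,1,-1),(0,2,0),(0,2,1),
    (1,1,-1),(2,0,0)],[(0,0,0),(0,1,-1),(0,2,0),(0,2,1),(1,1,-1),(1,1,1),(2,0,0)],[(0,0,0),(0,1,-1),
    (0,1,1),(0,2,0),(0,2,1),(1,1,-1),(1,1,1),(2,0,0)],[(0,0,0),(0,1,-1),(0,2,0),(0,2,1),(2,0,0)],
    [(0,0,0),(0,1,-1),(0,1,1),(0,2,0),(0,2,1),(2,0,0)]],[[(0,0,0),(0,1,-1),(0,1,1),(0,2,0),(0,2,1),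
    (1,1,1),(2,0,0)],[(0,0,0),(0,2,0),(0,2,1),(1,1,2),(2,0,0)],[(0,0,0),(0,1,1),(0,2,0),(0,2,1),
    (1,1,2),(2,0,0)],[(0,0,0),(0,1,2),(0,2,0),(0,2,1),(1,1,2),(2,0,0)],[(0,0,0),(0,2,0),(0,2,1),
    (1,0,1),(1,1,2),(2,0,0)]]],[[[(0,0,0),(0,1,1),(0,2,0),(0,2,1),(1,0,1),(1,1,2),(2,0,0)],[(0,0,0),
    (0,1,-1),(0,2,0),(0,2,2),(1,0,-1),(2,0,0)],[(0,0,0),(0,2,0),(0,2,2),(1,0,-1),(2,0,0)],[(0,0,0),
    (0,1,-1),(0,2,0),(0,2,2),(1,1,-1),(2,0,0)],[(0,0,0),(0,1,-1),(0,2,0),(0,2,2),(2,0,0)]],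
    [[(0,0,0),(0,2,0),(0,2,3),(2,0,0)],[(0,0,0),(0,2,0),(0,2,3),(1,1,2),(2,0,0)],[(0,0,0),(0,1,2),
    (0,2,0),(0,2,3),(1,1,2),(2,0,0)],[(0,0,0),(0,2,0),(0,2,4),(2,0,0)],[(0,0,0),(0,2,0),(0,2,1),
    (1,1,2),(2,0,0),(2,0,1)]],[[(0,0,0),(0,1,1),(0,2,0),(0,2,1),(1,1,2),(2,0,0),(2,0,1)],[(0,0,0),
    (0,1,1),(0,2,0),(0,2,1),(1,0,1),(1,1,2),(2,0,0),(2,0,1)],[(0,0,0),(0,2,0),(0,2,2),(1,1,2),
    (2,0,0),(2,0,1)],[(0,0,0),(0,2,0),(0,2,2),(1,0,1),(1,1,2),(2,0,0),(2,0,1)],[(0,0,0),(0,2,0),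
    (0,2,2),(2,0,0),(2,0,2)]],[[(0,0,0),(0,1,-1),(0,2,1),(1,0,-1),(1,1,0),(2,0,0)],[(0,0,0),
    (0,1,-1),(0,2,1),(1,0,-1),(1,1,0),(1,1,1),(2,0,0)],[(0,0,0),(0,1,-1),(0,1,1),(0,2,1),(1,0,-1),
    (1,1,0),(2,0,0)],[(0,0,0),(0,1,-1),(0,1,1),(0,2,1),(1,0,-1),(1,1,0),(1,1,1),(2,0,0)],[(0,0,0),
    (0,1,-1),(0,2,1),(1,0,-1),(2,0,0)]],[[(0,0,0),(0,1,-1),(0,2,1),(1,0,-1),(1,1,1),(2,0,0)],
    [(0,0,0),(0,1,-1),(0,1,1),(0,2,1),(1,0,-1),(2,0,0)],[(0,0,0),(0,1,-1),(0,1,1),(0,2,1),(1,0,-1),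
    (1,1,1),(2,0,0)],[(0,0,0),(0,1,0),(0,2,1),(1,0,-1),(1,0,1),(1,1,0),(2,0,0)],[(0,0,0),(0,1,0),
    (0,2,1),(1,0,-1),(1,0,1),(1,1,0),(1,1,1),(2,0,0)]]],[[[(0,0,0),(0,1,0),(0,1,1),(0,2,1),(1,0,-1),
    (1,0,1),(1,1,0),(1,1,1),(2,0,0)],[(0,0,0),(0,1,0),(0,2,1),(1,0,-1),(1,0,1),(2,0,0)],[(0,0,0),
    (0,1,0),(0,2,1),(1,0,-1),(1,0,1),(1,1,1),(2,0,0)],[(0,0,0),(0,2,1),(1,0,-1),(1,0,1),(2,0,0)],
    [(0,0,0),(0,1,-1),(0,2,1),(1,1,-1),(2,0,0)]],[[(0,0,0),(0,1,-1),(0,2,1),(1,1,-1),(1,1,1),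
    (2,0,0)],[(0,0,0),(0,1,-1),(0,1,1),(0,2,1),(1,1,-1),(1,1,1),(2,0,0)],[(0,0,0),(0,1,-1),(0,2,1),
    (1,1,0),(2,0,0)],[(0,0,0),(0,1,-1),(0,1,1),(0,2,1),(1,1,0),(2,0,0)],[(0,0,0),(0,1,-1),(0,1,1),
    (0,2,1),(1,1,0),(1,1,1),(2,0,0)]],[[(0,0,0),(0,1,-1),(0,2,1),(2,0,0)],[(0,0,0),(0,1,-1),(0,1,1),
    (0,2,1),(2,0,0)],[(0,0,0),(0,1,-1),(0,1,1),(0,2,1),(1,1,1),(2,0,0)],[(0,0,0),(0,1,0),(0,2,1),
    (0,2,3),(1,1,0),(2,0,0)],[(0,0,0),(0,1,0),(0,2,1),(0,2,3),(1,1,0),(1,1,2),(2,0,0)]],[[(0,0,0),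
    (0,1,0),(0,1,2),(0,2,1),(0,2,3),(1,1,0),(1,1,2),(2,0,0)],[(0,0,0),(0,1,0),(0,2,1),(0,2,3),
    (2,0,0)],[(0,0,0),(0,1,0),(0,2,1),(0,2,3),(1,1,2),(2,0,0)],[(0,0,0),(0,1,0),(0,1,2),(0,2,1),
    (0,2,3),(2,0,0)],[(0,0,0),(0,2,1),(0,2,3),(2,0,0)]],[[(0,0,0),(0,1,0),(0,2,1),(1,0,-1),(1,0,1),
    (1,1,0),(2,0,0),(2,0,1)],[(0,0,0),(0,1,0),(0,1,1),(0,2,1),(1,0,-1),(1,0,1),(1,1,0),(2,0,0),
    (2,0,1)],[(0,0,0),(0,1,0),(0,2,1),(1,0,-1),(1,0,1),(2,0,0),(2,0,1)],[(0,0,0),(0,2,1),(1,0,-1),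
    (1,0,1),(1,1,0),(2,0,0),(2,0,1)],[(0,0,0),(0,1,1),(0,2,1),(1,0,-1),(1,0,1),(1,1,0),(2,0,0),
    (2,0,1)]]],[[[(0,0,0),(0,2,1),(1,0,-1),(1,0,1),(2,0,0),(2,0,1)],[(0,0,0),(0,1,0),(0,2,1),
    (0,2,2),(1,1,0),(1,1,2),(2,0,0),(2,0,1)],[(0,0,0),(0,1,0),(0,2,1),(0,2,2),(1,0,1),(1,1,0),
    (1,1,2),(2,0,0),(2,0,1)],[(0,0,0),(0,2,1),(0,2,2),(1,1,0),(1,1,2),(2,0,0),(2,0,1)],[(0,0,0),
    (0,2,0),(0,2,2),(2,0,0)]]]]"

text \<open>The representatives of width one by family: 30 of index 2, two of index 3, one of index
  4, and the exceptional simplex.\<close>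

definition flat_tree :: "i3 list list list list" where
  "flat_tree =
    [[[[(0,0,0),(0,0,1),(0,3,0),(3,0,0)],[(0,0,0),(0,0,1),(0,1,1),(0,2,0),(1,0,1),(2,0,0)],[(0,0,0),
    (0,0,1),(1,-2,1),(1,0,0)],[(0,0,0),(0,0,1),(1,-2,1),(1,-1,1),(1,0,0)],[(0,0,0),(0,0,1),(1,-2,1),
    (1,0,0),(1,0,1)]],[[(0,0,0),(0,0,1),(0,1,0),(1,-2,1),(1,-1,1),(1,0,0)],[(0,0,0),(0,0,1),
    (1,-1,1),(1,0,0),(1,1,1)],[(0,0,0),(0,0,1),(0,1,1),(1,-1,1),(1,0,0),(1,1,1)],[(0,0,0),(0,0,1),
    (0,1,0),(1,-1,1),(1,0,0),(1,0,1)],[(0,0,0),(0,0,1),(0,1,0),(0,1,1),(1,-1,1),(1,0,0),(1,0,1)]],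
    [[(0,0,0),(0,0,1),(0,2,1),(1,0,0),(1,0,1),(1,2,1)],[(0,0,0),(0,0,1),(0,1,1),(1,0,0),(1,0,1),
    (1,1,0),(1,2,1)],[(0,0,0),(0,0,1),(0,1,0),(0,1,1),(1,0,0),(1,0,1),(1,1,0),(1,1,1)],[(0,0,0),
    (0,0,1),(1,-2,0),(2,0,0)],[(0,0,0),(0,0,1),(1,-1,0),(1,1,0),(2,0,0)]],[[(0,0,0),(0,0,1),(0,2,1),
    (2,0,0)],[(0,0,0),(0,0,1),(1,-1,0),(2,0,0),(2,1,0)],[(0,0,0),(0,0,1),(1,-1,0),(1,1,0),(2,0,0),
    (2,1,0)],[(0,0,0),(0,0,1),(1,2,0),(2,0,0),(2,1,0)],[(0,0,0),(0,0,1),(1,-1,0),(2,0,0),(2,2,0)]],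
    [[(0,0,0),(0,0,1),(0,1,1),(2,0,0),(2,2,0)],[(0,0,0),(0,0,1),(2,0,0),(2,3,0)],[(0,0,0),(0,0,1),
    (1,2,0),(2,0,0),(2,3,0)],[(0,0,0),(0,0,1),(2,0,0),(2,4,0)],[(0,0,0),(0,0,1),(0,1,0),(1,-1,0),
    (2,0,0),(2,1,0)]]],[[[(0,0,0),(0,0,1),(0,1,0),(1,2,0),(2,0,0),(2,2,0)],[(0,0,0),(0,0,1),(0,1,0),
    (2,0,0),(2,3,0)],[(0,0,0),(0,0,1),(0,2,0),(2,0,0),(2,2,0)],[(0,0,0),(0,0,1),(1,-1,0),(2,1,0)],
    [(0,0,0),(0,0,1),(0,1,0),(1,0,0),(1,2,0),(2,1,0),(2,2,0)]],[[(0,0,0),(0,0,1),(0,2,1),(1,0,0)],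
    [(0,0,0),(0,0,1),(0,1,1),(1,0,0),(1,1,0)],[(0,0,0),(0,0,1),(0,1,1),(1,0,0)],[(0,0,0),(0,0,1),
    (0,2,0),(2,0,0)]]]]"

text \<open>The unimodular maps to which the second entries of the certificates for
  \<open>half_enum\<close> refer.\<close>

definition half_maps :: "i12 list list list" where
  "half_maps =
    [[[(0,1,0,1,0,0,0,0,1,0,0,0),(-1,-1,0,0,1,0,0,0,1,2,0,0),(-1,-1,0,1,0,0,0,0,1,2,0,0),
    (1,0,0,0,1,0,0,0,1,0,0,0),(1,0,0,-1,-1,0,0,0,-1,0,2,1)],[(1,0,0,0,1,0,0,1,-1,0,0,0),
    (0,1,0,1,0,0,1,0,-1,0,0,0),(0,1,0,-1,-1,0,0,0,-1,0,2,1),(0,1,0,-1,-1,0,-1,-1,1,0,2,1),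
    (0,1,0,-1,-1,0,0,0,1,0,2,0)],[(-1,-1,0,0,1,0,0,1,-1,2,0,0),(-1,-1,0,1,0,0,1,0,-1,2,0,0),
    (1,0,0,-1,-1,0,-1,-1,1,0,2,1),(1,0,0,-1,-1,0,0,0,1,0,2,0),(1,0,0,0,0,1,0,-1,1,0,0,0)],
    [(0,1,0,0,0,1,-1,0,1,0,0,0),(-1,-1,0,0,0,1,0,-1,1,2,0,0),(-1,-1,0,0,0,1,-1,0,1,2,0,0),
    (1,0,0,-1,-1,1,0,0,1,0,1,-1),(0,1,0,-1,-1,1,0,0,1,0,1,-1)],[(-1,-1,0,1,1,-1,0,1,-1,2,0,0),
    (-1,-1,0,1,1,-1,1,0,-1,2,0,0),(0,1,0,1,0,0,1,1,-1,0,0,0),(-1,0,-1,0,0,1,0,1,0,2,0,0),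
    (0,-1,-1,0,0,1,1,0,0,2,0,0)]],[[(0,1,0,0,0,-1,1,1,-1,0,1,-1),(1,0,0,0,0,-1,1,1,-1,0,1,-1),
    (1,1,-1,0,0,1,1,0,0,0,0,0),(0,1,-1,-1,-1,1,-1,-1,0,1,1,2),(1,0,-1,-1,-1,1,-1,-1,0,1,1,2)],
    [(0,1,0,0,0,-1,-1,0,-1,0,1,1),(1,0,0,0,0,-1,0,-1,-1,0,1,1),(-1,-1,0,1,0,0,0,0,-1,2,0,1),
    (-1,-1,0,0,1,0,0,0,-1,2,0,1),(1,0,0,-1,0,-1,0,1,-1,0,2,0)],[(0,1,0,0,-1,-1,1,0,-1,0,2,0),
    (0,0,1,1,1,-1,0,1,0,0,0,0),(1,0,0,0,1,0,1,1,-1,0,0,0),(0,1,0,1,0,0,0,0,-1,0,0,0),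
    (1,0,0,-1,-1,0,0,0,-1,0,2,0)],[(-1,-1,0,0,1,0,0,0,-1,2,0,0),(1,0,0,0,1,0,0,2,-1,0,0,0),
    (0,1,0,1,0,0,2,0,-1,0,0,0),(1,0,0,-1,-1,0,-1,-1,-1,0,2,3),(0,0,1,-1,0,-1,0,1,0,0,2,0)],
    [(0,0,1,0,-1,-1,1,0,0,0,2,0),(1,0,0,0,1,-1,0,0,-1,0,1,1),(0,1,0,1,0,-1,0,0,-1,0,1,1),
    (1,1,-1,0,0,1,0,1,0,0,0,0),(0,0,1,1,1,-1,1,0,0,0,0,0)]],[[(-1,-1,1,0,1,-1,-1,-1,0,1,1,2),
    (-1,-1,1,1,0,-1,-1,-1,0,1,1,2),(1,0,0,0,1,-1,0,0,-1,0,0,0),(0,1,0,1,0,-1,0,0,-1,0,0,0),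
    (-1,-1,0,0,1,-1,0,0,-1,2,0,0)],[(-1,-1,0,1,0,-1,0,0,-1,2,0,0),(0,1,0,-1,-1,0,-1,-1,-1,0,2,2),
    (0,0,1,1,0,0,0,-1,0,0,0,0),(0,0,1,0,1,0,-1,0,0,0,0,0),(0,-1,1,0,1,0,-1,0,0,1,0,1)],
    [(0,0,1,-1,-1,0,0,-1,0,0,2,0),(-1,0,1,1,0,0,0,-1,0,1,0,1),(0,0,1,-1,-1,0,-1,0,0,0,2,0),
    (0,0,1,-1,-1,0,-1,0,0,0,2,1),(0,0,1,-1,-1,0,0,-1,0,0,2,1)],[(0,-1,1,0,1,0,1,1,0,1,0,-1),
    (-1,0,1,1,0,0,1,1,0,1,0,-1),(0,1,-1,1,0,0,1,1,0,1,0,-2),(1,0,-1,0,1,0,1,1,0,1,0,-2),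
    (-1,-1,0,0,1,0,0,2,-1,2,0,0)],[(-1,-1,0,1,0,0,2,0,-1,2,0,0),(0,1,0,-1,-1,0,-1,-1,-1,0,2,3),
    (1,0,0,0,1,0,0,0,-1,0,0,0),(0,1,0,-1,-1,0,0,0,-1,0,2,0),(-1,-1,0,1,0,0,0,0,-1,2,0,0)]],
    [[(0,0,1,1,0,0,0,-1,1,0,0,0),(-1,0,-1,1,0,0,0,-1,0,2,0,1),(0,0,1,0,1,0,-1,0,1,0,0,0),
    (0,-1,-1,0,1,0,-1,0,0,2,0,1),(0,1,0,-1,-1,-1,0,0,-1,0,2,0)],[(1,0,0,-1,-1,-1,0,0,-1,0,2,0),
    (0,1,-1,1,0,0,1,1,0,1,0,-1),(1,0,-1,0,1,0,1,1,0,1,0,-1),(-1,-1,1,0,1,0,0,0,1,1,0,-1),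
    (1,0,0,-1,-1,0,-1,-1,-1,0,2,2)],[(1,0,0,-1,0,-1,-1,-1,-1,0,2,2),(0,1,0,0,-1,-1,-1,-1,-1,0,2,2),
    (1,1,-1,-1,-1,0,0,-1,0,0,2,1),(1,1,-1,-1,-1,0,-1,0,0,0,2,1),(0,1,-1,1,0,0,0,0,-1,0,0,0)],
    [(1,0,-1,0,1,0,0,0,-1,0,0,0),(-1,0,-1,1,0,0,0,-1,0,2,0,0),(0,-1,-1,0,1,0,-1,0,0,2,0,0),
    (0,1,-1,1,0,0,0,0,1,1,0,-1),(-1,-1,-1,0,1,0,0,0,-1,2,0,0)],[(0,0,1,-1,-1,0,0,-1,1,0,2,0),
    (0,0,1,-1,-1,0,-1,0,1,0,2,0),(1,1,-1,-1,-1,0,0,-1,0,0,2,0),(1,1,-1,-1,-1,0,-1,0,0,0,2,0),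
    (-1,-1,1,1,0,0,1,1,0,1,0,-2)]],[[(-1,-1,1,0,1,0,1,1,0,1,0,-2),(1,0,0,0,1,0,0,0,1,0,0,1),
    (1,0,0,0,1,0,1,0,-1,0,0,0)]]]"

definition flat_maps :: "i12 list list list" where
  "flat_maps =
    [[[(1,0,0,0,0,1,0,1,0,0,0,0),(-1,-2,0,0,0,1,0,1,0,2,0,0),(0,1,0,0,0,1,1,0,0,0,0,0),
    (1,0,0,1,0,-1,0,1,0,0,0,0),(1,0,0,0,0,-1,0,1,0,0,0,0)],[(0,1,0,0,-1,1,-1,0,0,0,0,1),
    (-1,-2,0,0,-1,-1,0,1,0,2,1,0),(0,0,1,-1,0,0,0,-1,0,0,0,1),(0,1,0,0,0,1,-1,-1,0,0,0,1),
    (0,-1,0,-1,0,1,1,0,0,1,0,0)],[(0,0,1,-1,0,1,0,1,0,0,0,0),(0,1,0,0,-2,1,-1,0,0,0,0,1),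
    (0,1,0,0,0,1,-1,0,0,0,0,1),(1,0,0,0,0,1,0,-1,0,0,0,1),(0,0,1,1,0,0,0,1,0,0,0,0)],
    [(0,-1,0,1,1,0,0,0,-1,1,-1,1),(0,1,0,0,-1,1,-1,0,-1,0,0,1),(1,0,0,-1,0,1,0,-1,-1,0,0,1),
    (-1,0,0,1,1,1,0,-1,0,1,-1,1),(0,-1,0,1,1,-1,-1,0,0,1,-1,1)],[(1,0,0,-2,0,1,0,-1,0,0,0,1),
    (0,0,-1,1,2,0,0,-1,0,1,-2,1),(1,0,0,2,0,-1,0,1,0,0,0,0),(0,-2,-1,1,0,-1,0,1,0,2,0,0),
    (1,-1,-1,1,1,0,0,1,0,1,-1,0)]],[[(0,-1,0,2,2,1,-1,0,0,1,-2,1),(-1,-1,1,-1,-2,0,0,1,0,1,2,0),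
    (-1,-2,0,-1,-3,-1,0,1,0,2,3,0),(0,1,0,0,0,-1,-1,0,0,0,0,1),(0,-1,0,0,0,-1,1,0,0,1,0,0)],
    [(0,-1,0,0,0,-1,-1,0,0,1,0,1),(-1,0,0,0,0,1,0,-1,0,1,0,1),(0,-1,0,-1,0,0,0,0,-1,1,0,1),
    (0,0,-1,1,0,0,0,-1,0,1,0,1),(0,0,1,-1,0,0,0,1,0,0,0,0)],[(0,-1,-1,1,0,0,0,0,1,1,0,0),
    (1,0,0,0,1,-1,0,1,0,0,0,0),(-1,0,0,0,1,-1,0,1,0,1,0,0),(0,1,0,1,0,-1,1,0,0,0,0,0),
    (0,-1,0,1,0,-1,1,0,0,1,0,0)],[(1,0,0,-1,1,0,0,0,-1,0,0,1),(0,1,0,-1,0,-1,-1,0,0,0,1,1),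
    (0,1,0,1,-1,0,0,0,-1,0,0,1),(0,0,1,-1,0,-1,0,-1,0,0,1,1),(1,0,0,0,-1,-1,0,-1,0,0,1,1)],
    [(0,-1,0,-1,0,-1,-1,0,0,1,1,1),(-1,0,0,0,-1,-1,0,-1,0,1,1,1),(-1,0,0,0,-1,1,0,1,0,1,0,0),
    (1,0,0,-1,0,1,0,-1,0,0,0,1),(0,0,-1,1,1,0,0,-1,0,1,-1,1)]],[[(0,0,-1,-1,-1,0,0,-1,0,1,1,1),
    (0,0,1,-1,-1,0,0,-1,0,0,1,1),(0,0,1,-1,-1,0,0,1,0,0,1,0),(0,-1,0,1,1,1,-1,0,0,1,-1,1),
    (0,-1,0,-1,1,-1,1,0,0,1,0,0)],[(0,-1,0,-1,1,1,0,0,-1,1,-1,1),(-1,0,0,1,-1,1,0,0,-1,1,-1,1),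
    (0,-1,0,-1,-1,0,0,-1,1,1,1,1),(0,-1,1,1,1,0,0,1,0,1,-1,0),(0,-2,-1,1,0,0,0,1,0,2,0,0)],
    [(-1,-1,1,1,1,0,0,-1,0,1,-1,1),(-1,-1,1,0,1,1,0,1,0,1,-1,0),(-1,0,-1,2,1,1,-1,0,0,1,-2,1),
    (0,-1,0,1,2,1,0,-1,-1,1,-2,1),(1,1,-1,-2,0,1,1,0,0,0,0,0)],[(0,1,0,0,-2,1,1,1,-1,0,0,0),
    (-1,-1,1,1,0,-2,0,0,1,1,0,0),(-1,-1,1,1,2,0,0,-1,0,1,-2,1),(1,-1,-1,-1,-2,0,0,1,0,1,2,0),
    (-1,-1,1,1,2,0,0,1,0,1,-2,0)],[(-1,-2,0,-1,-2,-1,0,1,0,2,2,0),(0,-2,-1,-1,-2,-1,0,1,0,2,2,0)]]]"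

text \<open>One pair for each entry of \<open>half_enum 0 0\<close>, in the same order.\<close>

definition half_certs00 :: "(int \<times> int) list" where
  "half_certs00 =
    [(0,0),(1,1),(2,3),(0,1),(2,1),(3,1),(1,0),(2,0),(1,9),(-1,101),(-1,101),(4,0),(5,3),(6,3),
    (5,0),(6,0),(7,0),(2,9),(-1,101),(5,1),(4,1),(6,1),(5,9),(7,1),(6,9),(-1,101),(8,3),(8,1),
    (4,39),(9,1),(5,73),(5,38),(0,2),(2,2),(3,0),(2,13),(-1,101),(5,2),(5,13),(7,2),(4,2),(6,2),
    (6,13),(-1,101),(8,0),(9,0),(5,39),(8,2),(4,40),(5,72),(3,9),(-1,101),(9,9),(8,9),(5,74),(8,13),
    (5,40),(4,38),(-1,3),(-1,3),(3,39),(-1,3),(-1,3),(2,39),(3,38),(2,74),(0,39),(-1,3),(-1,3),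
    (2,73),(-1,3),(-1,3),(1,39),(2,38),(1,38),(3,40),(2,40),(0,40),(2,72),(1,40),(0,38),(10,3),
    (11,3),(12,3),(13,3),(10,1),(12,1),(11,1),(13,1),(8,89),(4,52),(4,54),(14,1),(15,1),(16,3),
    (16,1),(17,1),(18,3),(10,52),(19,3),(20,3),(18,1),(19,1),(10,54),(20,1),(-1,3),(-1,3),(21,3),
    (-1,3),(-1,3),(22,3),(21,1),(22,1),(23,1),(-1,3),(-1,3),(24,3),(-1,3),(-1,3),(25,3),(24,1),
    (25,1),(26,3),(26,1),(27,1),(28,1),(29,3),(29,1),(79,1),(29,10),(29,5),(28,5),(27,5),(26,10),
    (26,5),(30,1),(31,3),(31,1),(32,1),(33,1),(10,0),(11,0),(12,0),(13,0),(15,0),(16,0),(16,2),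
    (17,0),(18,0),(10,53),(19,0),(20,0),(10,2),(12,2),(11,2),(13,2),(8,90),(4,53),(4,55),(14,0),
    (18,2),(19,2),(10,55),(20,2),(-1,3),(-1,3),(21,0),(-1,3),(-1,3),(24,0),(-1,3),(-1,3),(22,0),
    (-1,3),(-1,3),(25,0),(21,2),(22,2),(23,0),(24,2),(25,2),(-1,3),(34,0),(-1,3),(35,3),(-1,3),
    (35,0),(-1,3),(36,0),(29,20),(37,3),(26,20),(38,3),(26,0),(28,0),(29,0),(26,2),(27,0),(29,2),
    (79,0),(29,11),(27,6),(26,11),(29,6),(28,6),(26,6),(29,21),(37,0),(26,21),(38,0),(39,0),(30,0),
    (31,0),(31,2),(32,0),(33,0),(15,9),(16,9),(16,13),(17,9),(10,9),(11,9),(12,9),(13,9),(18,9),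
    (10,79),(19,9),(20,9),(10,13),(12,13),(11,13),(13,13),(18,13),(19,13),(10,80),(20,13),(8,94),
    (4,79),(4,80),(14,9),(-1,3),(-1,3),(-1,3),(-1,3),(21,9),(24,9),(-1,3),(-1,3),(-1,3),(-1,3),
    (22,9),(25,9),(21,13),(24,13),(22,13),(25,13),(23,9),(-1,3),(-1,3),(34,1),(35,1),(-1,3),(-1,3),
    (35,9),(36,1),(29,34),(37,1),(26,34),(38,1),(-1,3),(-1,3),(-1,3),(-1,3),(34,2),(35,2),(35,13),
    (36,2),(-1,3),(29,35),(26,35),(37,2),(38,2),(28,9),(26,9),(29,9),(26,13),(29,13),(27,9),(79,9),
    (27,56),(29,84),(26,84),(29,56),(26,56),(28,56),(29,85),(26,85),(37,9),(38,9),(39,1),(29,86),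
    (26,86),(37,13),(38,13),(39,2),(30,9),(31,9),(31,13),(32,9),(33,9)]"

definition half_certs01 :: "(int \<times> int) list" where
  "half_certs01 =
    [(40,3),(41,3),(42,3),(43,3),(44,3),(45,3),(46,3),(47,3),(40,1),(42,1),(41,1),(43,1),(-1,5),
    (-1,5),(-1,5),(-1,5),(48,1),(49,3),(49,1),(50,1),(-1,5),(-1,5),(-1,5),(-1,5),(51,3),(52,3),
    (48,65),(49,10),(44,1),(46,1),(45,1),(47,1),(-1,5),(-1,5),(-1,5),(-1,5),(51,1),(48,59),(52,1),
    (49,5),(-1,5),(-1,5),(-1,5),(-1,5),(53,1),(51,10),(51,5),(48,5),(54,1),(55,3),(55,1),(56,1),
    (57,3),(40,52),(58,3),(59,3),(60,3),(44,52),(61,3),(62,3),(57,1),(58,1),(40,54),(59,1),(-1,3),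
    (-1,3),(62,10),(-1,3),(-1,3),(59,10),(62,5),(59,5),(56,5),(-1,3),(-1,3),(47,10),(-1,3),(-1,3),
    (43,10),(47,5),(43,5),(-1,3),(-1,3),(44,16),(-1,3),(-1,3),(40,16),(61,5),(58,5),(55,10),(-1,3),
    (-1,3),(45,10),(-1,3),(-1,3),(41,10),(46,5),(42,5),(60,1),(61,1),(44,54),(62,1),(-1,3),(-1,3),
    (61,10),(-1,3),(-1,3),(58,10),(44,14),(40,14),(55,5),(-1,3),(-1,3),(46,10),(-1,3),(-1,3),
    (42,10),(45,5),(41,5),(-1,3),(-1,3),(60,10),(-1,3),(-1,3),(57,10),(60,5),(57,5),(54,5),(-1,3),
    (-1,3),(44,10),(-1,3),(-1,3),(40,10),(44,5),(40,5),(25,10),(24,10),(25,5),(-1,5),(-1,5),(24,5),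
    (-1,5),(-1,5),(23,5),(22,10),(21,10),(22,5),(-1,5),(20,10),(20,5),(17,5),(14,5),(13,10),(13,5),
    (-1,5),(10,16),(19,5),(16,10),(4,16),(11,10),(12,5),(21,5),(-1,5),(19,10),(10,14),(16,5),(4,14),
    (12,10),(11,5),(-1,5),(18,10),(18,5),(15,5),(8,75),(10,10),(10,5),(63,1),(64,3),(64,1),(65,1),
    (66,3),(67,3),(68,3),(64,69),(66,1),(68,1),(67,1),(64,41),(69,1),(66,69),(66,41),(63,41),
    (32,41),(31,69),(31,41),(30,41),(59,25),(43,25),(70,3),(71,3),(58,25),(42,25),(72,3),(70,65),
    (62,25),(47,25),(73,3),(74,3),(61,25),(46,25),(75,3),(73,65),(-1,3),(73,87),(-1,3),(70,87),
    (-1,3),(74,4),(-1,3),(71,4),(-1,3),(46,16),(-1,3),(42,16),(-1,3),(47,16),(-1,3),(43,16),(-1,3),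
    (75,4),(-1,3),(72,4),(-1,3),(73,4),(-1,3),(70,4),(-1,3),(61,16),(-1,3),(58,16),(-1,3),(62,16),
    (-1,3),(59,16),(20,20),(76,3),(13,20),(77,3),(5,16),(12,16),(6,16),(13,16),(19,20),(78,3),
    (12,20),(76,22),(9,95),(19,16),(5,20),(20,16),(22,36),(35,36),(25,36),(36,36),(2,60),(24,48),
    (1,60),(25,48),(21,36),(34,36),(24,36),(35,48),(3,60),(21,48),(2,97),(22,48),(38,22),(26,16),
    (37,22),(29,16),(59,30),(43,30),(70,1),(71,1),(62,30),(47,30),(73,1),(74,1),(58,30),(42,30),
    (72,1),(70,59),(61,30),(46,30),(75,1),(73,59),(-1,3),(-1,3),(73,76),(70,76),(-1,3),(-1,3),
    (74,32),(71,32),(-1,3),(-1,3),(75,32),(72,32),(-1,3),(-1,3),(73,32),(70,32),(-1,3),(-1,3),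
    (46,14),(42,14),(-1,3),(-1,3),(47,14),(43,14),(-1,3),(-1,3),(61,14),(58,14),(-1,3),(-1,3),
    (62,14),(59,14),(20,34),(76,1),(13,34),(77,1),(19,34),(78,1),(12,34),(76,23),(5,14),(12,14),
    (6,14),(13,14),(9,75),(19,14),(5,34),(20,14),(36,4),(35,4),(35,32),(34,4),(-1,3),(-1,3),(-1,3),
    (-1,3),(22,44),(25,44),(35,44),(36,23),(21,44),(24,44),(34,23),(35,23),(2,57),(1,57),(24,23),
    (25,23),(3,57),(2,91),(21,23),(22,23),(38,23),(37,23),(26,14),(29,14)]"

definition half_certs10 :: "(int \<times> int) list" where
  "half_certs10 =
    [(40,0),(41,0),(42,0),(43,0),(44,0),(45,0),(46,0),(47,0),(54,0),(55,0),(55,2),(56,0),(57,0),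
    (40,53),(58,0),(59,0),(60,0),(44,53),(61,0),(62,0),(40,2),(42,2),(41,2),(43,2),(-1,102),
    (-1,102),(48,0),(49,0),(-1,102),(-1,102),(49,2),(50,0),(-1,102),(-1,102),(51,0),(52,0),(-1,102),
    (-1,102),(48,66),(49,11),(57,2),(58,2),(40,55),(59,2),(-1,3),(-1,3),(62,11),(-1,3),(-1,3),
    (47,11),(-1,3),(-1,3),(59,11),(-1,3),(-1,3),(43,11),(62,6),(59,6),(56,6),(47,6),(43,6),(-1,3),
    (-1,3),(44,17),(-1,3),(-1,3),(45,11),(-1,3),(-1,3),(40,17),(-1,3),(-1,3),(41,11),(61,6),(58,6),
    (55,11),(46,6),(42,6),(44,2),(46,2),(45,2),(47,2),(-1,102),(-1,102),(51,2),(48,61),(-1,102),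
    (-1,102),(52,2),(49,6),(-1,102),(-1,102),(53,0),(51,11),(-1,102),(-1,102),(51,6),(48,6),(60,2),
    (61,2),(44,55),(62,2),(-1,3),(-1,3),(61,11),(-1,3),(-1,3),(46,11),(-1,3),(-1,3),(58,11),(-1,3),
    (-1,3),(42,11),(44,15),(40,15),(55,6),(45,6),(41,6),(-1,3),(-1,3),(60,11),(-1,3),(-1,3),(44,11),
    (-1,3),(-1,3),(57,11),(-1,3),(-1,3),(40,11),(60,6),(57,6),(54,6),(44,6),(40,6),(59,26),(70,0),
    (43,26),(71,0),(58,26),(72,0),(42,26),(70,66),(-1,3),(73,88),(-1,3),(74,7),(-1,3),(70,88),
    (-1,3),(71,7),(-1,3),(46,17),(-1,3),(47,17),(-1,3),(42,17),(-1,3),(43,17),(62,26),(73,0),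
    (47,26),(74,0),(61,26),(75,0),(46,26),(73,66),(-1,3),(75,7),(-1,3),(73,7),(-1,3),(72,7),(-1,3),
    (70,7),(-1,3),(61,17),(-1,3),(62,17),(-1,3),(58,17),(-1,3),(59,17),(22,49),(35,49),(25,49),
    (36,27),(2,62),(24,27),(1,62),(25,27),(21,49),(34,27),(24,49),(35,27),(3,62),(21,27),(2,98),
    (22,27),(25,11),(24,11),(23,6),(22,11),(21,11),(25,6),(-1,102),(-1,102),(22,6),(-1,102),(20,11),
    (14,6),(13,11),(20,6),(17,6),(13,6),(-1,102),(10,17),(4,17),(11,11),(19,6),(16,11),(12,6),
    (24,6),(-1,102),(-1,102),(21,6),(-1,102),(19,11),(4,15),(12,11),(10,15),(16,6),(11,6),(-1,102),
    (18,11),(8,77),(10,11),(18,6),(15,6),(10,6),(20,21),(76,0),(13,21),(77,0),(5,17),(12,17),(6,17),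
    (13,17),(19,21),(78,0),(12,21),(76,27),(9,96),(19,17),(5,21),(20,17),(38,27),(26,17),(37,27),
    (29,17),(63,0),(64,0),(64,2),(65,0),(66,0),(67,0),(68,0),(64,70),(66,2),(68,2),(67,2),(64,42),
    (69,0),(66,70),(66,42),(63,42),(32,42),(31,70),(31,42),(30,42),(59,31),(43,31),(70,2),(71,2),
    (62,31),(47,31),(73,2),(74,2),(-1,3),(-1,3),(-1,3),(-1,3),(73,78),(70,78),(74,33),(71,33),
    (-1,3),(-1,3),(-1,3),(-1,3),(75,33),(72,33),(73,33),(70,33),(58,31),(42,31),(72,2),(70,61),
    (61,31),(46,31),(75,2),(73,61),(-1,3),(-1,3),(-1,3),(-1,3),(46,15),(42,15),(47,15),(43,15),
    (-1,3),(-1,3),(-1,3),(-1,3),(61,15),(58,15),(62,15),(59,15),(36,7),(35,7),(-1,3),(-1,3),(35,33),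
    (34,7),(-1,3),(-1,3),(20,35),(13,35),(76,2),(77,2),(19,35),(12,35),(78,2),(76,24),(5,15),(6,15),
    (12,15),(13,15),(9,77),(5,35),(19,15),(20,15),(22,45),(25,45),(35,45),(36,24),(21,45),(24,45),
    (34,24),(35,24),(2,58),(1,58),(24,24),(25,24),(3,58),(2,92),(21,24),(22,24),(38,24),(37,24),
    (26,15),(29,15)]"

definition half_certs11 :: "(int \<times> int) list" where
  "half_certs11 =
    [(54,8),(55,8),(55,12),(56,8),(40,8),(41,8),(42,8),(43,8),(57,8),(40,25),(58,8),(59,8),(44,8),
    (45,8),(46,8),(47,8),(60,8),(44,25),(61,8),(62,8),(40,12),(42,12),(41,12),(43,12),(57,12),
    (58,12),(40,26),(59,12),(-1,3),(48,8),(-1,3),(49,8),(-1,3),(49,12),(-1,3),(50,4),(-1,3),(-1,37),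
    (-1,3),(-1,37),(62,4),(47,4),(-1,3),(-1,37),(-1,3),(-1,37),(59,4),(43,4),(62,7),(47,7),(59,7),
    (43,7),(56,4),(-1,3),(51,8),(-1,3),(52,4),(-1,3),(48,63),(-1,3),(49,4),(-1,3),(-1,37),(-1,3),
    (-1,37),(44,18),(45,4),(-1,3),(-1,37),(-1,3),(-1,37),(40,18),(41,4),(61,7),(46,7),(58,7),(42,7),
    (55,4),(44,12),(46,12),(45,12),(47,12),(60,12),(61,12),(44,26),(62,12),(-1,3),(51,12),(-1,3),
    (48,64),(-1,3),(52,7),(-1,3),(49,7),(-1,3),(-1,37),(-1,3),(-1,37),(61,4),(46,4),(-1,3),(-1,37),
    (-1,3),(-1,37),(58,4),(42,4),(44,19),(45,7),(40,19),(41,7),(55,7),(-1,3),(53,4),(-1,3),(51,4),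
    (-1,3),(51,7),(-1,3),(48,4),(-1,3),(-1,37),(-1,3),(-1,37),(60,4),(44,4),(-1,3),(-1,37),(-1,3),
    (-1,37),(57,4),(40,4),(60,7),(44,7),(57,7),(40,7),(54,4),(59,20),(70,8),(43,20),(71,8),(-1,37),
    (-1,37),(73,81),(74,22),(-1,37),(-1,37),(70,81),(71,22),(58,20),(72,8),(42,20),(70,63),(-1,37),
    (-1,37),(46,18),(47,18),(-1,37),(-1,37),(42,18),(43,18),(62,20),(73,8),(47,20),(74,8),(-1,37),
    (-1,37),(75,22),(73,22),(-1,37),(-1,37),(72,22),(70,22),(61,20),(75,8),(46,20),(73,63),(-1,37),
    (-1,37),(61,18),(62,18),(-1,37),(-1,37),(58,18),(59,18),(22,50),(35,50),(25,50),(36,28),(2,99),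
    (24,28),(1,67),(25,28),(21,50),(34,28),(24,50),(35,28),(3,67),(21,28),(2,67),(22,28),(59,21),
    (70,12),(43,21),(71,12),(-1,37),(-1,37),(-1,37),(-1,37),(73,82),(74,37),(70,82),(71,37),(62,21),
    (73,12),(47,21),(74,12),(-1,37),(-1,37),(-1,37),(-1,37),(75,37),(73,37),(72,37),(70,37),(58,21),
    (72,12),(42,21),(70,64),(-1,37),(-1,37),(-1,37),(-1,37),(46,19),(47,19),(42,19),(43,19),(61,21),
    (75,12),(46,21),(73,64),(-1,37),(-1,37),(-1,37),(-1,37),(61,19),(62,19),(58,19),(59,19),(36,22),
    (-1,37),(35,22),(-1,37),(35,37),(-1,37),(34,22),(-1,37),(22,51),(25,51),(35,51),(36,29),(21,51),
    (24,51),(34,29),(35,29),(2,100),(1,68),(24,29),(25,29),(3,68),(2,68),(21,29),(22,29),(23,4),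
    (25,4),(22,4),(24,4),(21,4),(25,7),(22,7),(-1,3),(-1,3),(14,4),(20,4),(13,4),(20,7),(13,7),
    (17,4),(-1,3),(-1,3),(4,18),(10,18),(11,4),(19,7),(12,7),(16,4),(24,7),(21,7),(-1,3),(-1,3),
    (4,19),(19,4),(12,4),(10,19),(11,7),(16,7),(-1,3),(-1,3),(8,83),(18,4),(10,4),(18,7),(10,7),
    (15,4),(20,46),(13,46),(76,8),(77,8),(5,18),(6,18),(12,18),(13,18),(19,46),(12,46),(78,8),
    (76,28),(9,93),(5,46),(19,18),(20,18),(38,28),(26,18),(37,28),(29,18),(20,47),(13,47),(76,12),
    (77,12),(19,47),(12,47),(78,12),(76,29),(5,19),(6,19),(12,19),(13,19),(9,83),(5,47),(19,19),
    (20,19),(38,29),(37,29),(26,19),(29,19),(63,8),(64,8),(64,12),(65,8),(66,8),(67,8),(68,8),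
    (64,43),(66,12),(68,12),(67,12),(64,71),(69,8),(66,43),(66,71),(63,43),(32,43),(31,43),(31,71),
    (30,43)]"

definition square_certs :: "(int \<times> int) list" where
  "square_certs =
    [(2,0),(3,0),(4,0),(3,25),(5,0),(4,25),(6,0),(3,16),(5,62),(7,0),(3,17),(5,63),(7,2),(8,0),
    (5,16),(9,0),(5,17),(9,2),(6,18),(7,53),(7,18),(4,4),(7,36),(4,28),(7,37),(10,0),(7,38),(5,54),
    (9,15),(11,0),(4,29),(7,39),(10,2),(5,19),(9,40),(7,41),(11,12),(9,42),(9,43),(12,0),(7,44),
    (11,13),(4,30),(7,45),(10,12),(7,46),(11,31),(10,13),(3,4),(5,64),(6,5),(7,47),(5,65),(8,5),
    (9,9),(6,9),(7,9),(3,19),(5,55),(7,5),(5,56),(9,5),(7,48),(2,4),(3,11),(4,11),(3,20),(5,11),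
    (4,20)]"

definition triangle_certs :: "(int \<times> int) list" where
  "triangle_certs =
    [(13,0),(14,0),(13,4),(6,57),(6,15),(15,0),(16,0),(17,0),(18,0),(4,21),(7,49),(19,0),(19,3),
    (20,0),(21,0),(22,0),(23,0),(16,1),(17,1),(18,1),(4,32),(7,50),(24,0),(24,6),(10,33),(19,23),
    (25,0),(26,0),(19,1),(19,70),(20,1),(19,71),(25,1),(27,0),(21,1),(22,1),(26,1),(23,1),(28,0),
    (16,58),(16,24),(28,3),(3,21),(5,66),(2,7),(3,7),(18,3),(17,3),(16,3),(7,60),(4,67),(18,68),
    (24,24),(13,69),(18,26),(22,22),(21,22),(18,6),(17,6),(16,6),(7,51),(4,7),(17,23),(29,0),
    (14,10),(17,10),(25,26),(19,61),(18,59),(24,52),(13,34),(18,14),(25,14),(19,10),(22,27),(21,27)]"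

definition prism_certs :: "(int \<times> int) list" where
  "prism_certs =
    [(32,0),(30,0),(32,2),(31,0),(30,2),(32,8),(31,8),(31,35),(30,8)]"

definition simplex_certs :: "(int \<times> int) list" where
  "simplex_certs =
    [(0,0),(1,0),(33,0)]"

definition look :: "'a list list list \<Rightarrow> int \<Rightarrow> 'a" where
  "look t i = t ! nat (i div 25) ! nat (i div 5 mod 5) ! nat (i mod 5)"

text \<open>Rounds up, in contrast to \<open>div\<close>: the lowest lattice height on or above the
  midpoint of an edge with height sum \<open>a\<close>.\<close>

definition cd2 :: "int \<Rightarrow> int" where
  "cd2 a = (a + 1) div 2"

text \<open>Three columns whose base points sum to \<open>(2, 2)\<close> bound three times the
  height of the lower hull over the barycentre of \<open>2 Delta_2\<close>; the five sums are all
  such triples of corners and edge midpoints. If \<open>t\<close> exceeds one of them by 2, then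
  \<open>(1, 1, t / 2)\<close> satisfies all upward normals for the dilation 3/2. For the three
  corners an excess of 1 suffices when their heights are not congruent mod 2, because the only
  obstructing normal is then not integral.\<close>

definition low2 :: "int \<Rightarrow> int \<Rightarrow> int \<Rightarrow> int \<Rightarrow> int \<Rightarrow> int \<Rightarrow> int" where
  "low2 A B C D E F = min (A + B + C + 2 - (if even (B - A) \<and> even (C - A) then 0 else 1))
     (min (2 * D + C + 2) (min (2 * E + B + 2) (min (2 * F + A + 2) (D + E + F + 2))))"

text \<open>All six columns lie over the boundary of \<open>2 Delta_2\<close>. So the ends of the
  corner columns are vertices, and a midpoint column contributes a vertex exactly where it sticks
  out of the trapezoid over its edge.\<close>

definition half_verts :: "i12 \<Rightarrow> i3 list" where
  "half_verts = (\<lambda>(lA, uA, lB, uB, lC, uC, lD, uD, lE, uE, lF, uF).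
     [(0, 0, lA), (0, 0, uA), (2, 0, lB), (2, 0, uB), (0, 2, lC), (0, 2, uC)] @
     (if 2 * lD < lA + lB then [(1, 0, lD)] else []) @ (if 2 * uD > uA + uB then [(1, 0, uD)] else []) @
     (if 2 * lE < lA + lC then [(0, 1, lE)] else []) @ (if 2 * uE > uA + uC then [(0, 1, uE)] else []) @
     (if 2 * lF < lB + lC then [(1, 1, lF)] else []) @ (if 2 * uF > uB + uC then [(1, 1, uF)] else []))"

text \<open>With \<open>U\<close> the negated upper counterpart of \<open>L\<close>, upper sums
  minus 2 are at most \<open>U\<close>, which is at most \<open>L\<close>, which is at most lower
  sums plus 2. Comparing single terms gives the ranges, and 4 is the sum of the two slacks. The
  singleton range just names \<open>L\<close>.\<close>

definition half_enum :: "int \<Rightarrow> int \<Rightarrow> i12 list" where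
  "half_enum lB lC = [(0, uA, lB, uB, lC, uC, lD, uD, lE, uE, lF, uF).
     uA \<leftarrow> [0..4], uB \<leftarrow> [lB..lB + 4 - uA], uC \<leftarrow> [lC..lC + 4 - uA - (uB - lB)],
     lD \<leftarrow> [cd2 (uA + uB + uC - lC - 4)..cd2 lB],
     lE \<leftarrow> [cd2 (uA + uC + uB - lB - 4)..cd2 lC],
     lF \<leftarrow> [cd2 (uB + uC + uA - 4)..cd2 (lB + lC)],
     L \<leftarrow> [low2 0 lB lC lD lE lF],
     uD \<leftarrow> [(uA + uB) div 2..(4 + lB - uC + lC) div 2],
     uE \<leftarrow> [(uA + uC) div 2..(4 + lC - uB + lB) div 2],
     uF \<leftarrow> [(uB + uC) div 2..(4 + lB + lC - uA) div 2],
     - low2 (- uA) (- uB) (- uC) (- uD) (- uE) (- uF) \<le> L]"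

definition half_check :: "i12 \<Rightarrow> int \<times> int \<Rightarrow> bool" where
  "half_check c k = (case k of (i, j) \<Rightarrow>
     let g = look half_maps j; V = map (amap g) (half_verts c) in
     amap_det g \<in> {1, -1} \<and>
     (if i < 0 then list_all (\<lambda>(x, y, z). 0 \<le> z \<and> z \<le> 1) V
      else i < 80 \<and> set V = set (look half_tree i)))"

definition flat_check :: "i3 list \<Rightarrow> int \<times> int \<Rightarrow> bool" where
  "flat_check W k = (case k of (i, j) \<Rightarrow>
     let g = look flat_maps j in
     amap_det g \<in> {1, -1} \<and> 0 \<le> i \<and> i < 34 \<and> set (map (amap g) W) = set (look flat_tree i))"

definition square_verts :: "int \<times> int \<times> int \<times> int \<times> int \<Rightarrow> i3 list" where
  "square_verts = (\<lambda>(e, a, b, c, d).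
     [(0, 0, 0), (0, 0, a), (1, 0, 0), (1, 0, b), (0, 1, 0), (0, 1, c), (1, 1, e), (1, 1, d)])"

text \<open>Three lower ends have been sheared to 0. The filter leaves exactly one integer strictly
  between the lowest and the highest diagonal sum.\<close>

definition square_enum :: "(int \<times> int \<times> int \<times> int \<times> int) list" where
  "square_enum = [(e, a, b, c, d). e \<leftarrow> [-2..2], a \<leftarrow> [0..2], b \<leftarrow> [0..2], c \<leftarrow> [0..2],
     d \<leftarrow> [e..e + 4], max (a + d) (b + c) - min 0 e = 2]"

definition triangle_verts :: "int \<times> int \<times> int \<times> int \<times> int \<times> int \<Rightarrow> i3 list" where
  "triangle_verts = (\<lambda>(l2, u0, u2, uT, l1, u1).
     [(0, 0, 0), (0, 0, u0), (2, 0, l2), (2, 0, u2), (0, 1, 0), (0, 1, uT)] @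
     (if 2 * l1 < l2 then [(1, 0, l1)] else []) @ (if 2 * u1 > u0 + u2 then [(1, 0, u1)] else []))"

text \<open>\<open>h\<close> is the first integer above the lower end of the middle line of the
  Minkowski sum. That end is half-integral, hence the doubling; the filter says that
  \<open>h\<close> is inside and \<open>h + 1\<close> is not.\<close>

definition triangle_enum :: "(int \<times> int \<times> int \<times> int \<times> int \<times> int) list" where
  "triangle_enum = [(l2, u0, u2, uT, l1, u1).
     l2 \<leftarrow> [0..1], u0 \<leftarrow> [0..l2 + 4], u2 \<leftarrow> [l2..l2 + 4 - u0], uT \<leftarrow> [0..2],
     l1 \<leftarrow> [cd2 (u0 + u2 + 2 * uT - 4)..cd2 l2], u1 \<leftarrow> [(u0 + u2) div 2..(l2 + 4 - 2 * uT) div 2],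
     h \<leftarrow> [min (2 * l1) l2 div 2 + 1],
     2 * h < max (2 * u1) (u0 + u2) + 2 * uT \<and> \<not> 2 * (h + 1) < max (2 * u1) (u0 + u2) + 2 * uT]"

definition prism_verts :: "int \<times> int \<times> int \<Rightarrow> i3 list" where
  "prism_verts = (\<lambda>(a, b, c). [(0, 0, 0), (0, 0, a), (1, 0, 0), (1, 0, b), (0, 1, 0), (0, 1, c)])"

definition prism_enum :: "(int \<times> int \<times> int) list" where
  "prism_enum = [(a, b, c). a \<leftarrow> [0..2], b \<leftarrow> [0..2 - a], c \<leftarrow> [0..2 - a - b], 0 < a + b + c]"

text \<open>Two layers \<open>c0 Delta_2\<close> and \<open>c1 Delta_2\<close>, for
  \<open>(c0, c1)\<close> equal to \<open>(3, 0)\<close>, \<open>(2, 1)\<close> and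
  \<open>(2, 0)\<close>.\<close>

definition simplex_enum :: "i3 list list" where
  "simplex_enum = [[(0, 0, 0), (3, 0, 0), (0, 0, 3), (0, 1, 0)],
     [(0, 0, 0), (2, 0, 0), (0, 0, 2), (0, 1, 0), (1, 1, 0), (0, 1, 1)],
     [(0, 0, 0), (2, 0, 0), (0, 0, 2), (0, 1, 0)]]"

lemma square_checks: "list_all2 flat_check (map square_verts square_enum) square_certs"
  by code_simp

lemma triangle_checks: "list_all2 flat_check (map triangle_verts triangle_enum) triangle_certs"
  by code_simp

lemma prism_checks: "list_all2 flat_check (map prism_verts prism_enum) prism_certs"
  by code_simp

lemma simplex_checks: "list_all2 flat_check simplex_enum simplex_certs"
  by code_simp

section \<open>Classification of the point configurations\<close>

subsection \<open>Columns of finite point sets\<close>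

definition all_reps :: "i3 list list" where
  "all_reps = concat (concat half_tree) @ concat (concat flat_tree)"

definition good :: "i3 set \<Rightarrow> bool" where
  "good V \<longleftrightarrow> (\<exists>R\<in>set all_reps. unimodular_equiv (hullZ V) (hullZ (set R)))"

lemma good_amap:
  assumes "amap_det g \<in> {1, -1}" "good (amap g ` V)" shows "good V"
  using assms(2) unimodular_equiv_trans[OF hullZ_amap[OF assms(1)]] unfolding good_def by blast

lemma good_hull: "hullZ V = hullZ W \<Longrightarrow> good W \<Longrightarrow> good V"
  by (simp add: good_def)

lemma look_mem:
  assumes "nat (i div 25) < length t" "nat (i div 5 mod 5) < length (t ! nat (i div 25))"
    "nat (i mod 5) < length (t ! nat (i div 25) ! nat (i div 5 mod 5))"
  shows "look t i \<in> set (concat (concat t))"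
  unfolding look_def set_concat image_Union using assms by (auto intro!: nth_mem)

lemma look_half: "0 \<le> i \<Longrightarrow> i < 80 \<Longrightarrow> look half_tree i \<in> set all_reps"
proof -
  have "list_all (\<lambda>i. nat (i div 25) < length half_tree \<and> nat (i div 5 mod 5) < length (half_tree ! nat (i div 25)) \<and>
    nat (i mod 5) < length (half_tree ! nat (i div 25) ! nat (i div 5 mod 5))) [0..79]"
    by code_simp
  moreover assume "0 \<le> i" "i < 80"
  then have "i \<in> set [0..79]" by (simp only: set_upto atLeastAtMost_iff) simp
  ultimately have "look half_tree i \<in> set (concat (concat half_tree))"
    unfolding list_all_iff by (blast intro: look_mem)
  then show "look half_tree i \<in> set all_reps" unfolding all_reps_def set_append by blast
qed

lemma look_flat: "0 \<le> i \<Longrightarrow> i < 34 \<Longrightarrow> look flat_tree i \<in> set all_reps"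
proof -
  have "list_all (\<lambda>i. nat (i div 25) < length flat_tree \<and> nat (i div 5 mod 5) < length (flat_tree ! nat (i div 25)) \<and>
    nat (i mod 5) < length (flat_tree ! nat (i div 25) ! nat (i div 5 mod 5))) [0..33]"
    by code_simp
  moreover assume "0 \<le> i" "i < 34"
  then have "i \<in> set [0..33]" by (simp only: set_upto atLeastAtMost_iff) simp
  ultimately have "look flat_tree i \<in> set (concat (concat flat_tree))"
    unfolding list_all_iff by (blast intro: look_mem)
  then show "look flat_tree i \<in> set all_reps" unfolding all_reps_def set_append by blast
qed

lemma flat_check_good:
  assumes "flat_check W k" shows "good (set W)"
proof -
  obtain i j where k: "k = (i, j)" by (cases k)
  define g where "g = look flat_maps j"
  have c: "amap_det g \<in> {1, -1}" "0 \<le> i" "i < 34" "amap g ` set W = set (look flat_tree i)"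
    using assms unfolding flat_check_def k g_def Let_def prod.case set_map by blast+
  have "good (amap g ` set W)"
    unfolding good_def using look_flat[OF c(2,3)] unimodular_equiv_refl c(4) by metis
  then show ?thesis by (rule good_amap[OF c(1)])
qed

lemma list_all2_good:
  assumes "list_all2 flat_check Ws ks" "W \<in> set Ws" shows "good (set W)"
proof -
  obtain n where n: "n < length Ws" "W = Ws ! n" using assms(2) by (auto simp: in_set_conv_nth)
  show ?thesis unfolding n(2) by (rule flat_check_good[OF list_all2_nthD[OF assms(1) n(1)]])
qed

lemma hullZ_eqI:
  assumes "W \<subseteq> V" "\<And>v. v \<in> V \<Longrightarrow> pt v \<in> hullZ W" shows "hullZ V = hullZ W"
proof
  show "hullZ V \<subseteq> hullZ W"
    unfolding hullZ_def[of V] by (rule hull_minimal) (use assms(2) in \<open>auto simp: hullZ_def\<close>)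
  show "hullZ W \<subseteq> hullZ V" unfolding hullZ_def by (rule hull_mono) (use assms(1) in auto)
qed

lemma convex_hullZ: "convex (hullZ V)" by (simp add: hullZ_def)

lemma column_convex:
  fixes S :: "r3 set"
  assumes "convex S" "(x, y, a) \<in> S" "(x, y, b) \<in> S" "a \<le> z" "z \<le> b"
  shows "(x, y, z) \<in> S"
proof (cases "a = b")
  case True then show ?thesis using assms by simp
next
  case False
  then have ab: "b - a > 0" using assms by simp
  define t where "t = (z - a) / (b - a)"
  have t: "0 \<le> t" "t \<le> 1" "t * (b - a) = z - a" using assms(4,5) ab by (simp_all add: t_def)
  have "(1 - t) *\<^sub>R (x, y, a) + t *\<^sub>R (x, y, b) \<in> S"
    by (rule convexD_alt[OF assms(1-3) t(1,2)])
  moreover have "(1 - t) *\<^sub>R (x, y, a) + t *\<^sub>R (x, y, b) = (x, y, z)"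
    using t(3) by (simp add: algebra_simps)
  ultimately show ?thesis by simp
qed

lemma pt_column:
  assumes "convex S" "pt (x, y, a) \<in> S" "pt (x, y, b) \<in> S" "a \<le> z" "z \<le> b"
  shows "pt (x, y, z) \<in> S"
  using column_convex[of S "of_int x" "of_int y" "of_int a" "of_int b" "of_int z"] assms by simp

text \<open>Over the midpoint of an edge, \<open>S\<close> contains the averages of the two end
  columns; \<open>l\<close> and \<open>u\<close> either lie within those averages or are points of
  \<open>S\<close> themselves.\<close>

lemma pt_mid_column:
  assumes S: "convex S" "pt (xa, ya, la) \<in> S" "pt (xb, yb, lb) \<in> S" "pt (xa, ya, ua) \<in> S" "pt (xb, yb, ub) \<in> S"
    and m: "xa + xb = 2 * x" "ya + yb = 2 * y"
    and l: "2 * l < la + lb \<Longrightarrow> pt (x, y, l) \<in> S" and u: "ua + ub < 2 * u \<Longrightarrow> pt (x, y, u) \<in> S"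
    and z: "l \<le> z" "z \<le> u"
  shows "pt (x, y, z) \<in> S"
proof -
  have mid: "(of_int x, of_int y, of_int (a + b) / 2) \<in> S"
    if "pt (xa, ya, a) \<in> S" "pt (xb, yb, b) \<in> S" for a b
  proof -
    have "(1 / 2) *\<^sub>R pt (xa, ya, a) + (1 / 2) *\<^sub>R pt (xb, yb, b) \<in> S"
      by (rule convexD[OF S(1) that]) auto
    moreover have "real_of_int xa + of_int xb = 2 * of_int x" "real_of_int ya + of_int yb = 2 * of_int y"
      using m by (metis of_int_add of_int_mult of_int_numeral)+
    then have "(1 / 2) *\<^sub>R pt (xa, ya, a) + (1 / 2) *\<^sub>R pt (xb, yb, b) = (of_int x, of_int y, of_int (a + b) / 2)"
      by simp
    ultimately show ?thesis by (simp add: add_divide_distrib)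
  qed
  have "\<exists>t. (of_int x, of_int y, t) \<in> S \<and> t \<le> of_int z"
  proof (cases "2 * l < la + lb")
    case True then show ?thesis using l z(1) by (intro exI[of _ "of_int l"]) simp
  next
    case False
    then have "la + lb \<le> 2 * z" using z by simp
    then have "real_of_int (la + lb) \<le> 2 * of_int z" by (metis of_int_le_iff of_int_mult of_int_numeral)
    then show ?thesis using mid[OF S(2,3)] by (intro exI[of _ "of_int (la + lb) / 2"]) simp
  qed
  moreover have "\<exists>t. (of_int x, of_int y, t) \<in> S \<and> of_int z \<le> t"
  proof (cases "ua + ub < 2 * u")
    case True then show ?thesis using u z(2) by (intro exI[of _ "of_int u"]) simp
  next
    case False
    then have "2 * z \<le> ua + ub" using z by simp
    then have "2 * of_int z \<le> real_of_int (ua + ub)" by (metis of_int_le_iff of_int_mult of_int_numeral)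
    then show ?thesis using mid[OF S(4,5)] by (intro exI[of _ "of_int (ua + ub) / 2"]) simp
  qed
  ultimately obtain t t' where t: "(of_int x, of_int y, t) \<in> S" "(of_int x, of_int y, t') \<in> S"
    "t \<le> of_int z" "of_int z \<le> t'" by blast
  have "(of_int x, of_int y, of_int z) \<in> S" by (rule column_convex[OF S(1) t])
  then show ?thesis by simp
qed

definition ends :: "i3 set \<Rightarrow> int \<Rightarrow> int \<Rightarrow> int \<Rightarrow> int \<Rightarrow> bool" where
  "ends V x y l u \<longleftrightarrow> (x, y, l) \<in> V \<and> (x, y, u) \<in> V \<and> (\<forall>z. (x, y, z) \<in> V \<longrightarrow> l \<le> z \<and> z \<le> u)"

lemma endsD:
  assumes "ends V x y l u"
  shows "(x, y, l) \<in> V" "(x, y, u) \<in> V" "(x, y, z) \<in> V \<Longrightarrow> l \<le> z" "(x, y, z) \<in> V \<Longrightarrow> z \<le> u" "l \<le> u"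
  using assms unfolding ends_def by blast+

lemma ends_ex:
  assumes "finite V" "(x, y, z) \<in> V"
  obtains l u where "ends V x y l u"
proof -
  let ?C = "{z. (x, y, z) \<in> V}"
  have "?C \<subseteq> (\<lambda>(x, y, z). z) ` V" by force
  then have f: "finite ?C" using assms(1) finite_subset by blast
  have ne: "?C \<noteq> {}" using assms(2) by blast
  have "ends V x y (Min ?C) (Max ?C)"
    using Min_in[OF f ne] Max_in[OF f ne] Min_le[OF f] Max_ge[OF f] unfolding ends_def by blast
  then show ?thesis by (rule that)
qed

definition shear :: "int \<Rightarrow> int \<Rightarrow> int \<Rightarrow> i12" where
  "shear a b c = (1, 0, 0, 0, 1, 0, a, b, 1, 0, 0, c)"

lemma shear_det: "amap_det (shear a b c) \<in> {1, -1}"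
  by (simp add: shear_def amap_det_def)

lemma shear_mem: "(x, y, z) \<in> amap (shear a b c) ` V \<longleftrightarrow> (x, y, z - (a * x + b * y + c)) \<in> V"
proof
  assume "(x, y, z) \<in> amap (shear a b c) ` V"
  then show "(x, y, z - (a * x + b * y + c)) \<in> V" by (auto simp: amap_def shear_def)
next
  assume "(x, y, z - (a * x + b * y + c)) \<in> V"
  then show "(x, y, z) \<in> amap (shear a b c) ` V"
    by (rule rev_image_eqI) (simp add: amap_def shear_def)
qed

lemma ends_shear:
  assumes "ends V x y l u"
  shows "ends (amap (shear a b c) ` V) x y (l + (a * x + b * y + c)) (u + (a * x + b * y + c))"
  using assms unfolding ends_def shear_mem by (auto simp: algebra_simps)

text \<open>A column over the midpoint of an edge, with \<open>L\<close> and \<open>U\<close> the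
  sums of the lower and upper ends at the endpoints. If it does not reach below the edge,
  \<open>l\<close> takes the default \<open>cd2 L\<close>, and dually for \<open>u\<close>; so an
  empty column needs no case of its own.\<close>

definition midcol :: "i3 set \<Rightarrow> int \<Rightarrow> int \<Rightarrow> int \<Rightarrow> int \<Rightarrow> int \<Rightarrow> int \<Rightarrow> bool" where
  "midcol V x y L U l u \<longleftrightarrow> l \<le> cd2 L \<and> U div 2 \<le> u \<and> (2 * l < L \<longrightarrow> (x, y, l) \<in> V) \<and>
     (U < 2 * u \<longrightarrow> (x, y, u) \<in> V) \<and> (\<forall>z. (x, y, z) \<in> V \<longrightarrow> l \<le> z \<and> z \<le> u)"

lemma midcol_ex:
  assumes "finite V"
  obtains l u where "midcol V x y L U l u"
proof (cases "\<exists>z. (x, y, z) \<in> V")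
  case False
  have "\<not> 2 * cd2 L < L" "\<not> U < 2 * (U div 2)" unfolding cd2_def by presburger+
  with False have "midcol V x y L U (cd2 L) (U div 2)" by (simp add: midcol_def)
  then show ?thesis by (rule that)
next
  case True
  then obtain p q where e: "ends V x y p q" using ends_ex[OF assms] by blast
  have "midcol V x y L U (min (cd2 L) p) (max (U div 2) q)"
    using e unfolding midcol_def ends_def by (auto simp: cd2_def min_def max_def)
  then show ?thesis by (rule that)
qed

lemma midcol_shear:
  fixes a b c x y :: int
  assumes "midcol V x y L U l u"
  defines "k \<equiv> a * x + b * y + c"
  shows "midcol (amap (shear a b c) ` V) x y (L + 2 * k) (U + 2 * k) (l + k) (u + k)"
proof -
  have "cd2 (L + 2 * k) = cd2 L + k" by (simp add: cd2_def)
  then show ?thesis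
    using assms(1) unfolding midcol_def shear_mem k_def[symmetric]
    by (auto simp: algebra_simps)
qed

lemma hull_column:
  assumes "ends W x y l u" "(x, y, l) \<in> X" "(x, y, u) \<in> X" "(x, y, z) \<in> W"
  shows "pt (x, y, z) \<in> hullZ X"
  by (rule pt_column[OF convex_hullZ pt_mem_hullZ[OF assms(2)] pt_mem_hullZ[OF assms(3)]])
    (use endsD(3,4)[OF assms(1,4)] in auto)

lemma hull_midcol:
  assumes "midcol W x y (la + lb) (ua + ub) l u"
    and "(xa, ya, la) \<in> X" "(xb, yb, lb) \<in> X" "(xa, ya, ua) \<in> X" "(xb, yb, ub) \<in> X"
    and "xa + xb = 2 * x" "ya + yb = 2 * y"
    and "2 * l < la + lb \<Longrightarrow> (x, y, l) \<in> X" "ua + ub < 2 * u \<Longrightarrow> (x, y, u) \<in> X"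
    and "(x, y, z) \<in> W"
  shows "pt (x, y, z) \<in> hullZ X"
  by (rule pt_mid_column[OF convex_hullZ pt_mem_hullZ[OF assms(2)] pt_mem_hullZ[OF assms(3)]
        pt_mem_hullZ[OF assms(4)] pt_mem_hullZ[OF assms(5)] assms(6,7)
        pt_mem_hullZ[OF assms(8)] pt_mem_hullZ[OF assms(9)]])
    (use assms(1,10) in \<open>auto simp: midcol_def\<close>)

lemma ws_nonflat: "ws V \<Longrightarrow> n \<noteq> (0, 0, 0) \<Longrightarrow> \<exists>v\<in>V. pair n v \<noteq> d"
  using full_not_in_plane[OF wsD(3)] by blast

lemma FinZ_I:
  assumes "\<And>a b c. (a, b, c) \<noteq> (0, 0, 0) \<Longrightarrow> \<exists>v\<in>V. k * pair (a, b, c) v + 1 \<le> pair (a, b, c) p"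
  shows "pt p \<in> FinZ (of_int k) V"
proof -
  have "\<exists>v\<in>V. of_int k * of_int (pair n v) + 1 \<le> pt p \<bullet> pt n" if n: "n \<noteq> (0, 0, 0)" for n
  proof -
    obtain a b c where "n = (a, b, c)" by (cases n)
    then obtain v where v: "v \<in> V" "k * pair n v + 1 \<le> pair n p" using assms n by metis
    then have "real_of_int (k * pair n v + 1) \<le> of_int (pair n p)" by (simp only: of_int_le_iff)
    then show ?thesis using v(1) unfolding inner_pt by (intro bexI[of _ v]) simp_all
  qed
  then show ?thesis unfolding FinZ_def mem_Collect_eq by blast
qed

lemma FinZ_D:
  assumes "x \<in> FinZ d V" "(a, b, c) \<noteq> (0, 0, 0)"
  obtains v where "v \<in> V" "d * of_int (pair (a, b, c) v) + 1 \<le> x \<bullet> pt (a, b, c)"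
  using assms unfolding FinZ_def by blast

subsection \<open>Polytopes over the unit triangle\<close>

definition over1 :: "i3 set \<Rightarrow> bool" where
  "over1 V \<longleftrightarrow> (\<forall>(x, y, z)\<in>V. (x, y) \<in> {(0, 0), (1, 0), (0, 1)})"

text \<open>The three edge normals of the base give \<open>p, q \<ge> 1\<close> and
  \<open>p + q \<le> d - 1\<close>.\<close>

lemma over1_empty:
  assumes "over1 V" "0 \<le> d" "d < 3" shows "FinZ d V = {}"
proof (rule ccontr)
  assume "FinZ d V \<noteq> {}"
  then obtain p q r where x: "(p, q, r) \<in> FinZ d V" by auto
  obtain v1 where v1: "v1 \<in> V" "d * of_int (pair (1, 0, 0) v1) + 1 \<le> (p, q, r) \<bullet> pt (1, 0, 0)"
    by (rule FinZ_D[OF x, of 1 0 0]) simp_all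
  obtain v2 where v2: "v2 \<in> V" "d * of_int (pair (0, 1, 0) v2) + 1 \<le> (p, q, r) \<bullet> pt (0, 1, 0)"
    by (rule FinZ_D[OF x, of 0 1 0]) simp_all
  obtain v3 where v3: "v3 \<in> V" "d * of_int (pair (-1, -1, 0) v3) + 1 \<le> (p, q, r) \<bullet> pt (-1, -1, 0)"
    by (rule FinZ_D[OF x, of "-1" "-1" 0]) simp_all
  have "1 \<le> p" "1 \<le> q" "p + q \<le> d - 1"
    using v1 v2 v3 assms(1,2) by (auto simp: over1_def)
  then show False using assms(3) by simp
qed

text \<open>Adding the three bounds cancels \<open>m\<close> and \<open>n\<close>.\<close>

lemma prism_sum:
  fixes m n p q r s :: int
  shows "m + n + s \<le> 3 * p \<Longrightarrow> m + n + s \<le> 3 * (m + q) \<Longrightarrow> m + n + s \<le> 3 * (n + r) \<Longrightarrow> s \<le> p + q + r"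
proof -
  assume a: "m + n + s \<le> 3 * p" "m + n + s \<le> 3 * (m + q)" "m + n + s \<le> 3 * (n + r)"
  have "3 * s \<le> 3 * (p + q + r)" using a by (simp add: algebra_simps)
  then show "s \<le> p + q + r" by simp
qed

text \<open>With the lower ends sheared to 0 and column lengths \<open>a\<close>, \<open>b\<close>,
  \<open>c\<close>, the points \<open>(1, 1, h)\<close> with \<open>0 < h < a + b + c\<close> lie in
  \<open>F(3 W)\<close>. As there is at most one, \<open>a + b + c \<le> 2\<close>.\<close>

lemma over1_good:
  assumes ws: "ws V" and o: "over1 V" shows "good V"
proof -
  note fin = wsD(1)[OF ws]
  have cols: "(x, y) \<in> {(0, 0), (1, 0), (0, 1)}" if "(x, y, z) \<in> V" for x y z
    using o that unfolding over1_def by fast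
  have "\<exists>z. (0, 0, z) \<in> V"
  proof -
    obtain x y z where "(x, y, z) \<in> V" "pair (1, 1, 0) (x, y, z) \<noteq> 1"
      using ws_nonflat[OF ws, of "(1, 1, 0)" 1] by (auto simp del: pair_simp)
    then show ?thesis using cols[of x y z] by auto
  qed
  then obtain l0 u0 where e0: "ends V 0 0 l0 u0" using ends_ex[OF fin] by blast
  have "\<exists>z. (1, 0, z) \<in> V"
  proof -
    obtain x y z where "(x, y, z) \<in> V" "pair (1, 0, 0) (x, y, z) \<noteq> 0"
      using ws_nonflat[OF ws, of "(1, 0, 0)" 0] by (auto simp del: pair_simp)
    then show ?thesis using cols[of x y z] by auto
  qed
  then obtain l1 u1 where e1: "ends V 1 0 l1 u1" using ends_ex[OF fin] by blast
  have "\<exists>z. (0, 1, z) \<in> V"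
  proof -
    obtain x y z where "(x, y, z) \<in> V" "pair (0, 1, 0) (x, y, z) \<noteq> 0"
      using ws_nonflat[OF ws, of "(0, 1, 0)" 0] by (auto simp del: pair_simp)
    then show ?thesis using cols[of x y z] by auto
  qed
  then obtain l2 u2 where e2: "ends V 0 1 l2 u2" using ends_ex[OF fin] by blast
  define g where "g = shear (l0 - l1) (l0 - l2) (- l0)"
  define W where "W = amap g ` V"
  have det: "amap_det g \<in> {1, -1}" unfolding g_def by (rule shear_det)
  have wsW: "ws W" unfolding W_def by (rule ws_amap[OF ws det])
  define a b c where "a = u0 - l0" and "b = u1 - l1" and "c = u2 - l2"
  have E: "ends W 0 0 0 a" "ends W 1 0 0 b" "ends W 0 1 0 c"
    using ends_shear[OF e0, of "l0 - l1" "l0 - l2" "- l0"] ends_shear[OF e1, of "l0 - l1" "l0 - l2" "- l0"]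
      ends_shear[OF e2, of "l0 - l1" "l0 - l2" "- l0"]
    by (simp_all add: W_def g_def a_def b_def c_def)
  have colsW: "(x, y) \<in> {(0, 0), (1, 0), (0, 1)}" if "(x, y, z) \<in> W" for x y z
    using that cols unfolding W_def g_def shear_mem by blast
  have oW: "over1 W" unfolding over1_def using colsW by fast
  have pos: "0 \<le> a" "0 \<le> b" "0 \<le> c" using E endsD(5) by blast+
  \<comment> \<open>If a normal \<open>(m, n, k)\<close> fails for all points, the three lower ends
    together give \<open>k * h \<le> 0\<close> and the three upper ends
    \<open>k * (a + b + c - h) \<ge> 0\<close>. Hence \<open>k = 0\<close>, and then
    \<open>m = n = 0\<close>.\<close>
  have F: "pt (1, 1, h) \<in> FinZ 3 W" if h: "1 \<le> h" "h \<le> a + b + c - 1" for h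
  proof -
    have "\<exists>v\<in>W. 3 * pair (m, n, k) v + 1 \<le> pair (m, n, k) (1, 1, h)" if ne: "(m, n, k) \<noteq> (0, 0, 0)" for m n k
    proof (rule ccontr)
      assume "\<not> ?thesis"
      then have low: "m + n + k * h \<le> 3 * pair (m, n, k) v" if "v \<in> W" for v using that by force
      have "m + n + k * h \<le> 3 * (k * 0)" "m + n + k * h \<le> 3 * (m + k * 0)" "m + n + k * h \<le> 3 * (n + k * 0)"
        using low[OF endsD(1)[OF E(1)]] low[OF endsD(1)[OF E(2)]] low[OF endsD(1)[OF E(3)]] by simp_all
      then have 3: "m + n + k * h \<le> 0" "m + n + k * h \<le> 3 * m" "m + n + k * h \<le> 3 * n" by simp_all
      then have 1: "k * h \<le> 0" by linarith
      have "m + n + k * h \<le> 3 * (k * a)" "m + n + k * h \<le> 3 * (m + k * b)" "m + n + k * h \<le> 3 * (n + k * c)"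
        using low[OF endsD(2)[OF E(1)]] low[OF endsD(2)[OF E(2)]] low[OF endsD(2)[OF E(3)]] by simp_all
      then have "k * h \<le> k * a + k * b + k * c" by (rule prism_sum)
      then have 2: "0 \<le> k * (a + b + c - h)" by (simp add: algebra_simps)
      have "k = 0" using 1 2 h by (auto simp: mult_le_0_iff zero_le_mult_iff)
      then have "m = 0" "n = 0" using 3 by simp_all
      then show False using ne \<open>k = 0\<close> by simp
    qed
    then show ?thesis using FinZ_I[of W 3 "(1, 1, h)"] by simp
  qed
  have s2: "a + b + c \<le> 2"
  proof (rule ccontr)
    assume "\<not> a + b + c \<le> 2"
    then have "pt (1, 1, 1) \<in> FinZ 3 W" "pt (1, 1, 2) \<in> FinZ 3 W" using F[of 1] F[of 2] by simp_all
    then show False using ws_not_two_points[OF wsW, of 3 "pt (1, 1, 1)" "pt (1, 1, 2)"] over1_empty[OF oW] by simp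
  qed
  have s0: "0 < a + b + c"
  proof (rule ccontr)
    assume "\<not> 0 < a + b + c"
    then have z: "a = 0" "b = 0" "c = 0" using pos by simp_all
    obtain x y t where xyt: "(x, y, t) \<in> W" "pair (0, 0, 1) (x, y, t) \<noteq> 0"
      using ws_nonflat[OF wsW, of "(0, 0, 1)" 0] by (auto simp del: pair_simp)
    then have "ends W x y 0 0" using colsW[of x y t] E z by auto
    then have "t = 0" using xyt(1) unfolding ends_def by force
    then show False using xyt(2) by simp
  qed
  have "hullZ W = hullZ (set (prism_verts (a, b, c)))"
  proof (rule hullZ_eqI)
    show sub: "set (prism_verts (a, b, c)) \<subseteq> W" using E by (auto simp: prism_verts_def ends_def)
    fix v assume v: "v \<in> W"
    obtain x y z where xyz: "v = (x, y, z)" by (cases v)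
    have X: "(0, 0, 0) \<in> set (prism_verts (a, b, c))" "(0, 0, a) \<in> set (prism_verts (a, b, c))"
      "(1, 0, 0) \<in> set (prism_verts (a, b, c))" "(1, 0, b) \<in> set (prism_verts (a, b, c))"
      "(0, 1, 0) \<in> set (prism_verts (a, b, c))" "(0, 1, c) \<in> set (prism_verts (a, b, c))"
      by (simp_all add: prism_verts_def)
    have "(x, y) = (0, 0) \<or> (x, y) = (1, 0) \<or> (x, y) = (0, 1)" using colsW[of x y z] v xyz by auto
    then show "pt v \<in> hullZ (set (prism_verts (a, b, c)))"
    proof (elim disjE)
      assume "(x, y) = (0, 0)"
      then show ?thesis using hull_column[OF E(1) X(1,2), of z] v unfolding xyz by blast
    next
      assume "(x, y) = (1, 0)"
      then show ?thesis using hull_column[OF E(2) X(3,4), of z] v unfolding xyz by blast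
    next
      assume "(x, y) = (0, 1)"
      then show ?thesis using hull_column[OF E(3) X(5,6), of z] v unfolding xyz by blast
    qed
  qed
  moreover have "good (set (prism_verts (a, b, c)))"
  proof (rule list_all2_good[OF prism_checks])
    show "prism_verts (a, b, c) \<in> set (map prism_verts prism_enum)"
      using pos s2 s0 by (force simp: prism_enum_def)
  qed
  ultimately have "good W" by (rule good_hull)
  then show ?thesis unfolding W_def by (rule good_amap[OF det])
qed

subsection \<open>Polytopes of lattice width one\<close>

text \<open>The width direction is the second coordinate, so a point is \<open>(x, w, h)\<close> with \<open>w \<in> {0, 1}\<close>.\<close>

definition layered :: "i3 set \<Rightarrow> bool" where
  "layered V \<longleftrightarrow> (\<forall>(x, w, h)\<in>V. w = 0 \<or> w = 1)"

text \<open>The Minkowski sum of the two layers at the level of generating points: the middle slice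
  of \<open>2 P\<close>, as in the Cayley trick.\<close>

definition Tsum :: "i3 set \<Rightarrow> i2 set" where
  "Tsum V = {(x + x', h + h') | x h x' h'. (x, 0, h) \<in> V \<and> (x', 1, h') \<in> V}"

lemma TsumI: "(x, 0, h) \<in> V \<Longrightarrow> (x', 1, h') \<in> V \<Longrightarrow> (x + x', h + h') \<in> Tsum V"
  unfolding Tsum_def by blast

lemma TsumE:
  assumes "(p, q) \<in> Tsum V"
  obtains x h x' h' where "(x, 0, h) \<in> V" "(x', 1, h') \<in> V" "p = x + x'" "q = h + h'"
  using assms unfolding Tsum_def by blast

text \<open>The translation is multiplied by the layer coordinate: only layer 1 is shifted, so the
  Minkowski sum is shifted exactly once.\<close>

definition lift :: "i6 \<Rightarrow> i12" where
  "lift = (\<lambda>(a, b, c, d, s, t). (a, s, b, 0, 1, 0, c, t, d, 0, 0, 0))"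

lemma lift_det: "U2 g \<Longrightarrow> amap_det (lift g) \<in> {1, -1}"
  by (cases g) (auto simp: lift_def amap_det_def algebra_simps)

lemma Tsum_lift: "Tsum (amap (lift g) ` V) = am2 g ` Tsum V"
proof -
  obtain a b c d s t where g: "g = (a, b, c, d, s, t)" by (cases g)
  have L: "amap (lift g) (x, w, h) = (a * x + s * w + b * h, w, c * x + t * w + d * h)" for x w h
    by (simp add: g lift_def amap_def)
  show ?thesis
  proof (intro set_eqI iffI)
    fix z assume z: "z \<in> Tsum (amap (lift g) ` V)"
    obtain p q where pq: "z = (p, q)" by (cases z)
    obtain x h x' h' where m: "(x, 0, h) \<in> amap (lift g) ` V" "(x', 1, h') \<in> amap (lift g) ` V" "p = x + x'" "q = h + h'"
      using z unfolding pq by (rule TsumE)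
    obtain y w k where y: "(y, w, k) \<in> V" "(x, 0, h) = amap (lift g) (y, w, k)" using m(1) by (metis imageE prod_cases3)
    obtain y' w' k' where y': "(y', w', k') \<in> V" "(x', 1, h') = amap (lift g) (y', w', k')" using m(2) by (metis imageE prod_cases3)
    have "(y + y', k + k') \<in> Tsum V" using y y' by (intro TsumI) (auto simp: L)
    moreover have "z = am2 g (y + y', k + k')"
      using y(2)[unfolded L] y'(2)[unfolded L] m(3,4) by (auto simp: pq g algebra_simps)
    ultimately show "z \<in> am2 g ` Tsum V" by blast
  next
    fix z assume "z \<in> am2 g ` Tsum V"
    then obtain p q where pq: "(p, q) \<in> Tsum V" "z = am2 g (p, q)" by auto
    obtain x h x' h' where m: "(x, 0, h) \<in> V" "(x', 1, h') \<in> V" "p = x + x'" "q = h + h'"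
      using pq(1) by (rule TsumE)
    have "(a * x + s * 0 + b * h, 0, c * x + t * 0 + d * h) \<in> amap (lift g) ` V"
      by (rule image_eqI[OF _ m(1)]) (simp add: L)
    moreover have "(a * x' + s * 1 + b * h', 1, c * x' + t * 1 + d * h') \<in> amap (lift g) ` V"
      by (rule image_eqI[OF _ m(2)]) (simp add: L)
    ultimately have "(a * x + s * 0 + b * h + (a * x' + s * 1 + b * h'), c * x + t * 0 + d * h + (c * x' + t * 1 + d * h'))
        \<in> Tsum (amap (lift g) ` V)" by (rule TsumI)
    then show "z \<in> Tsum (amap (lift g) ` V)" by (simp add: pq m g algebra_simps)
  qed
qed

lemma layered_lift: "layered V \<Longrightarrow> layered (amap (lift g) ` V)"
  by (cases g) (force simp: layered_def lift_def amap_def)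

definition flipw :: i12 where
  "flipw = (1, 0, 0, 0, -1, 0, 0, 0, 1, 0, 1, 0)"

lemma flipw_det: "amap_det flipw \<in> {1, -1}"
  by (simp add: flipw_def amap_det_def)

lemma flipw_mem: "(x, w, h) \<in> amap flipw ` V \<longleftrightarrow> (x, 1 - w, h) \<in> V"
proof
  assume "(x, w, h) \<in> amap flipw ` V"
  then show "(x, 1 - w, h) \<in> V" by (auto simp: amap_def flipw_def)
next
  assume "(x, 1 - w, h) \<in> V"
  then show "(x, w, h) \<in> amap flipw ` V" by (rule rev_image_eqI) (simp add: amap_def flipw_def)
qed

lemma Tsum_flipw: "Tsum (amap flipw ` V) = Tsum V"
  unfolding Tsum_def flipw_mem by (auto; metis add.commute)

text \<open>The normals \<open>(0, 1, 0)\<close> and \<open>(0, -1, 0)\<close> leave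
  \<open>1 \<le> q \<le> d - 1\<close>.\<close>

lemma layered_empty:
  assumes "layered V" "0 \<le> d" "d < 2" shows "FinZ d V = {}"
proof (rule ccontr)
  assume "FinZ d V \<noteq> {}"
  then obtain p q r where x: "(p, q, r) \<in> FinZ d V" by auto
  obtain v1 where v1: "v1 \<in> V" "d * of_int (pair (0, 1, 0) v1) + 1 \<le> (p, q, r) \<bullet> pt (0, 1, 0)"
    by (rule FinZ_D[OF x, of 0 1 0]) simp_all
  obtain v2 where v2: "v2 \<in> V" "d * of_int (pair (0, -1, 0) v2) + 1 \<le> (p, q, r) \<bullet> pt (0, -1, 0)"
    by (rule FinZ_D[OF x, of 0 "-1" 0]) simp_all
  have "1 \<le> q" "q \<le> d - 1" using v1 v2 assms(1,2) by (auto simp: layered_def)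
  then show False using assms(3) by simp
qed

text \<open>A value below that of \<open>(a, b)\<close> is a sum of one value from each layer, so
  twice the smaller of the two is below it as well, and integrality supplies the summand 1. Normals
  \<open>(0, k, 0)\<close> are settled by the layers alone.\<close>

lemma Tsum_interior:
  assumes i: "in2 (Tsum V) (a, b)"
  shows "pt (a, 1, b) \<in> FinZ 2 V"
proof -
  have "\<exists>v\<in>V. 2 * pair (m, k, n) v + 1 \<le> pair (m, k, n) (a, 1, b)" if ne: "(m, k, n) \<noteq> (0, 0, 0)" for m k n
  proof (cases "(m, n) = (0, 0)")
    case False
    then have "\<exists>(x, y)\<in>Tsum V. m * (x - a) + n * (y - b) < 0" using i unfolding in2_def prod.case by blast
    then obtain p q where pq: "(p, q) \<in> Tsum V" "m * (p - a) + n * (q - b) < 0" by auto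
    obtain x h x' h' where m: "(x, 0, h) \<in> V" "(x', 1, h') \<in> V" "p = x + x'" "q = h + h'"
      using pq(1) by (rule TsumE)
    have "pair (m, k, n) (x, 0, h) + pair (m, k, n) (x', 1, h') < pair (m, k, n) (a, 1, b)"
      using pq(2) by (simp add: m algebra_simps)
    then have "2 * pair (m, k, n) (x, 0, h) + 1 \<le> pair (m, k, n) (a, 1, b) \<or>
        2 * pair (m, k, n) (x', 1, h') + 1 \<le> pair (m, k, n) (a, 1, b)" by linarith
    then show ?thesis using m by blast
  next
    case True
    have "\<exists>(x, y)\<in>Tsum V. 1 * (x - a) + 0 * (y - b) < 0"
      using i unfolding in2_def prod.case by (metis prod.inject zero_neq_one)
    then obtain p q where "(p, q) \<in> Tsum V" by auto
    then obtain x h x' h' where m: "(x, 0, h) \<in> V" "(x', 1, h') \<in> V" by (rule TsumE)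
    have "k \<noteq> 0" using ne True by simp
    then have "2 * pair (m, k, n) (x, 0, h) + 1 \<le> pair (m, k, n) (a, 1, b) \<or>
        2 * pair (m, k, n) (x', 1, h') + 1 \<le> pair (m, k, n) (a, 1, b)" using True by auto
    then show ?thesis using m by blast
  qed
  then show ?thesis using FinZ_I[of V 2 "(a, 1, b)"] by simp
qed

lemma Tsum_interior_unique:
  assumes "ws V" "layered V" "in2 (Tsum V) p" "in2 (Tsum V) q"
  shows "p = q"
proof (rule ccontr)
  assume ne: "p \<noteq> q"
  obtain a b c d where pq: "p = (a, b)" "q = (c, d)" by (cases p; cases q)
  have "pt (a, 1, b) \<in> FinZ 2 V" "pt (c, 1, d) \<in> FinZ 2 V"
    using Tsum_interior assms(3,4) pq by blast+
  moreover have "pt (a, 1, b) \<noteq> pt (c, 1, d)" using ne pq by auto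
  ultimately show False
    using ws_not_two_points[OF assms(1), of 2] layered_empty[OF assms(2)] by (metis zero_le_numeral)
qed

text \<open>The test functional vanishes on the line through \<open>(0, l0)\<close> and
  \<open>(1, h)\<close>. If \<open>h\<close> were too low, all of \<open>T\<close> would lie on or
  above this line.\<close>

lemma in2_row_bounds:
  assumes i: "in2 T (1, h)" and T: "\<And>x y. (x, y) \<in> T \<Longrightarrow> 0 \<le> x \<and> x \<le> 2"
    and l0: "\<And>y. (0, y) \<in> T \<Longrightarrow> l0 \<le> y" and l2: "\<And>y. (2, y) \<in> T \<Longrightarrow> l2 \<le> y"
    and l1: "\<And>y. (1, y) \<in> T \<Longrightarrow> l1 \<le> y"
  shows "min (2 * l1) (l0 + l2) < 2 * h"
proof (rule ccontr)
  assume "\<not> min (2 * l1) (l0 + l2) < 2 * h"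
  then have h: "h \<le> l1" "2 * h \<le> l0 + l2" by auto
  have "\<exists>(x, y)\<in>T. (l0 - h) * (x - 1) + 1 * (y - h) < 0"
    using i unfolding in2_def prod.case by (metis prod.inject zero_neq_one)
  then obtain x y where xy: "(x, y) \<in> T" "(l0 - h) * (x - 1) + (y - h) < 0" by auto
  have "x = 0 \<or> x = 1 \<or> x = 2" using T[OF xy(1)] by linarith
  then show False using xy l0[of y] l1[of y] l2[of y] h by auto
qed

lemma in2_row_bounds_upper:
  assumes i: "in2 T (1, h)" and T: "\<And>x y. (x, y) \<in> T \<Longrightarrow> 0 \<le> x \<and> x \<le> 2"
    and u: "\<And>y. (0, y) \<in> T \<Longrightarrow> y \<le> u0" "\<And>y. (2, y) \<in> T \<Longrightarrow> y \<le> u2" "\<And>y. (1, y) \<in> T \<Longrightarrow> y \<le> u1"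
  shows "2 * h < max (2 * u1) (u0 + u2)"
proof (rule ccontr)
  assume "\<not> 2 * h < max (2 * u1) (u0 + u2)"
  then have h: "u1 \<le> h" "u0 + u2 \<le> 2 * h" by auto
  have "\<exists>(x, y)\<in>T. (h - u0) * (x - 1) + (-1) * (y - h) < 0"
    using i unfolding in2_def prod.case by (metis prod.inject neg_equal_0_iff_equal zero_neq_one)
  then obtain x y where xy: "(x, y) \<in> T" "(h - u0) * (x - 1) - (y - h) < 0" by auto
  have "x = 0 \<or> x = 1 \<or> x = 2" using T[OF xy(1)] by linarith
  then show False using xy u(1)[of y] u(2)[of y] u(3)[of y] h by auto
qed

text \<open>For a supporting functional \<open>(m, n)\<close>, adding the bounds at the two outer
  columns cancels \<open>m\<close>. A point of the hull below \<open>h\<close> then gives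
  \<open>n \<le> 0\<close>, one above gives \<open>n \<ge> 0\<close>.\<close>

lemma in2_rowI:
  assumes T: "(0, l0) \<in> T" "(2, l2) \<in> T" "(0, u0) \<in> T" "(2, u2) \<in> T"
    and l: "(1, l1) \<in> T \<and> l1 < h \<or> l0 + l2 < 2 * h" and u: "(1, u1) \<in> T \<and> h < u1 \<or> 2 * h < u0 + u2"
  shows "in2 T (1, h)"
proof (rule ccontr)
  assume "\<not> in2 T (1, h)"
  then obtain m n where mn: "(m, n) \<noteq> (0, 0)"
    and p: "\<And>x y. (x, y) \<in> T \<Longrightarrow> 0 \<le> m * (x - 1) + n * (y - h)" using not_in2E by metis
  have v: "0 \<le> - m + n * (l0 - h)" "0 \<le> m + n * (l2 - h)" "0 \<le> - m + n * (u0 - h)" "0 \<le> m + n * (u2 - h)"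
    using p[OF T(1)] p[OF T(2)] p[OF T(3)] p[OF T(4)] by simp_all
  have "0 \<le> n * (l0 - h) + n * (l2 - h)" "0 \<le> n * (u0 - h) + n * (u2 - h)" using v by linarith+
  then have s: "0 \<le> n * (l0 + l2 - 2 * h)" "0 \<le> n * (u0 + u2 - 2 * h)" by (simp_all add: algebra_simps)
  have "n \<le> 0"
    using l
  proof
    assume a: "(1, l1) \<in> T \<and> l1 < h"
    then have "0 \<le> n * (l1 - h)" using p[of 1 l1] by simp
    then show ?thesis using a by (simp add: zero_le_mult_iff)
  next
    assume "l0 + l2 < 2 * h"
    then show ?thesis using s(1) by (simp add: zero_le_mult_iff)
  qed
  moreover have "0 \<le> n"
    using u
  proof
    assume a: "(1, u1) \<in> T \<and> h < u1"
    then have "0 \<le> n * (u1 - h)" using p[of 1 u1] by simp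
    then show ?thesis using a by (simp add: zero_le_mult_iff)
  next
    assume "2 * h < u0 + u2"
    then show ?thesis using s(2) by (simp add: zero_le_mult_iff)
  qed
  ultimately have "n = 0" by simp
  then have "m = 0" using v by simp
  then show False using mn \<open>n = 0\<close> by simp
qed

lemma in_concat_map: "y \<in> set xs \<Longrightarrow> x \<in> set (f y) \<Longrightarrow> x \<in> set (concat (map f xs))"
  by auto

text \<open>Over the unit square the middle line of the Minkowski sum runs between the extreme
  diagonal sums \<open>L\<close> and \<open>U\<close>, and its interior lattice points are the
  integers strictly between them. There is exactly one, so \<open>U - L = 2\<close>.\<close>

lemma square_good:
  assumes fin: "finite V" and cols: "\<And>x w h. (x, w, h) \<in> V \<Longrightarrow> x \<in> {0, 1} \<and> w \<in> {0, 1}"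
    and ne: "(1, 0, y10) \<in> V" "(1, 1, y11) \<in> V" "(0, 0, y00) \<in> V" "(0, 1, y01) \<in> V"
    and i: "in2 (Tsum V) (1, h)" and uniq: "\<And>h h'. in2 (Tsum V) (1, h) \<Longrightarrow> in2 (Tsum V) (1, h') \<Longrightarrow> h = h'"
  shows "good V"
proof -
  obtain l00 u00 where e00: "ends V 0 0 l00 u00" using ends_ex[OF fin ne(3)] .
  obtain l10 u10 where e10: "ends V 1 0 l10 u10" using ends_ex[OF fin ne(1)] .
  obtain l01 u01 where e01: "ends V 0 1 l01 u01" using ends_ex[OF fin ne(4)] .
  obtain l11 u11 where e11: "ends V 1 1 l11 u11" using ends_ex[OF fin ne(2)] .
  note D = endsD[OF e00] endsD[OF e10] endsD[OF e01] endsD[OF e11]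
  define L U where "L = min (l00 + l11) (l10 + l01)" and "U = max (u00 + u11) (u10 + u01)"
  have Tx: "0 \<le> x \<and> x \<le> 2" if t: "(x, y) \<in> Tsum V" for x y
  proof -
    obtain p k p' k' where m: "(p, 0, k) \<in> V" "(p', 1, k') \<in> V" "x = p + p'" using t by (rule TsumE)
    then show ?thesis using cols[OF m(1)] cols[OF m(2)] by auto
  qed
  have T0: "l00 + l01 \<le> y \<and> y \<le> u00 + u01" if t: "(0, y) \<in> Tsum V" for y
  proof -
    obtain x h x' h' where m: "(x, 0, h) \<in> V" "(x', 1, h') \<in> V" "0 = x + x'" "y = h + h'" using t by (rule TsumE)
    then have "x = 0" "x' = 0" using cols[OF m(1)] cols[OF m(2)] by auto
    then show ?thesis using m D(3,4)[of h] D(13,14)[of h'] by auto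
  qed
  have T2: "l10 + l11 \<le> y \<and> y \<le> u10 + u11" if t: "(2, y) \<in> Tsum V" for y
  proof -
    obtain x h x' h' where m: "(x, 0, h) \<in> V" "(x', 1, h') \<in> V" "2 = x + x'" "y = h + h'" using t by (rule TsumE)
    then have "x = 1" "x' = 1" using cols[OF m(1)] cols[OF m(2)] by auto
    then show ?thesis using m D(8,9)[of h] D(18,19)[of h'] by auto
  qed
  have T1: "L \<le> y \<and> y \<le> U" if t: "(1, y) \<in> Tsum V" for y
  proof -
    obtain x h x' h' where m: "(x, 0, h) \<in> V" "(x', 1, h') \<in> V" "1 = x + x'" "y = h + h'" using t by (rule TsumE)
    then have "(x = 0 \<and> x' = 1) \<or> (x = 1 \<and> x' = 0)" using cols[OF m(1)] cols[OF m(2)] by auto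
    then show ?thesis using m D(3,4)[of h] D(8,9)[of h] D(13,14)[of h'] D(18,19)[of h']
      by (auto simp: L_def U_def min_def max_def)
  qed
  have "min (2 * L) ((l00 + l01) + (l10 + l11)) < 2 * h"
    by (rule in2_row_bounds[OF i Tx]) (use T0 T1 T2 in blast)+
  \<comment> \<open>The four lower ends together are the sum of both diagonals, hence at least
    \<open>2 * L\<close>.\<close>
  then have Lh: "L < h" by (auto simp: L_def min_def split: if_splits)
  have "2 * h < max (2 * U) ((u00 + u01) + (u10 + u11))"
    by (rule in2_row_bounds_upper[OF i Tx]) (use T0 T1 T2 in blast)+
  then have hU: "h < U" by (auto simp: U_def max_def split: if_splits)
  have "in2 (Tsum V) (1, k)" if k: "L < k" "k < U" for k
  proof (rule in2_rowI)
    show "(0, l00 + l01) \<in> Tsum V" "(0, u00 + u01) \<in> Tsum V"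
      using TsumI[OF D(1) D(11)] TsumI[OF D(2) D(12)] by simp_all
    show "(2, l10 + l11) \<in> Tsum V" "(2, u10 + u11) \<in> Tsum V"
      using TsumI[OF D(6) D(16)] TsumI[OF D(7) D(17)] by simp_all
    have "(1, l00 + l11) \<in> Tsum V" "(1, l10 + l01) \<in> Tsum V"
      using TsumI[OF D(1) D(16)] TsumI[OF D(6) D(11)] by simp_all
    then show "(1, L) \<in> Tsum V \<and> L < k \<or> (l00 + l01) + (l10 + l11) < 2 * k" using k by (auto simp: L_def min_def)
    have "(1, u00 + u11) \<in> Tsum V" "(1, u10 + u01) \<in> Tsum V"
      using TsumI[OF D(2) D(17)] TsumI[OF D(7) D(12)] by simp_all
    then show "(1, U) \<in> Tsum V \<and> k < U \<or> 2 * k < (u00 + u01) + (u10 + u11)" using k by (auto simp: U_def max_def)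
  qed
  then have UL: "U - L = 2"
    using uniq[of h "h + 1"] uniq[of h "h - 1"] Lh hU by (cases "L < h - 1"; cases "h + 1 < U"; force)
  \<comment> \<open>This shear brings the lower ends over \<open>(0, 0)\<close>,
    \<open>(1, 0)\<close>, \<open>(0, 1)\<close> to 0; \<open>e\<close> is the remaining deviation
    over \<open>(1, 1)\<close>.\<close>
  define al be where "al = l00 - l10" and "be = l00 - l01"
  define W where "W = amap (shear al be (- l00)) ` V"
  define a b c e d where "a = u00 - l00" and "b = u10 - l10" and "c = u01 - l01" and "e = l11 + l00 - l10 - l01"
    and "d = u11 + l00 - l10 - l01"
  have E: "ends W 0 0 0 a" "ends W 1 0 0 b" "ends W 0 1 0 c" "ends W 1 1 e d"
    using ends_shear[OF e00, of al be "- l00"] ends_shear[OF e10, of al be "- l00"]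
      ends_shear[OF e01, of al be "- l00"] ends_shear[OF e11, of al be "- l00"]
    by (simp_all add: W_def a_def b_def c_def d_def e_def al_def be_def algebra_simps)
  have colsW: "x \<in> {0, 1} \<and> w \<in> {0, 1}" if "(x, w, h) \<in> W" for x w h
    using that cols unfolding W_def shear_mem by blast
  have pos: "0 \<le> a" "0 \<le> b" "0 \<le> c" "e \<le> d" using endsD(5)[OF E(1)] endsD(5)[OF E(2)] endsD(5)[OF E(3)] endsD(5)[OF E(4)] by simp_all
  have eq: "max (a + d) (b + c) - min 0 e = 2"
    using UL unfolding U_def L_def a_def b_def c_def d_def e_def by (auto simp: max_def min_def split: if_splits)
  let ?S = "hullZ (set (square_verts (e, a, b, c, d)))"
  have "hullZ W = ?S"
  proof (rule hullZ_eqI)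
    show "set (square_verts (e, a, b, c, d)) \<subseteq> W" using E by (auto simp: square_verts_def ends_def)
    fix v assume v: "v \<in> W"
    obtain x w z where xyz: "v = (x, w, z)" by (cases v)
    have X: "(0, 0, 0) \<in> set (square_verts (e, a, b, c, d))" "(0, 0, a) \<in> set (square_verts (e, a, b, c, d))"
      "(1, 0, 0) \<in> set (square_verts (e, a, b, c, d))" "(1, 0, b) \<in> set (square_verts (e, a, b, c, d))"
      "(0, 1, 0) \<in> set (square_verts (e, a, b, c, d))" "(0, 1, c) \<in> set (square_verts (e, a, b, c, d))"
      "(1, 1, e) \<in> set (square_verts (e, a, b, c, d))" "(1, 1, d) \<in> set (square_verts (e, a, b, c, d))"
      by (simp_all add: square_verts_def)
    have "(x, w) = (0, 0) \<or> (x, w) = (1, 0) \<or> (x, w) = (0, 1) \<or> (x, w) = (1, 1)" using colsW[of x w z] v xyz by auto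
    then show "pt v \<in> ?S"
    proof (elim disjE)
      assume "(x, w) = (0, 0)"
      then show ?thesis using hull_column[OF E(1) X(1,2), of z] v unfolding xyz by blast
    next
      assume "(x, w) = (1, 0)"
      then show ?thesis using hull_column[OF E(2) X(3,4), of z] v unfolding xyz by blast
    next
      assume "(x, w) = (0, 1)"
      then show ?thesis using hull_column[OF E(3) X(5,6), of z] v unfolding xyz by blast
    next
      assume "(x, w) = (1, 1)"
      then show ?thesis using hull_column[OF E(4) X(7,8), of z] v unfolding xyz by blast
    qed
  qed
  moreover have "good (set (square_verts (e, a, b, c, d)))"
  proof (rule list_all2_good[OF square_checks])
    have "-2 \<le> e" "e \<le> 2" "a \<le> 2" "b \<le> 2" "c \<le> 2" "d \<le> e + 4" using pos eq by (auto simp: max_def min_def split: if_splits)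
    then have m: "e \<in> set [-2..2]" "a \<in> set [0..2]" "b \<in> set [0..2]" "c \<in> set [0..2]" "d \<in> set [e..e + 4]"
      unfolding set_upto using pos by simp_all
    have "(e, a, b, c, d) \<in> set square_enum"
      unfolding square_enum_def
      by (rule in_concat_map[OF m(1)], rule in_concat_map[OF m(2)], rule in_concat_map[OF m(3)],
          rule in_concat_map[OF m(4)], rule in_concat_map[OF m(5)], simp add: eq)
    then show "square_verts (e, a, b, c, d) \<in> set (map square_verts square_enum)" by simp
  qed
  ultimately have "good W" by (rule good_hull)
  then show ?thesis unfolding W_def by (rule good_amap[OF shear_det])
qed

text \<open>Layer 1 is a single column, so the polytope lies over the triangle with corners
  \<open>(0, 0)\<close>, \<open>(2, 0)\<close>, \<open>(0, 1)\<close>. The middle line of the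
  Minkowski sum may have half-integral ends, and \<open>L\<close> and \<open>U\<close> are their
  doubles.\<close>

lemma triangle_good:
  assumes fin: "finite V" and cols: "\<And>x w h. (x, w, h) \<in> V \<Longrightarrow> (w = 0 \<and> x \<in> {0, 1, 2}) \<or> (w = 1 \<and> x = 0)"
    and ne: "(2, 0, y2) \<in> V" "(0, 0, y0) \<in> V" "(0, 1, yT) \<in> V"
    and i: "in2 (Tsum V) (1, h)" and uniq: "\<And>h h'. in2 (Tsum V) (1, h) \<Longrightarrow> in2 (Tsum V) (1, h') \<Longrightarrow> h = h'"
  shows "good V"
proof -
  obtain l0 u0 where e0: "ends V 0 0 l0 u0" using ends_ex[OF fin ne(2)] .
  obtain l2 u2 where e2: "ends V 2 0 l2 u2" using ends_ex[OF fin ne(1)] .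
  obtain lT uT where eT: "ends V 0 1 lT uT" using ends_ex[OF fin ne(3)] .
  obtain l1 u1 where m1: "midcol V 1 0 (l0 + l2) (u0 + u2) l1 u1" using midcol_ex[OF fin] .
  note D = endsD[OF e0] endsD[OF e2] endsD[OF eT]
  define L U where "L = min (2 * l1) (l0 + l2) + 2 * lT" and "U = max (2 * u1) (u0 + u2) + 2 * uT"
  have dec: "\<exists>k k'. (x, 0, k) \<in> V \<and> (0, 1, k') \<in> V \<and> y = k + k'" if t: "(x, y) \<in> Tsum V" for x y
  proof -
    obtain p k p' k' where m: "(p, 0, k) \<in> V" "(p', 1, k') \<in> V" "x = p + p'" "y = k + k'" using t by (rule TsumE)
    then show ?thesis using cols[OF m(2)] by auto
  qed
  have m1c: "l1 \<le> z \<and> z \<le> u1" if "(1, 0, z) \<in> V" for z using m1 that unfolding midcol_def by blast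
  have Tx: "0 \<le> x \<and> x \<le> 2" if t: "(x, y) \<in> Tsum V" for x y
  proof -
    obtain k k' where k: "(x, 0, k) \<in> V" "(0, 1, k') \<in> V" "y = k + k'" using dec[OF t] by blast
    show ?thesis using cols[OF k(1)] k(3) D(13)[OF k(2)] D(14)[OF k(2)] by auto
  qed
  have T0: "l0 + lT \<le> y \<and> y \<le> u0 + uT" if t: "(0, y) \<in> Tsum V" for y
  proof -
    obtain k k' where k: "(0, 0, k) \<in> V" "(0, 1, k') \<in> V" "y = k + k'" using dec[OF t] by blast
    show ?thesis using D(3)[OF k(1)] D(4)[OF k(1)] k(3) D(13)[OF k(2)] D(14)[OF k(2)] by auto
  qed
  have T2: "l2 + lT \<le> y \<and> y \<le> u2 + uT" if t: "(2, y) \<in> Tsum V" for y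
  proof -
    obtain k k' where k: "(2, 0, k) \<in> V" "(0, 1, k') \<in> V" "y = k + k'" using dec[OF t] by blast
    show ?thesis using D(8)[OF k(1)] D(9)[OF k(1)] k(3) D(13)[OF k(2)] D(14)[OF k(2)] by auto
  qed
  have T1: "l1 + lT \<le> y \<and> y \<le> u1 + uT" if t: "(1, y) \<in> Tsum V" for y
  proof -
    obtain k k' where k: "(1, 0, k) \<in> V" "(0, 1, k') \<in> V" "y = k + k'" using dec[OF t] by blast
    show ?thesis using m1c[OF k(1)] k(3) D(13)[OF k(2)] D(14)[OF k(2)] by auto
  qed
  have "min (2 * (l1 + lT)) ((l0 + lT) + (l2 + lT)) < 2 * h"
    by (rule in2_row_bounds[OF i Tx]) (use T0 T1 T2 in blast)+
  then have Lh: "L < 2 * h" by (auto simp: L_def min_def split: if_splits)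
  have "2 * h < max (2 * (u1 + uT)) ((u0 + uT) + (u2 + uT))"
    by (rule in2_row_bounds_upper[OF i Tx]) (use T0 T1 T2 in blast)+
  then have hU: "2 * h < U" by (auto simp: U_def max_def split: if_splits)
  have I: "in2 (Tsum V) (1, k)" if k: "L < 2 * k" "2 * k < U" for k
  proof (rule in2_rowI)
    show "(0, l0 + lT) \<in> Tsum V" "(0, u0 + uT) \<in> Tsum V"
      using TsumI[OF D(1) D(11)] TsumI[OF D(2) D(12)] by simp_all
    show "(2, l2 + lT) \<in> Tsum V" "(2, u2 + uT) \<in> Tsum V"
      using TsumI[OF D(6) D(11)] TsumI[OF D(7) D(12)] by simp_all
    have "(1, l1 + lT) \<in> Tsum V" if "2 * l1 < l0 + l2"
      using TsumI[OF _ D(11), of 1 l1] m1 that by (simp add: midcol_def)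
    then show "(1, l1 + lT) \<in> Tsum V \<and> l1 + lT < k \<or> (l0 + lT) + (l2 + lT) < 2 * k"
      using k by (auto simp: L_def min_def split: if_splits)
    have "(1, u1 + uT) \<in> Tsum V" if "u0 + u2 < 2 * u1"
      using TsumI[OF _ D(12), of 1 u1] m1 that by (simp add: midcol_def)
    then show "(1, u1 + uT) \<in> Tsum V \<and> k < u1 + uT \<or> 2 * k < (u0 + uT) + (u2 + uT)"
      using k by (auto simp: U_def max_def split: if_splits)
  qed
  have one: "\<not> (L < 2 * (h + 1) \<and> 2 * (h + 1) < U)" "\<not> (L < 2 * (h - 1) \<and> 2 * (h - 1) < U)"
    using uniq[OF I[of "h + 1"] I[of h]] uniq[OF I[of "h - 1"] I[of h]] Lh hU by auto
  \<comment> \<open>A shear changes \<open>l2 - l0\<close> by even amounts, so only its parity is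
    left.\<close>
  define k where "k = (l2 - l0) div 2"
  define al be ga where "al = - k" and "be = l0 - lT" and "ga = - l0"
  define W where "W = amap (shear al be ga) ` V"
  define l2' u0' u2' uT' l1' u1' where "l2' = l2 - l0 - 2 * k" and "u0' = u0 - l0" and "u2' = u2 - l0 - 2 * k"
    and "uT' = uT - lT" and "l1' = l1 - l0 - k" and "u1' = u1 - l0 - k"
  have E: "ends W 0 0 0 u0'" "ends W 2 0 l2' u2'" "ends W 0 1 0 uT'"
    using ends_shear[OF e0, of al be ga] ends_shear[OF e2, of al be ga] ends_shear[OF eT, of al be ga]
    by (simp_all add: W_def l2'_def u0'_def u2'_def uT'_def al_def be_def ga_def algebra_simps)
  have M: "midcol W 1 0 l2' (u0' + u2') l1' u1'"
    using midcol_shear[OF m1, of al be ga]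
    by (simp add: W_def l2'_def u0'_def u2'_def l1'_def u1'_def al_def be_def ga_def algebra_simps)
  have colsW: "(w = 0 \<and> x \<in> {0, 1, 2}) \<or> (w = 1 \<and> x = 0)" if "(x, w, h) \<in> W" for x w h
    using that cols unfolding W_def shear_mem by blast
  have pos: "0 \<le> u0'" "l2' \<le> u2'" "0 \<le> uT'" using endsD(5)[OF E(1)] endsD(5)[OF E(2)] endsD(5)[OF E(3)] by simp_all
  have l2': "l2' = 0 \<or> l2' = 1" unfolding l2'_def k_def by presburger
  define L' U' where "L' = min (2 * l1') l2'" and "U' = max (2 * u1') (u0' + u2') + 2 * uT'"
  define s where "s = lT + l0 + k"
  have LU: "L' = L - 2 * s" "U' = U - 2 * s"
    unfolding L'_def U'_def L_def U_def l2'_def u0'_def u2'_def uT'_def l1'_def u1'_def s_def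
    by (auto simp: min_def max_def)
  define h' where "h' = h - s"
  have h': "L' < 2 * h'" "2 * h' < U'" "\<not> (L' < 2 * (h' + 1) \<and> 2 * (h' + 1) < U')" "\<not> (L' < 2 * (h' - 1) \<and> 2 * (h' - 1) < U')"
    using Lh hU one by (auto simp: LU h'_def)
  \<comment> \<open>The predecessor of \<open>h'\<close> is below the upper end and not interior, so
    it does not exceed the lower end.\<close>
  have h'e: "h' = L' div 2 + 1" using h' by (auto simp: not_less)
  let ?S = "hullZ (set (triangle_verts (l2', u0', u2', uT', l1', u1')))"
  have "hullZ W = ?S"
  proof (rule hullZ_eqI)
    show "set (triangle_verts (l2', u0', u2', uT', l1', u1')) \<subseteq> W"
      using E M by (auto simp: triangle_verts_def ends_def midcol_def)
    fix v assume v: "v \<in> W"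
    obtain x w z where xyz: "v = (x, w, z)" by (cases v)
    let ?X = "set (triangle_verts (l2', u0', u2', uT', l1', u1'))"
    have X: "(0, 0, 0) \<in> ?X" "(0, 0, u0') \<in> ?X" "(2, 0, l2') \<in> ?X" "(2, 0, u2') \<in> ?X" "(0, 1, 0) \<in> ?X" "(0, 1, uT') \<in> ?X"
      by (simp_all add: triangle_verts_def)
    have Xl: "(1, 0, l1') \<in> ?X" if "2 * l1' < 0 + l2'" using that by (simp add: triangle_verts_def)
    have Xu: "(1, 0, u1') \<in> ?X" if "u0' + u2' < 2 * u1'" using that by (simp add: triangle_verts_def)
    have M': "midcol W 1 0 (0 + l2') (u0' + u2') l1' u1'" using M by simp
    have "(x, w) = (0, 0) \<or> (x, w) = (1, 0) \<or> (x, w) = (2, 0) \<or> (x, w) = (0, 1)" using colsW[of x w z] v xyz by auto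
    then show "pt v \<in> ?S"
    proof (elim disjE)
      assume "(x, w) = (0, 0)"
      then show ?thesis using hull_column[OF E(1) X(1,2), of z] v unfolding xyz by blast
    next
      assume "(x, w) = (1, 0)"
      then have e: "v = (1, 0, z)" using xyz by simp
      show ?thesis unfolding e
        by (rule hull_midcol[OF M' X(1,3,2,4) _ _ Xl Xu v[unfolded e]]) simp_all
    next
      assume "(x, w) = (2, 0)"
      then show ?thesis using hull_column[OF E(2) X(3,4), of z] v unfolding xyz by blast
    next
      assume "(x, w) = (0, 1)"
      then show ?thesis using hull_column[OF E(3) X(5,6), of z] v unfolding xyz by blast
    qed
  qed
  moreover have "good (set (triangle_verts (l2', u0', u2', uT', l1', u1')))"
  proof (rule list_all2_good[OF triangle_checks])
    have Mc: "l1' \<le> cd2 l2'" "(u0' + u2') div 2 \<le> u1'" using M by (auto simp: midcol_def)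
    have UL: "U' \<le> L' + 4" using h' by (auto simp: not_less)
    have a: "u0' + u2' + 2 * uT' \<le> U'" "2 * u1' + 2 * uT' \<le> U'" "L' \<le> l2'" "L' \<le> 2 * l1'" by (auto simp: U'_def L'_def)
    have b: "u0' + u2' + 2 * uT' \<le> l2' + 4" "u0' + u2' + 2 * uT' - 4 \<le> 2 * l1'" "2 * u1' \<le> l2' + 4 - 2 * uT'"
      using a UL by linarith+
    have c: "cd2 (u0' + u2' + 2 * uT' - 4) \<le> l1'" using b(2) by (simp add: cd2_def)
    have d: "u1' \<le> (l2' + 4 - 2 * uT') div 2" using b(3) by linarith
    have f: "2 * (L' div 2 + 1) < U'" "\<not> 2 * (L' div 2 + 1 + 1) < U'"
      using h' unfolding h'e[symmetric] by auto
    have g: "u0' \<le> l2' + 4" "u2' \<le> l2' + 4 - u0'" "uT' \<le> 2" using b(1) pos l2' by auto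
    have m: "l2' \<in> set [0..1]" "u0' \<in> set [0..l2' + 4]" "u2' \<in> set [l2'..l2' + 4 - u0']" "uT' \<in> set [0..2]"
      "l1' \<in> set [cd2 (u0' + u2' + 2 * uT' - 4)..cd2 l2']" "u1' \<in> set [(u0' + u2') div 2..(l2' + 4 - 2 * uT') div 2]"
      unfolding set_upto using pos l2' Mc c d g by auto
    have "(l2', u0', u2', uT', l1', u1') \<in> set triangle_enum"
      unfolding triangle_enum_def
      by (rule in_concat_map[OF m(1)], rule in_concat_map[OF m(2)], rule in_concat_map[OF m(3)],
          rule in_concat_map[OF m(4)], rule in_concat_map[OF m(5)], rule in_concat_map[OF m(6)])
        (use f in \<open>simp add: L'_def U'_def\<close>)
    then show "triangle_verts (l2', u0', u2', uT', l1', u1') \<in> set (map triangle_verts triangle_enum)" by simp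
  qed
  ultimately have "good W" by (rule good_hull)
  then show ?thesis unfolding W_def by (rule good_amap[OF shear_det])
qed

lemma corner_hull:
  assumes "(0, w, 0) \<in> X" "(c, w, 0) \<in> X" "(0, w, c) \<in> X" "0 \<le> x" "0 \<le> h" "x + h \<le> c"
  shows "pt (x, w, h) \<in> hullZ X"
proof (cases "c = 0")
  case True
  then have "(x, w, h) = (0, w, 0)" using assms(4-6) by simp
  then show ?thesis using pt_mem_hullZ[OF assms(1)] by simp
next
  case False
  then have c: "0 < c" using assms(4-6) by simp
  define r s where "r = real_of_int x / of_int c" and "s = real_of_int h / of_int c"
  have rs: "0 \<le> r" "0 \<le> s" "r * of_int c = of_int x" "s * of_int c = of_int h"
    using c assms(4,5) by (simp_all add: r_def s_def)
  have "real_of_int (x + h) \<le> of_int c" using assms(6) by (simp only: of_int_le_iff)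
  then have "(r + s) * of_int c \<le> 1 * of_int c" using rs by (simp add: distrib_right)
  then have rs1: "r + s \<le> 1" using c by simp
  have "convex hull {pt (0, w, 0), pt (c, w, 0), pt (0, w, c)} \<subseteq> hullZ X"
    by (rule hull_minimal) (use pt_mem_hullZ assms(1-3) convex_hullZ in blast)+
  moreover have "pt (x, w, h) \<in> convex hull {pt (0, w, 0), pt (c, w, 0), pt (0, w, c)}"
    unfolding convex_hull_3 mem_Collect_eq
    by (rule exI[of _ "1 - r - s"], rule exI[of _ r], rule exI[of _ s])
      (use rs rs1 in \<open>simp add: algebra_simps\<close>)
  ultimately show ?thesis by blast
qed

lemma simplex_good:
  assumes V: "layered V" and c: "(c0, c1) \<in> {(3, 0), (2, 1), (2, 0)}"
    and m: "(0, 0, 0) \<in> V" "(c0, 0, 0) \<in> V" "(0, 0, c0) \<in> V" "(0, 1, 0) \<in> V" "(c1, 1, 0) \<in> V" "(0, 1, c1) \<in> V"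
    and b0: "\<And>x h. (x, 0, h) \<in> V \<Longrightarrow> 0 \<le> x \<and> 0 \<le> h \<and> x + h \<le> c0"
    and b1: "\<And>x h. (x, 1, h) \<in> V \<Longrightarrow> 0 \<le> x \<and> 0 \<le> h \<and> x + h \<le> c1"
  shows "good V"
proof -
  define X :: "i3 set" where "X = {(0, 0, 0), (c0, 0, 0), (0, 0, c0), (0, 1, 0), (c1, 1, 0), (0, 1, c1)}"
  have "hullZ V = hullZ X"
  proof (rule hullZ_eqI)
    show "X \<subseteq> V" using m by (simp add: X_def)
    fix v assume v: "v \<in> V"
    obtain x w h where e: "v = (x, w, h)" by (cases v)
    have "w = 0 \<or> w = 1" using V v unfolding layered_def e by blast
    then show "pt v \<in> hullZ X"
    proof
      assume w: "w = 0"
      show ?thesis unfolding e w by (rule corner_hull[of _ _ c0]) (use b0 v e w in \<open>auto simp: X_def\<close>)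
    next
      assume w: "w = 1"
      show ?thesis unfolding e w by (rule corner_hull[of _ _ c1]) (use b1 v e w in \<open>auto simp: X_def\<close>)
    qed
  qed
  moreover have "good X"
  proof -
    have g: "good (set L)" if "L \<in> set simplex_enum" for L by (rule list_all2_good[OF simplex_checks that])
    have "X = set [(0, 0, 0), (3, 0, 0), (0, 0, 3), (0, 1, 0)] \<or>
      X = set [(0, 0, 0), (2, 0, 0), (0, 0, 2), (0, 1, 0), (1, 1, 0), (0, 1, 1)] \<or>
      X = set [(0, 0, 0), (2, 0, 0), (0, 0, 2), (0, 1, 0)]"
      using c by (auto simp: X_def)
    moreover have "good (set [(0, 0, 0), (3, 0, 0), (0, 0, 3), (0, 1, 0)])"
      "good (set [(0, 0, 0), (2, 0, 0), (0, 0, 2), (0, 1, 0), (1, 1, 0), (0, 1, 1)])"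
      "good (set [(0, 0, 0), (2, 0, 0), (0, 0, 2), (0, 1, 0)])"
      by (rule g, simp add: simplex_enum_def)+
    ultimately show ?thesis by metis
  qed
  ultimately show ?thesis by (rule good_hull)
qed

lemma ws_layers_nonempty:
  assumes "ws V" "layered V"
  obtains x0 h0 x1 h1 where "(x0, 0, h0) \<in> V" "(x1, 1, h1) \<in> V"
proof -
  obtain a b c where 0: "(a, b, c) \<in> V" "pair (0, 1, 0) (a, b, c) \<noteq> 1"
    using ws_nonflat[OF assms(1), of "(0, 1, 0)" 1] by (auto simp del: pair_simp)
  obtain d e f where 1: "(d, e, f) \<in> V" "pair (0, 1, 0) (d, e, f) \<noteq> 0"
    using ws_nonflat[OF assms(1), of "(0, 1, 0)" 0] by (auto simp del: pair_simp)
  have "b = 0" "e = 1" using 0 1 assms(2) unfolding layered_def by fastforce+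
  then show ?thesis using that 0(1) 1(1) by blast
qed

lemma layered_amap_w:
  assumes "layered V" "\<And>x w h. (x, w, h) \<in> V \<Longrightarrow> fst (snd (amap g (x, w, h))) = w"
  shows "layered (amap g ` V)"
  unfolding layered_def
proof
  fix v assume "v \<in> amap g ` V"
  then obtain x w h where m: "(x, w, h) \<in> V" "v = amap g (x, w, h)" by (metis imageE prod_cases3)
  have "w = 0 \<or> w = 1" using assms(1) m(1) unfolding layered_def by blast
  then show "case v of (x, w, h) \<Rightarrow> w = 0 \<or> w = 1" using assms(2)[OF m(1)] m(2) by (simp add: split_beta)
qed

text \<open>Unlike \<open>lift\<close>, it translates the two layers independently and leaves
  directions alone.\<close>

definition slide :: "int \<Rightarrow> int \<Rightarrow> int \<Rightarrow> int \<Rightarrow> i12" where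
  "slide x0 h0 x1 h1 = (1, x0 - x1, 0, 0, 1, 0, 0, h0 - h1, 1, - x0, 0, - h0)"

lemma slide_det: "amap_det (slide x0 h0 x1 h1) \<in> {1, -1}"
  by (simp add: slide_def amap_det_def)

lemma slide_mem:
  "(x, w, h) \<in> amap (slide x0 h0 x1 h1) ` V \<longleftrightarrow> (x + x0 + w * (x1 - x0), w, h + h0 + w * (h1 - h0)) \<in> V"
proof
  assume "(x, w, h) \<in> amap (slide x0 h0 x1 h1) ` V"
  then show "(x + x0 + w * (x1 - x0), w, h + h0 + w * (h1 - h0)) \<in> V"
    by (auto simp: amap_def slide_def algebra_simps)
next
  assume "(x + x0 + w * (x1 - x0), w, h + h0 + w * (h1 - h0)) \<in> V"
  then show "(x, w, h) \<in> amap (slide x0 h0 x1 h1) ` V"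
    by (rule rev_image_eqI) (simp add: amap_def slide_def algebra_simps)
qed

lemma slide_layer:
  "(x, 0, h) \<in> amap (slide x0 h0 x1 h1) ` V \<longleftrightarrow> (x + x0, 0, h + h0) \<in> V"
  "(x, 1, h) \<in> amap (slide x0 h0 x1 h1) ` V \<longleftrightarrow> (x + x1, 1, h + h1) \<in> V"
  unfolding slide_mem by (simp_all add: algebra_simps)

lemma layered_slide: "layered V \<Longrightarrow> layered (amap (slide x0 h0 x1 h1) ` V)"
  by (erule layered_amap_w) (simp add: amap_def slide_def)

lemma Tsum_slide: "Tsum (amap (slide x0 h0 x1 h1) ` V) = am2 (1, 0, 0, 1, - x0 - x1, - h0 - h1) ` Tsum V"
proof (intro set_eqI iffI)
  fix z assume z: "z \<in> Tsum (amap (slide x0 h0 x1 h1) ` V)"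
  obtain p q where pq: "z = (p, q)" by (cases z)
  obtain x h x' h' where m: "(x + x0, 0, h + h0) \<in> V" "(x' + x1, 1, h' + h1) \<in> V" "p = x + x'" "q = h + h'"
    using z unfolding pq by (elim TsumE) (simp only: slide_layer)
  show "z \<in> am2 (1, 0, 0, 1, - x0 - x1, - h0 - h1) ` Tsum V"
    by (rule image_eqI[OF _ TsumI[OF m(1,2)]]) (simp add: pq m)
next
  fix z assume "z \<in> am2 (1, 0, 0, 1, - x0 - x1, - h0 - h1) ` Tsum V"
  then obtain p q where pq: "(p, q) \<in> Tsum V" "z = am2 (1, 0, 0, 1, - x0 - x1, - h0 - h1) (p, q)" by auto
  obtain x h x' h' where m: "(x, 0, h) \<in> V" "(x', 1, h') \<in> V" "p = x + x'" "q = h + h'" using pq(1) by (rule TsumE)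
  have "(x - x0 + (x' - x1), h - h0 + (h' - h1)) \<in> Tsum (amap (slide x0 h0 x1 h1) ` V)"
    by (rule TsumI) (use m in \<open>simp_all add: slide_layer\<close>)
  then show "z \<in> Tsum (amap (slide x0 h0 x1 h1) ` V)" by (simp add: pq m algebra_simps)
qed

lemma layered_flipw: "layered V \<Longrightarrow> layered (amap flipw ` V)"
proof -
  assume V: "layered V"
  have "w = 0 \<or> w = 1" if "(x, w, h) \<in> amap flipw ` V" for x w h
  proof -
    have "(x, 1 - w, h) \<in> V" using that by (simp only: flipw_mem)
    then have "1 - w = 0 \<or> 1 - w = 1" using V unfolding layered_def by blast
    then show ?thesis by auto
  qed
  then show "layered (amap flipw ` V)" unfolding layered_def by blast
qed

lemma good_flipw: "good (amap flipw ` V) \<Longrightarrow> good V"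
  by (rule good_amap[OF flipw_det])

definition swap_yz :: i12 where
  "swap_yz = (1, 0, 0, 0, 0, 1, 0, 1, 0, 0, 0, 0)"

lemma swap_yz: "amap_det swap_yz \<in> {1, -1}" "amap swap_yz (x, y, z) = (x, z, y)"
  by (simp_all add: swap_yz_def amap_det_def amap_def)

lemma swap_yz_good:
  assumes ws: "ws V" and o: "\<And>x y z. (x, y, z) \<in> V \<Longrightarrow> (x, z) \<in> {(0, 0), (1, 0), (0, 1)}"
  shows "good V"
proof (rule good_amap[OF swap_yz(1)], rule over1_good[OF ws_amap[OF ws swap_yz(1)]])
  show "over1 (amap swap_yz ` V)"
    unfolding over1_def
  proof
    fix v assume "v \<in> amap swap_yz ` V"
    then obtain x y z where m: "(x, y, z) \<in> V" "v = amap swap_yz (x, y, z)" by (metis imageE prod_cases3)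
    then show "case v of (x, y, z) \<Rightarrow> (x, y) \<in> {(0, 0), (1, 0), (0, 1)}" using o[OF m(1)] by (simp add: swap_yz(2))
  qed
qed

lemma over_xw_good:
  assumes ws: "ws V" and o: "\<And>x w h. (x, w, h) \<in> V \<Longrightarrow> (x, w) \<in> {(0, 0), (1, 0), (0, 1)}"
  shows "good V"
  by (rule over1_good[OF ws]) (use o in \<open>auto simp: over1_def\<close>)

text \<open>Each corner of \<open>k Delta_2\<close> is a sum of one point from each layer. Once the
  corner 0 is split as \<open>0 + 0\<close>, the splittings of the other two show that the layers
  span \<open>c0 Delta_2\<close> and \<open>c1 Delta_2\<close> with
  \<open>c0 + c1 = k\<close>.\<close>

lemma tri_good:
  assumes ws: "ws V" and lay: "layered V" and tri: "tri2 k (Tsum V)" and k: "k = 2 \<or> k = 3"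
  shows "good V"
proof -
  have T: "0 \<le> x \<and> 0 \<le> y \<and> x + y \<le> k" if "(x, y) \<in> Tsum V" for x y
    using tri that unfolding tri2_def by blast
  have corners: "(0, 0) \<in> Tsum V" "(k, 0) \<in> Tsum V" "(0, k) \<in> Tsum V" using tri by (auto simp: tri2_def)
  obtain x0 h0 x1 h1 where m: "(x0, 0, h0) \<in> V" "(x1, 1, h1) \<in> V" "0 = x0 + x1" "0 = h0 + h1"
    using corners(1) by (rule TsumE)
  define W where "W = amap (slide x0 h0 x1 h1) ` V"
  have W: "ws W" "layered W"
    unfolding W_def by (rule ws_amap[OF ws slide_det], rule layered_slide[OF lay])
  have "- x0 - x1 = 0" "- h0 - h1 = 0" using m by simp_all
  then have TW: "Tsum W = Tsum V" unfolding W_def Tsum_slide by (simp only: am2_id image_ident)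
  have o: "(0, 0, 0) \<in> W" "(0, 1, 0) \<in> W" using m(1,2) by (simp_all add: W_def slide_layer)
  have b0: "0 \<le> x" "0 \<le> h" if "(x, 0, h) \<in> W" for x h
    using T[of "x + 0" "h + 0"] TsumI[OF that o(2)] unfolding TW by auto
  have b1: "0 \<le> x" "0 \<le> h" if "(x, 1, h) \<in> W" for x h
    using T[of "0 + x" "0 + h"] TsumI[OF o(1) that] unfolding TW by auto
  obtain c0 e0 c1 e1 where c: "(c0, 0, e0) \<in> W" "(c1, 1, e1) \<in> W" "k = c0 + c1" "0 = e0 + e1"
    using corners(2) unfolding TW[symmetric] by (rule TsumE)
  obtain f0 d0 f1 d1 where d: "(f0, 0, d0) \<in> W" "(f1, 1, d1) \<in> W" "0 = f0 + f1" "k = d0 + d1"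
    using corners(3) unfolding TW[symmetric] by (rule TsumE)
  have z: "e0 = 0" "e1 = 0" "f0 = 0" "f1 = 0" using b0[OF c(1)] b1[OF c(2)] b0[OF d(1)] b1[OF d(2)] c(4) d(3) by auto
  have s: "x + x' + (h + h') \<le> k" if "(x, 0, h) \<in> W" "(x', 1, h') \<in> W" for x h x' h'
    using T[of "x + x'" "h + h'"] TsumI[OF that] unfolding TW by simp
  \<comment> \<open>The sums of points taken from different splittings are also bounded by
    \<open>k\<close>, so the two splittings agree.\<close>
  have cd: "d0 = c0" "d1 = c1" using s[OF c(1) d(2)] s[OF d(1) c(2)] c(3) d(4) z by auto
  have B0: "0 \<le> x \<and> 0 \<le> h \<and> x + h \<le> c0" if "(x, 0, h) \<in> W" for x h
    using b0[OF that] s[OF that c(2)] z c(3) by auto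
  have B1: "0 \<le> x \<and> 0 \<le> h \<and> x + h \<le> c1" if "(x, 1, h) \<in> W" for x h
    using b1[OF that] s[OF c(1) that] z c(3) by auto
  note M = o(1) c(1)[unfolded z] d(1)[unfolded z cd] o(2) c(2)[unfolded z] d(2)[unfolded z cd]
  have pos: "0 \<le> c0" "0 \<le> c1" using b0[OF c(1)] b1[OF c(2)] by auto
  have "good W"
  proof (cases "(c0, c1) = (1, 1)")
    case True
    show ?thesis
    proof (rule swap_yz_good[OF W(1)])
      fix x y z assume v: "(x, y, z) \<in> W"
      then have "y = 0 \<or> y = 1" using W(2) unfolding layered_def by blast
      then have "0 \<le> x \<and> 0 \<le> z \<and> x + z \<le> 1" using B0[of x z] B1[of x z] v True by auto
      then show "(x, z) \<in> {(0, 0), (1, 0), (0, 1)}" by auto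
    qed
  next
    case F: False
    show ?thesis
    proof (cases "c1 < c0")
      case True
      then have "(c0, c1) \<in> {(3, 0), (2, 1), (2, 0)}" using pos c(3) k by auto
      then show ?thesis by (rule simplex_good[OF W(2) _ M B0 B1])
    next
      case False
      then have cc: "(c1, c0) \<in> {(3, 0), (2, 1), (2, 0)}" using pos c(3) k F by auto
      have "good (amap flipw ` W)"
        by (rule simplex_good[OF layered_flipw[OF W(2)] cc]) (use M B0 B1 in \<open>simp_all add: flipw_mem\<close>)
      then show ?thesis by (rule good_flipw)
    qed
  qed
  then show ?thesis unfolding W_def by (rule good_amap[OF slide_det])
qed

lemma finite_min_x:
  fixes V :: "i3 set"
  assumes "finite V" "(x, w, h) \<in> V"
  obtains x0 h0 where "(x0, w, h0) \<in> V" "\<And>x h. (x, w, h) \<in> V \<Longrightarrow> x0 \<le> x"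
proof -
  let ?S = "{x. \<exists>h. (x, w, h) \<in> V}"
  have "?S \<subseteq> fst ` V" by force
  then have f: "finite ?S" using assms(1) finite_subset by blast
  have ne: "?S \<noteq> {}" using assms(2) by blast
  obtain h0 where "(Min ?S, w, h0) \<in> V" using Min_in[OF f ne] by blast
  moreover have "Min ?S \<le> x" if "(x, w, h) \<in> V" for x h using Min_le[OF f] that by blast
  ultimately show ?thesis using that by blast
qed

text \<open>When both layers start at \<open>x = 0\<close>, their widths add up to at most
  \<open>j\<close>. The pairs of widths \<open>(1, 0)\<close>, \<open>(2, 0)\<close> and
  \<open>(1, 1)\<close> lead to the unit triangle, the triangle with one edge doubled and the unit
  square as bases.\<close>

lemma strip_good:
  assumes ws: "ws V" and lay: "layered V" and strip: "strip2 j (Tsum V)"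
    and j: "j = 1 \<or> (j = 2 \<and> (\<exists>p. in2 (Tsum V) p))"
  shows "good V"
proof -
  obtain a b c d where ne: "(a, 0, b) \<in> V" "(c, 1, d) \<in> V" using ws_layers_nonempty[OF ws lay] by metis
  obtain x0 h0 where x0: "(x0, 0, h0) \<in> V" "\<And>x h. (x, 0, h) \<in> V \<Longrightarrow> x0 \<le> x"
    using finite_min_x[OF wsD(1)[OF ws] ne(1)] by metis
  obtain x1 h1 where x1: "(x1, 1, h1) \<in> V" "\<And>x h. (x, 1, h) \<in> V \<Longrightarrow> x1 \<le> x"
    using finite_min_x[OF wsD(1)[OF ws] ne(2)] by metis
  obtain t where t: "\<And>x y. (x, y) \<in> Tsum V \<Longrightarrow> t \<le> x \<and> x \<le> t + j" using strip unfolding strip2_def by blast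
  define W where "W = amap (slide x0 h0 x1 h1) ` V"
  have W: "ws W" "layered W"
    unfolding W_def by (rule ws_amap[OF ws slide_det], rule layered_slide[OF lay])
  have o: "(0, 0, 0) \<in> W" "(0, 1, 0) \<in> W" using x0(1) x1(1) by (simp_all add: W_def slide_layer)
  have pos0: "0 \<le> x" if "(x, 0, h) \<in> W" for x h using x0(2)[of "x + x0" "h + h0"] that by (simp add: W_def slide_layer)
  have pos1: "0 \<le> x" if "(x, 1, h) \<in> W" for x h using x1(2)[of "x + x1" "h + h1"] that by (simp add: W_def slide_layer)
  have s: "x + x' \<le> j" if "(x, 0, h) \<in> W" "(x', 1, h') \<in> W" for x h x' h'
  proof -
    have "(x + x0, 0, h + h0) \<in> V" "(x' + x1, 1, h' + h1) \<in> V" using that by (simp_all add: W_def slide_layer)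
    then have "x + x0 + (x' + x1) \<le> t + j" using t TsumI by blast
    moreover have "t \<le> x0 + x1" using t TsumI[OF x0(1) x1(1)] by blast
    ultimately show ?thesis by simp
  qed
  have bw: "w = 0 \<or> w = 1" if "(x, w, h) \<in> W" for x w h using W(2) that unfolding layered_def by blast
  have "good W"
  proof (cases "j = 1")
    case True
    show ?thesis
    proof (cases "\<exists>h. (1, 1, h) \<in> W")
      case F: False
      show ?thesis
      proof (rule over_xw_good[OF W(1)])
        fix x w h assume v: "(x, w, h) \<in> W"
        have "w = 0 \<or> w = 1" by (rule bw[OF v])
        then show "(x, w) \<in> {(0, 0), (1, 0), (0, 1)}"
        proof
          assume w: "w = 0"
          then have "0 \<le> x" "x \<le> 1" using pos0[of x h] s[of x h 0 0] v o True by auto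
          then show ?thesis using w by auto
        next
          assume w: "w = 1"
          then have "0 \<le> x" "x \<le> 1" "x \<noteq> 1" using pos1[of x h] s[of 0 0 x h] v o True F by auto
          then show ?thesis using w by auto
        qed
      qed
    next
      case T: True
      \<comment> \<open>Layer 1 reaches \<open>x = 1\<close>, so layer 0 is confined to
        \<open>x = 0\<close> and the layers are exchanged.\<close>
      then obtain h1 where h1: "(1, 1, h1) \<in> W" by blast
      have "good (amap flipw ` W)"
      proof (rule over_xw_good[OF ws_amap[OF W(1) flipw_det]])
        fix x w h assume "(x, w, h) \<in> amap flipw ` W"
        then have v: "(x, 1 - w, h) \<in> W" by (simp only: flipw_mem)
        then have "w = 1 \<or> w = 0" using bw[OF v] by auto
        then show "(x, w) \<in> {(0, 0), (1, 0), (0, 1)}"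
        proof
          assume w: "w = 1"
          then have "0 \<le> x" "x + 1 \<le> 1" using pos0[of x h] s[of x h 1 h1] v h1 True by auto
          then show ?thesis using w by auto
        next
          assume w: "w = 0"
          then have "0 \<le> x" "x \<le> 1" using pos1[of x h] s[of 0 0 x h] v o True by auto
          then show ?thesis using w by auto
        qed
      qed
      then show ?thesis by (rule good_flipw)
    qed
  next
    case False
    then have j2: "j = 2" and "\<exists>p. in2 (Tsum V) p" using j by auto
    then obtain p0 where "in2 (Tsum V) p0" by blast
    then have "in2 (Tsum W) (am2 (1, 0, 0, 1, - x0 - x1, - h0 - h1) p0)"
      unfolding W_def Tsum_slide by (intro in2_am2_imp) simp_all
    then obtain p q where i: "in2 (Tsum W) (p, q)" by (metis surj_pair)
    have u: "\<And>h h'. in2 (Tsum W) (1, h) \<Longrightarrow> in2 (Tsum W) (1, h') \<Longrightarrow> h = h'"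
      using Tsum_interior_unique[OF W] by (metis prod.inject)
    \<comment> \<open>An interior point has points of the sum on both sides, so it lies on
      \<open>x = 1\<close> and the width 2 is attained.\<close>
    have "\<exists>(x, y)\<in>Tsum W. x < p"
      using i[unfolded in2_def prod.case, rule_format, of 1 0] by simp
    then obtain x y where xy: "(x, y) \<in> Tsum W" "x < p" by auto
    have "\<exists>(x, y)\<in>Tsum W. p < x"
      using i[unfolded in2_def prod.case, rule_format, of "-1" 0] by simp
    then obtain x' y' where xy': "(x', y') \<in> Tsum W" "p < x'" by auto
    obtain a b c d where 1: "(a, 0, b) \<in> W" "(c, 1, d) \<in> W" "x = a + c" using xy(1) by (rule TsumE)
    obtain a' b' c' d' where 2: "(a', 0, b') \<in> W" "(c', 1, d') \<in> W" "x' = a' + c'" using xy'(1) by (rule TsumE)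
    have "0 \<le> x" "x' \<le> 2" using pos0[OF 1(1)] pos1[OF 1(2)] s[OF 2(1,2)] 1 2 j2 by auto
    then have p: "p = 1" and x': "a' + c' = 2" using xy xy' 2 by auto
    note i = i[unfolded p]
    have up0: "x \<le> 2" if "(x, 0, h) \<in> W" for x h using s[OF that o(2)] j2 by simp
    have up1: "x \<le> 2" if "(x, 1, h) \<in> W" for x h using s[OF o(1) that] j2 by simp
    consider "a' = 2 \<and> c' = 0" | "a' = 0 \<and> c' = 2" | "a' = 1 \<and> c' = 1"
      using x' pos0[OF 2(1)] pos1[OF 2(2)] by force
    then show ?thesis
    proof cases
      case c1: 1
      show ?thesis
      proof (rule triangle_good[OF wsD(1)[OF W(1)] _ _ o(1,2) i u])
        show "(2, 0, b') \<in> W" using 2(1) c1 by simp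
        fix x w h assume v: "(x, w, h) \<in> W"
        have "w = 0 \<or> w = 1" by (rule bw[OF v])
        then show "(w = 0 \<and> x \<in> {0, 1, 2}) \<or> (w = 1 \<and> x = 0)"
        proof
          assume w: "w = 0"
          then have "0 \<le> x" "x \<le> 2" using pos0[of x h] up0[of x h] v by auto
          then show ?thesis using w by auto
        next
          assume w: "w = 1"
          then have "0 \<le> x" "2 + x \<le> 2" using pos1[of x h] s[of 2 b' x h] v 2(1) c1 j2 by auto
          then show ?thesis using w by auto
        qed
      qed
    next
      case c2: 2
      have "good (amap flipw ` W)"
      proof (rule triangle_good[of _ d' 0 0 q])
        show "finite (amap flipw ` W)" using wsD(1)[OF W(1)] by simp
        show "(2, 0, d') \<in> amap flipw ` W" "(0, 0, 0) \<in> amap flipw ` W" "(0, 1, 0) \<in> amap flipw ` W"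
          using 2(2) c2 o by (simp_all add: flipw_mem)
        show "in2 (Tsum (amap flipw ` W)) (1, q)" unfolding Tsum_flipw by (rule i)
        show "h = h'" if "in2 (Tsum (amap flipw ` W)) (1, h)" "in2 (Tsum (amap flipw ` W)) (1, h')" for h h'
          using u that unfolding Tsum_flipw by blast
        fix x w h assume "(x, w, h) \<in> amap flipw ` W"
        then have v: "(x, 1 - w, h) \<in> W" by (simp only: flipw_mem)
        then have "w = 1 \<or> w = 0" using bw[OF v] by auto
        then show "(w = 0 \<and> x \<in> {0, 1, 2}) \<or> (w = 1 \<and> x = 0)"
        proof
          assume w: "w = 0"
          then have "0 \<le> x" "x \<le> 2" using pos1[of x h] up1[of x h] v by auto
          then show ?thesis using w by auto
        next
          assume w: "w = 1"
          then have "0 \<le> x" "x + 2 \<le> 2" using pos0[of x h] s[of x h 2 d'] v 2(2) c2 j2 by auto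
          then show ?thesis using w by auto
        qed
      qed
      then show ?thesis by (rule good_flipw)
    next
      case c3: 3
      show ?thesis
      proof (cases "(\<exists>h. (2, 0, h) \<in> W) \<or> (\<exists>h. (2, 1, h) \<in> W)")
        case True
        then show ?thesis
        proof
          assume "\<exists>h. (2, 0, h) \<in> W"
          then obtain h where "(2, 0, h) \<in> W" by blast
          then have "2 + c' \<le> 2" using s[OF _ 2(2)] j2 by blast
          then show ?thesis using c3 by simp
        next
          assume "\<exists>h. (2, 1, h) \<in> W"
          then obtain h where "(2, 1, h) \<in> W" by blast
          then have "a' + 2 \<le> 2" using s[OF 2(1)] j2 by blast
          then show ?thesis using c3 by simp
        qed
      next
        case F: False
        show ?thesis
        proof (rule square_good[OF wsD(1)[OF W(1)] _ _ _ o i u])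
          show "(1, 0, b') \<in> W" "(1, 1, d') \<in> W" using 2 c3 by simp_all
          fix x w h assume v: "(x, w, h) \<in> W"
          have w: "w = 0 \<or> w = 1" by (rule bw[OF v])
          then have "0 \<le> x" "x \<le> 2" "x \<noteq> 2" using pos0[of x h] up0[of x h] pos1[of x h] up1[of x h] v F by auto
          then show "x \<in> {0, 1} \<and> w \<in> {0, 1}" using w by auto
        qed
      qed
    qed
  qed
  then show ?thesis unfolding W_def by (rule good_amap[OF slide_det])
qed

lemma cl2_am2_functional:
  assumes "q \<in> cl2 T" "am2 g q = (x0, y0)"
  obtains x y where "(x, y) \<in> am2 g ` T" "m * (x - x0) + n * (y - y0) \<le> 0"
proof -
  obtain a b c d s t where g: "g = (a, b, c, d, s, t)" by (cases g)
  obtain u v where q: "q = (u, v)" by (cases q)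
  have "\<exists>(x, y)\<in>T. (m * a + n * c) * (x - u) + (m * b + n * d) * (y - v) \<le> 0"
    using assms(1) unfolding cl2_def q mem_Collect_eq prod.case by blast
  then obtain z where z: "z \<in> T" "case z of (x, y) \<Rightarrow> (m * a + n * c) * (x - u) + (m * b + n * d) * (y - v) \<le> 0" by (rule bexE)
  obtain x y where xy: "z = (x, y)" by (cases z)
  obtain x' y' where xy': "am2 g (x, y) = (x', y')" by (cases "am2 g (x, y)")
  have "m * (x' - x0) + n * (y' - y0) \<le> 0"
    using am2_functional[of a b c d s t u v x0 y0 x y x' y' m n] z(2) assms(2) xy' by (simp add: g q xy)
  moreover have "(x', y') \<in> am2 g ` T" using z(1) xy xy' by (metis imageI)
  ultimately show ?thesis using that by blast
qed

text \<open>At each corner of the triangle some functional has its only minimum among the lattice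
  points of the triangle, so \<open>cl2\<close> cannot have added that corner.\<close>

lemma tri2_cl2:
  assumes "tri2 k (am2 g ` cl2 T)" shows "tri2 k (am2 g ` T)"
proof -
  have sub: "am2 g ` T \<subseteq> am2 g ` cl2 T" using subset_cl2 by blast
  have b: "0 \<le> x \<and> 0 \<le> y \<and> x + y \<le> k" if "(x, y) \<in> am2 g ` T" for x y
    using assms sub that unfolding tri2_def by blast
  have c: "(x0, y0) \<in> am2 g ` T"
    if x0: "(x0, y0) \<in> am2 g ` cl2 T"
      and f: "\<And>x y. 0 \<le> x \<Longrightarrow> 0 \<le> y \<Longrightarrow> x + y \<le> k \<Longrightarrow> m * (x - x0) + n * (y - y0) \<le> 0 \<Longrightarrow> (x, y) = (x0, y0)"
    for x0 y0 m n
  proof -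
    obtain q where q: "q \<in> cl2 T" "am2 g q = (x0, y0)" using x0 by auto
    obtain x y where xy: "(x, y) \<in> am2 g ` T" "m * (x - x0) + n * (y - y0) \<le> 0"
      using cl2_am2_functional[OF q] by metis
    then show ?thesis using f[of x y] b[OF xy(1)] by auto
  qed
  have m: "(0, 0) \<in> am2 g ` cl2 T" "(k, 0) \<in> am2 g ` cl2 T" "(0, k) \<in> am2 g ` cl2 T" using assms by (auto simp: tri2_def)
  have "(0, 0) \<in> am2 g ` T" by (rule c[OF m(1), of 1 1]) auto
  moreover have "(k, 0) \<in> am2 g ` T" by (rule c[OF m(2), of "-1" 0]) auto
  moreover have "(0, k) \<in> am2 g ` T" by (rule c[OF m(3), of 0 "-1"]) auto
  ultimately show ?thesis using b unfolding tri2_def by blast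
qed

text \<open>The Minkowski sum of the layers has at most one interior lattice point, so
  \<open>hollow2\<close> or \<open>reflexive2\<close> puts it into a strip or a triangle;
  \<open>lift\<close> carries the planar map to space.\<close>

theorem layered_good:
  assumes ws: "ws V" and lay: "layered V" shows "good V"
proof -
  let ?T = "Tsum V"
  obtain j k where jk: "fits2 j k (cl2 ?T)" "(j = 1 \<or> (j = 2 \<and> (\<exists>p. in2 ?T p)))" "k = 2 \<or> k = 3"
  proof (cases "\<exists>p. in2 ?T p")
    case False
    have "fits2 1 2 (cl2 ?T)" by (rule hollow2[OF closed2_cl2]) (use False in \<open>simp only: in2_cl2; blast\<close>)
    then show ?thesis using that by blast
  next
    case True
    then obtain a b where ab: "in2 ?T (a, b)" by (metis surj_pair)
    let ?g = "(1, 0, 0, 1, - a, - b)"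
    have U: "U2 ?g" by simp
    have u: "p = (a, b)" if "in2 (cl2 ?T) p" for p
      using Tsum_interior_unique[OF ws lay] ab that by (metis in2_cl2)
    have "fits2 2 3 (am2 ?g ` cl2 ?T)"
    proof (rule reflexive2)
      show "closed2 (am2 ?g ` cl2 ?T)" by (rule closed2_am2[OF U closed2_cl2])
      have "in2 (am2 ?g ` cl2 ?T) (am2 ?g (a, b))" by (rule in2_am2_imp[OF U]) (simp add: in2_cl2 ab)
      then show "in2 (am2 ?g ` cl2 ?T) (0, 0)" by simp
      show "p = (0, 0)" if "in2 (am2 ?g ` cl2 ?T) p" for p
        using am2_transport(2)[OF U closed2_cl2 u that] by simp
    qed
    then have "fits2 2 3 (cl2 ?T)" by (rule fits2_am2[OF U])
    then show ?thesis using that True by blast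
  qed
  obtain g where g: "U2 g" "strip2 j (am2 g ` cl2 ?T) \<or> tri2 k (am2 g ` cl2 ?T)"
    using jk(1) unfolding fits2_def by blast
  define W where "W = amap (lift g) ` V"
  have W: "ws W" "layered W" "Tsum W = am2 g ` ?T"
    unfolding W_def by (rule ws_amap[OF ws lift_det[OF g(1)]], rule layered_lift[OF lay], rule Tsum_lift)
  from g(2) have "good W"
  proof
    assume "strip2 j (am2 g ` cl2 ?T)"
    then have "strip2 j (Tsum W)" unfolding W(3) strip2_def using subset_cl2[of ?T] by blast
    moreover have "j = 1 \<or> (j = 2 \<and> (\<exists>p. in2 (Tsum W) p))"
      using jk(2) in2_am2_imp[OF g(1)] unfolding W(3) by blast
    ultimately show ?thesis by (rule strip_good[OF W(1,2)])
  next
    assume "tri2 k (am2 g ` cl2 ?T)"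
    then have "tri2 k (Tsum W)" unfolding W(3) by (rule tri2_cl2)
    then show ?thesis by (rule tri_good[OF W(1,2) _ jk(3)])
  qed
  then show ?thesis unfolding W_def by (rule good_amap[OF lift_det[OF g(1)]])
qed

lemma flat_good:
  assumes ws: "ws V" and "flat V" shows "good V"
proof (rule good_amap[OF swap_yz(1)], rule layered_good[OF ws_amap[OF ws swap_yz(1)]])
  show "layered (amap swap_yz ` V)"
    unfolding layered_def
  proof
    fix v assume "v \<in> amap swap_yz ` V"
    then obtain x y z where m: "(x, y, z) \<in> V" "v = amap swap_yz (x, y, z)" by (metis imageE prod_cases3)
    then have "0 \<le> z \<and> z \<le> 1" using assms(2) unfolding flat_def by blast
    then show "case v of (x, w, h) \<Rightarrow> w = 0 \<or> w = 1" using m(2) by (auto simp: swap_yz(2))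
  qed
qed

subsection \<open>Polytopes over twice the unit triangle\<close>

text \<open>The four parity classes of \<open>half_enum\<close> are checked separately; the certificates name a
  representative, or \<open>-1\<close> for a polytope of width one, together with the map that shows it.\<close>

lemma half_check00: "list_all2 half_check (half_enum 0 0) half_certs00"
  by code_simp

lemma half_check01: "list_all2 half_check (half_enum 0 1) half_certs01"
  by code_simp

lemma half_check10: "list_all2 half_check (half_enum 1 0) half_certs10"
  by code_simp

lemma half_check11: "list_all2 half_check (half_enum 1 1) half_certs11"
  by code_simp

lemma half_check_good:
  assumes "half_check c k" "ws (set (half_verts c))" shows "good (set (half_verts c))"
proof -
  obtain i j where k: "k = (i, j)" by (cases k)
  define g where "g = look half_maps j"
  let ?V = "set (half_verts c)"
  have g: "amap_det g \<in> {1, -1}"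
    using assms(1) unfolding half_check_def k g_def Let_def prod.case by blast
  show ?thesis
  proof (rule good_amap[OF g])
    have ch: "if i < 0 then list_all (\<lambda>(x, y, z). 0 \<le> z \<and> z \<le> 1) (map (amap g) (half_verts c))
        else i < 80 \<and> amap g ` ?V = set (look half_tree i)"
      using assms(1) unfolding half_check_def k g_def Let_def prod.case set_map by blast
    show "good (amap g ` ?V)"
    proof (cases "i < 0")
      case True
      then have "flat (amap g ` ?V)" using ch unfolding flat_def list_all_iff by simp
      then show ?thesis by (rule flat_good[OF ws_amap[OF assms(2) g]])
    next
      case False
      then have "look half_tree i \<in> set all_reps" "amap g ` ?V = set (look half_tree i)"
        using ch by (auto intro: look_half)
      then show ?thesis unfolding good_def using unimodular_equiv_refl by metis
    qed
  qed
qed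

lemma low2_le:
  "low2 A B C D E F \<le> A + B + C + 2" "low2 A B C D E F \<le> 2 * D + C + 2"
  "low2 A B C D E F \<le> 2 * E + B + 2" "low2 A B C D E F \<le> 2 * F + A + 2"
  unfolding low2_def by (simp_all add: min_le_iff_disj)

text \<open>The assumptions are the negated inequalities of an upward normal
  \<open>(m, n, k)\<close>, cleared of denominators. Adding three of them at base points with sum
  \<open>(2, 2)\<close> cancels \<open>m\<close> and \<open>n\<close> and leaves
  \<open>k * t - 1 \<le> k * S\<close>, which contradicts \<open>S + 2 \<le> t\<close>.\<close>

lemma half_core:
  fixes k :: int
  assumes k: "0 < k" and t: "low2 A B C D E F \<le> t"
    and A: "2 * (m + n) + k * t - 1 \<le> 3 * (k * A)" and B: "2 * (m + n) + k * t - 1 \<le> 3 * (2 * m + k * B)"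
    and C: "2 * (m + n) + k * t - 1 \<le> 3 * (2 * n + k * C)"
    and D: "2 * D < A + B \<Longrightarrow> 2 * (m + n) + k * t - 1 \<le> 3 * (m + k * D)"
    and E: "2 * E < A + C \<Longrightarrow> 2 * (m + n) + k * t - 1 \<le> 3 * (n + k * E)"
    and F: "2 * F < B + C \<Longrightarrow> 2 * (m + n) + k * t - 1 \<le> 3 * (m + n + k * F)"
  shows False
proof -
  define q where "q = 2 * (m + n) + k * t - 1"
  note A = A[folded q_def] and B = B[folded q_def] and C = C[folded q_def]
  note D = D[folded q_def] and E = E[folded q_def] and F = F[folded q_def]
  \<comment> \<open>A midpoint column with default height need not contain a point; its bound is the
    average of the bounds at the ends of the edge.\<close>
  have mid: "q \<le> 3 * (c + k * Z)"
    if "2 * Z < X + Y \<Longrightarrow> q \<le> 3 * (c + k * Z)" "q \<le> 3 * (a + k * X)" "q \<le> 3 * (b + k * Y)" "a + b = 2 * c"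
    for X Y Z a b c
  proof (cases "2 * Z < X + Y")
    case False
    then have "k * (X + Y) \<le> k * (2 * Z)" using k by simp
    then have "k * X + k * Y \<le> 2 * (k * Z)" by (simp add: algebra_simps)
    then have "2 * q \<le> 2 * (3 * (c + k * Z))" using that(2-4) by (simp add: algebra_simps)
    then show ?thesis by simp
  qed (use that(1) in blast)
  have D': "q \<le> 3 * (m + k * D)" by (rule mid[of D A B m 0 "2 * m"]) (use D A B in auto)
  have E': "q \<le> 3 * (n + k * E)" by (rule mid[of E A C n 0 "2 * n"]) (use E A C in auto)
  have F': "q \<le> 3 * (m + n + k * F)" by (rule mid[of F B C "m + n" "2 * m" "2 * n"]) (use F B C in auto)
  have fin: False if le: "3 * q \<le> 3 * (2 * (m + n) + k * S)" and S: "S + 2 \<le> t" for S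
  proof -
    have "k * (S + 2) \<le> k * t" using k S by simp
    then have "k * S + 2 * k \<le> k * t" by (simp add: algebra_simps)
    moreover have "k * t - 1 \<le> k * S" using le by (simp add: q_def)
    ultimately show False using k by linarith
  qed
  have "A + B + C + 2 - (if even (B - A) \<and> even (C - A) then 0 else 1) \<le> t \<or> 2 * D + C + 2 \<le> t \<or>
      2 * E + B + 2 \<le> t \<or> 2 * F + A + 2 \<le> t \<or> D + E + F + 2 \<le> t"
    using t unfolding low2_def by (simp only: min_le_iff_disj)
  then show False
  proof (elim disjE)
    assume "2 * D + C + 2 \<le> t"
    then show False by (rule fin[rotated]) (use D' C in \<open>simp add: algebra_simps\<close>)
  next
    assume "2 * E + B + 2 \<le> t"
    then show False by (rule fin[rotated]) (use E' B in \<open>simp add: algebra_simps\<close>)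
  next
    assume "2 * F + A + 2 \<le> t"
    then show False by (rule fin[rotated]) (use F' A in \<open>simp add: algebra_simps\<close>)
  next
    assume "D + E + F + 2 \<le> t"
    then show False by (rule fin[rotated]) (use D' E' F' in \<open>simp add: algebra_simps\<close>)
  next
    assume t: "A + B + C + 2 - (if even (B - A) \<and> even (C - A) then 0 else 1) \<le> t"
    have sum: "3 * q \<le> 3 * (2 * (m + n) + k * (A + B + C))" using A B C by (simp add: algebra_simps)
    show False
    proof (cases "A + B + C + 2 \<le> t")
      case True
      then show False by (rule fin[OF sum])
    next
      case False
      \<comment> \<open>With excess 1 only \<open>k = 1\<close> remains, and the three corner bounds
        become equalities; they make the corner heights congruent mod 2.\<close>
      then have odd: "\<not> (even (B - A) \<and> even (C - A))" and te: "t = A + B + C + 1" using t by (auto split: if_splits)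
      have "k * t = k * (A + B + C) + k" by (simp add: te algebra_simps)
      then have "k \<le> 1" using sum by (simp add: q_def)
      then have "k = 1" using k by simp
      then have "q = 2 * (m + n) + (A + B + C)" "q \<le> 3 * A" "q \<le> 3 * (2 * m + B)" "q \<le> 3 * (2 * n + C)"
        using A B C by (simp_all add: q_def te)
      then have "B - A = 2 * (- m)" "C - A = 2 * (- n)" by presburger+
      then show False using odd by (metis dvd_triv_left)
    qed
  qed
qed

text \<open>Normals with \<open>k > 0\<close> are settled by the lower ends and, after reversal of
  all heights, those with \<open>k < 0\<close> by the upper ends; for \<open>k = 0\<close> only the
  base triangle matters.\<close>

lemma half_interior:
  assumes m: "(0, 0, lA) \<in> W" "(0, 0, uA) \<in> W" "(2, 0, lB) \<in> W" "(2, 0, uB) \<in> W" "(0, 2, lC) \<in> W" "(0, 2, uC) \<in> W"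
    and D: "2 * lD < lA + lB \<Longrightarrow> (1, 0, lD) \<in> W" "uA + uB < 2 * uD \<Longrightarrow> (1, 0, uD) \<in> W"
    and E: "2 * lE < lA + lC \<Longrightarrow> (0, 1, lE) \<in> W" "uA + uC < 2 * uE \<Longrightarrow> (0, 1, uE) \<in> W"
    and F: "2 * lF < lB + lC \<Longrightarrow> (1, 1, lF) \<in> W" "uB + uC < 2 * uF \<Longrightarrow> (1, 1, uF) \<in> W"
    and t: "low2 lA lB lC lD lE lF \<le> t" "low2 (- uA) (- uB) (- uC) (- uD) (- uE) (- uF) \<le> - t"
  shows "(1, 1, of_int t / 2) \<in> FinZ (3 / 2) W"
proof -
  have "\<exists>v\<in>W. 3 / 2 * of_int (pair n v) + 1 \<le> (1, 1, of_int t / 2) \<bullet> pt n" if ne: "n \<noteq> (0, 0, 0)" for n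
  proof (rule ccontr)
    assume neg: "\<not> ?thesis"
    obtain m' n' k where n: "n = (m', n', k)" by (cases n)
    have low: "2 * (m' + n') + k * t - 1 \<le> 3 * (m' * x + n' * y + k * z)" if v: "(x, y, z) \<in> W" for x y z
    proof -
      have "(1, 1, of_int t / 2) \<bullet> pt n < 3 / 2 * of_int (pair n (x, y, z)) + 1" using neg v by force
      then have "real_of_int (2 * (m' + n') + k * t) < real_of_int (3 * (m' * x + n' * y + k * z) + 2)"
        by (simp add: n algebra_simps)
      then have "2 * (m' + n') + k * t < 3 * (m' * x + n' * y + k * z) + 2" by (simp only: of_int_less_iff)
      then show ?thesis by simp
    qed
    consider "0 < k" | "0 < - k" | "k = 0" by linarith
    then show False
    proof cases
      case 1
      show False
        by (rule half_core[OF 1 t(1), of m' n'])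
          (use low[OF m(1)] low[OF m(3)] low[OF m(5)] low[OF D(1)] low[OF E(1)] low[OF F(1)] in \<open>simp_all add: algebra_simps\<close>)
    next
      case 2
      show False
        by (rule half_core[OF 2 t(2), of m' n'])
          (use low[OF m(2)] low[OF m(4)] low[OF m(6)] low[OF D(2)] low[OF E(2)] low[OF F(2)] in \<open>simp_all add: algebra_simps\<close>)
    next
      case 3
      have "2 * (m' + n') - 1 \<le> 0" "2 * (m' + n') - 1 \<le> 6 * m'" "2 * (m' + n') - 1 \<le> 6 * n'"
        using low[OF m(1)] low[OF m(3)] low[OF m(5)] 3 by simp_all
      then have "m' = 0 \<and> n' = 0" by presburger
      then show False using ne n 3 by simp
    qed
  qed
  then show ?thesis unfolding FinZ_def mem_Collect_eq by blast
qed

text \<open>The three edge normals of \<open>2 Delta_2\<close>. At \<open>d = 3/2\<close> they leave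
  only the line over \<open>(1, 1)\<close>.\<close>

lemma over2_D:
  assumes "over2 V" "0 \<le> d" "(p, q, r) \<in> FinZ d V"
  shows "1 \<le> p" "1 \<le> q" "p + q \<le> 2 * d - 1"
proof -
  obtain v1 where v1: "v1 \<in> V" "d * of_int (pair (1, 0, 0) v1) + 1 \<le> (p, q, r) \<bullet> pt (1, 0, 0)"
    by (rule FinZ_D[OF assms(3), of 1 0 0]) simp_all
  obtain v2 where v2: "v2 \<in> V" "d * of_int (pair (0, 1, 0) v2) + 1 \<le> (p, q, r) \<bullet> pt (0, 1, 0)"
    by (rule FinZ_D[OF assms(3), of 0 1 0]) simp_all
  obtain v3 where v3: "v3 \<in> V" "d * of_int (pair (-1, -1, 0) v3) + 1 \<le> (p, q, r) \<bullet> pt (-1, -1, 0)"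
    by (rule FinZ_D[OF assms(3), of "-1" "-1" 0]) simp_all
  have b: "0 \<le> pair (1, 0, 0) v \<and> 0 \<le> pair (0, 1, 0) v \<and> - 2 \<le> pair (-1, -1, 0) v" if "v \<in> V" for v
    using assms(1) that by (cases v) (auto simp: over2_def)
  have "0 \<le> d * of_int (pair (1, 0, 0) v1)" "0 \<le> d * of_int (pair (0, 1, 0) v2)"
    using b[OF v1(1)] b[OF v2(1)] assms(2) by simp_all
  then show "1 \<le> p" "1 \<le> q" using v1(2) v2(2) by simp_all
  have "real_of_int (- 2) \<le> of_int (pair (-1, -1, 0) v3)" using b[OF v3(1)] by (simp only: of_int_le_iff)
  then have "d * (- 2) \<le> d * of_int (pair (-1, -1, 0) v3)" using assms(2) by (intro mult_left_mono) auto
  then show "p + q \<le> 2 * d - 1" using v3(2) by simp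
qed

lemma over2_empty:
  assumes "over2 V" "0 \<le> d" "d < 3 / 2" shows "FinZ d V = {}"
proof (rule ccontr)
  assume "FinZ d V \<noteq> {}"
  then obtain p q r where "(p, q, r) \<in> FinZ d V" by auto
  from over2_D[OF assms(1,2) this] show False using assms(3) by simp
qed

lemma relayer_good:
  assumes ws: "ws V" and g: "amap_det g \<in> {1, -1}"
    and l: "\<And>x y z. (x, y, z) \<in> V \<Longrightarrow> fst (snd (amap g (x, y, z))) = 0 \<or> fst (snd (amap g (x, y, z))) = 1"
  shows "good V"
proof (rule good_amap[OF g], rule layered_good[OF ws_amap[OF ws g]])
  show "layered (amap g ` V)"
    unfolding layered_def
  proof
    fix v assume "v \<in> amap g ` V"
    then obtain x y z where m: "(x, y, z) \<in> V" "v = amap g (x, y, z)" by (metis imageE prod_cases3)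
    then show "case v of (x, w, h) \<Rightarrow> w = 0 \<or> w = 1" using l[OF m(1)] by (simp add: split_beta)
  qed
qed

text \<open>If a corner column is empty, the other base points lie on two adjacent lattice lines and
  the width is one. Otherwise every integer \<open>t\<close> from \<open>L\<close> to
  \<open>U\<close> gives a point of \<open>F(3/2 W)\<close>, so \<open>U \<le> L\<close>, and the
  column heights occur in \<open>half_enum\<close>.\<close>

theorem over2_good:
  assumes ws: "ws V" and o: "over2 V" shows "good V"
proof -
  have b: "0 \<le> x \<and> 0 \<le> y \<and> x + y \<le> 2" if "(x, y, z) \<in> V" for x y z
    using bspec[OF o[unfolded over2_def] that] by simp
  have six: "(x, y) \<in> {(0, 0), (2, 0), (0, 2), (1, 0), (0, 1), (1, 1)}" if v: "(x, y, z) \<in> V" for x y z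
  proof -
    have "x = 0 \<or> x = 1 \<or> x = 2" "y = 0 \<or> y = 1 \<or> y = 2" using b[OF v] by linarith+
    then show ?thesis using b[OF v] by auto
  qed
  consider "\<nexists>z. (0, 0, z) \<in> V" | "\<nexists>z. (2, 0, z) \<in> V" | "\<nexists>z. (0, 2, z) \<in> V" |
    "(\<exists>z. (0, 0, z) \<in> V) \<and> (\<exists>z. (2, 0, z) \<in> V) \<and> (\<exists>z. (0, 2, z) \<in> V)" by blast
  then show ?thesis
  proof cases
    \<comment> \<open>Without \<open>(0, 0)\<close> the base points have \<open>x + y\<close> equal
      to 1 or 2.\<close>
    case 1
    show ?thesis
    proof (rule relayer_good[OF ws, of "(1, 0, 0, 1, 1, 0, 0, 0, 1, 0, -1, 0)"])
      fix x y z assume v: "(x, y, z) \<in> V"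
      then have "x \<noteq> 0 \<or> y \<noteq> 0" using 1 by auto
      then show "fst (snd (amap (1, 0, 0, 1, 1, 0, 0, 0, 1, 0, -1, 0) (x, y, z))) = 0 \<or>
          fst (snd (amap (1, 0, 0, 1, 1, 0, 0, 0, 1, 0, -1, 0) (x, y, z))) = 1"
        using six[OF v] by (auto simp: amap_def)
    qed (simp add: amap_det_def)
  next
    case 2
    show ?thesis
    proof (rule relayer_good[OF ws, of "(0, 1, 0, 1, 0, 0, 0, 0, 1, 0, 0, 0)"])
      fix x y z assume v: "(x, y, z) \<in> V"
      then have "x \<noteq> 2 \<or> y \<noteq> 0" using 2 by auto
      then show "fst (snd (amap (0, 1, 0, 1, 0, 0, 0, 0, 1, 0, 0, 0) (x, y, z))) = 0 \<or>
          fst (snd (amap (0, 1, 0, 1, 0, 0, 0, 0, 1, 0, 0, 0) (x, y, z))) = 1"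
        using six[OF v] by (auto simp: amap_def)
    qed (simp add: amap_det_def)
  next
    case 3
    show ?thesis
    proof (rule relayer_good[OF ws, of "(1, 0, 0, 0, 1, 0, 0, 0, 1, 0, 0, 0)"])
      fix x y z assume v: "(x, y, z) \<in> V"
      then have "x \<noteq> 0 \<or> y \<noteq> 2" using 3 by auto
      then show "fst (snd (amap (1, 0, 0, 0, 1, 0, 0, 0, 1, 0, 0, 0) (x, y, z))) = 0 \<or>
          fst (snd (amap (1, 0, 0, 0, 1, 0, 0, 0, 1, 0, 0, 0) (x, y, z))) = 1"
        using six[OF v] by (auto simp: amap_def)
    qed (simp add: amap_det_def)
  next
    case 4
    note fin = wsD(1)[OF ws]
    obtain a ua where eA: "ends V 0 0 a ua" using 4 ends_ex[OF fin] by metis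
    obtain b' ub where eB: "ends V 2 0 b' ub" using 4 ends_ex[OF fin] by metis
    obtain c uc where eC: "ends V 0 2 c uc" using 4 ends_ex[OF fin] by metis
    \<comment> \<open>A shear changes the differences of corner heights by even amounts, so four
      parity classes remain.\<close>
    define k l where "k = (b' - a) div 2" and "l = (c - a) div 2"
    define g where "g = shear (- k) (- l) (- a)"
    have g: "amap_det g \<in> {1, -1}" unfolding g_def by (rule shear_det)
    define W where "W = amap g ` V"
    have wsW: "ws W" unfolding W_def by (rule ws_amap[OF ws g])
    have oW: "over2 W" unfolding over2_def
    proof
      fix v assume "v \<in> W"
      then obtain x y z where v: "v = (x, y, z)" "(x, y, z) \<in> W" by (cases v) blast
      then show "case v of (x, y, z) \<Rightarrow> 0 \<le> x \<and> 0 \<le> y \<and> x + y \<le> 2"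
        using b unfolding W_def g_def shear_mem by simp
    qed
    have sixW: "(x, y) \<in> {(0, 0), (2, 0), (0, 2), (1, 0), (0, 1), (1, 1)}" if "(x, y, z) \<in> W" for x y z
      using six that unfolding W_def g_def shear_mem by blast
    define uA lB uB lC uC where "uA = ua - a" and "lB = b' - a - 2 * k" and "uB = ub - a - 2 * k"
      and "lC = c - a - 2 * l" and "uC = uc - a - 2 * l"
    have E: "ends W 0 0 0 uA" "ends W 2 0 lB uB" "ends W 0 2 lC uC"
      using ends_shear[OF eA, of "- k" "- l" "- a"] ends_shear[OF eB, of "- k" "- l" "- a"] ends_shear[OF eC, of "- k" "- l" "- a"]
      by (simp_all add: W_def g_def uA_def lB_def uB_def lC_def uC_def algebra_simps)
    have par: "lB = 0 \<or> lB = 1" "lC = 0 \<or> lC = 1" unfolding lB_def lC_def k_def l_def by presburger+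
    note finW = wsD(1)[OF wsW]
    obtain lD uD where mD: "midcol W 1 0 (0 + lB) (uA + uB) lD uD" using midcol_ex[OF finW] .
    obtain lE uE where mE: "midcol W 0 1 (0 + lC) (uA + uC) lE uE" using midcol_ex[OF finW] .
    obtain lF uF where mF: "midcol W 1 1 (lB + lC) (uB + uC) lF uF" using midcol_ex[OF finW] .
    define L U where "L = low2 0 lB lC lD lE lF" and "U = - low2 (- uA) (- uB) (- uC) (- uD) (- uE) (- uF)"
    have int: "(1, 1, of_int t / 2) \<in> FinZ (3 / 2) W" if "L \<le> t" "t \<le> U" for t
      by (rule half_interior[of 0 W uA lB uB lC uC lD uD lE uE lF uF t])
        (use E mD mE mF that in \<open>simp_all add: ends_def midcol_def L_def U_def\<close>)
    have UL: "U \<le> L"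
    proof (rule ccontr)
      assume "\<not> U \<le> L"
      then have "(1, 1, of_int L / 2) \<in> FinZ (3 / 2) W" "(1, 1, of_int U / 2) \<in> FinZ (3 / 2) W" "of_int L / 2 \<noteq> (of_int U / 2 :: real)"
        using int[of L] int[of U] by simp_all
      then show False using ws_not_two_points[OF wsW, of "3 / 2"] over2_empty[OF oW] by fastforce
    qed
    define cc :: i12 where "cc = (0, uA, lB, uB, lC, uC, lD, uD, lE, uE, lF, uF)"
    have Lb: "L \<le> lB + lC + 2" "L \<le> 2 * lD + lC + 2" "L \<le> 2 * lE + lB + 2" "L \<le> 2 * lF + 2"
      using low2_le[of 0 lB lC lD lE lF] by (simp_all add: L_def)
    have Ub: "uA + uB + uC - 2 \<le> U" "2 * uD + uC - 2 \<le> U" "2 * uE + uB - 2 \<le> U" "2 * uF + uA - 2 \<le> U"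
      using low2_le[of "- uA" "- uB" "- uC" "- uD" "- uE" "- uF"] by (simp_all add: U_def)
    have pos: "0 \<le> uA" "lB \<le> uB" "lC \<le> uC" using E endsD(5) by blast+
    have M: "lD \<le> cd2 lB" "lE \<le> cd2 lC" "lF \<le> cd2 (lB + lC)"
      "(uA + uB) div 2 \<le> uD" "(uA + uC) div 2 \<le> uE" "(uB + uC) div 2 \<le> uF"
      using mD mE mF by (simp_all add: midcol_def)
    have m: "uA \<in> set [0..4]" "uB \<in> set [lB..lB + 4 - uA]" "uC \<in> set [lC..lC + 4 - uA - (uB - lB)]"
      unfolding set_upto using Lb Ub UL pos by simp_all
    have m2: "lD \<in> set [cd2 (uA + uB + uC - lC - 4)..cd2 lB]" "lE \<in> set [cd2 (uA + uC + uB - lB - 4)..cd2 lC]"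
      "lF \<in> set [cd2 (uB + uC + uA - 4)..cd2 (lB + lC)]"
      unfolding set_upto atLeastAtMost_iff using Lb Ub UL M(1-3) by (simp_all add: cd2_def)
    have m3: "uD \<in> set [(uA + uB) div 2..(4 + lB - uC + lC) div 2]" "uE \<in> set [(uA + uC) div 2..(4 + lC - uB + lB) div 2]"
      "uF \<in> set [(uB + uC) div 2..(4 + lB + lC - uA) div 2]"
      unfolding set_upto atLeastAtMost_iff using Lb Ub UL M(4-6) by (simp_all; linarith)+
    have "cc \<in> set (half_enum lB lC)"
      unfolding half_enum_def cc_def
      by (rule in_concat_map[OF m(1)], rule in_concat_map[OF m(2)], rule in_concat_map[OF m(3)],
          rule in_concat_map[OF m2(1)], rule in_concat_map[OF m2(2)], rule in_concat_map[OF m2(3)],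
          rule in_concat_map[of L], simp add: L_def,
          rule in_concat_map[OF m3(1)], rule in_concat_map[OF m3(2)], rule in_concat_map[OF m3(3)])
        (use UL in \<open>simp add: U_def\<close>)
    moreover have "\<exists>ks. list_all2 half_check (half_enum lB lC) ks"
      using par half_check00 half_check01 half_check10 half_check11 by metis
    ultimately obtain key where key: "half_check cc key"
      by (metis in_set_conv_nth list_all2_nthD)
    have hull: "hullZ W = hullZ (set (half_verts cc))"
    proof (rule hullZ_eqI)
      let ?X = "set (half_verts cc)"
      show "?X \<subseteq> W" using E mD mE mF by (auto simp: cc_def half_verts_def ends_def midcol_def split: if_splits)
      fix v assume v: "v \<in> W"
      obtain x y z where xyz: "v = (x, y, z)" by (cases v)
      have X: "(0, 0, 0) \<in> ?X" "(0, 0, uA) \<in> ?X" "(2, 0, lB) \<in> ?X" "(2, 0, uB) \<in> ?X" "(0, 2, lC) \<in> ?X" "(0, 2, uC) \<in> ?X"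
        by (simp_all add: cc_def half_verts_def)
      have XD: "2 * lD < 0 + lB \<Longrightarrow> (1, 0, lD) \<in> ?X" "uA + uB < 2 * uD \<Longrightarrow> (1, 0, uD) \<in> ?X"
        by (simp_all add: cc_def half_verts_def)
      have XE: "2 * lE < 0 + lC \<Longrightarrow> (0, 1, lE) \<in> ?X" "uA + uC < 2 * uE \<Longrightarrow> (0, 1, uE) \<in> ?X"
        by (simp_all add: cc_def half_verts_def)
      have XF: "2 * lF < lB + lC \<Longrightarrow> (1, 1, lF) \<in> ?X" "uB + uC < 2 * uF \<Longrightarrow> (1, 1, uF) \<in> ?X"
        by (simp_all add: cc_def half_verts_def)
      have "(x, y) = (0, 0) \<or> (x, y) = (2, 0) \<or> (x, y) = (0, 2) \<or> (x, y) = (1, 0) \<or> (x, y) = (0, 1) \<or> (x, y) = (1, 1)"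
        using sixW[of x y z] v xyz by auto
      then show "pt v \<in> hullZ ?X"
      proof (elim disjE)
        assume "(x, y) = (0, 0)"
        then show ?thesis using hull_column[OF E(1) X(1,2), of z] v unfolding xyz by blast
      next
        assume "(x, y) = (2, 0)"
        then show ?thesis using hull_column[OF E(2) X(3,4), of z] v unfolding xyz by blast
      next
        assume "(x, y) = (0, 2)"
        then show ?thesis using hull_column[OF E(3) X(5,6), of z] v unfolding xyz by blast
      next
        assume "(x, y) = (1, 0)"
        then have e: "v = (1, 0, z)" using xyz by simp
        show ?thesis unfolding e by (rule hull_midcol[OF mD X(1,3,2,4) _ _ XD v[unfolded e]]) simp_all
      next
        assume "(x, y) = (0, 1)"
        then have e: "v = (0, 1, z)" using xyz by simp
        show ?thesis unfolding e by (rule hull_midcol[OF mE X(1,5,2,6) _ _ XE v[unfolded e]]) simp_all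
      next
        assume "(x, y) = (1, 1)"
        then have e: "v = (1, 1, z)" using xyz by simp
        show ?thesis unfolding e by (rule hull_midcol[OF mF X(3,5,4,6) _ _ XF v[unfolded e]]) simp_all
      qed
    qed
    have "ws (set (half_verts cc))" using wsW hull unfolding ws_def by simp
    then have "good (set (half_verts cc))" by (rule half_check_good[OF key])
    then have "good W" by (rule good_hull[OF hull])
    then show ?thesis unfolding W_def by (rule good_amap[OF g])
  qed
qed

section \<open>Verification of the representatives\<close>

subsection \<open>Gorenstein polytopes\<close>

lemma dilate_dilate: "dilate c (dilate d P) = dilate (c * d) P"
  by (simp add: dilate_def image_image)

text \<open>The polar dual is spanned by lattice vectors \<open>n\<close> on which \<open>Q\<close>
  is at least -1, so \<open>x \<bullet> n \<ge> 1 - c\<close> for the nonzero ones. For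
  \<open>c \<le> 1\<close> this makes \<open>x\<close> nonnegative on the dual, which surrounds 0;
  hence \<open>x = 0\<close>, and then \<open>c \<ge> 1\<close>.\<close>

lemma reflexive_fine_interior:
  fixes Q :: "'a::euclidean_space set"
  assumes "reflexive_polytope Q"
  shows "fine_interior (dilate 1 Q) = {0}"
    and "0 \<le> c \<Longrightarrow> c < 1 \<Longrightarrow> fine_interior (dilate c Q) = {}"
proof -
  have Q: "lattice_polytope Q" "0 \<in> interior Q" "lattice_polytope (polar_dual Q)"
    using assms by (auto simp: reflexive_polytope_def)
  obtain W where W: "finite W" "W \<subseteq> int_lattice" "Q = convex hull W"
    using Q(1) unfolding lattice_polytope_iff by blast
  obtain D where D: "finite D" "D \<subseteq> int_lattice" "polar_dual Q = convex hull D"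
    using Q(3) unfolding lattice_polytope_iff by blast
  have cp: "compact Q" using W(1,3) by (simp add: finite_imp_compact_convex_hull)
  have ne: "Q \<noteq> {}" using Q(2) interior_subset by blast
  obtain e where e: "0 < e" "cball 0 e \<subseteq> Q" using Q(2) mem_interior_cball by blast
  obtain r where r: "0 < r" "\<And>x. x \<in> Q \<Longrightarrow> norm x \<le> r"
    using compact_imp_bounded[OF cp] bounded_pos by metis
  have small: "y \<in> polar_dual Q" if y: "r * norm y \<le> 1" for y
  proof -
    have "- 1 \<le> x \<bullet> y" if "x \<in> Q" for x
    proof -
      have "\<bar>x \<bullet> y\<bar> \<le> norm x * norm y" by (rule Cauchy_Schwarz_ineq2)
      also have "\<dots> \<le> r * norm y" using r(2)[OF that] by (intro mult_right_mono) auto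
      finally show ?thesis using y by linarith
    qed
    then show ?thesis by (simp add: polar_dual_def)
  qed
  \<comment> \<open>A ball around 0 inside \<open>Q\<close> makes the minimum of \<open>n\<close>
    over \<open>Q\<close> negative. It is attained at a lattice point, so it is at most -1.\<close>
  have zero: "0 \<in> fine_interior (dilate 1 Q)"
    unfolding fine_interior_dilate_iff[OF cp ne]
  proof
    fix n :: 'a assume n: "n \<in> int_lattice - {0}"
    then have n0: "0 < norm n" by simp
    define p where "p = - (e / norm n) *\<^sub>R n"
    have "p \<in> Q" by (rule subsetD[OF e(2)]) (use e(1) n0 in \<open>simp add: p_def\<close>)
    moreover have "1 * (p \<bullet> n) \<le> - (e * norm n)"
      using n0 by (simp add: p_def dot_square_norm power2_eq_square)
    ultimately have "\<exists>p\<in>convex hull W. 1 * (p \<bullet> n) \<le> - (e * norm n)" using W(3) by blast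
    then obtain w where w: "w \<in> W" "1 * (w \<bullet> n) \<le> - (e * norm n)" unfolding hull_exists_le_iff by blast
    have "0 < e * norm n" using e(1) n0 by simp
    then have "w \<bullet> n < 0" using w(2) by linarith
    moreover have "w \<bullet> n \<in> \<int>" using int_lattice_inner W(2) n w(1) by blast
    ultimately have "w \<bullet> n \<le> - 1" by (elim Ints_cases) simp
    moreover have "w \<in> Q" using w(1) W(3) by (simp add: hull_inc)
    ultimately show "\<exists>p\<in>Q. 1 * (p \<bullet> n) + 1 \<le> 0 \<bullet> n" by (intro bexI[of _ w]) simp_all
  qed
  have only: "x = 0 \<and> 1 \<le> c" if c: "0 \<le> c" "c \<le> 1" and x: "x \<in> fine_interior (dilate c Q)" for c x
  proof -
    have low: "1 - c \<le> x \<bullet> n" if n: "n \<in> D - {0}" for n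
    proof -
      have "n \<in> int_lattice - {0}" using n D(2) by blast
      then obtain p where p: "p \<in> Q" "c * (p \<bullet> n) + 1 \<le> x \<bullet> n"
        using x unfolding fine_interior_dilate_iff[OF cp ne] by blast
      have "n \<in> polar_dual Q" using n D(3) by (simp add: hull_inc)
      then have "- 1 \<le> p \<bullet> n" using p(1) by (simp add: polar_dual_def)
      then have "c * (- 1) \<le> c * (p \<bullet> n)" using c(1) by (rule mult_left_mono)
      then show ?thesis using p(2) by simp
    qed
    have "0 \<le> x \<bullet> y" if "y \<in> D" for y
      using low[of y] that c(2) by (cases "y = 0") auto
    then have "D \<subseteq> {y. x \<bullet> y \<ge> 0}" by blast
    then have half: "polar_dual Q \<subseteq> {y. x \<bullet> y \<ge> 0}"
      unfolding D(3) by (intro hull_minimal convex_halfspace_ge)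
    have x0: "x = 0"
    proof (rule ccontr)
      assume ne: "x \<noteq> 0"
      define y where "y = - (1 / (r * norm x)) *\<^sub>R x"
      have "y \<in> polar_dual Q" by (rule small) (use r(1) ne in \<open>simp add: y_def\<close>)
      then have "0 \<le> x \<bullet> y" using half by blast
      moreover have "0 < 1 / (r * norm x) * (x \<bullet> x)" using r(1) ne by simp
      ultimately show False by (simp add: y_def)
    qed
    obtain b :: 'a where b: "b \<in> Basis" using nonempty_Basis by blast
    have bp: "(1 / r) *\<^sub>R b \<in> polar_dual Q" by (rule small) (use r(1) b in simp)
    have "\<exists>n\<in>D. n \<noteq> 0"
    proof (rule ccontr)
      assume "\<not> ?thesis"
      then have "D \<subseteq> {0}" by blast
      then have "convex hull D \<subseteq> {0}" by (intro hull_minimal) auto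
      then have "(1 / r) *\<^sub>R b = 0" using bp D(3) by blast
      then show False using r(1) nonzero_Basis[OF b] by simp
    qed
    then obtain n where "n \<in> D - {0}" by blast
    from low[OF this] x0 show ?thesis by simp
  qed
  show "fine_interior (dilate 1 Q) = {0}" using zero only[of 1] by auto
  show "fine_interior (dilate c Q) = {}" if "0 \<le> c" "c < 1"
  proof (rule ccontr)
    assume "fine_interior (dilate c Q) \<noteq> {}"
    then obtain x where "x \<in> fine_interior (dilate c Q)" by blast
    from only[OF that(1) _ this] that(2) show False by simp
  qed
qed

text \<open>The reflexive polytope is a unimodular image of \<open>k P\<close>, so dilating it by
  \<open>c\<close> amounts to dilating \<open>P\<close> by \<open>c * k\<close>.\<close>

lemma Gorenstein_fine_interior:
  fixes P :: "'a::euclidean_space set"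
  assumes "Gorenstein_polytope k P"
  obtains x where "fine_interior (dilate (real k) P) = {x}"
    and "\<And>d. 0 \<le> d \<Longrightarrow> d < real k \<Longrightarrow> fine_interior (dilate d P) = {}"
proof -
  obtain Q :: "'a set" where Q: "k \<ge> 1" "full_lattice_polytope P" "reflexive_polytope Q" "unimodular_equiv (dilate (real k) P) Q"
    using assms unfolding Gorenstein_polytope_def by blast
  obtain A t where A: "unimod A" "Q = (\<lambda>x. A x + t) ` dilate (real k) P"
    using Q(4) unfolding unimodular_equiv_iff by blast
  note P = full_lattice_polytope_compact[OF Q(2)]
  have e: "fine_interior (dilate c Q) = (\<lambda>x. A x + c *\<^sub>R t) ` fine_interior (dilate (c * real k) P)" for c
    unfolding A(2) fine_interior_dilate_image[OF A(1) dilate_facts[OF P]] dilate_dilate ..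
  have inj: "A x = A y \<Longrightarrow> x = y" for x y using A(1) by (simp add: unimod_def bij_def inj_eq)
  have one: "(\<lambda>x. A x + t) ` fine_interior (dilate (real k) P) = {0}"
    using e[of 1] reflexive_fine_interior(1)[OF Q(3)] by simp
  then obtain x where x: "x \<in> fine_interior (dilate (real k) P)" by blast
  have "y = x" if "y \<in> fine_interior (dilate (real k) P)" for y
  proof (rule inj)
    have "A y + t = 0" "A x + t = 0" using one x that by blast+
    then show "A y = A x" by (metis add_right_cancel)
  qed
  then have "fine_interior (dilate (real k) P) = {x}" using x by blast
  moreover have "fine_interior (dilate d P) = {}" if "0 \<le> d" "d < real k" for d
  proof -
    have "fine_interior (dilate (d / real k) Q) = {}"
      by (rule reflexive_fine_interior(2)[OF Q(3)]) (use that in simp_all)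
    then show ?thesis unfolding e using that by simp
  qed
  ultimately show ?thesis using that by blast
qed

lemma Gorenstein_min_multiplier:
  assumes "Gorenstein_polytope k P" shows "min_multiplier P = real k"
  using Gorenstein_fine_interior[OF assms] by (metis insert_not_empty min_multiplier_eqI of_nat_0_le_iff)

lemma Gorenstein_weakly_sporadic:
  assumes "Gorenstein_polytope k P" "2 \<le> k" shows "weakly_sporadic_F_hollow P"
proof -
  obtain x where x: "fine_interior (dilate (real k) P) = {x}" using Gorenstein_fine_interior[OF assms(1)] .
  have "full_lattice_polytope P" using assms(1) by (simp add: Gorenstein_polytope_def)
  then show ?thesis using assms(2) x
    by (simp add: weakly_sporadic_F_hollow_def F_hollow_def Gorenstein_min_multiplier[OF assms(1)] aff_dim_eq_0)
qed

lemma reflexive_image: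
  fixes A :: "'a::euclidean_space \<Rightarrow> 'b::euclidean_space"
  assumes A: "unimod A" and Q: "reflexive_polytope Q"
  shows "reflexive_polytope (A ` Q)"
proof -
  have lin: "linear A" and bij: "bij A" using A by (auto simp: unimod_def)
  have "lattice_polytope (A ` Q)"
    using lattice_polytope_image[OF A int_lattice_0] Q by (simp add: reflexive_polytope_def)
  moreover have "0 \<in> interior (A ` Q)"
  proof -
    have "A ` interior Q \<subseteq> interior (A ` Q)"
      by (intro interior_maximal image_mono interior_subset open_surjective_linear_image open_interior lin)
        (use bij in \<open>simp add: bij_def\<close>)
    moreover have "0 \<in> A ` interior Q"
      using Q linear_0[OF lin] by (metis image_eqI reflexive_polytope_def)
    ultimately show ?thesis by blast
  qed
  moreover have "lattice_polytope (polar_dual (A ` Q))"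
  proof -
    let ?B = "adjoint A"
    have B: "unimod ?B" by (rule unimod_adjoint[OF A])
    have s: "?B (inv ?B y) = y" and i: "inv ?B (?B y') = y'" for y y'
      using B by (auto simp: unimod_def bij_def surj_f_inv_f)
    have mem: "y \<in> polar_dual (A ` Q) \<longleftrightarrow> ?B y \<in> polar_dual Q" for y
      by (simp add: polar_dual_def adjoint_works[OF lin])
    have "polar_dual (A ` Q) = inv ?B ` polar_dual Q"
    proof (intro equalityI subsetI)
      fix y assume "y \<in> polar_dual (A ` Q)"
      then show "y \<in> inv ?B ` polar_dual Q" unfolding mem by (metis i image_eqI)
    next
      fix y assume "y \<in> inv ?B ` polar_dual Q"
      then show "y \<in> polar_dual (A ` Q)" unfolding mem by (auto simp: s)
    qed
    then show ?thesis
      using lattice_polytope_image[OF unimod_inv[OF B] int_lattice_0] Q by (simp add: reflexive_polytope_def)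
  qed
  ultimately show ?thesis by (simp add: reflexive_polytope_def)
qed

lemma Gorenstein_equiv:
  fixes P :: "'a::euclidean_space set" and P' :: "'b::euclidean_space set"
  assumes "unimodular_equiv P P'" "Gorenstein_polytope k P"
  shows "Gorenstein_polytope k P'"
proof -
  obtain Q :: "'a set" where Q: "k \<ge> 1" "full_lattice_polytope P" "reflexive_polytope Q" "unimodular_equiv (dilate (real k) P) Q"
    using assms(2) unfolding Gorenstein_polytope_def by blast
  obtain A t where A: "unimod A" "t \<in> int_lattice" "P' = (\<lambda>x. A x + t) ` P"
    using assms(1) unfolding unimodular_equiv_iff by blast
  have lin: "linear A" using A(1) by (simp add: unimod_def)
  have "real k *\<^sub>R t \<in> int_lattice" using A(2) by (simp add: int_lattice_def)
  moreover have "dilate (real k) P' = (\<lambda>x. A x + real k *\<^sub>R t) ` dilate (real k) P"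
    by (simp add: A(3) dilate_def image_image linear_scale[OF lin] scaleR_add_right)
  ultimately have "unimodular_equiv (dilate (real k) P) (dilate (real k) P')"
    using A(1) unfolding unimodular_equiv_iff by blast
  then have "unimodular_equiv (dilate (real k) P') (A ` Q)"
    using unimodular_equiv_trans unimodular_equiv_sym Q(4) unimod_equiv_image[OF A(1)] by metis
  then show ?thesis
    using Q(1) full_lattice_polytope_image[OF A(1,2) Q(2)] reflexive_image[OF A(1) Q(3)] A(3)
    unfolding Gorenstein_polytope_def by blast
qed

lemma sum_pairs:
  "(\<Sum>(v, w)\<leftarrow>vw. of_int w * (pt v \<bullet> (a, b, c))) =
    a * of_int (\<Sum>(v, w)\<leftarrow>vw. w * pair (1, 0, 0) v) + b * of_int (\<Sum>(v, w)\<leftarrow>vw. w * pair (0, 1, 0) v) +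
    c * of_int (\<Sum>(v, w)\<leftarrow>vw. w * pair (0, 0, 1) v)"
proof (induction vw)
  case (Cons p vw)
  obtain x y z w where "p = ((x, y, z), w)" by (metis prod.exhaust)
  with Cons.IH show ?case by (simp add: algebra_simps)
qed simp

text \<open>Vectors of rank at most two have a common normal: a nonzero cross product of two of them
  if there is one, and otherwise a normal of the line that they span.\<close>

lemma orthogonal_vector:
  fixes T :: "r3 set"
  assumes "\<And>u1 u2 u3 v1 v2 v3 w1 w2 w3. (u1, u2, u3) \<in> T \<Longrightarrow> (v1, v2, v3) \<in> T \<Longrightarrow> (w1, w2, w3) \<in> T \<Longrightarrow>
    u1 * (v2 * w3 - v3 * w2) - u2 * (v1 * w3 - v3 * w1) + u3 * (v1 * w2 - v2 * w1) = 0"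
  obtains a :: r3 where "a \<noteq> 0" "\<And>t. t \<in> T \<Longrightarrow> t \<bullet> a = 0"
proof (cases "T \<subseteq> {(0, 0, 0)}")
  case True
  show thesis
    by (rule that[of "(1, 0, 0)"]) (use True in \<open>auto simp: zero_prod_def\<close>)
next
  case False
  then obtain u where "u \<in> T" "u \<noteq> (0, 0, 0)" by blast
  moreover obtain u1 u2 u3 where "u = (u1, u2, u3)" by (cases u)
  ultimately have u: "(u1, u2, u3) \<in> T" "(u1, u2, u3) \<noteq> (0, 0, 0)" by simp_all
  show thesis
  proof (cases "\<exists>v1 v2 v3. (v1, v2, v3) \<in> T \<and> (u2 * v3 - u3 * v2, u3 * v1 - u1 * v3, u1 * v2 - u2 * v1) \<noteq> (0, 0, 0)")
    case True
    then obtain v1 v2 v3 where v: "(v1, v2, v3) \<in> T"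
      "(u2 * v3 - u3 * v2, u3 * v1 - u1 * v3, u1 * v2 - u2 * v1) \<noteq> (0, 0, 0)" by blast
    show thesis
    proof (rule that)
      show "(u2 * v3 - u3 * v2, u3 * v1 - u1 * v3, u1 * v2 - u2 * v1) \<noteq> (0 :: r3)"
        using v(2) by (simp add: zero_prod_def)
      fix t assume t: "t \<in> T"
      obtain w1 w2 w3 where w: "t = (w1, w2, w3)" by (cases t)
      show "t \<bullet> (u2 * v3 - u3 * v2, u3 * v1 - u1 * v3, u1 * v2 - u2 * v1) = 0"
        using assms[OF u(1) v(1), of w1 w2 w3] t unfolding w by (simp add: algebra_simps)
    qed
  next
    case False
    have par: "u2 * v3 = u3 * v2" "u3 * v1 = u1 * v3" "u1 * v2 = u2 * v1" if "(v1, v2, v3) \<in> T" for v1 v2 v3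
      using False that by auto
    show thesis
    proof (cases "u1 = 0 \<and> u2 = 0")
      case True
      show thesis
      proof (rule that)
        show "(1, 0, 0) \<noteq> (0 :: r3)" by (simp add: zero_prod_def)
        fix t assume t: "t \<in> T"
        obtain v1 v2 v3 where v: "t = (v1, v2, v3)" by (cases t)
        show "t \<bullet> (1, 0, 0) = 0" using par(2)[of v1 v2 v3] t u(2) True unfolding v by simp
      qed
    next
      case False
      show thesis
      proof (rule that)
        show "(u2, - u1, 0) \<noteq> (0 :: r3)" using False by (auto simp: zero_prod_def)
        fix t assume t: "t \<in> T"
        obtain v1 v2 v3 where v: "t = (v1, v2, v3)" by (cases t)
        show "t \<bullet> (u2, - u1, 0) = 0" using par(3)[of v1 v2 v3] t unfolding v by (simp add: algebra_simps)
      qed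
    qed
  qed
qed

text \<open>The sum of cross products \<open>u x v + v x w + w x u\<close>, a normal of the plane
  through the three points.\<close>

definition tri_normal :: "i3 \<Rightarrow> i3 \<Rightarrow> i3 \<Rightarrow> i3" where
  "tri_normal = (\<lambda>(u1, u2, u3) (v1, v2, v3) (w1, w2, w3).
    (u2 * v3 - u3 * v2 + (v2 * w3 - v3 * w2) + (w2 * u3 - w3 * u2),
     u3 * v1 - u1 * v3 + (v3 * w1 - v1 * w3) + (w3 * u1 - w1 * u3),
     u1 * v2 - u2 * v1 + (v1 * w2 - v2 * w1) + (w1 * u2 - w2 * u1)))"

text \<open>A solution \<open>y\<close> of \<open>u \<bullet> y = v \<bullet> y = w \<bullet> y = -1\<close> is \<open>- tri_normal u v w / det (u, v, w)\<close>; it must be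
  integral or violate the inequality of another point.\<close>

definition reflexive_check :: "(i3 \<times> int) list \<Rightarrow> bool" where
  "reflexive_check vw \<longleftrightarrow> list_all (\<lambda>(v, w). 0 < w) vw \<and>
     (\<Sum>(v, w)\<leftarrow>vw. w * pair (1, 0, 0) v) = 0 \<and> (\<Sum>(v, w)\<leftarrow>vw. w * pair (0, 1, 0) v) = 0 \<and>
     (\<Sum>(v, w)\<leftarrow>vw. w * pair (0, 0, 1) v) = 0 \<and>
     (let V = map fst vw in list_all (\<lambda>u. list_all (\<lambda>v. list_all (\<lambda>w.
        let d = vdet (0, 0, 0) u v w in d = 0 \<or>
        (let n = tri_normal u v w in
          (case n of (x, y, z) \<Rightarrow> d dvd x \<and> d dvd y \<and> d dvd z) \<or> list_ex (\<lambda>p. d * d < d * pair n p) V)) V) V) V)"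

text \<open>Cramer's rule for a system with right-hand side -1.\<close>

lemma tri_solve:
  fixes d :: real
  assumes "u1 * y1 + u2 * y2 + u3 * y3 = - 1" "v1 * y1 + v2 * y2 + v3 * y3 = - 1" "w1 * y1 + w2 * y2 + w3 * y3 = - 1"
    and "d = u1 * (v2 * w3 - v3 * w2) - u2 * (v1 * w3 - v3 * w1) + u3 * (v1 * w2 - v2 * w1)"
  shows "d * y1 = - (u2 * v3 - u3 * v2 + (v2 * w3 - v3 * w2) + (w2 * u3 - w3 * u2))"
    "d * y2 = - (u3 * v1 - u1 * v3 + (v3 * w1 - v1 * w3) + (w3 * u1 - w1 * u3))"
    "d * y3 = - (u1 * v2 - u2 * v1 + (v1 * w2 - v2 * w1) + (w1 * u2 - w2 * u1))"
  using assms by algebra+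

lemma div_int_lattice:
  assumes "real_of_int d * y = - of_int n" "d dvd n" "d \<noteq> 0" shows "y \<in> \<int>"
proof -
  obtain m where "n = d * m" using assms(2) by auto
  then have "real_of_int d * y = of_int d * of_int (- m)" using assms(1) by simp
  then have "y = of_int (- m)" using assms(3) by (simp only: mult_cancel_left of_int_eq_0_iff) simp
  then show ?thesis by simp
qed

text \<open>At an extreme point the tight inequalities have rank three, since otherwise the point
  could move both ways along a common normal of the tight vectors. So it solves one of the checked
  systems, and it violates no other inequality.\<close>

lemma polar_extreme_integral:
  assumes V: "finite V"
    and chk: "\<And>u v w. u \<in> V \<Longrightarrow> v \<in> V \<Longrightarrow> w \<in> V \<Longrightarrow> vdet (0, 0, 0) u v w \<noteq> 0 \<Longrightarrow>
      (case tri_normal u v w of (x, y, z) \<Rightarrow> vdet (0, 0, 0) u v w dvd x \<and> vdet (0, 0, 0) u v w dvd y \<and> vdet (0, 0, 0) u v w dvd z) \<or>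
      (\<exists>p\<in>V. vdet (0, 0, 0) u v w * vdet (0, 0, 0) u v w < vdet (0, 0, 0) u v w * pair (tri_normal u v w) p)"
    and y: "y extreme_point_of {y. \<forall>v\<in>V. - 1 \<le> pt v \<bullet> y}"
  shows "y \<in> int_lattice"
proof -
  let ?K = "{y. \<forall>v\<in>V. - 1 \<le> pt v \<bullet> y}"
  define T where "T = {v \<in> V. pt v \<bullet> y = - 1}"
  have yK: "\<And>v. v \<in> V \<Longrightarrow> - 1 \<le> pt v \<bullet> y" using y by (simp add: extreme_point_of_def)
  have "\<exists>u\<in>T. \<exists>v\<in>T. \<exists>w\<in>T. vdet (0, 0, 0) u v w \<noteq> 0"
  proof (rule ccontr)
    assume neg: "\<not> ?thesis"
    obtain a :: r3 where a: "a \<noteq> 0" "\<And>t. t \<in> pt ` T \<Longrightarrow> t \<bullet> a = 0"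
    proof (rule orthogonal_vector[of "pt ` T"])
      fix u1 u2 u3 v1 v2 v3 w1 w2 w3 :: real
      assume m: "(u1, u2, u3) \<in> pt ` T" "(v1, v2, v3) \<in> pt ` T" "(w1, w2, w3) \<in> pt ` T"
      have ex: "\<exists>a b c. (x, y, z) = pt (a, b, c) \<and> (a, b, c) \<in> T" if xyz: "(x, y, z) \<in> pt ` T" for x y z
      proof -
        obtain v where v: "v \<in> T" "(x, y, z) = pt v" using xyz by blast
        obtain a b c where "v = (a, b, c)" by (cases v)
        then show ?thesis using v by blast
      qed
      obtain a1 a2 a3 where a: "(u1, u2, u3) = pt (a1, a2, a3)" "(a1, a2, a3) \<in> T" using ex[OF m(1)] by blast
      obtain b1 b2 b3 where b: "(v1, v2, v3) = pt (b1, b2, b3)" "(b1, b2, b3) \<in> T" using ex[OF m(2)] by blast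
      obtain c1 c2 c3 where c: "(w1, w2, w3) = pt (c1, c2, c3)" "(c1, c2, c3) \<in> T" using ex[OF m(3)] by blast
      have "vdet (0, 0, 0) (a1, a2, a3) (b1, b2, b3) (c1, c2, c3) = 0" using neg a(2) b(2) c(2) by blast
      then have "real_of_int (a1 * (b2 * c3 - b3 * c2) - a2 * (b1 * c3 - b3 * c1) + a3 * (b1 * c2 - b2 * c1)) = 0"
        by (simp add: vdet_def algebra_simps)
      then show "u1 * (v2 * w3 - v3 * w2) - u2 * (v1 * w3 - v3 * w1) + u3 * (v1 * w2 - v2 * w1) = 0"
        using a(1) b(1) c(1) by simp
    qed blast
    \<comment> \<open>Dividing by \<open>M\<close> makes the move small enough for all inequalities
      that are not tight.\<close>
    define M where "M = Max (insert 1 ((\<lambda>v. \<bar>pt v \<bullet> a\<bar> / (pt v \<bullet> y + 1)) ` (V - T)))"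
    have fin: "finite (insert 1 ((\<lambda>v. \<bar>pt v \<bullet> a\<bar> / (pt v \<bullet> y + 1)) ` (V - T)))" using V by simp
    have M: "1 \<le> M" unfolding M_def by (rule Max_ge[OF fin]) simp
    have bound: "\<bar>pt v \<bullet> ((1 / M) *\<^sub>R a)\<bar> \<le> pt v \<bullet> y + 1" if v: "v \<in> V" for v
    proof (cases "v \<in> T")
      case True
      then show ?thesis using a(2)[of "pt v"] yK[OF v] by simp
    next
      case False
      then have "- 1 \<noteq> pt v \<bullet> y" using v unfolding T_def by fastforce
      then have pos: "0 < pt v \<bullet> y + 1" using yK[OF v] by simp
      have "\<bar>pt v \<bullet> a\<bar> / (pt v \<bullet> y + 1) \<le> M" unfolding M_def by (rule Max_ge[OF fin]) (use v False in auto)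
      then have "\<bar>pt v \<bullet> a\<bar> \<le> M * (pt v \<bullet> y + 1)" using pos by (simp add: pos_divide_le_eq)
      then have "\<bar>pt v \<bullet> a\<bar> / M \<le> pt v \<bullet> y + 1" using M by (simp add: pos_divide_le_eq mult.commute)
      moreover have eq: "\<bar>pt v \<bullet> ((1 / M) *\<^sub>R a)\<bar> = \<bar>pt v \<bullet> a\<bar> / M" using M by (simp add: abs_mult)
      ultimately show ?thesis unfolding eq by blast
    qed
    let ?b = "(1 / M) *\<^sub>R a"
    have "- 1 \<le> pt v \<bullet> (y + ?b)" "- 1 \<le> pt v \<bullet> (y - ?b)" if "v \<in> V" for v
      using bound[OF that] unfolding inner_add_right inner_diff_right by linarith+
    then have K: "y + ?b \<in> ?K" "y - ?b \<in> ?K" by blast+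
    have "?b \<noteq> 0" using a(1) M by simp
    have "y - ?b \<noteq> y + ?b"
    proof
      assume "y - ?b = y + ?b"
      then have "?b + ?b = 0" by (metis add.inverse_unique add_left_cancel diff_conv_add_uminus right_minus)
      then have "2 *\<^sub>R ?b = 0" by (simp only: scaleR_2)
      then show False using \<open>?b \<noteq> 0\<close> by (simp only: scaleR_eq_0_iff) simp
    qed
    moreover have "midpoint (y - ?b) (y + ?b) = y"
    proof -
      have "y - ?b + (y + ?b) = 2 *\<^sub>R y" unfolding scaleR_2 by (simp only: diff_add_eq add_diff_cancel_right' add.assoc[symmetric])
      then show ?thesis unfolding midpoint_def by simp
    qed
    ultimately have "y \<in> open_segment (y - ?b) (y + ?b)" by (metis midpoint_in_open_segment)
    then show False using y K unfolding extreme_point_of_def by blast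
  qed
  then obtain u v w where t: "u \<in> T" "v \<in> T" "w \<in> T" "vdet (0, 0, 0) u v w \<noteq> 0" by blast
  obtain u1 u2 u3 v1 v2 v3 w1 w2 w3 where uvw: "u = (u1, u2, u3)" "v = (v1, v2, v3)" "w = (w1, w2, w3)"
    by (cases u; cases v; cases w)
  obtain y1 y2 y3 where yy: "y = (y1, y2, y3)" by (cases y)
  define d where "d = vdet (0, 0, 0) u v w"
  obtain n1 n2 n3 where n: "tri_normal u v w = (n1, n2, n3)" by (cases "tri_normal u v w")
  have d0: "d \<noteq> 0" using t(4) by (simp add: d_def)
  have tight: "of_int u1 * y1 + of_int u2 * y2 + of_int u3 * y3 = - 1" "of_int v1 * y1 + of_int v2 * y2 + of_int v3 * y3 = - 1"
    "of_int w1 * y1 + of_int w2 * y2 + of_int w3 * y3 = - 1"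
    using t(1-3) by (simp_all add: T_def uvw yy)
  have "real_of_int d = of_int u1 * (of_int v2 * of_int w3 - of_int v3 * of_int w2) -
      of_int u2 * (of_int v1 * of_int w3 - of_int v3 * of_int w1) + of_int u3 * (of_int v1 * of_int w2 - of_int v2 * of_int w1)"
    by (simp add: d_def uvw vdet_def algebra_simps)
  note sol = tri_solve[OF tight this]
  have dn: "of_int d * y1 = - of_int n1" "of_int d * y2 = - of_int n2" "of_int d * y3 = - of_int n3"
    using sol n by (auto simp: uvw tri_normal_def)
  show ?thesis
  proof (cases "d dvd n1 \<and> d dvd n2 \<and> d dvd n3")
    case True
    then have "y1 \<in> \<int>" "y2 \<in> \<int>" "y3 \<in> \<int>" using dn d0 by (blast intro: div_int_lattice)+
    then show ?thesis by (simp add: yy int_lattice_Pair int_lattice_real)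
  next
    case False
    then obtain p where p: "p \<in> V" "d * d < d * pair (n1, n2, n3) p"
      using chk[of u v w] t n by (auto simp: T_def d_def)
    obtain p1 p2 p3 where pp: "p = (p1, p2, p3)" by (cases p)
    have "of_int d * (pt p \<bullet> y) = of_int p1 * (of_int d * y1) + of_int p2 * (of_int d * y2) + of_int p3 * (of_int d * y3)"
      by (simp add: pp yy algebra_simps)
    also have "\<dots> = - of_int (pair (n1, n2, n3) p)" unfolding dn by (simp add: pp algebra_simps)
    finally have "of_int d * (of_int d * (pt p \<bullet> y)) = - (of_int d * of_int (pair (n1, n2, n3) p))" by simp
    moreover have "real_of_int (d * d) < of_int (d * pair (n1, n2, n3) p)" using p(2) by (simp only: of_int_less_iff)
    ultimately have "(of_int d * of_int d) * (pt p \<bullet> y) < of_int d * of_int d * (- 1)" by simp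
    moreover have "of_int d * of_int d * (- 1) \<le> (of_int d * of_int d) * (pt p \<bullet> y)"
      by (rule mult_left_mono[OF yK[OF p(1)]]) simp
    ultimately show ?thesis by linarith
  qed
qed

text \<open>If 0 were not interior, a functional nonnegative on all generating points would have
  weighted sum 0 by the positive relation, and the points would lie in a plane. The ball around 0
  bounds the dual, and \<open>polar_extreme_integral\<close> makes it a lattice polytope.\<close>

lemma reflexive_hullZ:
  assumes full: "full_lattice_polytope (hullZ (fst ` set vw))" and chk: "reflexive_check vw"
  shows "reflexive_polytope (hullZ (fst ` set vw))"
proof -
  let ?V = "fst ` set vw" and ?S = "hullZ (fst ` set vw)"
  have noplane: "\<not> ?S \<subseteq> {x. a \<bullet> x = b}" if "a \<noteq> 0" for a b
  proof
    assume "?S \<subseteq> {x. a \<bullet> x = b}"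
    then have "aff_dim ?S \<le> aff_dim {x. a \<bullet> x = b}" by (rule aff_dim_subset)
    also have "\<dots> = int DIM(r3) - 1" using aff_dim_hyperplane[OF that, of b] by simp
    finally show False using full by (simp add: full_lattice_polytope_def)
  qed
  have conv: "convex ?S" by (rule convex_hullZ)
  have int: "0 \<in> interior ?S"
  proof (rule ccontr)
    assume "0 \<notin> interior ?S"
    have ne: "interior ?S \<noteq> {}" using empty_interior_subset_hyperplane[OF conv] noplane by metis
    then obtain a b where ab: "a \<noteq> 0" "\<forall>x\<in>{0}. a \<bullet> x \<le> b" "\<forall>x\<in>interior ?S. b \<le> a \<bullet> x"
      using separating_hyperplane_sets[of "{0}" "interior ?S"] \<open>0 \<notin> interior ?S\<close> convex_interior[OF conv] by auto
    then have "interior ?S \<subseteq> {x. a \<bullet> x \<ge> 0}" by fastforce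
    then have "closure (interior ?S) \<subseteq> {x. a \<bullet> x \<ge> 0}" by (intro closure_minimal closed_halfspace_ge)
    then have S: "?S \<subseteq> {x. a \<bullet> x \<ge> 0}"
      unfolding convex_closure_interior[OF conv ne] using closure_subset by blast
    obtain a1 a2 a3 where a: "a = (a1, a2, a3)" by (cases a)
    have "(\<Sum>(v, w)\<leftarrow>vw. of_int w * (pt v \<bullet> a)) = 0"
      unfolding a sum_pairs using chk by (simp add: reflexive_check_def)
    moreover have nn: "0 \<le> (case p of (v, w) \<Rightarrow> of_int w * (pt v \<bullet> a))" if p: "p \<in> set vw" for p
    proof -
      obtain v w where vw: "p = (v, w)" by (cases p)
      have "0 < w" using chk p unfolding reflexive_check_def list_all_iff vw by blast
      moreover have "v \<in> ?V" using p vw by force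
      then have "0 \<le> a \<bullet> pt v" using S pt_mem_hullZ by blast
      ultimately show ?thesis by (simp add: vw inner_commute)
    qed
    ultimately have z: "\<And>p. p \<in> set vw \<Longrightarrow> (case p of (v, w) \<Rightarrow> of_int w * (pt v \<bullet> a)) = 0"
      by (subst (asm) sum_list_nonneg_eq_0_iff) auto
    have "a \<bullet> pt v = 0" if v: "v \<in> ?V" for v
    proof -
      obtain w where p: "(v, w) \<in> set vw" using v by auto
      have "0 < w" using chk p unfolding reflexive_check_def list_all_iff by blast
      then show ?thesis using z[OF p] by (simp add: inner_commute)
    qed
    then have "pt ` ?V \<subseteq> {x. a \<bullet> x = 0}" by blast
    then have "?S \<subseteq> {x. a \<bullet> x = 0}" unfolding hullZ_def by (intro hull_minimal convex_hyperplane)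
    then show False using noplane[OF ab(1)] by blast
  qed
  have polar: "polar_dual ?S = {y. \<forall>v\<in>?V. - 1 \<le> pt v \<bullet> y}"
  proof (intro equalityI subsetI CollectI ballI)
    fix y v assume "y \<in> polar_dual ?S" "v \<in> ?V"
    then show "- 1 \<le> pt v \<bullet> y" using pt_mem_hullZ by (auto simp: polar_dual_def)
  next
    fix y assume "y \<in> {y. \<forall>v\<in>?V. - 1 \<le> pt v \<bullet> y}"
    then have "pt ` ?V \<subseteq> {x. y \<bullet> x \<ge> - 1}" by (auto simp: inner_commute)
    then have "?S \<subseteq> {x. y \<bullet> x \<ge> - 1}" unfolding hullZ_def by (intro hull_minimal convex_halfspace_ge)
    then show "y \<in> polar_dual ?S" by (auto simp: polar_dual_def inner_commute)
  qed
  have "polytope (polar_dual ?S)"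
    unfolding polytope_eq_bounded_polyhedron
  proof
    have "polar_dual ?S = \<Inter> ((\<lambda>v. {y. pt v \<bullet> y \<ge> - 1}) ` ?V)" unfolding polar by blast
    moreover have "polyhedron (\<Inter> ((\<lambda>v. {y. pt v \<bullet> y \<ge> - 1}) ` ?V))"
      by (intro polyhedron_Inter) (auto intro: polyhedron_halfspace_ge)
    ultimately show "polyhedron (polar_dual ?S)" by simp
    obtain e where e: "0 < e" "cball 0 e \<subseteq> ?S" using int mem_interior_cball by blast
    have "norm y \<le> 1 / e" if y: "y \<in> polar_dual ?S" for y
    proof (cases "y = 0")
      case False
      have "- (e / norm y) *\<^sub>R y \<in> ?S" by (rule subsetD[OF e(2)]) (use e(1) False in simp)
      then have "- 1 \<le> (- (e / norm y) *\<^sub>R y) \<bullet> y" using y unfolding polar_dual_def by blast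
      then have "e * norm y \<le> 1" using False by (simp add: dot_square_norm power2_eq_square)
      then show ?thesis using e(1) by (simp add: pos_le_divide_eq mult.commute)
    qed (use e(1) in simp)
    then show "bounded (polar_dual ?S)" unfolding bounded_iff by blast
  qed
  moreover have "y \<in> int_lattice" if "y extreme_point_of polar_dual ?S" for y
  proof (rule polar_extreme_integral[of ?V])
    show "y extreme_point_of {y. \<forall>v\<in>?V. - 1 \<le> pt v \<bullet> y}" using that polar by simp
    fix u v w assume u: "u \<in> ?V" and v: "v \<in> ?V" and w: "w \<in> ?V" and nz: "vdet (0, 0, 0) u v w \<noteq> 0"
    note all = chk[unfolded reflexive_check_def Let_def list_all_iff list_ex_iff set_map,
      THEN conjunct2, THEN conjunct2, THEN conjunct2, THEN conjunct2]
    show "(case tri_normal u v w of (x, y, z) \<Rightarrow> vdet (0, 0, 0) u v w dvd x \<and> vdet (0, 0, 0) u v w dvd y \<and> vdet (0, 0, 0) u v w dvd z) \<or>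
      (\<exists>p\<in>?V. vdet (0, 0, 0) u v w * vdet (0, 0, 0) u v w < vdet (0, 0, 0) u v w * pair (tri_normal u v w) p)"
      by (rule mp[OF iffD1[OF disj_imp bspec[OF bspec[OF bspec[OF all u] v] w]] nz])
  qed simp
  ultimately show ?thesis
    using int hullZ_lattice[of ?V] by (simp add: reflexive_polytope_def lattice_polytope_def)
qed

definition full_check :: "i3 list \<Rightarrow> bool" where
  "full_check V \<longleftrightarrow> (\<exists>a\<in>set V. \<exists>b\<in>set V. \<exists>c\<in>set V. \<exists>d\<in>set V. vdet a b c d \<noteq> 0)"

lemma full_check: "full_check V \<Longrightarrow> full_lattice_polytope (hullZ (set V))"
  unfolding full_check_def by (blast intro: hullZ_full)

text \<open>The data: the index \<open>k\<close>, the lattice point of \<open>k P\<close> that is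
  moved to the origin, and the weights of a positive relation among the translated vertices.\<close>

definition gor_check :: "i3 list \<Rightarrow> nat \<times> i3 \<times> int list \<Rightarrow> bool" where
  "gor_check V = (\<lambda>(k, (x, y, z), wl). 1 \<le> k \<and> full_check V \<and> length wl = length V \<and>
     (let U = map (amap (int k, 0, 0, 0, int k, 0, 0, 0, int k, - x, - y, - z)) V in
       full_check U \<and> reflexive_check (zip U wl)))"

lemma gor_check:
  assumes "gor_check V (k, (x, y, z), wl)"
  shows "Gorenstein_polytope k (hullZ (set V))"
proof -
  let ?U = "map (amap (int k, 0, 0, 0, int k, 0, 0, 0, int k, - x, - y, - z)) V"
  note c' = assms[unfolded gor_check_def Let_def prod.case]
  note c = c'[THEN conjunct1] c'[THEN conjunct2, THEN conjunct1] c'[THEN conjunct2, THEN conjunct2, THEN conjunct1]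
    c'[THEN conjunct2, THEN conjunct2, THEN conjunct2, THEN conjunct1] c'[THEN conjunct2, THEN conjunct2, THEN conjunct2, THEN conjunct2]
  have "map fst (zip ?U wl) = ?U" by (rule map_fst_zip) (simp add: c(3))
  then have "set (map fst (zip ?U wl)) = set ?U" by (rule arg_cong)
  then have U: "fst ` set (zip ?U wl) = set ?U" by (simp only: set_map)
  have "reflexive_polytope (hullZ (set ?U))"
    by (rule reflexive_hullZ[of "zip ?U wl", unfolded U, OF full_check[OF c(4)] c(5)])
  moreover have "unimodular_equiv (dilate (real k) (hullZ (set V))) (hullZ (set ?U))"
  proof -
    let ?s = "amap (int k, 0, 0, 0, int k, 0, 0, 0, int k, 0, 0, 0)" and ?t = "(1, 0, 0, 0, 1, 0, 0, 0, 1, - x, - y, - z)"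
    have "dilate (real k) (hullZ (set V)) = convex hull ((\<lambda>p. real k *\<^sub>R p) ` pt ` set V)"
      by (simp add: dilate_def hullZ_def convex_hull_scaling)
    also have "(\<lambda>p. real k *\<^sub>R p) ` pt ` set V = pt ` ?s ` set V"
      unfolding image_image by (rule image_cong) (auto simp: amap_def)
    finally have "dilate (real k) (hullZ (set V)) = hullZ (?s ` set V)" by (simp add: hullZ_def)
    moreover have "set ?U = amap ?t ` ?s ` set V"
      unfolding set_map image_image by (rule image_cong) (auto simp: amap_def)
    moreover have "amap_det ?t \<in> {1, -1}" by (simp add: amap_det_def)
    ultimately show ?thesis using hullZ_amap by metis
  qed
  ultimately show ?thesis using c(1) full_check[OF c(2)] unfolding Gorenstein_polytope_def by blast
qed

subsection \<open>Lattice width and simplices\<close>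

lemma Min_on_image:
  fixes A :: "'a::euclidean_space \<Rightarrow> 'b::euclidean_space"
  assumes lin: "linear A" and P: "compact P" "P \<noteq> {}"
  shows "Min_on ((\<lambda>x. A x + t) ` P) n = Min_on P (adjoint A n) + t \<bullet> n"
proof -
  have "compact ((\<lambda>x. A x + t) ` P)"
    by (rule compact_continuous_image[OF _ P(1)], intro continuous_on_add continuous_on_const linear_continuous_on)
      (use lin in \<open>simp add: linear_linear\<close>)
  moreover have "(\<lambda>x. A x + t) ` P \<noteq> {}" using P(2) by simp
  ultimately have "Min_on ((\<lambda>x. A x + t) ` P) n \<le> r \<longleftrightarrow> (\<exists>p\<in>P. (A p + t) \<bullet> n \<le> r)" for r
    by (simp add: Min_on_le_iff)
  also have "(\<exists>p\<in>P. (A p + t) \<bullet> n \<le> r) \<longleftrightarrow> Min_on P (adjoint A n) + t \<bullet> n \<le> r" for r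
    using Min_on_le_iff[OF P, of "adjoint A n" "r - t \<bullet> n"]
    by (simp add: inner_add_left adjoint_works[OF lin] le_diff_eq)
  finally show ?thesis by (metis order_antisym order_refl)
qed

text \<open>Translations cancel in the width, and the adjoint permutes the nonzero dual
  vectors.\<close>

lemma lattice_width_equiv:
  fixes P :: "'a::euclidean_space set" and Q :: "'b::euclidean_space set"
  assumes "unimodular_equiv P Q" "compact P" "P \<noteq> {}"
  shows "lattice_width Q = lattice_width P"
proof -
  obtain A t where A: "unimod A" "Q = (\<lambda>x. A x + t) ` P"
    using assms(1) unfolding unimodular_equiv_iff by blast
  have lin: "linear A" using A(1) by (simp add: unimod_def)
  define g where "g m = - Min_on P (- m) - Min_on P m" for m
  have "- Min_on Q (- n) - Min_on Q n = g (adjoint A n)" for n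
    by (simp add: A(2) Min_on_image[OF lin assms(2,3)] g_def linear_neg[OF adjoint_linear[OF lin]])
  then have "lattice_width Q = Inf (g ` adjoint A ` (int_lattice - {0}))"
    unfolding lattice_width_def image_image by simp
  also have "\<dots> = lattice_width P"
    unfolding unimod_adjoint_dual[OF A(1)] lattice_width_def g_def ..
  finally show ?thesis .
qed

lemma Min_on_hullZ:
  assumes "finite V" "V \<noteq> {}"
  obtains v where "v \<in> V" "Min_on (hullZ V) (pt n) = of_int (pair n v)" "\<And>w. w \<in> V \<Longrightarrow> pair n v \<le> pair n w"
proof -
  let ?M = "Min_on (hullZ V) (pt n)"
  have le: "?M \<le> r \<longleftrightarrow> (\<exists>v\<in>V. of_int (pair n v) \<le> r)" for r
    using hull_exists_le_iff[of "pt ` V" 1 "pt n" r] Min_on_le_iff[OF hullZ_compact[OF assms], of "pt n" r]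
    by (simp add: hullZ_def inner_pt del: pt_simp split_paired_All split_paired_Ex)
  obtain v where v: "v \<in> V" "of_int (pair n v) \<le> ?M" using le[of ?M] by blast
  have up: "?M \<le> of_int (pair n w)" if "w \<in> V" for w using le that by blast
  show ?thesis
  proof (rule that[OF v(1)])
    show "?M = of_int (pair n v)" using v up by (simp add: antisym)
    fix w assume "w \<in> V"
    then have "real_of_int (pair n v) \<le> of_int (pair n w)" using v(2) up by (meson order_trans)
    then show "pair n v \<le> pair n w" by simp
  qed
qed

text \<open>Adding the inequalities of a point of \<open>F(3/2 P)\<close> for \<open>n\<close> and
  \<open>-n\<close> shows that 3/2 times the width in direction \<open>n\<close> is at least 2. The
  width in direction \<open>n\<close> is an integer greater than 1, and the direction
  \<open>(1, 0, 0)\<close> gives at most 2.\<close>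

lemma over2_lattice_width:
  assumes V: "finite V" "V \<noteq> {}" and o: "over2 V" and F: "x \<in> FinZ (3 / 2) V"
  shows "lattice_width (hullZ V) = 2"
proof -
  define g where "g m = - Min_on (hullZ V) (- m) - Min_on (hullZ V) m" for m
  have ge: "2 \<le> g (pt n)" if n: "n \<noteq> (0, 0, 0)" for n
  proof -
    obtain a b c where abc: "n = (a, b, c)" by (cases n)
    let ?m = "(- a, - b, - c)"
    have m: "pt ?m = - pt n" "?m \<noteq> (0, 0, 0)" using n by (auto simp: abc)
    obtain v where v: "Min_on (hullZ V) (pt n) = of_int (pair n v)" "\<And>w. w \<in> V \<Longrightarrow> pair n v \<le> pair n w"
      using Min_on_hullZ[OF V] by metis
    obtain u where u: "Min_on (hullZ V) (pt ?m) = of_int (pair ?m u)" "\<And>w. w \<in> V \<Longrightarrow> pair ?m u \<le> pair ?m w"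
      using Min_on_hullZ[OF V] by metis
    obtain v' where v': "v' \<in> V" "3 / 2 * of_int (pair n v') + 1 \<le> x \<bullet> pt n"
      using F n unfolding FinZ_def by blast
    obtain u' where u': "u' \<in> V" "3 / 2 * of_int (pair ?m u') + 1 \<le> x \<bullet> pt ?m"
      using F m(2) unfolding FinZ_def by blast
    have "real_of_int (pair n v) \<le> of_int (pair n v')" "real_of_int (pair ?m u) \<le> of_int (pair ?m u')"
      using v(2)[OF v'(1)] u(2)[OF u'(1)] by (simp_all only: of_int_le_iff)
    moreover have "x \<bullet> pt ?m = - (x \<bullet> pt n)" unfolding m(1) by simp
    ultimately have "3 * real_of_int (pair n v) + 3 * of_int (pair ?m u) + 4 \<le> 0" using v'(2) u'(2) by linarith
    then have "real_of_int (3 * pair n v + 3 * pair ?m u + 4) \<le> of_int 0" by simp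
    then have "3 * pair n v + 3 * pair ?m u + 4 \<le> 0" by (simp only: of_int_le_iff)
    then have "pair n v + pair ?m u \<le> - 2" by presburger
    then have "real_of_int (pair n v + pair ?m u) \<le> of_int (- 2)" by (simp only: of_int_le_iff)
    then show ?thesis unfolding g_def m(1)[symmetric] v(1) u(1) by simp
  qed
  have le: "g (pt (1, 0, 0)) \<le> 2"
  proof -
    have b: "0 \<le> x \<and> 0 \<le> y \<and> x + y \<le> 2" if "(x, y, z) \<in> V" for x y z
      using bspec[OF o[unfolded over2_def] that] by simp
    obtain v where v: "v \<in> V" "Min_on (hullZ V) (pt (1, 0, 0)) = of_int (pair (1, 0, 0) v)"
      using Min_on_hullZ[OF V] by metis
    obtain u where u: "u \<in> V" "Min_on (hullZ V) (pt (-1, 0, 0)) = of_int (pair (-1, 0, 0) u)"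
      using Min_on_hullZ[OF V] by metis
    have "0 \<le> pair (1, 0, 0) v" using b v(1) by (cases v) simp
    moreover have "- 2 \<le> pair (-1, 0, 0) u" using b u(1) by (cases u) fastforce
    ultimately have "real_of_int 0 \<le> of_int (pair (1, 0, 0) v)" "real_of_int (- 2) \<le> of_int (pair (-1, 0, 0) u)"
      by (simp_all only: of_int_le_iff)
    moreover have "- pt (1, 0, 0) = pt (-1, 0, 0)" by simp
    ultimately show ?thesis unfolding g_def using v(2) u(2) by simp
  qed
  have "lattice_width (hullZ V) = Inf (g ` pt ` (- {(0, 0, 0)}))"
    unfolding lattice_width_def dual_r3 g_def ..
  also have "\<dots> = 2"
  proof (rule cInf_eq_minimum)
    have "g (pt (1, 0, 0)) = 2" using le ge[of "(1, 0, 0)"] by simp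
    then show "2 \<in> g ` pt ` (- {(0, 0, 0)})" by (intro image_eqI[of _ _ "pt (1, 0, 0)"] imageI) (simp_all del: pt_simp)
    fix r assume "r \<in> g ` pt ` (- {(0, 0, 0)})"
    then obtain n where "n \<noteq> (0, 0, 0)" "r = g (pt n)" by blast
    then show "2 \<le> r" using ge by simp
  qed
  finally show ?thesis .
qed

text \<open>At most four points with three-dimensional affine hull are exactly four and affinely
  independent.\<close>

lemma simplex3I:
  fixes P :: "(real ^ 3) set"
  assumes "full_lattice_polytope P" "P = convex hull C" "finite C" "card C \<le> 4"
  shows "3 simplex P"
proof -
  have d: "aff_dim C = 3" using assms(1,2) by (simp add: full_lattice_polytope_def aff_dim_convex_hull)
  then have "card C = 4" using aff_dim_le_card[OF assms(3)] assms(4) by simp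
  then have "\<not> affine_dependent C" "int (card C) = 3 + 1" using d assms(3) by (simp_all add: affine_independent_iff_card)
  then show ?thesis unfolding simplex_def using assms(2) by blast
qed

lemma simplex3_equiv:
  fixes P :: "(real ^ 3) set"
  assumes "unimodular_equiv (hullZ V) P" "full_lattice_polytope P" "finite V" "card V \<le> 4"
  shows "3 simplex P"
proof -
  obtain A t where A: "unimod A" "P = (\<lambda>x. A x + t) ` hullZ V"
    using assms(1) unfolding unimodular_equiv_iff by blast
  have lin: "linear A" using A(1) by (simp add: unimod_def)
  have P: "P = convex hull ((\<lambda>x. A x + t) ` pt ` V)"
    by (simp add: A(2) hullZ_def affine_image_eq convex_hull_linear_image[OF lin] convex_hull_translation)
  show ?thesis
  proof (rule simplex3I[OF assms(2) P])
    show "card ((\<lambda>x. A x + t) ` pt ` V) \<le> 4"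
      unfolding image_image using card_image_le[OF assms(3)] assms(4) by (rule order_trans)
  qed (use assms(3) in simp)
qed

text \<open>The four facet normals of the simplex. The least value 4 of \<open>p + q + 2 * r\<close>
  equals \<open>2 * d - 1\<close> at \<open>d = 5/2\<close>, which explains this multiplier.\<close>

lemma exceptional_D:
  assumes "0 \<le> d" "(p, q, r) \<in> FinZ d {(0, 0, 0), (0, 0, 1), (0, 2, 0), (2, 0, 0)}"
  shows "1 \<le> p" "1 \<le> q" "1 \<le> r" "p + q + 2 * r \<le> 2 * d - 1"
proof -
  let ?V = "{(0, 0, 0), (0, 0, 1), (0, 2, 0), (2, 0, 0)} :: i3 set"
  obtain v1 where v1: "v1 \<in> ?V" "d * of_int (pair (1, 0, 0) v1) + 1 \<le> (p, q, r) \<bullet> pt (1, 0, 0)"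
    by (rule FinZ_D[OF assms(2), of 1 0 0]) simp_all
  obtain v2 where v2: "v2 \<in> ?V" "d * of_int (pair (0, 1, 0) v2) + 1 \<le> (p, q, r) \<bullet> pt (0, 1, 0)"
    by (rule FinZ_D[OF assms(2), of 0 1 0]) simp_all
  obtain v3 where v3: "v3 \<in> ?V" "d * of_int (pair (0, 0, 1) v3) + 1 \<le> (p, q, r) \<bullet> pt (0, 0, 1)"
    by (rule FinZ_D[OF assms(2), of 0 0 1]) simp_all
  obtain v4 where v4: "v4 \<in> ?V" "d * of_int (pair (-1, -1, -2) v4) + 1 \<le> (p, q, r) \<bullet> pt (-1, -1, -2)"
    by (rule FinZ_D[OF assms(2), of "-1" "-1" "-2"]) simp_all
  show "1 \<le> p" using v1 assms(1) by auto
  show "1 \<le> q" using v2 assms(1) by auto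
  show "1 \<le> r" using v3 assms(1) by auto
  show "p + q + 2 * r \<le> 2 * d - 1" using v4 assms(1) by auto
qed

lemma exceptional_interior: "(1, 1, 1) \<in> FinZ (5 / 2) {(0, 0, 0), (0, 0, 1), (0, 2, 0), (2, 0, 0)}"
proof -
  let ?V = "{(0, 0, 0), (0, 0, 1), (0, 2, 0), (2, 0, 0)} :: i3 set"
  have "\<exists>v\<in>?V. 5 / 2 * of_int (pair n v) + 1 \<le> (1, 1, 1) \<bullet> pt n" if ne: "n \<noteq> (0, 0, 0)" for n
  proof (rule ccontr)
    assume neg: "\<not> ?thesis"
    obtain a b c where n: "n = (a, b, c)" by (cases n)
    have low: "2 * (a + b + c) < 5 * pair n v + 2" if v: "v \<in> ?V" for v
    proof -
      have "(1, 1, 1) \<bullet> pt n < 5 / 2 * of_int (pair n v) + 1" using neg v by fastforce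
      then have "real_of_int (2 * (a + b + c)) < of_int (5 * pair n v + 2)" by (simp add: n)
      then show ?thesis by (simp only: of_int_less_iff)
    qed
    have "2 * (a + b + c) < 2" "2 * (a + b + c) < 5 * c + 2" "2 * (a + b + c) < 10 * b + 2" "2 * (a + b + c) < 10 * a + 2"
      using low[of "(0, 0, 0)"] low[of "(0, 0, 1)"] low[of "(0, 2, 0)"] low[of "(2, 0, 0)"] by (simp_all add: n)
    \<comment> \<open>Adding the bounds for \<open>5 * a\<close>, \<open>5 * b\<close> and
      \<open>5 * c\<close> confines \<open>s\<close> to -1 and 0. Rounding then makes
      \<open>a\<close>, \<open>b\<close>, \<open>c\<close> nonnegative, with sum at most 0.\<close>
    moreover define s where "s = a + b + c"
    ultimately have l: "2 * s < 2" "2 * s < 5 * c + 2" "2 * s < 10 * b + 2" "2 * s < 10 * a + 2" by simp_all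
    have "s \<le> 0" using l(1) by simp
    moreover have "s \<le> 5 * a" using l(4) by simp
    moreover have "s \<le> 5 * b" using l(3) by simp
    moreover have "2 * s \<le> 5 * c + 1" using l(2) by simp
    moreover have "5 * s = 5 * a + 5 * b + 5 * c" by (simp add: s_def)
    ultimately have "- 1 \<le> s" "s \<le> 0" "- 1 \<le> 5 * a" "- 1 \<le> 5 * b" "- 3 \<le> 5 * c" by simp_all
    then have "0 \<le> a" "0 \<le> b" "0 \<le> c" "a + b + c \<le> 0" by (simp_all add: s_def)
    then have "a = 0 \<and> b = 0 \<and> c = 0" by simp
    then show False using ne n by simp
  qed
  then show ?thesis unfolding FinZ_def mem_Collect_eq by blast
qed

lemma exceptional:
  defines "V \<equiv> {(0, 0, 0), (0, 0, 1), (0, 2, 0), (2, 0, 0)} :: i3 set"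
  shows "ws V" "min_multiplier (hullZ V) = 5 / 2"
proof -
  have "vdet (0, 0, 0) (0, 0, 1) (0, 2, 0) (2, 0, 0) \<noteq> 0" by (simp add: vdet_def)
  then have full: "full_lattice_polytope (hullZ V)" unfolding V_def by (rule hullZ_full[rotated 5]) simp_all
  have one: "FinZ (5 / 2) V = {(1, 1, 1)}"
  proof (intro equalityI subsetI)
    fix x assume x: "x \<in> FinZ (5 / 2) V"
    obtain p q r where "x = (p, q, r)" by (cases x)
    then show "x \<in> {(1, 1, 1)}" using exceptional_D[of "5 / 2" p q r] x unfolding V_def by simp
  qed (use exceptional_interior in \<open>simp add: V_def\<close>)
  have none: "FinZ d V = {}" if d: "0 \<le> d" "d < 5 / 2" for d
  proof (rule ccontr)
    assume "FinZ d V \<noteq> {}"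
    then obtain x where "x \<in> FinZ d V" by blast
    moreover obtain p q r where "x = (p, q, r)" by (cases x)
    ultimately show False using exceptional_D[OF d(1), of p q r] d(2) unfolding V_def by simp
  qed
  have fin: "finite V" by (simp add: V_def)
  have c: "1 < (5 / 2 :: real)" by simp
  show "ws V" "min_multiplier (hullZ V) = 5 / 2" using wsI[OF fin full c one none] by blast+
qed

subsection \<open>Verification of the representatives of width two\<close>

text \<open>Apart from the column heights and the height \<open>t / 2\<close> of the only point of the Fine interior of
  \<open>3 / 2 P\<close>, the data are normals \<open>(a, b, 1)\<close> and \<open>(a', b', -1)\<close> that bound this height from below and above.\<close>

definition half_fact :: "i3 list \<Rightarrow> i12 \<times> int \<times> (int \<times> int) \<times> int \<times> int \<Rightarrow> bool" where
  "half_fact V = (\<lambda>((lA, uA, lB, uB, lC, uC, lD, uD, lE, uE, lF, uF), t, (a, b), a', b').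
    set (half_verts (lA, uA, lB, uB, lC, uC, lD, uD, lE, uE, lF, uF)) = set V \<and> full_check V \<and>
    low2 lA lB lC lD lE lF \<le> t \<and> low2 (- uA) (- uB) (- uC) (- uD) (- uE) (- uF) \<le> - t \<and>
    list_all (\<lambda>v. 2 * (a + b) + t \<le> 3 * pair (a, b, 1) v + 2) V \<and>
    list_all (\<lambda>v. 2 * (a' + b') - t \<le> 3 * pair (a', b', -1) v + 2) V \<and>
    list_all (\<lambda>(x, y, z). 0 \<le> x \<and> 0 \<le> y \<and> x + y \<le> 2) V)"

lemma half_fact:
  assumes "half_fact V k"
  shows "ws (set V)" "min_multiplier (hullZ (set V)) = 3 / 2" "over2 (set V)" "FinZ (3 / 2) (set V) \<noteq> {}"
proof -
  obtain lA uA lB uB lC uC lD uD lE uE lF uF t a b a' b'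
    where k: "k = ((lA, uA, lB, uB, lC, uC, lD, uD, lE, uE, lF, uF), t, (a, b), a', b')"
    by (metis prod.exhaust)
  note c = assms[unfolded half_fact_def k prod.case]
  have V: "set V = set (half_verts (lA, uA, lB, uB, lC, uC, lD, uD, lE, uE, lF, uF))" using c by blast
  have t: "low2 lA lB lC lD lE lF \<le> t" "low2 (- uA) (- uB) (- uC) (- uD) (- uE) (- uF) \<le> - t" using c by blast+
  have lo: "2 * (a + b) + t \<le> 3 * pair (a, b, 1) v + 2" and up: "2 * (a' + b') - t \<le> 3 * pair (a', b', -1) v + 2"
    if "v \<in> set V" for v using c that unfolding list_all_iff by blast+
  have full: "full_lattice_polytope (hullZ (set V))" by (rule full_check) (use c in blast)
  show o: "over2 (set V)" unfolding over2_def using c[THEN conjunct2, THEN conjunct2, THEN conjunct2, THEN conjunct2, THEN conjunct2, THEN conjunct2]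
    by (simp only: list_all_iff)
  have int: "(1, 1, of_int t / 2) \<in> FinZ (3 / 2) (set V)"
    by (rule half_interior[of lA _ uA lB uB lC uC lD uD lE uE lF uF t]) (use t in \<open>simp_all add: V half_verts_def\<close>)
  have one: "FinZ (3 / 2) (set V) = {(1, 1, of_int t / 2)}"
  proof (intro equalityI subsetI)
    fix x assume x: "x \<in> FinZ (3 / 2) (set V)"
    obtain p q r where pqr: "x = (p, q, r)" by (cases x)
    have "1 \<le> p" "1 \<le> q" "p + q \<le> 2" using over2_D[OF o _ x[unfolded pqr]] by simp_all
    then have pq: "p = 1" "q = 1" by linarith+
    obtain v where v: "v \<in> set V" "3 / 2 * of_int (pair (a, b, 1) v) + 1 \<le> x \<bullet> pt (a, b, 1)"
      by (rule FinZ_D[OF x, of a b 1]) simp_all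
    have "real_of_int (2 * (a + b) + t) \<le> of_int (3 * pair (a, b, 1) v + 2)" using lo[OF v(1)] by (simp only: of_int_le_iff)
    then have 1: "of_int t / 2 \<le> r" using v(2) by (simp add: pqr pq del: pair_simp)
    obtain u where u: "u \<in> set V" "3 / 2 * of_int (pair (a', b', -1) u) + 1 \<le> x \<bullet> pt (a', b', -1)"
      by (rule FinZ_D[OF x, of a' b' "-1"]) simp_all
    have "real_of_int (2 * (a' + b') - t) \<le> of_int (3 * pair (a', b', -1) u + 2)" using up[OF u(1)] by (simp only: of_int_le_iff)
    then have 2: "r \<le> of_int t / 2" using u(2) by (simp add: pqr pq del: pair_simp)
    show "x \<in> {(1, 1, of_int t / 2)}" using 1 2 by (simp add: pqr pq)
  qed (use int in simp)
  show "FinZ (3 / 2) (set V) \<noteq> {}" using int by blast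
  have none: "FinZ d (set V) = {}" if "0 \<le> d" "d < 3 / 2" for d by (rule over2_empty[OF o that])
  have c: "1 < (3 / 2 :: real)" by simp
  show "ws (set V)" "min_multiplier (hullZ (set V)) = 3 / 2" using wsI[OF finite_set full c one none] by blast+
qed

section \<open>Inequivalence of the representatives, and the count\<close>

subsection \<open>An invariant of lattice polytopes\<close>

fun pair_sum :: "('a \<Rightarrow> 'a \<Rightarrow> int) \<Rightarrow> 'a list \<Rightarrow> int" where
  "pair_sum f [] = 0" | "pair_sum f (x # xs) = sum_list (map (f x) xs) + pair_sum f xs"

fun triple_sum :: "('a \<Rightarrow> 'a \<Rightarrow> 'a \<Rightarrow> int) \<Rightarrow> 'a list \<Rightarrow> int" where
  "triple_sum f [] = 0" | "triple_sum f (x # xs) = pair_sum (f x) xs + triple_sum f xs"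

fun quad_sum :: "('a \<Rightarrow> 'a \<Rightarrow> 'a \<Rightarrow> 'a \<Rightarrow> int) \<Rightarrow> 'a list \<Rightarrow> int" where
  "quad_sum f [] = 0" | "quad_sum f (x # xs) = triple_sum (f x) xs + quad_sum f xs"

lemma pair_sum:
  assumes sym: "\<And>a b. f a b = f b a" and z: "\<And>a. f a a = 0"
  shows "(\<Sum>a\<leftarrow>xs. \<Sum>b\<leftarrow>xs. f a b) = 2 * pair_sum f xs"
proof (induction xs)
  case (Cons x xs)
  have "(\<Sum>a\<leftarrow>xs. f a x) = (\<Sum>a\<leftarrow>xs. f x a)" using sym by simp
  then show ?case using Cons.IH by (simp add: sum_list_addf z)
qed simp

lemma triple_sum:
  assumes s: "\<And>a b c. f a b c = f b a c" "\<And>a b c. f a b c = f a c b" and z: "\<And>a b. f a a b = 0"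
  shows "(\<Sum>a\<leftarrow>xs. \<Sum>b\<leftarrow>xs. \<Sum>c\<leftarrow>xs. f a b c) = 6 * triple_sum f xs"
proof (induction xs)
  case (Cons x xs)
  have z': "f a b a = 0" "f b a a = 0" for a b using z s by metis+
  have "(\<Sum>a\<leftarrow>xs. \<Sum>c\<leftarrow>xs. f a x c) = (\<Sum>a\<leftarrow>xs. \<Sum>c\<leftarrow>xs. f x a c)" by (subst s(1)) (rule refl)
  moreover have "f a b x = f x a b" for a b using s by metis
  then have "(\<Sum>a\<leftarrow>xs. \<Sum>b\<leftarrow>xs. f a b x) = (\<Sum>a\<leftarrow>xs. \<Sum>b\<leftarrow>xs. f x a b)" by (simp only:)
  moreover have "(\<Sum>a\<leftarrow>xs. \<Sum>b\<leftarrow>xs. f x a b) = 2 * pair_sum (f x) xs" by (rule pair_sum) (use s z' in auto)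
  moreover have "f a a = (\<lambda>_. 0)" for a by (rule ext) (rule z)
  ultimately show ?case using Cons.IH by (simp add: sum_list_addf z')
qed simp

text \<open>Relates the sum over unordered quadruples, which is what gets evaluated, to the sum over
  all quadruples, which depends only on the set of entries and can be transported along a bijection.
  Vanishing on repetitions removes the diagonal.\<close>

lemma quad_sum:
  assumes s: "\<And>a b c d. f a b c d = f b a c d" "\<And>a b c d. f a b c d = f a c b d" "\<And>a b c d. f a b c d = f a b d c"
    and z: "\<And>a b c. f a a b c = 0"
  shows "(\<Sum>a\<leftarrow>xs. \<Sum>b\<leftarrow>xs. \<Sum>c\<leftarrow>xs. \<Sum>d\<leftarrow>xs. f a b c d) = 24 * quad_sum f xs"
proof (induction xs)
  case (Cons x xs)
  have z1: "f b a a c = 0" for a b c using z s by metis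
  have z2: "f a b a c = 0" for a b c using z1 s(1) by metis
  have z3: "f b c a a = 0" for a b c using z1 s(2,3) by metis
  have z4: "f b a c a = 0" for a b c using z3 s(2) by metis
  have z5: "f a b c a = 0" for a b c using z4 s(1) by metis
  have m1: "f a x c d = f x a c d" for a c d by (rule s(1))
  have m2: "f a b x d = f x a b d" for a b d using s(1)[of x a] s(2)[of a x] by metis
  have m3: "f a b c x = f x a b c" for a b c using m2[of a b c] s(3)[of a b c x] by metis
  let ?S = "\<Sum>a\<leftarrow>xs. \<Sum>b\<leftarrow>xs. \<Sum>c\<leftarrow>xs. f x a b c"
  have "(\<Sum>a\<leftarrow>xs. \<Sum>c\<leftarrow>xs. \<Sum>d\<leftarrow>xs. f a x c d) = ?S" by (subst m1) (rule refl)
  moreover have "(\<Sum>a\<leftarrow>xs. \<Sum>b\<leftarrow>xs. \<Sum>d\<leftarrow>xs. f a b x d) = ?S" by (subst m2) (rule refl)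
  moreover have "(\<Sum>a\<leftarrow>xs. \<Sum>b\<leftarrow>xs. \<Sum>c\<leftarrow>xs. f a b c x) = ?S" by (subst m3) (rule refl)
  moreover have "?S = 6 * triple_sum (f x) xs" by (rule triple_sum) (rule s(2) s(3) z1)+
  moreover have "f a a = (\<lambda>_ _. 0)" "f b a a = (\<lambda>_. 0)" "f a b a = (\<lambda>_. 0)" for a b by (simp_all add: fun_eq_iff z z1 z2)
  ultimately show ?case using Cons.IH by (simp add: sum_list_addf z3 z4 z5)
qed simp

text \<open>The difference of the two points is divisible by 2 in the lattice.\<close>

definition par3 :: "i3 \<Rightarrow> i3 \<Rightarrow> bool" where
  "par3 = (\<lambda>(x, y, z) (x', y', z'). even (x' - x) \<and> even (y' - y) \<and> even (z' - z))"

text \<open>\<open>D\<close> is the normalized volume of the four points and \<open>s\<close> counts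
  the edges divisible by 2, both unimodular invariants. The factor \<open>D\<close> kills quadruples
  with a repetition; the polynomial is one for which the sums differ within each family, as
  \<open>key_facts\<close> confirms.\<close>

definition quad_weight :: "i3 \<Rightarrow> i3 \<Rightarrow> i3 \<Rightarrow> i3 \<Rightarrow> int" where
  "quad_weight a b c d = (let D = \<bar>vdet a b c d\<bar>; s = (if par3 a b then 1 else 0) + (if par3 a c then 1 else 0) +
     (if par3 a d then 1 else 0) + (if par3 b c then 1 else 0) + (if par3 b d then 1 else 0) + (if par3 c d then 1 else 0)
   in D * (3 + D + s * (1 + 2 * D)))"

definition key :: "i3 list \<Rightarrow> int" where
  "key V = quad_sum quad_weight V"

lemma par3_sym: "par3 a b = par3 b a"
  by (cases a; cases b) (auto simp: par3_def)

lemma vdet_swap: "vdet b a c d = - vdet a b c d" "vdet a c b d = - vdet a b c d" "vdet a b d c = - vdet a b c d"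
  by (cases a; cases b; cases c; cases d; simp add: vdet_def algebra_simps)+

lemma quad_weight_sym: "quad_weight a b c d = quad_weight b a c d" "quad_weight a b c d = quad_weight a c b d"
  "quad_weight a b c d = quad_weight a b d c" "quad_weight a a c d = 0"
proof -
  show "quad_weight a b c d = quad_weight b a c d"
    unfolding quad_weight_def Let_def vdet_swap(1)[of b a c d] par3_sym[of b a] abs_minus_cancel by (simp only: ac_simps)
  show "quad_weight a b c d = quad_weight a c b d"
    unfolding quad_weight_def Let_def vdet_swap(2)[of a c b d] par3_sym[of c b] abs_minus_cancel by (simp only: ac_simps)
  show "quad_weight a b c d = quad_weight a b d c"
    unfolding quad_weight_def Let_def vdet_swap(3)[of a b d c] par3_sym[of d c] abs_minus_cancel by (simp only: ac_simps)
  have "vdet a a c d = 0" by (cases a; cases c; cases d) (simp add: vdet_def)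
  then show "quad_weight a a c d = 0" by (simp add: quad_weight_def)
qed

lemma det3_mult:
  fixes a b c d e f g h i u1 u2 u3 v1 v2 v3 w1 w2 w3 :: int
  shows "(a * u1 + b * u2 + c * u3) * ((d * v1 + e * v2 + f * v3) * (g * w1 + h * w2 + i * w3) - (g * v1 + h * v2 + i * v3) * (d * w1 + e * w2 + f * w3)) -
    (d * u1 + e * u2 + f * u3) * ((a * v1 + b * v2 + c * v3) * (g * w1 + h * w2 + i * w3) - (g * v1 + h * v2 + i * v3) * (a * w1 + b * w2 + c * w3)) +
    (g * u1 + h * u2 + i * u3) * ((a * v1 + b * v2 + c * v3) * (d * w1 + e * w2 + f * w3) - (d * v1 + e * v2 + f * v3) * (a * w1 + b * w2 + c * w3)) =
    (a * (e * i - f * h) - b * (d * i - f * g) + c * (d * h - e * g)) *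
    (u1 * (v2 * w3 - v3 * w2) - u2 * (v1 * w3 - v3 * w1) + u3 * (v1 * w2 - v2 * w1))"
  by (simp add: algebra_simps)

lemma i12_cases: obtains a b c d e f g h i s t u :: int where "k = (a, b, c, d, e, f, g, h, i, s, t, u)"
proof -
  obtain a b c d e f k' where "k = (a, b, c, d, e, f, k')" by (cases k)
  moreover obtain g h i s t u where "k' = (g, h, i, s, t, u)" by (cases k')
  ultimately show ?thesis using that by blast
qed

lemma amap_diff:
  fixes a b c x y z x' y' z' s :: int
  shows "a * x' + b * y' + c * z' + s - (a * x + b * y + c * z + s) = a * (x' - x) + b * (y' - y) + c * (z' - z)"
  by (simp add: algebra_simps)

lemma vdet_amap: "vdet (amap k p) (amap k q) (amap k r) (amap k v) = amap_det k * vdet p q r v"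
proof -
  obtain a b c d e f g h i s t u where k: "k = (a, b, c, d, e, f, g, h, i, s, t, u)" by (rule i12_cases)
  obtain p1 p2 p3 where p: "p = (p1, p2, p3)" by (cases p)
  obtain q1 q2 q3 where q: "q = (q1, q2, q3)" by (cases q)
  obtain r1 r2 r3 where r: "r = (r1, r2, r3)" by (cases r)
  obtain v1 v2 v3 where v: "v = (v1, v2, v3)" by (cases v)
  show ?thesis
    unfolding k p q r v vdet_def amap_def amap_det_def prod.case amap_diff by (rule det3_mult)
qed

text \<open>An integer matrix preserves divisibility of a difference by 2; conversely the adjugate
  recovers that difference up to sign.\<close>

lemma par3_amap:
  assumes "amap_det k \<in> {1, -1}" shows "par3 (amap k p) (amap k q) = par3 p q"
proof -
  obtain a b c d e f g h i s t u where k: "k = (a, b, c, d, e, f, g, h, i, s, t, u)" by (rule i12_cases)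
  obtain p1 p2 p3 where p: "p = (p1, p2, p3)" by (cases p)
  obtain q1 q2 q3 where q: "q = (q1, q2, q3)" by (cases q)
  define x y z where "x = q1 - p1" and "y = q2 - p2" and "z = q3 - p3"
  have L: "par3 (amap k p) (amap k q) \<longleftrightarrow> even (a * x + b * y + c * z) \<and> even (d * x + e * y + f * z) \<and> even (g * x + h * y + i * z)"
    unfolding k p q par3_def amap_def prod.case amap_diff x_def y_def z_def ..
  have R: "par3 p q \<longleftrightarrow> even x \<and> even y \<and> even z" by (simp add: p q par3_def x_def y_def z_def)
  define D where "D = a * (e * i - f * h) - b * (d * i - f * g) + c * (d * h - e * g)"
  have D: "D = 1 \<or> D = - 1" using assms by (simp add: k amap_det_def D_def)
  have "D * x = (e * i - f * h) * (a * x + b * y + c * z) - (b * i - c * h) * (d * x + e * y + f * z) + (b * f - c * e) * (g * x + h * y + i * z)"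
    "D * y = (f * g - d * i) * (a * x + b * y + c * z) - (c * g - a * i) * (d * x + e * y + f * z) + (c * d - a * f) * (g * x + h * y + i * z)"
    "D * z = (d * h - e * g) * (a * x + b * y + c * z) - (a * h - b * g) * (d * x + e * y + f * z) + (a * e - b * d) * (g * x + h * y + i * z)"
    unfolding D_def by (simp_all add: algebra_simps)
  note adj = this
  show ?thesis
  proof
    assume "par3 (amap k p) (amap k q)"
    then have "even (a * x + b * y + c * z)" "even (d * x + e * y + f * z)" "even (g * x + h * y + i * z)" using L by blast+
    then have "even (D * x)" "even (D * y)" "even (D * z)" unfolding adj by (simp_all only: dvd_mult dvd_add dvd_diff)
    then show "par3 p q" using D R by auto
  next
    assume "par3 p q"
    then have "even x" "even y" "even z" using R by blast+
    then show "par3 (amap k p) (amap k q)" unfolding L by (simp only: dvd_mult dvd_add simp_thms)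
  qed
qed

lemma unimod_amap0:
  fixes A :: "r3 \<Rightarrow> r3"
  assumes "unimod A"
  obtains a b c d e f g h i where "\<And>v. A (pt v) = pt (amap (a, b, c, d, e, f, g, h, i, 0, 0, 0) v)"
proof -
  have lin: "linear A" and lat: "A ` int_lattice = int_lattice" using assms by (auto simp: unimod_def)
  have ex: "\<exists>w. A (pt v) = pt w" for v using lat unfolding int_lattice_r3 by blast
  obtain w1 where w1: "A (pt (1, 0, 0)) = pt w1" using ex by blast
  obtain w2 where w2: "A (pt (0, 1, 0)) = pt w2" using ex by blast
  obtain w3 where w3: "A (pt (0, 0, 1)) = pt w3" using ex by blast
  obtain a d g where w1': "w1 = (a, d, g)" by (cases w1)
  obtain b e h where w2': "w2 = (b, e, h)" by (cases w2)
  obtain c f i where w3': "w3 = (c, f, i)" by (cases w3)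
  have "A (pt v) = pt (amap (a, b, c, d, e, f, g, h, i, 0, 0, 0) v)" for v
  proof -
    obtain x y z where v: "v = (x, y, z)" by (cases v)
    have "pt v = of_int x *\<^sub>R pt (1, 0, 0) + (of_int y *\<^sub>R pt (0, 1, 0) + of_int z *\<^sub>R pt (0, 0, 1))" by (simp add: v)
    then have "A (pt v) = of_int x *\<^sub>R A (pt (1, 0, 0)) + (of_int y *\<^sub>R A (pt (0, 1, 0)) + of_int z *\<^sub>R A (pt (0, 0, 1)))"
      by (simp only: linear_add[OF lin] linear_scale[OF lin])
    then show ?thesis unfolding w1 w2 w3 by (simp add: w1' w2' w3' v amap_def algebra_simps)
  qed
  then show ?thesis by (rule that)
qed

text \<open>On the lattice both the map and its inverse are integer matrices. Comparing the volume
  of the unit simplex before and after their composite shows that the determinants multiply to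
  1.\<close>

lemma unimod_amap:
  fixes A :: "r3 \<Rightarrow> r3"
  assumes A: "unimod A" and t: "t \<in> int_lattice"
  obtains k where "amap_det k \<in> {1, -1}" "\<And>v. A (pt v) + t = pt (amap k v)"
proof -
  obtain a b c d e f g h i where 1: "\<And>v. A (pt v) = pt (amap (a, b, c, d, e, f, g, h, i, 0, 0, 0) v)"
    using unimod_amap0[OF A] by blast
  obtain a' b' c' d' e' f' g' h' i' where 2: "\<And>v. inv A (pt v) = pt (amap (a', b', c', d', e', f', g', h', i', 0, 0, 0) v)"
    using unimod_amap0[OF unimod_inv[OF A]] by blast
  let ?k = "(a, b, c, d, e, f, g, h, i, 0, 0, 0)" and ?k' = "(a', b', c', d', e', f', g', h', i', 0, 0, 0)"
  have "inv A (A x) = x" for x using A by (simp add: unimod_def bij_def)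
  then have "pt (amap ?k' (amap ?k v)) = pt v" for v by (metis 1 2)
  then have id: "amap ?k' (amap ?k v) = v" for v using inj_pt by (meson injD)
  have "vdet v0 v1 v2 v3 = amap_det ?k' * (amap_det ?k * vdet v0 v1 v2 v3)" for v0 v1 v2 v3
    using vdet_amap[of ?k' "amap ?k v0" "amap ?k v1" "amap ?k v2" "amap ?k v3"] unfolding id vdet_amap .
  from this[of "(0, 0, 0)" "(1, 0, 0)" "(0, 1, 0)" "(0, 0, 1)"] have "amap_det ?k * amap_det ?k' = 1"
    by (simp add: vdet_def mult.commute)
  then have det: "amap_det ?k \<in> {1, -1}" by (auto simp: zmult_eq_1_iff)
  obtain w where w: "t = pt w" using t unfolding int_lattice_r3 by blast
  obtain s1 s2 s3 where s: "w = (s1, s2, s3)" by (cases w)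
  show ?thesis
  proof (rule that)
    show "amap_det (a, b, c, d, e, f, g, h, i, s1, s2, s3) \<in> {1, -1}" using det by (simp add: amap_det_def)
    fix v :: i3
    obtain x y z where "v = (x, y, z)" by (cases v)
    then show "A (pt v) + t = pt (amap (a, b, c, d, e, f, g, h, i, s1, s2, s3) v)" unfolding 1 w s by (simp add: amap_def)
  qed
qed

definition vert_check :: "i3 list \<Rightarrow> i3 list \<Rightarrow> bool" where
  "vert_check V ns \<longleftrightarrow> distinct V \<and> list_all2 (\<lambda>v n. list_all (\<lambda>w. w = v \<or> pair n v < pair n w) V) V ns"

text \<open>Each point comes with a normal whose minimum over the list is attained there alone, so
  it is outside the hull of the others.\<close>

lemma vert_check:
  assumes "vert_check V ns" shows "{p. p extreme_point_of hullZ (set V)} = pt ` set V"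
proof -
  have "p extreme_point_of (convex hull (pt ` set V)) \<longleftrightarrow> p \<in> pt ` set V" for p
  proof (rule extreme_point_of_convex_hull_convex_independent)
    show "compact (pt ` set V)" by (simp add: finite_imp_compact)
    fix q assume "q \<in> pt ` set V"
    then obtain v where v: "v \<in> set V" "q = pt v" by blast
    have L: "list_all2 (\<lambda>v n. list_all (\<lambda>w. w = v \<or> pair n v < pair n w) V) V ns"
      using assms by (simp add: vert_check_def)
    obtain i where i: "i < length V" "V ! i = v" using v(1) by (metis in_set_conv_nth)
    have "list_all (\<lambda>w. w = V ! i \<or> pair (ns ! i) (V ! i) < pair (ns ! i) w) V" using list_all2_nthD[OF L i(1)] .
    then obtain n where n: "\<And>w. w \<in> set V \<Longrightarrow> w = v \<or> pair n v < pair n w"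
      unfolding list_all_iff i(2) by blast
    have "pt ` set V - {q} \<subseteq> {x. pt n \<bullet> x > of_int (pair n v)}"
    proof
      fix x assume x: "x \<in> pt ` set V - {q}"
      then obtain w where w: "w \<in> set V" "x = pt w" by blast
      then have "pair n v < pair n w" using n[OF w(1)] x v(2) by blast
      then show "x \<in> {x. pt n \<bullet> x > of_int (pair n v)}" by (simp add: w(2) inner_commute[of "pt n"] inner_pt del: pt_simp)
    qed
    then have "convex hull (pt ` set V - {q}) \<subseteq> {x. pt n \<bullet> x > of_int (pair n v)}"
      by (intro hull_minimal convex_halfspace_gt)
    moreover have "q \<notin> {x. pt n \<bullet> x > of_int (pair n v)}" by (simp add: v(2) inner_commute[of "pt n"] inner_pt del: pt_simp)
    ultimately show "q \<notin> convex hull (pt ` set V - {q})" by blast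
  qed
  then show ?thesis unfolding hullZ_def by blast
qed

lemma extreme_points_affine_image:
  assumes "unimod A"
  shows "{p. p extreme_point_of (\<lambda>x. A x + t) ` P} = (\<lambda>x. A x + t) ` {p. p extreme_point_of P}"
proof -
  have lin: "linear A" and inj: "inj A" using assms by (auto simp: unimod_def bij_def)
  have iff: "A x extreme_point_of A ` P \<longleftrightarrow> x extreme_point_of P" for x
    using face_of_linear_image[OF lin inj, of "{x}" P] by (simp add: face_of_singleton)
  have "{p. p extreme_point_of A ` P} = A ` {p. p extreme_point_of P}"
  proof (intro equalityI subsetI)
    fix p assume p: "p \<in> {p. p extreme_point_of A ` P}"
    then obtain x where "p = A x" by (auto simp: extreme_point_of_def)
    then show "p \<in> A ` {p. p extreme_point_of P}" using p iff by blast
  qed (use iff in blast)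
  then show ?thesis unfolding affine_image_eq extreme_points_of_translation by simp
qed

text \<open>An equivalence carries extreme points to extreme points, hence one vertex list
  bijectively onto the other, and it preserves volumes and parities.\<close>

lemma key_equiv:
  assumes "unimodular_equiv (hullZ (set V)) (hullZ (set W))" "vert_check V ns" "vert_check W ms"
  shows "key V = key W"
proof -
  obtain A t where A: "unimod A" "t \<in> int_lattice" "hullZ (set W) = (\<lambda>x. A x + t) ` hullZ (set V)"
    using assms(1) unfolding unimodular_equiv_iff by blast
  obtain k where k: "amap_det k \<in> {1, -1}" "\<And>v. A (pt v) + t = pt (amap k v)"
    using unimod_amap[OF A(1,2)] by blast
  have inj: "inj (amap k)"
  proof (rule injI)
    fix v w assume "amap k v = amap k w"
    then have "A (pt v) = A (pt w)" using k(2) by (metis add_right_cancel)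
    then show "v = w" using A(1) inj_pt by (simp add: unimod_def bij_def inj_eq)
  qed
  have "pt ` set W = pt ` amap k ` set V"
    using extreme_points_affine_image[OF A(1), of t "hullZ (set V)"]
    unfolding A(3)[symmetric] vert_check[OF assms(2)] vert_check[OF assms(3)] image_image k(2) .
  then have W: "set W = amap k ` set V" by (simp add: inj_image_eq_iff[OF inj_pt])
  have d: "distinct V" "distinct W" using assms(2,3) by (simp_all add: vert_check_def)
  have q: "quad_weight (amap k a) (amap k b) (amap k c) (amap k d) = quad_weight a b c d" for a b c d
  proof -
    have "\<bar>vdet (amap k a) (amap k b) (amap k c) (amap k d)\<bar> = \<bar>vdet a b c d\<bar>" using k(1) by (auto simp: vdet_amap abs_mult)
    then show ?thesis unfolding quad_weight_def par3_amap[OF k(1)] by simp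
  qed
  have s: "24 * key X = (\<Sum>a\<in>set X. \<Sum>b\<in>set X. \<Sum>c\<in>set X. \<Sum>d\<in>set X. quad_weight a b c d)" if "distinct X" for X
    unfolding key_def using quad_sum[of quad_weight X, OF quad_weight_sym] that by (simp add: sum_list_distinct_conv_sum_set)
  have "24 * key W = 24 * key V"
    unfolding s[OF d(1)] s[OF d(2)] W sum.reindex[OF inj_on_subset[OF inj subset_UNIV]] o_def q ..
  then show ?thesis by simp
qed

subsection \<open>Counting classes\<close>

lemma num_classes_reps:
  fixes r :: "'i \<Rightarrow> 'a::euclidean_space set"
  assumes mem: "\<And>i. i \<in> I \<Longrightarrow> r i \<in> X" and cov: "\<And>P. P \<in> X \<Longrightarrow> \<exists>i\<in>I. unimodular_equiv P (r i)"
    and ne: "\<And>i j. i \<in> I \<Longrightarrow> j \<in> I \<Longrightarrow> unimodular_equiv (r i) (r j) \<Longrightarrow> i = j"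
  shows "num_classes X = card I"
proof -
  define E where "E = {(P :: 'a set, Q :: 'a set). unimodular_equiv P Q}"
  have eq: "E `` {P} = E `` {Q}" if "unimodular_equiv P Q" for P Q
    using that unimodular_equiv_sym unimodular_equiv_trans unfolding E_def by blast
  have "X // E = (\<lambda>i. E `` {r i}) ` I"
  proof (intro equalityI subsetI)
    fix c assume "c \<in> X // E"
    then obtain P where P: "P \<in> X" "c = E `` {P}" by (auto simp: quotient_def)
    then obtain i where "i \<in> I" "unimodular_equiv P (r i)" using cov by blast
    then show "c \<in> (\<lambda>i. E `` {r i}) ` I" using eq P(2) by blast
  qed (use mem in \<open>auto simp: quotient_def\<close>)
  moreover have "inj_on (\<lambda>i. E `` {r i}) I"
  proof (rule inj_onI)
    fix i j assume ij: "i \<in> I" "j \<in> I" "E `` {r i} = E `` {r j}"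
    have "r j \<in> E `` {r j}" using unimodular_equiv_refl by (auto simp: E_def)
    then have "unimodular_equiv (r i) (r j)" using ij(3) by (auto simp: E_def)
    then show "i = j" using ne ij by blast
  qed
  ultimately show ?thesis unfolding num_classes_def E_def[symmetric] by (simp add: card_image)
qed

subsection \<open>The list of representatives\<close>

definition half_data :: "(i12 \<times> int \<times> (int \<times> int) \<times> int \<times> int) list list" where
  "half_data =
    [[((0,0,0,0,0,0,-2,0,-2,0,0,0),-2,(-2,-2),(0,0)),((0,0,0,0,0,0,-2,0,-1,0,-1,
    0),-2,(0,-1),(0,0)),((0,0,0,0,0,0,-2,0,-1,0,0,0),-2,(0,-1),(0,0)),((0,0,0,0,0,
    0,-2,0,0,0,0,0),-2,(0,-1),(0,0)),((0,0,0,0,0,0,-1,0,-1,0,0,1),0,(-1,-1),(0,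
    1)),((0,0,0,0,0,0,-1,0,-1,1,0,0),0,(-1,-1),(0,1)),((0,0,0,0,0,0,-1,0,-1,1,0,
    1),0,(-1,-1),(0,1)),((0,0,0,0,0,0,-1,1,-1,1,0,0),0,(-1,-1),(-1,-1)),((0,0,0,0,
    0,0,-1,0,0,0,0,1),0,(1,0),(0,1)),((0,0,0,0,0,0,-1,1,0,0,0,0),0,(1,0),(1,0))],
    [((0,0,0,0,0,1,-1,0,-1,0,0,0),0,(-1,-1),(0,1)),((0,0,0,0,0,1,-1,0,-1,0,0,1),
    0,(-1,-1),(0,1)),((0,0,0,0,0,1,-1,0,-1,1,0,0),0,(-1,-1),(0,1)),((0,0,0,0,0,1,
    -1,0,-1,1,0,1),0,(-1,-1),(0,1)),((0,0,0,0,0,1,-1,0,0,1,0,1),0,(1,0),(0,1)),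
    ((0,0,0,0,0,1,0,0,-1,0,-1,0),0,(0,1),(0,1)),((0,0,0,0,0,1,0,0,-1,0,-1,1),0,
    (0,1),(0,1)),((0,0,0,0,0,1,0,0,-1,1,-1,1),0,(0,1),(0,1)),((0,0,0,0,0,1,0,0,
    -1,0,0,0),0,(0,1),(0,1)),((0,0,0,0,0,1,0,0,-1,1,0,0),0,(0,1),(0,1))],[((0,0,0,
    0,0,1,0,0,-1,1,0,1),0,(0,1),(0,1)),((0,0,0,0,0,1,0,0,0,0,0,2),2,(0,0),(0,
    2)),((0,0,0,0,0,1,0,0,0,1,0,2),2,(0,0),(0,2)),((0,0,0,0,0,1,0,0,0,2,0,2),2,
    (0,0),(0,2)),((0,0,0,0,0,1,0,1,0,0,0,2),2,(0,0),(1,1)),((0,0,0,0,0,1,0,1,0,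
    1,0,2),2,(0,0),(1,1)),((0,0,0,0,0,2,-1,0,-1,1,0,1),0,(-1,-1),(0,1)),((0,0,0,0,
    0,2,-1,0,0,1,0,1),0,(1,0),(0,1)),((0,0,0,0,0,2,0,0,-1,1,-1,1),0,(0,1),(0,1)),
    ((0,0,0,0,0,2,0,0,-1,1,0,1),0,(0,1),(0,1))],[((0,0,0,0,0,3,0,0,0,1,0,1),2,
    (0,0),(0,2)),((0,0,0,0,0,3,0,0,0,1,0,2),2,(0,0),(0,2)),((0,0,0,0,0,3,0,0,0,
    2,0,2),2,(0,0),(0,2)),((0,0,0,0,0,4,0,0,0,2,0,2),2,(0,0),(0,2)),((0,0,0,1,0,
    1,0,0,0,0,0,2),2,(0,0),(1,1)),((0,0,0,1,0,1,0,0,0,1,0,2),2,(0,0),(1,1)),((0,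
    0,0,1,0,1,0,1,0,1,0,2),2,(0,0),(1,1)),((0,0,0,1,0,2,0,0,0,1,0,2),2,(0,0),
    (1,1)),((0,0,0,1,0,2,0,1,0,1,0,2),2,(0,0),(1,1)),((0,0,0,2,0,2,0,1,0,1,0,2),
    2,(0,0),(1,1))],[((0,0,0,0,1,1,-1,0,-1,0,0,0),0,(-1,-1),(0,1)),((0,0,0,0,1,1,
    -1,0,-1,0,0,1),0,(-1,-1),(0,1)),((0,0,0,0,1,1,-1,0,-1,1,0,0),0,(-1,-1),(0,1)),
    ((0,0,0,0,1,1,-1,0,-1,1,0,1),0,(-1,-1),(0,1)),((0,0,0,0,1,1,-1,0,-1,0,1,0),0,
    (-1,-1),(0,1)),((0,0,0,0,1,1,-1,0,-1,0,1,1),0,(-1,-1),(0,1)),((0,0,0,0,1,1,-1,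
    0,-1,1,1,0),0,(-1,-1),(0,1)),((0,0,0,0,1,1,-1,0,-1,1,1,1),0,(-1,-1),(0,1)),((0,
    0,0,0,1,1,-1,1,0,0,0,0),1,(0,-1),(0,0)),((0,0,0,0,1,1,-1,1,0,0,0,1),1,(0,
    -1),(0,0))],[((0,0,0,0,1,1,-1,1,0,1,0,1),1,(0,-1),(0,0)),((0,0,0,0,1,1,-1,1,0,
    0,1,0),1,(0,-1),(0,0)),((0,0,0,0,1,1,-1,1,0,0,1,1),1,(0,-1),(0,0)),((0,0,0,0,
    1,1,-1,1,1,0,1,0),1,(0,-1),(0,0)),((0,0,0,0,1,1,0,0,-1,0,-1,0),0,(0,1),(0,
    1)),((0,0,0,0,1,1,0,0,-1,0,-1,1),0,(0,1),(0,1)),((0,0,0,0,1,1,0,0,-1,1,-1,1),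
    0,(0,1),(0,1)),((0,0,0,0,1,1,0,0,-1,0,0,0),0,(0,1),(0,1)),((0,0,0,0,1,1,0,0,
    -1,1,0,0),0,(0,1),(0,1)),((0,0,0,0,1,1,0,0,-1,1,0,1),0,(0,1),(0,1))],[((0,0,0,
    0,1,1,0,0,-1,0,1,0),0,(0,1),(0,1)),((0,0,0,0,1,1,0,0,-1,1,1,0),0,(0,1),(0,
    1)),((0,0,0,0,1,1,0,0,-1,1,1,1),0,(0,1),(0,1)),((0,0,0,0,1,3,0,0,0,1,0,1),2,
    (0,0),(0,2)),((0,0,0,0,1,3,0,0,0,1,0,2),2,(0,0),(0,2)),((0,0,0,0,1,3,0,0,0,
    2,0,2),2,(0,0),(0,2)),((0,0,0,0,1,3,0,0,0,1,1,1),2,(0,0),(0,2)),((0,0,0,0,1,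
    3,0,0,0,1,1,2),2,(0,0),(0,2)),((0,0,0,0,1,3,0,0,0,2,1,1),2,(0,0),(0,2)),((0,
    0,0,0,1,3,0,0,1,1,1,1),2,(0,0),(0,2))],[((0,0,0,1,1,1,-1,1,0,0,0,1),1,(0,
    -1),(0,0)),((0,0,0,1,1,1,-1,1,0,1,0,1),1,(0,-1),(0,0)),((0,0,0,1,1,1,-1,1,0,
    0,1,1),1,(0,-1),(0,0)),((0,0,0,1,1,1,-1,1,1,0,0,1),1,(0,-1),(0,0)),((0,0,0,1,
    1,1,-1,1,1,1,0,1),1,(0,-1),(0,0)),((0,0,0,1,1,1,-1,1,1,0,1,1),1,(0,-1),(0,
    0)),((0,0,0,1,1,2,0,0,0,1,0,2),2,(0,0),(1,1)),((0,0,0,1,1,2,0,1,0,1,0,2),2,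
    (0,0),(1,1)),((0,0,0,1,1,2,0,0,1,1,0,2),2,(0,0),(1,1))]]"

text \<open>For each representative, the lattice point and the weights required by
  \<open>gor_check\<close>.\<close>

definition gor2_data :: "(i3 \<times> int list) list list" where
  "gor2_data =
    [[((1,2,1),[1,1,1,1]),((1,1,1),[1,3,1,1]),((1,1,1),[2,2,2,2,2,2]),((1,-1,1),[1,
    1,1,1]),((1,-1,1),[2,1,1,1,1]),((1,-1,1),[3,1,2,1,1]),((1,-1,1),[2,1,1,2,1,1]),
    ((1,0,1),[2,1,1,1,1])],[((1,0,1),[3,1,1,2,2,1]),((1,0,1),[1,1,1,1,1,1]),((1,0,
    1),[2,1,1,1,2,2,1]),((1,1,1),[2,1,1,2,1,1]),((1,1,1),[2,1,1,1,1,1,1]),((1,1,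
    1),[1,1,1,1,1,1,1,1]),((1,-1,1),[1,4,2,1]),((1,0,1),[1,4,1,1,1])],[((1,1,1),[1,
    1,1,1]),((1,0,1),[2,5,1,1,1]),((1,0,1),[2,7,2,1,1,1]),((1,1,1),[2,7,3,1,1]),
    ((1,0,1),[2,6,2,1,1]),((1,1,1),[2,2,2,1,1]),((1,1,1),[3,6,1,2]),((1,1,1),[4,10,
    2,2,2])],[((1,1,1),[2,4,1,1]),((1,0,1),[2,8,1,2,2,1]),((1,1,1),[2,9,1,3,2,1]),
    ((1,1,1),[3,12,3,3,3]),((1,1,1),[1,4,1,1,1]),((1,0,1),[1,3,1,1]),((1,1,1),[1,6,
    1,1,1,1,1])]]"

definition gor3_data :: "(i3 \<times> int list) list" where
  "gor3_data =
    [((1,1,1),[2,1,1,2]),((1,1,1),[2,1,1,1,1])]"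

definition gor4_data :: "(i3 \<times> int list) list" where
  "gor4_data =
    [((1,1,2),[1,1,1,1])]"

text \<open>For each representative, one exposing normal per vertex, as required by
  \<open>vert_check\<close>.\<close>

definition normals :: "i3 list list list" where
  "normals =
    [[[(1,1,0),(0,-1,1),(0,-1,0),(-1,0,1),(-1,0,0)],[(1,1,0),(2,0,1),(0,-1,0),(0,0,
    1),(-2,-2,1),(-1,0,0)],[(1,1,0),(2,0,1),(0,-1,0),(0,0,1),(-1,0,0)],[(1,1,0),(0,
    -1,0),(0,0,1),(-1,0,0)],[(1,1,0),(1,0,1),(0,-1,0),(0,1,1),(0,0,-1),(-1,0,0)],
    [(1,1,0),(1,0,1),(0,0,-1),(0,-1,0),(0,1,1),(-1,0,0)],[(1,1,0),(1,0,1),(1,0,-1),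
    (0,-1,0),(0,1,1),(-1,-1,-1),(-1,0,0)],[(1,1,0),(1,0,1),(1,0,-1),(0,-1,0),(0,1,
    1),(0,1,-1),(-1,0,0)],[(1,1,0),(0,-1,0),(0,0,1),(0,0,-1),(-1,0,0)],[(1,1,0),(0,
    -1,0),(0,0,1),(0,0,-1),(-1,0,0)]],[[(1,1,0),(1,0,1),(0,-2,1),(0,0,-1),(0,1,1),
    (-1,0,0)],[(1,1,0),(1,0,1),(0,-2,1),(0,-1,-1),(0,1,1),(-1,0,-2),(-1,0,0)],[(1,1,
    0),(1,0,1),(0,1,-2),(0,-2,1),(0,-1,-1),(0,1,1),(-1,0,0)],[(1,1,0),(1,0,1),(1,1,
    -2),(0,-2,1),(0,-1,-1),(0,1,1),(-1,0,-2),(-1,0,0)],[(1,1,0),(1,1,-2),(0,-1,1),(0,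
    -1,-1),(0,0,1),(-1,0,-2),(-1,0,0)],[(1,1,0),(1,0,1),(0,-2,1),(0,0,-1),(-1,-1,1),
    (-1,0,0)],[(1,1,0),(1,0,1),(0,-2,1),(0,-1,-1),(-1,-1,1),(-1,0,-2),(-1,0,0)],[(1,
    1,0),(1,0,1),(1,1,-2),(0,-2,1),(0,-1,-1),(-1,-1,1),(-1,0,-2),(-1,0,0)],[(1,1,0),
    (0,0,1),(0,-2,1),(0,0,-1),(-1,0,0)],[(1,1,0),(0,0,1),(0,1,-2),(0,-2,1),(0,-1,
    -1),(-1,0,0)]],[[(1,1,0),(0,0,1),(1,1,-2),(0,-2,1),(0,-1,-1),(-1,0,-2),(-1,0,0)],
    [(1,1,0),(0,-1,1),(0,-2,-1),(0,0,-1),(-1,0,0)],[(1,1,0),(3,1,-2),(0,-1,1),(0,-2,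
    -1),(0,0,-1),(-1,0,0)],[(1,1,0),(1,0,-1),(0,-1,1),(0,-2,-1),(-1,0,-1),(-1,0,0)],
    [(1,1,0),(0,-1,1),(0,-2,-1),(0,2,-1),(0,0,-1),(-1,0,0)],[(1,1,0),(3,1,-2),(0,-1,
    1),(0,-2,-1),(0,2,-1),(0,0,-1),(-1,0,0)],[(1,1,0),(1,0,1),(0,-2,1),(0,0,-1),(0,
    1,1),(-1,0,0)],[(1,1,0),(0,-1,1),(0,0,-1),(0,0,1),(-1,0,0)],[(1,1,0),(1,0,1),(0,
    -2,1),(0,0,-1),(-1,-1,1),(-1,0,0)],[(1,1,0),(0,0,1),(0,-2,1),(0,0,-1),(-1,0,0)]],
    [[(1,1,0),(0,-1,1),(0,0,-1),(-1,0,0)],[(1,1,0),(0,-1,1),(0,0,-1),(-3,0,-2),(-1,0,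
    0)],[(1,1,0),(1,3,-2),(0,-1,1),(0,0,-1),(-3,0,-2),(-1,0,0)],[(1,1,0),(0,-1,1),(0,
    0,-1),(-1,0,0)],[(1,1,0),(0,-1,1),(0,-2,-1),(0,0,-1),(-1,0,1),(-2,0,-1)],[(1,1,
    0),(3,1,-2),(0,-1,1),(0,-2,-1),(0,0,-1),(-1,0,1),(-2,0,-1)],[(1,1,0),(3,1,-2),(0,
    -1,1),(0,-2,-1),(1,3,-2),(0,0,-1),(-1,0,1),(-2,0,-1)],[(1,1,0),(0,-1,1),(0,-1,
    -1),(-1,0,-2),(-1,0,1),(-2,0,-1)],[(1,1,0),(0,-1,1),(0,-1,-1),(1,3,-2),(-1,0,-2),
    (-1,0,1),(-2,0,-1)],[(1,1,0),(0,-1,1),(0,-1,-1),(-1,0,1),(-1,0,-1)]],[[(1,1,0),(0,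
    -1,1),(0,-1,0),(0,1,1),(-3,-4,2),(-1,0,0)],[(1,1,0),(0,-1,1),(0,-1,0),(0,1,1),
    (-3,-4,2),(-1,0,-2),(-1,0,0)],[(1,1,0),(0,-1,1),(0,1,-2),(0,-1,0),(0,1,1),(-3,-4,
    2),(-1,0,0)],[(1,1,0),(0,-1,1),(1,1,-2),(0,-1,0),(0,1,1),(-3,-4,2),(-1,0,-2),(-1,
    0,0)],[(1,1,0),(0,-1,1),(0,-1,0),(0,1,1),(-1,0,0)],[(1,1,0),(0,-1,1),(0,-1,0),
    (0,1,1),(-1,0,-2),(-1,0,0)],[(1,1,0),(0,-1,1),(0,1,-2),(0,-1,0),(0,1,1),(-1,0,
    0)],[(1,1,0),(0,-1,1),(1,1,-2),(0,-1,0),(0,1,1),(-1,0,-2),(-1,0,0)],[(1,1,0),(2,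
    -1,2),(0,-1,0),(0,0,1),(0,1,-1),(-2,-3,2),(-1,0,0)],[(1,1,0),(2,-1,2),(0,-1,0),
    (0,0,1),(0,1,-1),(-2,-3,2),(-2,-1,-2),(-1,0,0)]],[[(1,1,0),(2,-1,2),(2,1,-2),(0,
    -1,0),(0,0,1),(0,1,-1),(-2,-3,2),(-2,-1,-2),(-1,0,0)],[(1,1,0),(2,-1,2),(0,-1,0),
    (0,0,1),(0,1,-1),(-1,0,0)],[(1,1,0),(2,-1,2),(0,-1,0),(0,0,1),(0,1,-1),(-2,-1,
    -2),(-1,0,0)],[(1,1,0),(0,-1,0),(0,0,1),(0,1,-1),(-1,0,0)],[(1,1,0),(1,0,1),(0,
    -1,0),(-1,-1,1),(-1,0,0)],[(1,1,0),(1,0,1),(0,-1,0),(-1,-1,1),(-1,0,-2),(-1,0,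
    0)],[(1,1,0),(1,0,1),(1,1,-2),(0,-1,0),(-1,-1,1),(-1,0,-2),(-1,0,0)],[(1,1,0),(0,
    0,1),(0,-1,0),(-3,-4,2),(-1,0,0)],[(1,1,0),(0,0,1),(0,1,-2),(0,-1,0),(-3,-4,2),
    (-1,0,0)],[(1,1,0),(0,0,1),(1,1,-2),(0,-1,0),(-3,-4,2),(-1,0,-2),(-1,0,0)]],[[(1,
    1,0),(0,0,1),(0,-1,0),(-1,0,0)],[(1,1,0),(0,0,1),(0,1,-2),(0,-1,0),(-1,0,0)],
    [(1,1,0),(0,0,1),(1,1,-2),(0,-1,0),(-1,0,-2),(-1,0,0)],[(1,1,0),(1,-1,2),(0,-2,
    1),(0,0,-1),(-1,-2,2),(-1,0,0)],[(1,1,0),(1,-1,2),(0,-2,1),(0,0,-1),(-1,-2,2),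
    (-3,0,-2),(-1,0,0)],[(1,1,0),(1,-1,2),(1,3,-2),(0,-2,1),(0,0,-1),(-1,-2,2),(-3,0,
    -2),(-1,0,0)],[(1,1,0),(0,-1,2),(0,-2,1),(0,0,-1),(-1,0,0)],[(1,1,0),(0,-1,2),(0,
    -2,1),(0,0,-1),(-3,0,-2),(-1,0,0)],[(1,1,0),(0,-1,2),(0,3,-2),(0,-2,1),(0,0,-1),
    (-1,0,0)],[(1,0,1),(0,-1,1),(0,0,-1),(-1,0,0)]],[[(1,1,0),(2,-1,2),(0,-1,0),(0,0,
    1),(1,1,-2),(-2,-3,2),(-2,0,1),(-1,0,-1)],[(1,1,0),(2,-1,2),(2,1,-2),(0,-1,0),(0,
    0,1),(1,2,-2),(-2,-3,2),(-2,0,1),(-1,0,-1)],[(1,1,0),(2,-1,2),(0,-1,0),(0,0,1),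
    (1,1,-2),(-2,0,1),(-1,0,-1)],[(1,1,0),(0,-1,0),(0,0,1),(1,1,-2),(-2,-3,2),(-2,0,
    1),(-1,0,-1)],[(1,1,0),(2,1,-2),(0,-1,0),(0,0,1),(1,2,-2),(-2,-3,2),(-2,0,1),(-1,
    0,-1)],[(1,1,0),(0,-1,0),(0,0,1),(1,1,-2),(-2,0,1),(-1,0,-1)],[(1,1,0),(1,-1,2),
    (0,-2,1),(0,-1,-1),(-1,-2,2),(-1,0,-2),(-1,0,1),(-2,0,-1)],[(1,1,0),(1,-1,2),(0,
    -2,1),(0,-1,-1),(1,3,-2),(-1,-2,2),(-1,0,-2),(-1,0,1),(-2,0,-1)],[(1,0,1),(0,-2,
    1),(0,-1,-1),(0,-1,2),(-1,0,-2),(-1,0,1),(-2,0,-1)],[(1,1,0),(0,-1,1),(0,0,-1),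
    (-1,0,0)]],[[(1,1,1),(0,0,-1),(0,-1,0),(-1,0,0)],[(1,1,1),(1,1,-1),(0,-1,-2),(0,
    -1,0),(-1,0,-2),(-1,0,0)],[(1,0,1),(0,-1,-1),(0,1,0),(-1,-1,0)],[(1,0,1),(0,-1,
    -1),(0,1,0),(-2,-1,-2),(-1,-1,0)],[(1,0,1),(1,0,-1),(0,1,0),(-1,0,1),(-1,-1,-1)],
    [(1,1,2),(1,0,-1),(0,-1,0),(0,1,0),(-2,-1,-2),(-1,0,1)],[(1,0,1),(1,0,-1),(0,1,
    0),(-1,0,1),(0,-1,0)],[(1,0,1),(2,1,-1),(1,-1,0),(0,1,0),(-1,0,1),(-1,-1,0)],[(1,
    1,1),(1,0,-1),(0,-1,0),(0,1,0),(-1,0,1),(-1,-1,-1)],[(1,1,1),(2,1,-1),(0,-1,1),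
    (0,-1,-1),(0,1,0),(-1,0,1),(-2,-1,-1)]],[[(1,0,1),(1,1,-1),(1,-1,0),(-1,0,1),(-1,
    1,-1),(-1,-1,0)],[(1,0,1),(1,1,-1),(2,-1,0),(-1,1,1),(-1,1,-1),(0,-1,2),(0,-1,
    0)],[(1,1,1),(1,1,-1),(1,-1,1),(1,-1,-1),(-1,1,1),(-1,1,-1),(-1,-1,1),(-1,-1,-1)],
    [(1,0,1),(0,0,-1),(0,1,0),(-1,0,0)],[(1,0,1),(0,0,-1),(0,1,0),(0,-1,0),(-1,0,
    0)],[(1,0,1),(0,1,-1),(0,-1,0),(-1,0,0)],[(1,0,1),(0,0,-1),(0,1,0),(-2,1,0),(0,
    -1,0)],[(1,0,1),(0,0,-1),(0,1,0),(1,-2,0),(-2,1,0),(-1,-1,0)],[(1,0,1),(0,0,-1),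
    (0,-1,0),(-1,1,0),(-2,-1,0)],[(1,0,1),(0,0,-1),(0,1,0),(-2,1,0),(0,-1,0)]],[[(1,
    0,1),(0,1,-1),(1,-1,0),(-1,1,0),(0,-1,0)],[(1,0,1),(0,0,-1),(-1,1,0),(0,-1,0)],
    [(1,0,1),(0,0,-1),(3,-2,0),(-1,1,0),(0,-1,0)],[(1,0,1),(0,0,-1),(-1,1,0),(0,-1,
    0)],[(2,1,1),(0,0,-1),(1,-1,0),(0,1,0),(-2,1,0),(-1,-1,0)],[(1,1,1),(0,0,-1),(2,
    -1,0),(1,-2,0),(-1,1,0),(-1,-1,0)],[(1,1,1),(0,0,-1),(2,-1,0),(-1,1,0),(0,-1,0)],
    [(1,1,1),(0,0,-1),(1,-1,0),(-1,1,0),(-1,-1,0)],[(1,0,1),(0,0,-1),(0,1,0),(-1,0,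
    0)],[(1,1,1),(0,0,-1),(2,-1,0),(-1,2,0),(1,-2,0),(-2,1,0),(-1,-1,0)]],[[(1,0,1),
    (0,1,-1),(0,-1,0),(-1,0,0)],[(1,0,1),(0,1,-1),(0,-1,-1),(-1,1,0),(-1,-1,0)],[(1,
    0,1),(0,1,-1),(0,-1,0),(-1,0,0)],[(1,1,1),(0,0,-1),(0,-1,0),(-1,0,0)]]]"

text \<open>The cuts after 79, 110, 112 and 113 entries separate the values 3/2, 2, 3, 4 and 5/2 of
  mu. \<open>reps2\<close> begins with the last entry of \<open>half_tree\<close>, twice a
  unimodular simplex.\<close>

definition reps1 :: "i3 list list" where "reps1 = take 79 all_reps"
definition reps2 :: "i3 list list" where "reps2 = take 31 (drop 79 all_reps)"
definition reps3 :: "i3 list list" where "reps3 = take 2 (drop 110 all_reps)"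
definition reps4 :: "i3 list list" where "reps4 = take 1 (drop 112 all_reps)"
definition reps5 :: "i3 list list" where "reps5 = drop 113 all_reps"

lemma half_facts: "list_all2 half_fact reps1 (concat half_data)"
  by code_simp

lemma gor_facts:
  "list_all2 (\<lambda>V (p, wl). gor_check V (2, p, wl)) reps2 (concat gor2_data)"
  "list_all2 (\<lambda>V (p, wl). gor_check V (3, p, wl)) reps3 gor3_data"
  "list_all2 (\<lambda>V (p, wl). gor_check V (4, p, wl)) reps4 gor4_data"
  by code_simp+

lemma vert_facts: "list_all2 vert_check all_reps (concat normals)"
  by code_simp

lemma key_facts: "distinct (map key reps1)" "distinct (map key reps2)" "distinct (map key reps3)"
  by code_simp+

lemma lengths: "length reps1 = 79" "length reps2 = 31" "length reps3 = 2" "length reps4 = 1" "length reps5 = 1"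
  by code_simp+

lemma reps5: "reps5 = [[(0, 0, 0), (0, 0, 1), (0, 2, 0), (2, 0, 0)]]"
  by code_simp

lemma flat_or_over2: "list_all (\<lambda>V. list_all (\<lambda>(x, y, z). 0 \<le> z \<and> z \<le> 1) V \<or>
    list_all (\<lambda>(x, y, z). 0 \<le> x \<and> 0 \<le> y \<and> x + y \<le> 2) V) all_reps"
  by code_simp

lemma all_reps_split: "all_reps = reps1 @ reps2 @ reps3 @ reps4 @ reps5"
proof -
  have "drop i all_reps = take j (drop i all_reps) @ drop (i + j) all_reps" for i j
    by (metis append_take_drop_id drop_drop add.commute)
  from this[of 0 79] this[of 79 31] this[of 110 2] this[of 112 1] show ?thesis
    by (simp add: reps1_def reps2_def reps3_def reps4_def reps5_def)
qed

lemma list_all2_mem: "list_all2 R xs ys \<Longrightarrow> x \<in> set xs \<Longrightarrow> \<exists>y. R x y"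
  by (auto simp: list_all2_conv_all_nth in_set_conv_nth)

lemma gor_group:
  assumes "list_all2 (\<lambda>V (p, wl). gor_check V (k, p, wl)) G D" "V \<in> set G"
  shows "Gorenstein_polytope k (hullZ (set V))"
proof -
  obtain q where q: "case q of (p, wl) \<Rightarrow> gor_check V (k, p, wl)" using list_all2_mem[OF assms] by blast
  obtain x y z wl where "q = ((x, y, z), wl)" by (metis prod.exhaust)
  then show ?thesis using q gor_check by simp
qed

lemma mu1: "V \<in> set reps1 \<Longrightarrow> min_multiplier (hullZ (set V)) = 3 / 2"
  using list_all2_mem[OF half_facts] half_fact(2) by blast

lemma mu2: "V \<in> set reps2 \<Longrightarrow> min_multiplier (hullZ (set V)) = 2"
  using Gorenstein_min_multiplier[OF gor_group[OF gor_facts(1)]] by simp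

lemma mu3: "V \<in> set reps3 \<Longrightarrow> min_multiplier (hullZ (set V)) = 3"
  using Gorenstein_min_multiplier[OF gor_group[OF gor_facts(2)]] by simp

lemma mu4: "V \<in> set reps4 \<Longrightarrow> min_multiplier (hullZ (set V)) = 4"
  using Gorenstein_min_multiplier[OF gor_group[OF gor_facts(3)]] by simp

lemma set_reps5: "V \<in> set reps5 \<Longrightarrow> set V = {(0, 0, 0), (0, 0, 1), (0, 2, 0), (2, 0, 0)}"
  by (simp add: reps5)

lemma mu5: "V \<in> set reps5 \<Longrightarrow> min_multiplier (hullZ (set V)) = 5 / 2"
  using exceptional(2) by (simp only: set_reps5)

lemma all_reps_cases:
  assumes "V \<in> set all_reps"
  obtains "V \<in> set reps1" | "V \<in> set reps2" | "V \<in> set reps3" | "V \<in> set reps4" | "V \<in> set reps5"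
  using assms unfolding all_reps_split set_append by blast

lemma ws_all_reps:
  assumes "V \<in> set all_reps" shows "ws (set V)"
  using assms
proof (cases rule: all_reps_cases)
  case 1
  then show ?thesis using list_all2_mem[OF half_facts] half_fact(1) by blast
next
  case 2
  then show ?thesis using Gorenstein_weakly_sporadic[OF gor_group[OF gor_facts(1)]] by (simp add: ws_def)
next
  case 3
  then show ?thesis using Gorenstein_weakly_sporadic[OF gor_group[OF gor_facts(2)]] by (simp add: ws_def)
next
  case 4
  then show ?thesis using Gorenstein_weakly_sporadic[OF gor_group[OF gor_facts(3)]] by (simp add: ws_def)
next
  case 5
  then show ?thesis using exceptional(1) by (simp only: set_reps5)
qed

lemma rep3_mem: "V \<in> set all_reps \<Longrightarrow> rep3 (set V) \<in> weakly_not_sporadic"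
proof (rule rep3_weakly_not_sporadic[OF ws_all_reps])
  assume V: "V \<in> set all_reps"
  show "flat (set V) \<or> over2 (set V)"
    using bspec[OF flat_or_over2[unfolded list_all_iff] V] unfolding flat_def over2_def .
qed

lemma distinct_singleton: "length xs = 1 \<Longrightarrow> distinct (map f xs)"
  by (cases xs) auto

text \<open>Mu determines the family and \<open>key\<close> the member within it; the last two
  families have one member each.\<close>

lemma key_inj:
  assumes V: "V \<in> set all_reps" "W \<in> set all_reps" and e: "unimodular_equiv (hullZ (set V)) (hullZ (set W))"
  shows "V = W"
proof -
  have "compact (hullZ (set V))" "hullZ (set V) \<noteq> {}" using hullZ_compact wsD(1,2)[OF ws_all_reps[OF V(1)]] by blast+
  then have mu: "min_multiplier (hullZ (set W)) = min_multiplier (hullZ (set V))" by (rule min_multiplier_equiv[OF e])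
  obtain ns ms where "vert_check V ns" "vert_check W ms" using list_all2_mem[OF vert_facts] V by metis
  then have key: "key V = key W" by (rule key_equiv[OF e])
  have one: "V = W" if "distinct (map key G)" "V \<in> set G" "W \<in> set G" for G
    using that key unfolding distinct_map by (meson inj_onD)
  note single = distinct_singleton[OF lengths(4), of key] distinct_singleton[OF lengths(5), of key]
  show ?thesis
    using V(1)
  proof (cases rule: all_reps_cases)
    case 1
    note v = this
    show ?thesis using V(2) by (cases rule: all_reps_cases) (use mu mu1 mu2 mu3 mu4 mu5 v one[OF key_facts(1)] in simp_all)
  next
    case 2
    note v = this
    show ?thesis using V(2) by (cases rule: all_reps_cases) (use mu mu1 mu2 mu3 mu4 mu5 v one[OF key_facts(2)] in simp_all)
  next
    case 3
    note v = this
    show ?thesis using V(2) by (cases rule: all_reps_cases) (use mu mu1 mu2 mu3 mu4 mu5 v one[OF key_facts(3)] in simp_all)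
  next
    case 4
    note v = this
    show ?thesis using V(2) by (cases rule: all_reps_cases) (use mu mu1 mu2 mu3 mu4 mu5 v one[OF single(1)] in simp_all)
  next
    case 5
    note v = this
    show ?thesis using V(2) by (cases rule: all_reps_cases) (use mu mu1 mu2 mu3 mu4 mu5 v one[OF single(2)] in simp_all)
  qed
qed

lemma distinct_all_reps: "distinct all_reps"
proof -
  have d: "A \<inter> B = {}" if "\<And>V. V \<in> A \<Longrightarrow> min_multiplier (hullZ (set V)) = c"
    "\<And>V. V \<in> B \<Longrightarrow> min_multiplier (hullZ (set V)) \<noteq> c" for A B and c :: real
    using that by blast
  have "distinct reps1" "distinct reps2" "distinct reps3" using key_facts by (simp_all add: distinct_map)
  moreover have "distinct reps4" "distinct reps5"
    using distinct_singleton[OF lengths(4), of id] distinct_singleton[OF lengths(5), of id] by simp_all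
  moreover have "set reps1 \<inter> (set reps2 \<union> (set reps3 \<union> (set reps4 \<union> set reps5))) = {}"
    by (rule d[OF mu1]) (auto simp: mu2 mu3 mu4 mu5)
  moreover have "set reps2 \<inter> (set reps3 \<union> (set reps4 \<union> set reps5)) = {}"
    by (rule d[OF mu2]) (auto simp: mu3 mu4 mu5)
  moreover have "set reps3 \<inter> (set reps4 \<union> set reps5) = {}" by (rule d[OF mu3]) (auto simp: mu4 mu5)
  moreover have "set reps4 \<inter> set reps5 = {}" by (rule d[OF mu4]) (auto simp: mu5)
  ultimately show ?thesis unfolding all_reps_split distinct_append set_append by blast
qed

lemma weakly_not_sporadic_rep:
  assumes P: "P \<in> weakly_not_sporadic"
  obtains V where "V \<in> set all_reps" "unimodular_equiv P (hullZ (set V))"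
    "min_multiplier P = min_multiplier (hullZ (set V))"
proof -
  obtain X where X: "ws X" "unimodular_equiv P (hullZ X)" "flat X \<or> over2 X" using P by (rule weakly_not_sporadicE)
  then have "good X" using flat_good over2_good by blast
  then obtain V where V: "V \<in> set all_reps" "unimodular_equiv (hullZ X) (hullZ (set V))" unfolding good_def by blast
  have e: "unimodular_equiv P (hullZ (set V))" by (rule unimodular_equiv_trans[OF X(2) V(2)])
  have "weakly_sporadic_F_hollow P" using P by (simp add: weakly_not_sporadic_def)
  then have "min_multiplier (hullZ (set V)) = min_multiplier P"
    using min_multiplier_equiv[OF e] weakly_sporadic_compact by blast
  then show ?thesis using that[OF V(1) e] by simp
qed

text \<open>The images under \<open>rep3\<close> of the members of \<open>G\<close> form a system of
  representatives in \<open>real ^ 3\<close>; their inequivalence is \<open>key_inj\<close>.\<close>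

lemma class_count:
  assumes G: "set G \<subseteq> set all_reps" "distinct G"
    and Q: "\<And>P. P \<in> weakly_not_sporadic \<Longrightarrow> Q P \<longleftrightarrow> (\<exists>V\<in>set G. unimodular_equiv P (hullZ (set V)))"
  shows "num_classes {P \<in> weakly_not_sporadic. Q P} = length G"
proof -
  have img: "unimodular_equiv (hullZ (set V)) (rep3 (set V))" for V by (rule unimodular_equiv_sym[OF rep3_equiv])
  have "num_classes {P \<in> weakly_not_sporadic. Q P} = card (set G)"
  proof (rule num_classes_reps[of _ "\<lambda>V. rep3 (set V)"])
    fix V assume V: "V \<in> set G"
    have "rep3 (set V) \<in> weakly_not_sporadic" using V G(1) by (intro rep3_mem) blast
    then show "rep3 (set V) \<in> {P \<in> weakly_not_sporadic. Q P}" using Q V rep3_equiv by blast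
  next
    fix P assume "P \<in> {P \<in> weakly_not_sporadic. Q P}"
    then obtain V where "V \<in> set G" "unimodular_equiv P (hullZ (set V))" using Q by blast
    then show "\<exists>V\<in>set G. unimodular_equiv P (rep3 (set V))" using unimodular_equiv_trans img by blast
  next
    fix V W assume VW: "V \<in> set G" "W \<in> set G" "unimodular_equiv (rep3 (set V)) (rep3 (set W))"
    have "unimodular_equiv (hullZ (set V)) (hullZ (set W))"
      by (rule unimodular_equiv_trans[OF img unimodular_equiv_trans[OF VW(3) rep3_equiv]])
    then show "V = W" using key_inj VW(1,2) G(1) by blast
  qed
  then show ?thesis using G(2) by (simp add: distinct_card)
qed

text \<open>The index equals mu, so the representative of a Gorenstein polytope of index
  \<open>k\<close> falls into \<open>G\<close>; conversely the property is invariant under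
  equivalence.\<close>

lemma Gorenstein_iff:
  assumes P: "P \<in> weakly_not_sporadic"
    and G: "\<And>V. V \<in> set G \<Longrightarrow> Gorenstein_polytope k (hullZ (set V))"
    and mu: "\<And>V. V \<in> set all_reps \<Longrightarrow> min_multiplier (hullZ (set V)) = real k \<Longrightarrow> V \<in> set G"
  shows "Gorenstein_polytope k P \<longleftrightarrow> (\<exists>V\<in>set G. unimodular_equiv P (hullZ (set V)))"
proof
  assume g: "Gorenstein_polytope k P"
  obtain V where V: "V \<in> set all_reps" "unimodular_equiv P (hullZ (set V))" "min_multiplier P = min_multiplier (hullZ (set V))"
    using P by (rule weakly_not_sporadic_rep)
  have "V \<in> set G" by (rule mu[OF V(1)]) (use V(3) Gorenstein_min_multiplier[OF g] in simp)
  then show "\<exists>V\<in>set G. unimodular_equiv P (hullZ (set V))" using V(2) by blast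
next
  assume "\<exists>V\<in>set G. unimodular_equiv P (hullZ (set V))"
  then show "Gorenstein_polytope k P" using G Gorenstein_equiv[OF unimodular_equiv_sym] by blast
qed

lemma mu_group:
  assumes "V \<in> set all_reps"
  shows "min_multiplier (hullZ (set V)) = 3 / 2 \<Longrightarrow> V \<in> set reps1" "min_multiplier (hullZ (set V)) = 2 \<Longrightarrow> V \<in> set reps2"
    "min_multiplier (hullZ (set V)) = 3 \<Longrightarrow> V \<in> set reps3" "min_multiplier (hullZ (set V)) = 4 \<Longrightarrow> V \<in> set reps4"
    "min_multiplier (hullZ (set V)) = 5 / 2 \<Longrightarrow> V \<in> set reps5"
  using assms by (cases rule: all_reps_cases; use mu1 mu2 mu3 mu4 mu5 in simp)+

text \<open>Among the representatives only the one in \<open>reps5\<close> has mu = 5/2, and an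
  affine image of its four vertices again spans a simplex.\<close>

lemma exceptional_iff:
  assumes P: "P \<in> weakly_not_sporadic"
  shows "3 simplex P \<and> min_multiplier P = 5 / 2 \<longleftrightarrow> (\<exists>V\<in>set reps5. unimodular_equiv P (hullZ (set V)))"
proof -
  obtain V where V: "V \<in> set all_reps" "unimodular_equiv P (hullZ (set V))" "min_multiplier P = min_multiplier (hullZ (set V))"
    using P by (rule weakly_not_sporadic_rep)
  have P': "weakly_sporadic_F_hollow P" using P by (simp add: weakly_not_sporadic_def)
  then have full: "full_lattice_polytope P" by (simp add: weakly_sporadic_F_hollow_def F_hollow_def)
  have "3 simplex P \<and> min_multiplier P = 5 / 2" if W: "W \<in> set reps5" "unimodular_equiv P (hullZ (set W))" for W
  proof
    show "3 simplex P"
      by (rule simplex3_equiv[OF unimodular_equiv_sym[OF W(2)] full]) (simp_all add: set_reps5[OF W(1)])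
    show "min_multiplier P = 5 / 2"
      using min_multiplier_equiv[OF W(2)] weakly_sporadic_compact[OF P'] mu5[OF W(1)] by simp
  qed
  moreover have "V \<in> set reps5" if "min_multiplier P = 5 / 2" using mu_group(5)[OF V(1)] V(3) that by simp
  ultimately show ?thesis using V(2) by blast
qed

text \<open>The value 3/2 leads to \<open>reps1\<close>, whose members have width two by
  \<open>over2_lattice_width\<close>.\<close>

lemma width_iff:
  assumes P: "P \<in> weakly_not_sporadic"
  shows "lattice_width P = 2 \<and> min_multiplier P = 3 / 2 \<longleftrightarrow> (\<exists>V\<in>set reps1. unimodular_equiv P (hullZ (set V)))"
proof -
  obtain V where V: "V \<in> set all_reps" "unimodular_equiv P (hullZ (set V))" "min_multiplier P = min_multiplier (hullZ (set V))"
    using P by (rule weakly_not_sporadic_rep)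
  have P': "weakly_sporadic_F_hollow P" using P by (simp add: weakly_not_sporadic_def)
  note c = weakly_sporadic_compact[OF P']
  have "lattice_width P = 2 \<and> min_multiplier P = 3 / 2" if W: "W \<in> set reps1" "unimodular_equiv P (hullZ (set W))" for W
  proof
    obtain k where k: "half_fact W k" using list_all2_mem[OF half_facts W(1)] by blast
    obtain x where "x \<in> FinZ (3 / 2) (set W)" using half_fact(4)[OF k] by blast
    then have "lattice_width (hullZ (set W)) = 2"
      using over2_lattice_width wsD(1,2)[OF half_fact(1)[OF k]] half_fact(3)[OF k] by blast
    then show "lattice_width P = 2" using lattice_width_equiv[OF W(2) c] by simp
    show "min_multiplier P = 3 / 2" using min_multiplier_equiv[OF W(2) c] mu1[OF W(1)] by simp
  qed
  moreover have "V \<in> set reps1" if "min_multiplier P = 3 / 2" using mu_group(1)[OF V(1)] V(3) that by simp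
  ultimately show ?thesis using V(2) by blast
qed

theorem theorem6p8:
  "num_classes weakly_not_sporadic = 114 \<and>
   weakly_not_sporadic =
     {P \<in> weakly_not_sporadic. Gorenstein_polytope 2 P} \<union>
     {P \<in> weakly_not_sporadic. Gorenstein_polytope 3 P} \<union>
     {P \<in> weakly_not_sporadic. Gorenstein_polytope 4 P} \<union>
     {P \<in> weakly_not_sporadic. 3 simplex P \<and> min_multiplier P = 5 / 2} \<union>
     {P \<in> weakly_not_sporadic. lattice_width P = 2 \<and> min_multiplier P = 3 / 2} \<and>
   num_classes {P \<in> weakly_not_sporadic. Gorenstein_polytope 2 P} = 31 \<and>
   num_classes {P \<in> weakly_not_sporadic. Gorenstein_polytope 3 P} = 2 \<and>
   num_classes {P \<in> weakly_not_sporadic. Gorenstein_polytope 4 P} = 1 \<and>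
   num_classes {P \<in> weakly_not_sporadic. 3 simplex P \<and> min_multiplier P = 5 / 2} = 1 \<and>
   num_classes {P \<in> weakly_not_sporadic. lattice_width P = 2 \<and> min_multiplier P = 3 / 2} = 79"
proof -
  note sub = all_reps_split[THEN arg_cong[of _ _ set], unfolded set_append]
  have s: "set reps1 \<subseteq> set all_reps" "set reps2 \<subseteq> set all_reps" "set reps3 \<subseteq> set all_reps"
    "set reps4 \<subseteq> set all_reps" "set reps5 \<subseteq> set all_reps" unfolding sub by blast+
  have d: "distinct reps1" "distinct reps2" "distinct reps3" "distinct reps4" "distinct reps5"
    using distinct_all_reps unfolding all_reps_split distinct_append by blast+
  have g2: "Gorenstein_polytope 2 P \<longleftrightarrow> (\<exists>V\<in>set reps2. unimodular_equiv P (hullZ (set V)))" if "P \<in> weakly_not_sporadic" for P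
    by (rule Gorenstein_iff[OF that gor_group[OF gor_facts(1)]]) (use mu_group(2) in simp_all)
  have g3: "Gorenstein_polytope 3 P \<longleftrightarrow> (\<exists>V\<in>set reps3. unimodular_equiv P (hullZ (set V)))" if "P \<in> weakly_not_sporadic" for P
    by (rule Gorenstein_iff[OF that gor_group[OF gor_facts(2)]]) (use mu_group(3) in simp_all)
  have g4: "Gorenstein_polytope 4 P \<longleftrightarrow> (\<exists>V\<in>set reps4. unimodular_equiv P (hullZ (set V)))" if "P \<in> weakly_not_sporadic" for P
    by (rule Gorenstein_iff[OF that gor_group[OF gor_facts(3)]]) (use mu_group(4) in simp_all)
  have all: "\<exists>V\<in>set all_reps. unimodular_equiv P (hullZ (set V))" if "P \<in> weakly_not_sporadic" for P
    using weakly_not_sporadic_rep[OF that] by blast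
  have "num_classes {P \<in> weakly_not_sporadic. True} = length all_reps"
    by (rule class_count[OF order_refl distinct_all_reps]) (use all in blast)
  then have n: "num_classes weakly_not_sporadic = 114" by (simp add: all_reps_split lengths)
  have "Gorenstein_polytope 2 P \<or> Gorenstein_polytope 3 P \<or> Gorenstein_polytope 4 P \<or> (3 simplex P \<and> min_multiplier P = 5 / 2) \<or>
      (lattice_width P = 2 \<and> min_multiplier P = 3 / 2)" if P: "P \<in> weakly_not_sporadic" for P
    using all[OF P] unfolding g2[OF P] g3[OF P] g4[OF P] exceptional_iff[OF P] width_iff[OF P] sub by blast
  then have u: "weakly_not_sporadic =
     {P \<in> weakly_not_sporadic. Gorenstein_polytope 2 P} \<union>
     {P \<in> weakly_not_sporadic. Gorenstein_polytope 3 P} \<union>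
     {P \<in> weakly_not_sporadic. Gorenstein_polytope 4 P} \<union>
     {P \<in> weakly_not_sporadic. 3 simplex P \<and> min_multiplier P = 5 / 2} \<union>
     {P \<in> weakly_not_sporadic. lattice_width P = 2 \<and> min_multiplier P = 3 / 2}"
    by blast
  show ?thesis
    using n u class_count[OF s(2) d(2) g2] class_count[OF s(3) d(3) g3] class_count[OF s(4) d(4) g4]
      class_count[OF s(5) d(5) exceptional_iff] class_count[OF s(1) d(1) width_iff]
    unfolding lengths by (intro conjI)
qed

end
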